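(* Let $V$ be a lextensive category and let $(E,\iota,\sigma)$ be a distributive cartesian multitensor on $V$. Then applying $\Gamma$ gives an equivalence of categories $$E\text{-}\mathrm{Mult}\;\simeq\;\Gamma E\text{-}\mathrm{Op}_{\mathbf{Set}}$$ between the category of $E$-multitensors and the category of $\Gamma E$-operads over $\mathbf{Set}$.
   Context: A category is *extensive* if it has small coproducts and for every family $(X_i)_{i\in I}$ the functor $\coprod:\prod_i(V/X_i)\to V/\coprod_iX_i$ is an equivalence; *lextensive* means extensive with finite limits. A natural transformation is *cartesian* if its naturality squares are pullbacks. A monad is cartesian if its functor preserves pullbacks and its unit and multiplication are cartesian. **Enriched graphs.** $\mathcal{G}V$ is the category of $V$-graphs $X$ (a set $X_0$ and $X(a,b)\in V$ for $a,b\in X_0$) with morphisms functions on objects and maps on homs. A monad on $\mathcal{G}V$ is *over $\mathbf{Set}$* if its functor does not change object sets (nor object maps) and the components of its unit and multiplication are identities on objects. **Multitensors.** $MV$ is the category of finite sequences from $V$ (morphisms: sequences of morphisms between sequences of equal length). A multitensor on $V$ is a functor $E:MV\to V$ with natural maps $\iota_Z:Z\to E(Z)$ and $\sigma:\mathop{E}_i\mathop{E}_jZ_{ij}\to\mathop{E}_{ij}Z_{ij}$ satisfying unit and associativity laws. It is *distributive* if $E$ preserves coproducts in each variable, and *cartesian* if $E$ preserves pullbacks and $\iota$, $\sigma$ are cartesian. A morphism of multitensors is a natural transformation compatible with units and substitutions. **$E$-multitensors.** An $E$-multitensor is a cartesian multitensor $A$ on $V$ with a cartesian multitensor morphism $\alpha:A\to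 E$; morphisms are multitensor morphisms over $E$. The category is $E\text{-}\mathrm{Mult}$. **$\Gamma$.** For a distributive multitensor $E$, $\Gamma E$ is the monad over $\mathbf{Set}$ on $\mathcal{G}V$ that is the identity on objects, with $\Gamma EX(a,b)=\coprod_{a=x_0,\dots,x_n=b}\mathop{E}_iX(x_{i-1},x_i)$. Its unit is $\iota$ followed by the inclusion of the summand $(a,b)$, and its multiplication is induced by $\sigma$ after decomposing $(\Gamma E)^2X(a,b)$, by distributivity, as a coproduct of objects $\mathop{E}_i\mathop{E}_jX(\dots)$. For $\phi:A\to E$, $\Gamma\phi$ has hom maps $\coprod\phi$. **Operads over $\mathbf{Set}$.** For a cartesian monad $T$ over $\mathbf{Set}$ on $\mathcal{G}V$, a $T$-operad over $\mathbf{Set}$ is a cartesian monad $A$ on $\mathcal{G}V$ with a cartesian monad morphism $\alpha:A\to T$, where $A$ is over $\mathbf{Set}$ and the components of $\alpha$ are identities on objects. Morphisms are monad morphisms over $T$. The category is $T\text{-}\mathrm{Op}_{\mathbf{Set}}$. *)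

theory Defs
  imports Main "HOL-Library.FuncSet"
begin

section \<open>Categories, functors, natural transformations\<close>

record ('o, 'a) cat =
  Obj :: "'o set"
  Arr :: "'a set"
  Dom :: "'a \<Rightarrow> 'o"
  Cod :: "'a \<Rightarrow> 'o"
  Ident :: "'o \<Rightarrow> 'a"
  Comp :: "'a \<Rightarrow> 'a \<Rightarrow> 'a"  \<comment> \<open>\<open>Comp C g f\<close> is \<open>g\<close> after \<open>f\<close>\<close>

definition hom :: "('o, 'a) cat \<Rightarrow> 'o \<Rightarrow> 'o \<Rightarrow> 'a set" where
  "hom C x y = {f \<in> Arr C. Dom C f = x \<and> Cod C f = y}"

definition category :: "('o, 'a) cat \<Rightarrow> bool" where
  "category C \<longleftrightarrow>
     (\<forall>f\<in>Arr C. Dom C f \<in> Obj C \<and> Cod C f \<in> Obj C) \<and>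
     (\<forall>x\<in>Obj C. Ident C x \<in> hom C x x) \<and>
     (\<forall>f\<in>Arr C. \<forall>g\<in>Arr C. Dom C g = Cod C f \<longrightarrow> Comp C g f \<in> hom C (Dom C f) (Cod C g)) \<and>
     (\<forall>f\<in>Arr C. Comp C f (Ident C (Dom C f)) = f \<and> Comp C (Ident C (Cod C f)) f = f) \<and>
     (\<forall>f\<in>Arr C. \<forall>g\<in>Arr C. \<forall>h\<in>Arr C. Dom C g = Cod C f \<longrightarrow> Dom C h = Cod C g \<longrightarrow>
        Comp C h (Comp C g f) = Comp C (Comp C h g) f)"

text \<open>
  Functors and transformations are functions on the whole object and arrow types; they are
  required to be \<^const>\<open>extensional\<close>, so that they are determined by their values on the carriers
  and equality of functors and of transformations is equality in HOL.
\<close>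

record ('o, 'a, 'p, 'b) fctr =
  FObj :: "'o \<Rightarrow> 'p"
  FArr :: "'a \<Rightarrow> 'b"

definition is_functor :: "('o, 'a) cat \<Rightarrow> ('p, 'b) cat \<Rightarrow> ('o, 'a, 'p, 'b) fctr \<Rightarrow> bool" where
  "is_functor C D F \<longleftrightarrow> category C \<and> category D \<and>
     FObj F \<in> extensional (Obj C) \<and> FArr F \<in> extensional (Arr C) \<and>
     (\<forall>x\<in>Obj C. FObj F x \<in> Obj D) \<and>
     (\<forall>f\<in>Arr C. FArr F f \<in> hom D (FObj F (Dom C f)) (FObj F (Cod C f))) \<and>
     (\<forall>x\<in>Obj C. FArr F (Ident C x) = Ident D (FObj F x)) \<and>
     (\<forall>f\<in>Arr C. \<forall>g\<in>Arr C. Dom C g = Cod C f \<longrightarrow>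
        FArr F (Comp C g f) = Comp D (FArr F g) (FArr F f))"

definition id_fctr :: "('o, 'a) cat \<Rightarrow> ('o, 'a, 'o, 'a) fctr" where
  "id_fctr C = \<lparr>FObj = (\<lambda>x\<in>Obj C. x), FArr = (\<lambda>f\<in>Arr C. f)\<rparr>"

definition comp_fctr ::
  "('o, 'a) cat \<Rightarrow> ('p, 'b, 'q, 'c) fctr \<Rightarrow> ('o, 'a, 'p, 'b) fctr \<Rightarrow> ('o, 'a, 'q, 'c) fctr" where
  "comp_fctr C G F =
     \<lparr>FObj = (\<lambda>x\<in>Obj C. FObj G (FObj F x)), FArr = (\<lambda>f\<in>Arr C. FArr G (FArr F f))\<rparr>"

definition is_nat ::
  "('o, 'a) cat \<Rightarrow> ('p, 'b) cat \<Rightarrow> ('o, 'a, 'p, 'b) fctr \<Rightarrow> ('o, 'a, 'p, 'b) fctr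
    \<Rightarrow> ('o \<Rightarrow> 'b) \<Rightarrow> bool" where
  "is_nat C D F G \<tau> \<longleftrightarrow> \<tau> \<in> extensional (Obj C) \<and>
     (\<forall>x\<in>Obj C. \<tau> x \<in> hom D (FObj F x) (FObj G x)) \<and>
     (\<forall>f\<in>Arr C. Comp D (FArr G f) (\<tau> (Dom C f)) = Comp D (\<tau> (Cod C f)) (FArr F f))"

definition id_nat ::
  "('o, 'a) cat \<Rightarrow> ('p, 'b) cat \<Rightarrow> ('o, 'a, 'p, 'b) fctr \<Rightarrow> 'o \<Rightarrow> 'b" where
  "id_nat C D F = (\<lambda>x\<in>Obj C. Ident D (FObj F x))"

definition comp_nat ::
  "('o, 'a) cat \<Rightarrow> ('p, 'b) cat \<Rightarrow> ('o \<Rightarrow> 'b) \<Rightarrow> ('o \<Rightarrow> 'b) \<Rightarrow> 'o \<Rightarrow> 'b" where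
  "comp_nat C D \<psi> \<phi> = (\<lambda>x\<in>Obj C. Comp D (\<psi> x) (\<phi> x))"

definition is_iso :: "('o, 'a) cat \<Rightarrow> 'a \<Rightarrow> bool" where
  "is_iso C f \<longleftrightarrow> f \<in> Arr C \<and>
     (\<exists>g\<in>hom C (Cod C f) (Dom C f).
        Comp C g f = Ident C (Dom C f) \<and> Comp C f g = Ident C (Cod C f))"

definition is_nat_iso ::
  "('o, 'a) cat \<Rightarrow> ('p, 'b) cat \<Rightarrow> ('o, 'a, 'p, 'b) fctr \<Rightarrow> ('o, 'a, 'p, 'b) fctr
    \<Rightarrow> ('o \<Rightarrow> 'b) \<Rightarrow> bool" where
  "is_nat_iso C D F G \<tau> \<longleftrightarrow> is_nat C D F G \<tau> \<and> (\<forall>x\<in>Obj C. is_iso D (\<tau> x))"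

definition is_equivalence ::
  "('o, 'a) cat \<Rightarrow> ('p, 'b) cat \<Rightarrow> ('o, 'a, 'p, 'b) fctr \<Rightarrow> bool" where
  "is_equivalence C D F \<longleftrightarrow> is_functor C D F \<and>
     (\<exists>G \<eta> \<epsilon>. is_functor D C G \<and>
        is_nat_iso C C (id_fctr C) (comp_fctr C G F) \<eta> \<and>
        is_nat_iso D D (comp_fctr D F G) (id_fctr D) \<epsilon>)"


section \<open>Limits and cartesian transformations\<close>

text \<open>\<open>p\<close> and \<open>q\<close> are the projections of a pullback of \<open>f\<close> and \<open>g\<close>.\<close>

definition is_pullback :: "('o, 'a) cat \<Rightarrow> 'a \<Rightarrow> 'a \<Rightarrow> 'a \<Rightarrow> 'a \<Rightarrow> bool" where
  "is_pullback C p q f g \<longleftrightarrow>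
     p \<in> Arr C \<and> q \<in> Arr C \<and> f \<in> Arr C \<and> g \<in> Arr C \<and>
     Dom C p = Dom C q \<and> Cod C p = Dom C f \<and> Cod C q = Dom C g \<and> Cod C f = Cod C g \<and>
     Comp C f p = Comp C g q \<and>
     (\<forall>z\<in>Obj C. \<forall>h\<in>hom C z (Dom C f). \<forall>k\<in>hom C z (Dom C g). Comp C f h = Comp C g k \<longrightarrow>
        (\<exists>!u. u \<in> hom C z (Dom C p) \<and> Comp C p u = h \<and> Comp C q u = k))"

definition preserves_pullbacks ::
  "('o, 'a) cat \<Rightarrow> ('p, 'b) cat \<Rightarrow> ('o, 'a, 'p, 'b) fctr \<Rightarrow> bool" where
  "preserves_pullbacks C D F \<longleftrightarrow>
     (\<forall>p q f g. is_pullback C p q f g \<longrightarrow>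
        is_pullback D (FArr F p) (FArr F q) (FArr F f) (FArr F g))"

definition is_cartesian_nat ::
  "('o, 'a) cat \<Rightarrow> ('p, 'b) cat \<Rightarrow> ('o, 'a, 'p, 'b) fctr \<Rightarrow> ('o, 'a, 'p, 'b) fctr
    \<Rightarrow> ('o \<Rightarrow> 'b) \<Rightarrow> bool" where
  "is_cartesian_nat C D F G \<tau> \<longleftrightarrow> is_nat C D F G \<tau> \<and>
     (\<forall>f\<in>Arr C. is_pullback D (\<tau> (Dom C f)) (FArr F f) (FArr G f) (\<tau> (Cod C f)))"

definition is_cone ::
  "('j, 'k) cat \<Rightarrow> ('o, 'a) cat \<Rightarrow> ('j, 'k, 'o, 'a) fctr \<Rightarrow> 'o \<Rightarrow> ('j \<Rightarrow> 'a) \<Rightarrow> bool" where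
  "is_cone J C D x \<pi> \<longleftrightarrow> x \<in> Obj C \<and>
     (\<forall>j\<in>Obj J. \<pi> j \<in> hom C x (FObj D j)) \<and>
     (\<forall>k\<in>Arr J. Comp C (FArr D k) (\<pi> (Dom J k)) = \<pi> (Cod J k))"

definition is_limit ::
  "('j, 'k) cat \<Rightarrow> ('o, 'a) cat \<Rightarrow> ('j, 'k, 'o, 'a) fctr \<Rightarrow> 'o \<Rightarrow> ('j \<Rightarrow> 'a) \<Rightarrow> bool" where
  "is_limit J C D x \<pi> \<longleftrightarrow> is_cone J C D x \<pi> \<and>
     (\<forall>y \<mu>. is_cone J C D y \<mu> \<longrightarrow>
        (\<exists>!u. u \<in> hom C y x \<and> (\<forall>j\<in>Obj J. Comp C (\<pi> j) u = \<mu> j)))"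

text \<open>Every finite category is isomorphic to one whose objects and arrows are natural numbers.\<close>

definition has_finite_limits :: "('o, 'a) cat \<Rightarrow> bool" where
  "has_finite_limits C \<longleftrightarrow>
     (\<forall>(J :: (nat, nat) cat) D. finite (Obj J) \<longrightarrow> finite (Arr J) \<longrightarrow> is_functor J C D \<longrightarrow>
        (\<exists>x \<pi>. is_limit J C D x \<pi>))"


section \<open>Small coproducts and extensivity\<close>

text \<open>
  Smallness is relative to a collection \<open>U\<close> of sets, the small ones, that contains an infinite
  set and is closed under passing to sets of no larger cardinality and under unions of small
  families.  In particular \<open>U\<close> is closed, up to bijection, under finite products and under
  forming sets of finite sequences.  Closure under power sets, which is part of the definition of
  a Grothendieck universe, is not demanded; thus \<open>U\<close> can be a Grothendieck universe (the sets of
  cardinality below an inaccessible cardinal), but also, for instance, the collection of all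
  subsets of an infinite type.
\<close>

definition universe :: "'i set set \<Rightarrow> bool" where
  "universe U \<longleftrightarrow>
     (\<exists>A\<in>U. infinite A) \<and>
     (\<forall>A\<in>U. \<forall>B g. inj_on g B \<and> g ` B \<subseteq> A \<longrightarrow> B \<in> U) \<and>
     (\<forall>I\<in>U. \<forall>A. (\<forall>i\<in>I. A i \<in> U) \<longrightarrow> (\<Union>i\<in>I. A i) \<in> U)"

definition is_coproduct ::
  "('o, 'a) cat \<Rightarrow> 'j set \<Rightarrow> ('j \<Rightarrow> 'o) \<Rightarrow> 'o \<Rightarrow> ('j \<Rightarrow> 'a) \<Rightarrow> bool" where
  "is_coproduct C I X c \<iota> \<longleftrightarrow> c \<in> Obj C \<and> (\<forall>i\<in>I. \<iota> i \<in> hom C (X i) c) \<and>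
     (\<forall>d\<in>Obj C. \<forall>f. (\<forall>i\<in>I. f i \<in> hom C (X i) d) \<longrightarrow>
        (\<exists>!u. u \<in> hom C c d \<and> (\<forall>i\<in>I. Comp C u (\<iota> i) = f i)))"

definition has_small_coproducts :: "'i set set \<Rightarrow> ('o, 'a) cat \<Rightarrow> bool" where
  "has_small_coproducts U C \<longleftrightarrow>
     (\<forall>I\<in>U. \<forall>X\<in>I \<rightarrow> Obj C. \<exists>c \<iota>. is_coproduct C I X c \<iota>)"

text \<open>
  A choice of coproducts.  The index type is arbitrary, since families indexed by sets of
  finite sequences are needed as well.
\<close>

definition coprod :: "('o, 'a) cat \<Rightarrow> 'j set \<Rightarrow> ('j \<Rightarrow> 'o) \<Rightarrow> 'o" where
  "coprod C I X = fst (SOME (c, \<iota>). is_coproduct C I X c \<iota>)"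

definition coinj :: "('o, 'a) cat \<Rightarrow> 'j set \<Rightarrow> ('j \<Rightarrow> 'o) \<Rightarrow> 'j \<Rightarrow> 'a" where
  "coinj C I X = snd (SOME (c, \<iota>). is_coproduct C I X c \<iota>)"

definition cotuple ::
  "('o, 'a) cat \<Rightarrow> 'j set \<Rightarrow> ('j \<Rightarrow> 'o) \<Rightarrow> 'o \<Rightarrow> ('j \<Rightarrow> 'a) \<Rightarrow> 'a" where
  "cotuple C I X d f =
     (THE u. u \<in> hom C (coprod C I X) d \<and> (\<forall>i\<in>I. Comp C u (coinj C I X i) = f i))"

definition coprod_map ::
  "('o, 'a) cat \<Rightarrow> 'j set \<Rightarrow> ('j \<Rightarrow> 'o) \<Rightarrow> ('j \<Rightarrow> 'o) \<Rightarrow> ('j \<Rightarrow> 'a) \<Rightarrow> 'a" where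
  "coprod_map C I X Y f = cotuple C I X (coprod C I Y) (\<lambda>i. Comp C (coinj C I Y i) (f i))"

text \<open>An arrow of the slice over \<open>x\<close> is a triple \<open>(f, g, h)\<close> with \<open>g \<circ> h = f\<close>.\<close>

definition slice :: "('o, 'a) cat \<Rightarrow> 'o \<Rightarrow> ('a, 'a \<times> 'a \<times> 'a) cat" where
  "slice C x =
     \<lparr>Obj = {f \<in> Arr C. Cod C f = x},
      Arr = {(f, g, h). f \<in> Arr C \<and> g \<in> Arr C \<and> Cod C f = x \<and> Cod C g = x \<and>
               h \<in> hom C (Dom C f) (Dom C g) \<and> Comp C g h = f},
      Dom = (\<lambda>(f, g, h). f),
      Cod = (\<lambda>(f, g, h). g),
      Ident = (\<lambda>f. (f, f, Ident C (Dom C f))),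
      Comp = (\<lambda>(g, k, h') (f, g', h). (f, k, Comp C h' h))\<rparr>"

definition prod_cat :: "'j set \<Rightarrow> ('j \<Rightarrow> ('o, 'a) cat) \<Rightarrow> ('j \<Rightarrow> 'o, 'j \<Rightarrow> 'a) cat" where
  "prod_cat I C =
     \<lparr>Obj = (\<Pi>\<^sub>E i\<in>I. Obj (C i)),
      Arr = (\<Pi>\<^sub>E i\<in>I. Arr (C i)),
      Dom = (\<lambda>f. \<lambda>i\<in>I. Dom (C i) (f i)),
      Cod = (\<lambda>f. \<lambda>i\<in>I. Cod (C i) (f i)),
      Ident = (\<lambda>x. \<lambda>i\<in>I. Ident (C i) (x i)),
      Comp = (\<lambda>g f. \<lambda>i\<in>I. Comp (C i) (g i) (f i))\<rparr>"

definition slice_coprod ::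
  "('o, 'a) cat \<Rightarrow> 'j set \<Rightarrow> ('j \<Rightarrow> 'o) \<Rightarrow> ('j \<Rightarrow> 'a, 'j \<Rightarrow> 'a \<times> 'a \<times> 'a, 'a, 'a \<times> 'a \<times> 'a) fctr"
where
  "slice_coprod C I X =
     (let P = prod_cat I (\<lambda>i. slice C (X i));
          ob = (\<lambda>f. coprod_map C I (\<lambda>i. Dom C (f i)) X f)
      in \<lparr>FObj = (\<lambda>f\<in>Obj P. ob f),
          FArr = (\<lambda>t\<in>Arr P. (ob (Dom P t), ob (Cod P t),
             coprod_map C I (\<lambda>i. Dom C (Dom P t i)) (\<lambda>i. Dom C (Cod P t i))
               (\<lambda>i. snd (snd (t i)))))\<rparr>)"

definition extensive :: "'i set set \<Rightarrow> ('o, 'a) cat \<Rightarrow> bool" where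
  "extensive U V \<longleftrightarrow> category V \<and> has_small_coproducts U V \<and>
     (\<forall>I\<in>U. \<forall>X\<in>I \<rightarrow> Obj V.
        is_equivalence (prod_cat I (\<lambda>i. slice V (X i))) (slice V (coprod V I X))
          (slice_coprod V I X))"

definition lextensive :: "'i set set \<Rightarrow> ('o, 'a) cat \<Rightarrow> bool" where
  "lextensive U V \<longleftrightarrow> extensive U V \<and> has_finite_limits V"


section \<open>Monads\<close>

record ('o, 'a) monad =
  MFun :: "('o, 'a, 'o, 'a) fctr"
  MUnit :: "'o \<Rightarrow> 'a"
  MMult :: "'o \<Rightarrow> 'a"

definition is_monad :: "('o, 'a) cat \<Rightarrow> ('o, 'a) monad \<Rightarrow> bool" where
  "is_monad C T \<longleftrightarrow> is_functor C C (MFun T) \<and>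
     is_nat C C (id_fctr C) (MFun T) (MUnit T) \<and>
     is_nat C C (comp_fctr C (MFun T) (MFun T)) (MFun T) (MMult T) \<and>
     (\<forall>x\<in>Obj C.
        Comp C (MMult T x) (MUnit T (FObj (MFun T) x)) = Ident C (FObj (MFun T) x) \<and>
        Comp C (MMult T x) (FArr (MFun T) (MUnit T x)) = Ident C (FObj (MFun T) x) \<and>
        Comp C (MMult T x) (MMult T (FObj (MFun T) x)) =
          Comp C (MMult T x) (FArr (MFun T) (MMult T x)))"

definition is_cartesian_monad :: "('o, 'a) cat \<Rightarrow> ('o, 'a) monad \<Rightarrow> bool" where
  "is_cartesian_monad C T \<longleftrightarrow> is_monad C T \<and> preserves_pullbacks C C (MFun T) \<and>
     is_cartesian_nat C C (id_fctr C) (MFun T) (MUnit T) \<and>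
     is_cartesian_nat C C (comp_fctr C (MFun T) (MFun T)) (MFun T) (MMult T)"

definition is_monad_mor ::
  "('o, 'a) cat \<Rightarrow> ('o, 'a) monad \<Rightarrow> ('o, 'a) monad \<Rightarrow> ('o \<Rightarrow> 'a) \<Rightarrow> bool" where
  "is_monad_mor C S T \<phi> \<longleftrightarrow> is_nat C C (MFun S) (MFun T) \<phi> \<and>
     (\<forall>x\<in>Obj C.
        Comp C (\<phi> x) (MUnit S x) = MUnit T x \<and>
        Comp C (\<phi> x) (MMult S x) =
          Comp C (MMult T x) (Comp C (\<phi> (FObj (MFun T) x)) (FArr (MFun S) (\<phi> x))))"


section \<open>Enriched graphs\<close>

record ('i, 'o) vgraph =
  Vert :: "'i set"
  VHom :: "'i \<times> 'i \<Rightarrow> 'o"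

record ('i, 'o, 'a) vgmap =
  GDom :: "('i, 'o) vgraph"
  GCod :: "('i, 'o) vgraph"
  OMap :: "'i \<Rightarrow> 'i"
  HMap :: "'i \<times> 'i \<Rightarrow> 'a"

definition vgraphs :: "'i set set \<Rightarrow> ('o, 'a) cat \<Rightarrow> ('i, 'o) vgraph set" where
  "vgraphs U V = {X. Vert X \<in> U \<and> VHom X \<in> (Vert X \<times> Vert X) \<rightarrow>\<^sub>E Obj V}"

definition vgmaps :: "'i set set \<Rightarrow> ('o, 'a) cat \<Rightarrow> ('i, 'o, 'a) vgmap set" where
  "vgmaps U V = {f. GDom f \<in> vgraphs U V \<and> GCod f \<in> vgraphs U V \<and>
     OMap f \<in> Vert (GDom f) \<rightarrow>\<^sub>E Vert (GCod f) \<and>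
     HMap f \<in> (\<Pi>\<^sub>E (a, b)\<in>Vert (GDom f) \<times> Vert (GDom f).
       hom V (VHom (GDom f) (a, b)) (VHom (GCod f) (OMap f a, OMap f b)))}"

definition Graphs ::
  "'i set set \<Rightarrow> ('o, 'a) cat \<Rightarrow> (('i, 'o) vgraph, ('i, 'o, 'a) vgmap) cat" where
  "Graphs U V =
     \<lparr>Obj = vgraphs U V,
      Arr = vgmaps U V,
      Dom = GDom,
      Cod = GCod,
      Ident = (\<lambda>X. \<lparr>GDom = X, GCod = X, OMap = (\<lambda>a\<in>Vert X. a),
                HMap = (\<lambda>p\<in>Vert X \<times> Vert X. Ident V (VHom X p))\<rparr>),
      Comp = (\<lambda>g f. \<lparr>GDom = GDom f, GCod = GCod g,
                OMap = (\<lambda>a\<in>Vert (GDom f). OMap g (OMap f a)),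
                HMap = (\<lambda>(a, b)\<in>Vert (GDom f) \<times> Vert (GDom f).
                          Comp V (HMap g (OMap f a, OMap f b)) (HMap f (a, b)))\<rparr>)\<rparr>"

definition id_on_objects :: "('i, 'o, 'a) vgmap \<Rightarrow> bool" where
  "id_on_objects f \<longleftrightarrow> Vert (GCod f) = Vert (GDom f) \<and> OMap f = (\<lambda>a\<in>Vert (GDom f). a)"

definition over_Set ::
  "'i set set \<Rightarrow> ('o, 'a) cat \<Rightarrow> (('i, 'o) vgraph, ('i, 'o, 'a) vgmap) monad \<Rightarrow> bool" where
  "over_Set U V T \<longleftrightarrow>
     (\<forall>X\<in>vgraphs U V. Vert (FObj (MFun T) X) = Vert X) \<and>
     (\<forall>f\<in>vgmaps U V. OMap (FArr (MFun T) f) = OMap f) \<and>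
     (\<forall>X\<in>vgraphs U V. id_on_objects (MUnit T X) \<and> id_on_objects (MMult T X))"


section \<open>Operads over Set\<close>

type_synonym ('i, 'o, 'a) operad =
  "(('i, 'o) vgraph, ('i, 'o, 'a) vgmap) monad \<times> (('i, 'o) vgraph \<Rightarrow> ('i, 'o, 'a) vgmap)"

definition operads_Set ::
  "'i set set \<Rightarrow> ('o, 'a) cat \<Rightarrow> (('i, 'o) vgraph, ('i, 'o, 'a) vgmap) monad
    \<Rightarrow> ('i, 'o, 'a) operad set" where
  "operads_Set U V T = {(A, \<alpha>).
     is_cartesian_monad (Graphs U V) A \<and> over_Set U V A \<and>
     is_monad_mor (Graphs U V) A T \<alpha> \<and>
     is_cartesian_nat (Graphs U V) (Graphs U V) (MFun A) (MFun T) \<alpha> \<and>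
     (\<forall>X\<in>vgraphs U V. id_on_objects (\<alpha> X))}"

definition Op_Set ::
  "'i set set \<Rightarrow> ('o, 'a) cat \<Rightarrow> (('i, 'o) vgraph, ('i, 'o, 'a) vgmap) monad
    \<Rightarrow> (('i, 'o, 'a) operad,
        ('i, 'o, 'a) operad \<times> ('i, 'o, 'a) operad \<times> (('i, 'o) vgraph \<Rightarrow> ('i, 'o, 'a) vgmap)) cat"
where
  "Op_Set U V T =
     \<lparr>Obj = operads_Set U V T,
      Arr = {((A, \<alpha>), (B, \<beta>), \<phi>).
               (A, \<alpha>) \<in> operads_Set U V T \<and> (B, \<beta>) \<in> operads_Set U V T \<and>
               is_monad_mor (Graphs U V) A B \<phi> \<and>
               comp_nat (Graphs U V) (Graphs U V) \<beta> \<phi> = \<alpha>},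
      Dom = (\<lambda>(a, b, \<phi>). a),
      Cod = (\<lambda>(a, b, \<phi>). b),
      Ident = (\<lambda>(A, \<alpha>). ((A, \<alpha>), (A, \<alpha>), id_nat (Graphs U V) (Graphs U V) (MFun A))),
      Comp = (\<lambda>(b, c, \<psi>) (a, b', \<phi>). (a, c, comp_nat (Graphs U V) (Graphs U V) \<psi> \<phi>))\<rparr>"


section \<open>Multitensors\<close>

text \<open>
  The category \<open>MV\<close> of finite sequences.  The construction is functorial and carries the
  structure of a monad, with unit \<open>Z \<mapsto> [Z]\<close> and multiplication given by concatenation; these
  are used to express the functors between which the unit and the substitution of a multitensor
  are transformations.
\<close>

definition seq_cat :: "('o, 'a) cat \<Rightarrow> ('o list, 'a list) cat" where
  "seq_cat C =
     \<lparr>Obj = lists (Obj C),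
      Arr = lists (Arr C),
      Dom = map (Dom C),
      Cod = map (Cod C),
      Ident = map (Ident C),
      Comp = map2 (Comp C)\<rparr>"

definition seq_map ::
  "('o, 'a) cat \<Rightarrow> ('o, 'a, 'p, 'b) fctr \<Rightarrow> ('o list, 'a list, 'p list, 'b list) fctr" where
  "seq_map C F =
     \<lparr>FObj = (\<lambda>xs\<in>lists (Obj C). map (FObj F) xs), FArr = (\<lambda>fs\<in>lists (Arr C). map (FArr F) fs)\<rparr>"

definition seq_unit :: "('o, 'a) cat \<Rightarrow> ('o, 'a, 'o list, 'a list) fctr" where
  "seq_unit C = \<lparr>FObj = (\<lambda>x\<in>Obj C. [x]), FArr = (\<lambda>f\<in>Arr C. [f])\<rparr>"

definition seq_concat :: "('o, 'a) cat \<Rightarrow> ('o list list, 'a list list, 'o list, 'a list) fctr" where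
  "seq_concat C =
     \<lparr>FObj = (\<lambda>xss\<in>lists (lists (Obj C)). concat xss),
      FArr = (\<lambda>fss\<in>lists (lists (Arr C)). concat fss)\<rparr>"

record ('o, 'a) multitensor =
  EFun :: "('o list, 'a list, 'o, 'a) fctr"
  EUnit :: "'o \<Rightarrow> 'a"
  ESubst :: "'o list list \<Rightarrow> 'a"

text \<open>The functors \<open>Z \<mapsto> E [Z]\<close>, \<open>Z\<^sub>i\<^sub>j \<mapsto> E\<^sub>i E\<^sub>j Z\<^sub>i\<^sub>j\<close> and \<open>Z\<^sub>i\<^sub>j \<mapsto> E\<^sub>i\<^sub>j Z\<^sub>i\<^sub>j\<close>.\<close>

definition unary_part :: "('o, 'a) cat \<Rightarrow> ('o, 'a) multitensor \<Rightarrow> ('o, 'a, 'o, 'a) fctr" where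
  "unary_part V E = comp_fctr V (EFun E) (seq_unit V)"

definition nested ::
  "('o, 'a) cat \<Rightarrow> ('o, 'a) multitensor \<Rightarrow> ('o list list, 'a list list, 'o, 'a) fctr" where
  "nested V E = comp_fctr (seq_cat (seq_cat V)) (EFun E) (seq_map (seq_cat V) (EFun E))"

definition flattened ::
  "('o, 'a) cat \<Rightarrow> ('o, 'a) multitensor \<Rightarrow> ('o list list, 'a list list, 'o, 'a) fctr" where
  "flattened V E = comp_fctr (seq_cat (seq_cat V)) (EFun E) (seq_concat V)"

definition is_multitensor :: "('o, 'a) cat \<Rightarrow> ('o, 'a) multitensor \<Rightarrow> bool" where
  "is_multitensor V E \<longleftrightarrow> is_functor (seq_cat V) V (EFun E) \<and>
     is_nat V V (id_fctr V) (unary_part V E) (EUnit E) \<and>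
     is_nat (seq_cat (seq_cat V)) V (nested V E) (flattened V E) (ESubst E) \<and>
     (\<forall>Z\<in>lists (Obj V).
        Comp V (ESubst E [Z]) (EUnit E (FObj (EFun E) Z)) = Ident V (FObj (EFun E) Z) \<and>
        Comp V (ESubst E (map (\<lambda>z. [z]) Z)) (FArr (EFun E) (map (EUnit E) Z)) =
          Ident V (FObj (EFun E) Z)) \<and>
     (\<forall>Z\<in>lists (lists (lists (Obj V))).
        Comp V (ESubst E (concat Z)) (ESubst E (map (map (FObj (EFun E))) Z)) =
        Comp V (ESubst E (map concat Z)) (FArr (EFun E) (map (ESubst E) Z)))"

definition is_cartesian_multitensor :: "('o, 'a) cat \<Rightarrow> ('o, 'a) multitensor \<Rightarrow> bool" where
  "is_cartesian_multitensor V E \<longleftrightarrow> is_multitensor V E \<and>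
     preserves_pullbacks (seq_cat V) V (EFun E) \<and>
     is_cartesian_nat V V (id_fctr V) (unary_part V E) (EUnit E) \<and>
     is_cartesian_nat (seq_cat (seq_cat V)) V (nested V E) (flattened V E) (ESubst E)"

definition is_distributive ::
  "'i set set \<Rightarrow> ('o, 'a) cat \<Rightarrow> ('o, 'a) multitensor \<Rightarrow> bool" where
  "is_distributive U V E \<longleftrightarrow>
     (\<forall>xs\<in>lists (Obj V). \<forall>ys\<in>lists (Obj V). \<forall>I\<in>U. \<forall>X\<in>I \<rightarrow> Obj V. \<forall>c \<iota>.
        is_coproduct V I X c \<iota> \<longrightarrow>
        is_coproduct V I (\<lambda>i. FObj (EFun E) (xs @ [X i] @ ys)) (FObj (EFun E) (xs @ [c] @ ys))
          (\<lambda>i. FArr (EFun E) (map (Ident V) xs @ [\<iota> i] @ map (Ident V) ys)))"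

definition is_multitensor_mor ::
  "('o, 'a) cat \<Rightarrow> ('o, 'a) multitensor \<Rightarrow> ('o, 'a) multitensor \<Rightarrow> ('o list \<Rightarrow> 'a) \<Rightarrow> bool" where
  "is_multitensor_mor V A B \<phi> \<longleftrightarrow> is_nat (seq_cat V) V (EFun A) (EFun B) \<phi> \<and>
     (\<forall>x\<in>Obj V. Comp V (\<phi> [x]) (EUnit A x) = EUnit B x) \<and>
     (\<forall>Z\<in>lists (lists (Obj V)).
        Comp V (\<phi> (concat Z)) (ESubst A Z) =
        Comp V (ESubst B Z)
          (Comp V (\<phi> (map (FObj (EFun B)) Z)) (FArr (EFun A) (map \<phi> Z))))"

type_synonym ('o, 'a) multitensor_over = "('o, 'a) multitensor \<times> ('o list \<Rightarrow> 'a)"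

definition multitensors_over ::
  "('o, 'a) cat \<Rightarrow> ('o, 'a) multitensor \<Rightarrow> ('o, 'a) multitensor_over set" where
  "multitensors_over V E = {(A, \<alpha>).
     is_cartesian_multitensor V A \<and> is_multitensor_mor V A E \<alpha> \<and>
     is_cartesian_nat (seq_cat V) V (EFun A) (EFun E) \<alpha>}"

definition Mult ::
  "('o, 'a) cat \<Rightarrow> ('o, 'a) multitensor
    \<Rightarrow> (('o, 'a) multitensor_over,
        ('o, 'a) multitensor_over \<times> ('o, 'a) multitensor_over \<times> ('o list \<Rightarrow> 'a)) cat"
where
  "Mult V E =
     \<lparr>Obj = multitensors_over V E,
      Arr = {((A, \<alpha>), (B, \<beta>), \<phi>).
               (A, \<alpha>) \<in> multitensors_over V E \<and> (B, \<beta>) \<in> multitensors_over V E \<and>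
               is_multitensor_mor V A B \<phi> \<and> comp_nat (seq_cat V) V \<beta> \<phi> = \<alpha>},
      Dom = (\<lambda>(a, b, \<phi>). a),
      Cod = (\<lambda>(a, b, \<phi>). b),
      Ident = (\<lambda>(A, \<alpha>). ((A, \<alpha>), (A, \<alpha>), id_nat (seq_cat V) V (EFun A))),
      Comp = (\<lambda>(b, c, \<psi>) (a, b', \<phi>). (a, c, comp_nat (seq_cat V) V \<psi> \<phi>))\<rparr>"


section \<open>The construction \<open>\<Gamma>\<close>\<close>

text \<open>
  A sequence \<open>a = x\<^sub>0, \<dots>, x\<^sub>n = b\<close> is a nonempty list; \<open>steps\<close> lists its \<open>n\<close> pairs of
  consecutive entries.
\<close>

definition paths :: "'i set \<Rightarrow> 'i \<Rightarrow> 'i \<Rightarrow> 'i list set" where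
  "paths S a b = {p \<in> lists S. p \<noteq> [] \<and> hd p = a \<and> last p = b}"

definition steps :: "'i list \<Rightarrow> ('i \<times> 'i) list" where
  "steps p = zip p (tl p)"

definition path_tensor ::
  "('o, 'a) multitensor \<Rightarrow> ('i, 'o) vgraph \<Rightarrow> 'i list \<Rightarrow> 'o" where
  "path_tensor E X p = FObj (EFun E) (map (VHom X) (steps p))"

definition gamma_obj ::
  "('o, 'a) cat \<Rightarrow> ('o, 'a) multitensor \<Rightarrow> ('i, 'o) vgraph \<Rightarrow> ('i, 'o) vgraph" where
  "gamma_obj V E X =
     \<lparr>Vert = Vert X,
      VHom = (\<lambda>(a, b)\<in>Vert X \<times> Vert X. coprod V (paths (Vert X) a b) (path_tensor E X))\<rparr>"

definition gamma_inj ::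
  "('o, 'a) cat \<Rightarrow> ('o, 'a) multitensor \<Rightarrow> ('i, 'o) vgraph \<Rightarrow> 'i list \<Rightarrow> 'a" where
  "gamma_inj V E X p = coinj V (paths (Vert X) (hd p) (last p)) (path_tensor E X) p"

definition gamma_arr ::
  "('o, 'a) cat \<Rightarrow> ('o, 'a) multitensor \<Rightarrow> ('i, 'o, 'a) vgmap \<Rightarrow> ('i, 'o, 'a) vgmap" where
  "gamma_arr V E f =
     (let X = GDom f; Y = GCod f in
     \<lparr>GDom = gamma_obj V E X,
      GCod = gamma_obj V E Y,
      OMap = OMap f,
      HMap = (\<lambda>(a, b)\<in>Vert X \<times> Vert X.
        cotuple V (paths (Vert X) a b) (path_tensor E X)
          (VHom (gamma_obj V E Y) (OMap f a, OMap f b))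
          (\<lambda>p. Comp V (gamma_inj V E Y (map (OMap f) p))
                 (FArr (EFun E) (map (HMap f) (steps p)))))\<rparr>)"

definition gamma_unit ::
  "('o, 'a) cat \<Rightarrow> ('o, 'a) multitensor \<Rightarrow> ('i, 'o) vgraph \<Rightarrow> ('i, 'o, 'a) vgmap" where
  "gamma_unit V E X =
     \<lparr>GDom = X,
      GCod = gamma_obj V E X,
      OMap = (\<lambda>a\<in>Vert X. a),
      HMap = (\<lambda>(a, b)\<in>Vert X \<times> Vert X.
        Comp V (gamma_inj V E X [a, b]) (EUnit E (VHom X (a, b))))\<rparr>"

text \<open>
  By distributivity, \<open>(\<Gamma>E)\<^sup>2 X (a, b)\<close> is the coproduct of the objects
  \<open>E\<^sub>i E\<^sub>j X (\<dots>)\<close>, indexed by the pairs of a sequence \<open>p\<close> from \<open>a\<close> to \<open>b\<close> and a list \<open>qs\<close> which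
  contains, for each step \<open>(x, y)\<close> of \<open>p\<close>, a sequence from \<open>x\<close> to \<open>y\<close>; the coprojections are
  \<open>gamma_inj V E (gamma_obj V E X) p \<circ> E\<^sub>i (gamma_inj V E X (qs ! i))\<close>.  The multiplication maps
  the summand of \<open>(p, qs)\<close> by the substitution of \<open>E\<close> to the summand of the sequence obtained by
  gluing \<open>qs\<close>.
\<close>

definition refinements :: "'i set \<Rightarrow> 'i list \<Rightarrow> 'i list list set" where
  "refinements S p = {qs. list_all2 (\<lambda>q (x, y). q \<in> paths S x y) qs (steps p)}"

definition glue :: "'i list \<Rightarrow> 'i list list \<Rightarrow> 'i list" where
  "glue p qs = hd p # concat (map tl qs)"

definition gamma_mult ::
  "('o, 'a) cat \<Rightarrow> ('o, 'a) multitensor \<Rightarrow> ('i, 'o) vgraph \<Rightarrow> ('i, 'o, 'a) vgmap" where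
  "gamma_mult V E X =
     (let X1 = gamma_obj V E X; X2 = gamma_obj V E X1 in
     \<lparr>GDom = X2,
      GCod = X1,
      OMap = (\<lambda>a\<in>Vert X. a),
      HMap = (\<lambda>(a, b)\<in>Vert X \<times> Vert X.
        (THE m. m \<in> hom V (VHom X2 (a, b)) (VHom X1 (a, b)) \<and>
           (\<forall>p\<in>paths (Vert X) a b. \<forall>qs\<in>refinements (Vert X) p.
              Comp V m (Comp V (gamma_inj V E X1 p) (FArr (EFun E) (map (gamma_inj V E X) qs))) =
              Comp V (gamma_inj V E X (glue p qs))
                (ESubst E (map (\<lambda>q. map (VHom X) (steps q)) qs)))))\<rparr>)"

definition gamma_monad ::
  "'i set set \<Rightarrow> ('o, 'a) cat \<Rightarrow> ('o, 'a) multitensor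
    \<Rightarrow> (('i, 'o) vgraph, ('i, 'o, 'a) vgmap) monad" where
  "gamma_monad U V E =
     \<lparr>MFun = \<lparr>FObj = (\<lambda>X\<in>vgraphs U V. gamma_obj V E X), FArr = (\<lambda>f\<in>vgmaps U V. gamma_arr V E f)\<rparr>,
      MUnit = (\<lambda>X\<in>vgraphs U V. gamma_unit V E X),
      MMult = (\<lambda>X\<in>vgraphs U V. gamma_mult V E X)\<rparr>"

definition gamma_mor ::
  "'i set set \<Rightarrow> ('o, 'a) cat \<Rightarrow> ('o, 'a) multitensor \<Rightarrow> ('o, 'a) multitensor \<Rightarrow> ('o list \<Rightarrow> 'a)
    \<Rightarrow> ('i, 'o) vgraph \<Rightarrow> ('i, 'o, 'a) vgmap" where
  "gamma_mor U V A B \<phi> = (\<lambda>X\<in>vgraphs U V.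
     \<lparr>GDom = gamma_obj V A X,
      GCod = gamma_obj V B X,
      OMap = (\<lambda>a\<in>Vert X. a),
      HMap = (\<lambda>(a, b)\<in>Vert X \<times> Vert X.
        coprod_map V (paths (Vert X) a b) (path_tensor A X) (path_tensor B X)
          (\<lambda>p. \<phi> (map (VHom X) (steps p))))\<rparr>)"

definition gamma_over ::
  "'i set set \<Rightarrow> ('o, 'a) cat \<Rightarrow> ('o, 'a) multitensor \<Rightarrow> ('o, 'a) multitensor_over
    \<Rightarrow> ('i, 'o, 'a) operad" where
  "gamma_over U V E = (\<lambda>(A, \<alpha>). (gamma_monad U V A, gamma_mor U V A E \<alpha>))"

definition Gamma ::
  "'i set set \<Rightarrow> ('o, 'a) cat \<Rightarrow> ('o, 'a) multitensor
    \<Rightarrow> (('o, 'a) multitensor_over,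
        ('o, 'a) multitensor_over \<times> ('o, 'a) multitensor_over \<times> ('o list \<Rightarrow> 'a),
        ('i, 'o, 'a) operad,
        ('i, 'o, 'a) operad \<times> ('i, 'o, 'a) operad \<times> (('i, 'o) vgraph \<Rightarrow> ('i, 'o, 'a) vgmap)) fctr"
where
  "Gamma U V E =
     \<lparr>FObj = (\<lambda>a\<in>Obj (Mult V E). gamma_over U V E a),
      FArr = (\<lambda>(a, b, \<phi>)\<in>Arr (Mult V E).
        (gamma_over U V E a, gamma_over U V E b, gamma_mor U V (fst a) (fst b) \<phi>))\<rparr>"

end

(*
 A sequence Z of objects of V is encoded by the graph gr Z on the vertices 0, ..., n which has Z_i as
 hom from i - 1 to i and the initial object elsewhere.  A path in a V-graph X with sequence of homs Z
 is the same thing as a map gr Z -> X, and the only path from 0 to n in gr Z that does not pass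
 through an initial hom is 0, 1, ..., n.  Hence the hom of Gamma E (gr Z) from 0 to n is E Z, and the
 multitensor E, as well as a morphism of multitensors, is recovered from its image under Gamma.

 Let alpha : S -> Gamma E be an operad over Set.  Its cartesian naturality squares at the maps
 gr Z -> X, together with the stability of coproducts under pullback, exhibit the homs of S X as
 coproducts, indexed by the paths of X, of the values at Z of A Z := S (gr Z) (0, n).  So A is the
 multitensor with Gamma A isomorphic to S.

 Both constructions are instances of one relation: a monad T over Set is presented by a multitensor E
 if there are coproduct diagrams E X(p) -> T X (a, b), indexed by the paths p from a to b, which are
 compatible with the functors, units and multiplications.  The axioms of the multitensor
 correspond to those of the monad, because the summand of a path is mono and every sequence is the
 sequence of homs of some path.  A multitensor with a cartesian morphism to the cartesian multitensor
 E is itself cartesian, by cancellation of pullback squares.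
*)
theory Submission
 imports Defs
begin

section \<open>Categories, pullbacks and coproducts\<close>

text \<open>Three obstacles shape the proof. Extensivity is an equivalence of slices for index sets
  in \<open>U\<close>, but the sums that occur are indexed by lists of vertices or by paths with
  refinements. Strict initial objects, disjointness, monic coprojections and universality are
  therefore extracted from fullness and essential surjectivity, for every index set in bijection
  with a member of \<open>U\<close>. The functor of an operad has no chosen coproducts, and its
  multitensor determines it only up to isomorphism. Presentations therefore allow arbitrary
  coprojections: two monads presented by the same multitensor are compared through the identity of
  that multitensor. The multiplication of an operad is known only on whole graphs. A substitution is
  read off at the graph of the concatenated sequence, after its standard path has been cut at the
  prescribed lengths. That the outcome fits an arbitrary graph rests on one fact: a refinement is
  determined by its gluing and the lengths of its pieces. The same fact makes multiplications
  cartesian.\<close>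

lemma hom_iff [simp]: "f \<in> hom C x y \<longleftrightarrow> f \<in> Arr C \<and> Dom C f = x \<and> Cod C f = y"
 by (auto simp: hom_def)

definition mono_arr :: "('o, 'a) cat \<Rightarrow> 'a \<Rightarrow> bool" where
 "mono_arr C m \<longleftrightarrow> m \<in> Arr C \<and>
   (\<forall>u\<in>Arr C. \<forall>v\<in>Arr C. Dom C u = Dom C v \<longrightarrow> Cod C u = Dom C m \<longrightarrow> Cod C v = Dom C m \<longrightarrow>
    Comp C m u = Comp C m v \<longrightarrow> u = v)"

definition initial :: "('o, 'a) cat \<Rightarrow> 'o \<Rightarrow> bool" where
 "initial C x \<longleftrightarrow> x \<in> Obj C \<and> (\<forall>d\<in>Obj C. \<exists>!u. u \<in> hom C x d)"

locale Category =
 fixes C :: "('o, 'a) cat"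
 assumes category: "category C"
begin

abbreviation cmp (infixr "**" 70) where "g ** f \<equiv> Comp C g f"

lemma Dom_Obj [simp]: "f \<in> Arr C \<Longrightarrow> Dom C f \<in> Obj C"
 and Cod_Obj [simp]: "f \<in> Arr C \<Longrightarrow> Cod C f \<in> Obj C"
 using category by (auto simp: category_def)

lemma Ident_Arr [simp]: "x \<in> Obj C \<Longrightarrow> Ident C x \<in> Arr C"
 and Dom_Ident [simp]: "x \<in> Obj C \<Longrightarrow> Dom C (Ident C x) = x"
 and Cod_Ident [simp]: "x \<in> Obj C \<Longrightarrow> Cod C (Ident C x) = x"
 using category by (auto simp: category_def)

lemma Comp_Arr [simp]: "f \<in> Arr C \<Longrightarrow> g \<in> Arr C \<Longrightarrow> Dom C g = Cod C f \<Longrightarrow> g ** f \<in> Arr C"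
 and Dom_Comp [simp]: "f \<in> Arr C \<Longrightarrow> g \<in> Arr C \<Longrightarrow> Dom C g = Cod C f \<Longrightarrow> Dom C (g ** f) = Dom C f"
 and Cod_Comp [simp]: "f \<in> Arr C \<Longrightarrow> g \<in> Arr C \<Longrightarrow> Dom C g = Cod C f \<Longrightarrow> Cod C (g ** f) = Cod C g"
 using category by (auto simp: category_def)

lemma Comp_Ident_right [simp]: "f \<in> Arr C \<Longrightarrow> Dom C f = x \<Longrightarrow> f ** Ident C x = f"
 and Comp_Ident_left [simp]: "f \<in> Arr C \<Longrightarrow> Cod C f = x \<Longrightarrow> Ident C x ** f = f"
 using category by (auto simp: category_def)

lemma Comp_assoc [simp]:
 "f \<in> Arr C \<Longrightarrow> g \<in> Arr C \<Longrightarrow> h \<in> Arr C \<Longrightarrow> Dom C g = Cod C f \<Longrightarrow> Dom C h = Cod C g \<Longrightarrow>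
  (h ** g) ** f = h ** g ** f"
 using category by (auto simp: category_def)

lemma Comp_reassoc:
 assumes "g ** f = k" "f \<in> Arr C" "g \<in> Arr C" "e \<in> Arr C" "Dom C g = Cod C f" "Dom C f = Cod C e"
 shows "g ** f ** e = k ** e"
 using assms Comp_assoc by metis

lemma Comp_swap:
 assumes "g ** f = g' ** f'" "f \<in> Arr C" "g \<in> Arr C" "f' \<in> Arr C" "g' \<in> Arr C" "e \<in> Arr C"
  "Dom C g = Cod C f" "Dom C g' = Cod C f'" "Dom C f = Cod C e" "Dom C f' = Cod C e"
 shows "g ** f ** e = g' ** f' ** e"
 using assms Comp_assoc by metis

lemma isoE:
 assumes "is_iso C f"
 obtains g where "f \<in> Arr C" "g \<in> Arr C" "Dom C g = Cod C f" "Cod C g = Dom C f"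
  "g ** f = Ident C (Dom C f)" "f ** g = Ident C (Cod C f)"
 using assms by (auto simp: is_iso_def)

lemma mono_arrD:
 assumes "mono_arr C m" "m ** u = m ** v" "u \<in> Arr C" "v \<in> Arr C" "Dom C u = Dom C v"
  "Cod C u = Dom C m" "Cod C v = Dom C m"
 shows "u = v"
 using assms by (auto simp: mono_arr_def)

section \<open>Pullback squares: lifting, pasting, cancellation\<close>

lemma pullbackI:
 assumes "p \<in> Arr C" "q \<in> Arr C" "f \<in> Arr C" "g \<in> Arr C" "Dom C p = Dom C q"
  "Cod C p = Dom C f" "Cod C q = Dom C g" "Cod C f = Cod C g" "f ** p = g ** q"
  and "\<And>h k. \<lbrakk>h \<in> Arr C; k \<in> Arr C; Dom C h = Dom C k; Cod C h = Dom C f; Cod C k = Dom C g;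
     f ** h = g ** k\<rbrakk> \<Longrightarrow>
    \<exists>u\<in>Arr C. Dom C u = Dom C h \<and> Cod C u = Dom C p \<and> p ** u = h \<and> q ** u = k"
  and "\<And>u v. \<lbrakk>u \<in> Arr C; v \<in> Arr C; Dom C u = Dom C v; Cod C u = Dom C p; Cod C v = Dom C p;
     p ** u = p ** v; q ** u = q ** v\<rbrakk> \<Longrightarrow> u = v"
 shows "is_pullback C p q f g"
 unfolding is_pullback_def
proof (intro conjI ballI impI)
 fix z h k assume z: "z \<in> Obj C" and h: "h \<in> hom C z (Dom C f)" and k: "k \<in> hom C z (Dom C g)"
  and e: "f ** h = g ** k"
 obtain u where u: "u \<in> Arr C" "Dom C u = Dom C h" "Cod C u = Dom C p" "p ** u = h" "q ** u = k"
  using assms(10)[of h k] h k e by auto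
 show "\<exists>!u. u \<in> hom C z (Dom C p) \<and> p ** u = h \<and> q ** u = k"
 proof (rule ex1I[of _ u])
  show "u \<in> hom C z (Dom C p) \<and> p ** u = h \<and> q ** u = k" using u h by simp
  fix v assume "v \<in> hom C z (Dom C p) \<and> p ** v = h \<and> q ** v = k"
  then show "v = u" using u h by - (rule assms(11), auto)
 qed
qed (use assms in simp_all)

lemma pullback_facts:
 assumes "is_pullback C p q f g"
 shows "p \<in> Arr C" "q \<in> Arr C" "f \<in> Arr C" "g \<in> Arr C" "Dom C p = Dom C q"
  "Cod C p = Dom C f" "Cod C q = Dom C g" "Cod C f = Cod C g" "f ** p = g ** q"
 using assms by (auto simp: is_pullback_def)

lemma pullback_lift:
 assumes "is_pullback C p q f g" "h \<in> Arr C" "k \<in> Arr C" "Dom C h = Dom C k" "Cod C h = Dom C f"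
  "Cod C k = Dom C g" "f ** h = g ** k"
 obtains u where "u \<in> Arr C" "Dom C u = Dom C h" "Cod C u = Dom C p" "p ** u = h" "q ** u = k"
proof -
 have "\<exists>u. u \<in> hom C (Dom C h) (Dom C p) \<and> p ** u = h \<and> q ** u = k"
  using assms unfolding is_pullback_def by (metis Dom_Obj hom_iff)
 then show ?thesis using that by auto
qed

lemma pullback_eqI:
 assumes "is_pullback C p q f g" "u \<in> Arr C" "v \<in> Arr C" "Dom C u = Dom C v" "Cod C u = Dom C p"
  "Cod C v = Dom C p" "p ** u = p ** v" "q ** u = q ** v"
 shows "u = v"
proof -
 note pb = pullback_facts[OF assms(1)]
 have "f ** (p ** u) = g ** (q ** u)"
  using Comp_swap[OF pb(9)] pb assms by simp
 moreover have "p ** u \<in> hom C (Dom C u) (Dom C f)" "q ** u \<in> hom C (Dom C u) (Dom C g)"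
  using pb assms by simp_all
 ultimately have "\<exists>!w. w \<in> hom C (Dom C u) (Dom C p) \<and> p ** w = p ** u \<and> q ** w = q ** u"
  using assms(1,2) unfolding is_pullback_def by (metis Dom_Obj)
 moreover have "u \<in> hom C (Dom C u) (Dom C p)" "v \<in> hom C (Dom C u) (Dom C p)"
  using assms by simp_all
 ultimately show ?thesis using assms(7,8) by metis
qed

lemma pullback_sym: assumes "is_pullback C p q f g" shows "is_pullback C q p g f"
proof -
 note pb = pullback_facts[OF assms]
 show ?thesis
 proof (rule pullbackI)
  fix h k assume "h \<in> Arr C" "k \<in> Arr C" "Dom C h = Dom C k" "Cod C h = Dom C g"
   "Cod C k = Dom C f" "g ** h = f ** k"
  then show "\<exists>u\<in>Arr C. Dom C u = Dom C h \<and> Cod C u = Dom C q \<and> q ** u = h \<and> p ** u = k"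
   using pullback_lift[OF assms, of k h] pb by metis
 next
  fix u v assume "u \<in> Arr C" "v \<in> Arr C" "Dom C u = Dom C v" "Cod C u = Dom C q"
   "Cod C v = Dom C q" "q ** u = q ** v" "p ** u = p ** v"
  then show "u = v" using pullback_eqI[OF assms] pb by metis
 qed (use pb in simp_all)
qed

lemma pullback_paste:
 assumes pb1: "is_pullback C p q f g" and pb2: "is_pullback C p' f f' g'"
 shows "is_pullback C (p' ** p) q f' (g' ** g)"
proof -
 note a = pullback_facts[OF pb1] and b = pullback_facts[OF pb2]
 have e: "f' ** p' ** u = g' ** f ** u" if "u \<in> Arr C" "Cod C u = Dom C f" for u
  using Comp_swap[OF b(9)] b that by simp
 have e': "f ** p ** u = g ** q ** u" if "u \<in> Arr C" "Cod C u = Dom C p" for u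
  using Comp_swap[OF a(9)] a that by simp
 show ?thesis
 proof (rule pullbackI)
  show "f' ** (p' ** p) = (g' ** g) ** q" using a b e by simp
  fix h k assume hk: "h \<in> Arr C" "k \<in> Arr C" "Dom C h = Dom C k" "Cod C h = Dom C f'"
   "Cod C k = Dom C (g' ** g)" "f' ** h = (g' ** g) ** k"
  obtain u where u: "u \<in> Arr C" "Dom C u = Dom C h" "Cod C u = Dom C p'" "p' ** u = h" "f ** u = g ** k"
   using pullback_lift[OF pb2, of h "g ** k"] hk a b by auto
  obtain w where w: "w \<in> Arr C" "Dom C w = Dom C u" "Cod C w = Dom C p" "p ** w = u" "q ** w = k"
   using pullback_lift[OF pb1, of u k] hk u a b by auto
  show "\<exists>u\<in>Arr C. Dom C u = Dom C h \<and> Cod C u = Dom C (p' ** p) \<and> (p' ** p) ** u = h \<and> q ** u = k"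
   using w u a b by (intro bexI[of _ w]) auto
 next
  fix u v assume uv: "u \<in> Arr C" "v \<in> Arr C" "Dom C u = Dom C v" "Cod C u = Dom C (p' ** p)"
   "Cod C v = Dom C (p' ** p)" "(p' ** p) ** u = (p' ** p) ** v" "q ** u = q ** v"
  have "p ** u = p ** v"
   using uv a b e' by - (rule pullback_eqI[OF pb2], auto)
  then show "u = v" using uv a b by - (rule pullback_eqI[OF pb1], auto)
 qed (use a b in simp_all)
qed

lemma pullback_Ident:
 assumes "f \<in> Arr C" shows "is_pullback C (Ident C (Dom C f)) f f (Ident C (Cod C f))"
 by (rule pullbackI) (use assms in auto)

text \<open>A cone \<open>(h, k)\<close> on \<open>f\<close> and \<open>g\<close> becomes the cone
  \<open>(m ** h, k)\<close> on the outer square; its lift satisfies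
  \<open>m ** p ** u = m ** h\<close>, and \<open>m\<close> cancels. The second square only has to
  commute, since \<open>m\<close> being monic takes over the role of its universal property.\<close>

lemma pullback_mono_cancel:
 assumes pb: "is_pullback C (m ** p) q f' (m' ** g)" and m: "mono_arr C m"
  and pq: "p \<in> Arr C" "f \<in> Arr C" "g \<in> Arr C" "m' \<in> Arr C" "Cod C p = Dom C m" "Cod C p = Dom C f"
  "Cod C f = Cod C g" "Dom C m' = Cod C g"
  and e1: "f ** p = g ** q" and e2: "f' ** m = m' ** f"
 shows "is_pullback C p q f g"
proof -
 note a = pullback_facts(1-8)[OF pb]
 have mA: "m \<in> Arr C" using m by (simp add: mono_arr_def)
 show ?thesis
 proof (rule pullbackI)
  fix h k assume hk: "h \<in> Arr C" "k \<in> Arr C" "Dom C h = Dom C k" "Cod C h = Dom C f"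
   "Cod C k = Dom C g" "f ** h = g ** k"
  have "f' ** m ** h = m' ** f ** h" using Comp_swap[OF e2] hk a mA pq by simp
  then obtain u where u: "u \<in> Arr C" "Dom C u = Dom C h" "Cod C u = Dom C (m ** p)"
    "(m ** p) ** u = m ** h" "q ** u = k"
   using pullback_lift[OF pb, of "m ** h" k] hk a mA pq by auto
  have "p ** u = h" using u(1-4) hk(1-5) a mA pq by - (rule mono_arrD[OF m], auto)
  then show "\<exists>u\<in>Arr C. Dom C u = Dom C h \<and> Cod C u = Dom C p \<and> p ** u = h \<and> q ** u = k"
   using u mA pq by (intro bexI[of _ u]) auto
 next
  fix u v assume uv: "u \<in> Arr C" "v \<in> Arr C" "Dom C u = Dom C v" "Cod C u = Dom C p"
   "Cod C v = Dom C p" "p ** u = p ** v" "q ** u = q ** v"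
  then show "u = v" using a mA pq by - (rule pullback_eqI[OF pb], auto)
 qed (use a mA pq e1 in simp_all)
qed

text \<open>A cone on \<open>f ** i\<close> and \<open>g\<close> is a cone on \<open>f\<close> and
  \<open>g\<close> after composition with \<open>i\<close>; the lift is the right one because the
  monic \<open>i\<close> cancels. It serves to move a coprojection from one side of a naturality
  square to the other.\<close>

lemma pullback_shift:
 assumes pb: "is_pullback C (i ** p) q f g" and i: "mono_arr C i" and "p \<in> Arr C" "Cod C p = Dom C i"
 shows "is_pullback C p q (f ** i) g"
proof -
 note a = pullback_facts(1-8)[OF pb] and a9 = pullback_facts(9)[OF pb]
 have iA: "i \<in> Arr C" using i by (simp add: mono_arr_def)
 show ?thesis
 proof (rule pullbackI)
  fix h k assume hk: "h \<in> Arr C" "k \<in> Arr C" "Dom C h = Dom C k" "Cod C h = Dom C (f ** i)"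
   "Cod C k = Dom C g" "(f ** i) ** h = g ** k"
  then obtain u where u: "u \<in> Arr C" "Dom C u = Dom C h" "Cod C u = Dom C (i ** p)"
    "(i ** p) ** u = i ** h" "q ** u = k"
   using pullback_lift[OF pb, of "i ** h" k] a iA assms by auto
  have "p ** u = h" using u(1-4) hk(1-5) a iA assms(3,4) by - (rule mono_arrD[OF i], auto)
  then show "\<exists>u\<in>Arr C. Dom C u = Dom C h \<and> Cod C u = Dom C p \<and> p ** u = h \<and> q ** u = k"
   using u iA assms(3,4) by (intro bexI[of _ u]) auto
 next
  fix u v assume uv: "u \<in> Arr C" "v \<in> Arr C" "Dom C u = Dom C v" "Cod C u = Dom C p"
   "Cod C v = Dom C p" "p ** u = p ** v" "q ** u = q ** v"
  then show "u = v" using a iA assms(3,4) by - (rule pullback_eqI[OF pb], auto)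
 qed (use a a9 iA assms(3,4) in simp_all)
qed

section \<open>Coproducts with arbitrary coprojections\<close>

lemma coproduct_facts:
 assumes "is_coproduct C I X c \<iota>"
 shows "c \<in> Obj C" "\<And>i. i \<in> I \<Longrightarrow> \<iota> i \<in> Arr C" "\<And>i. i \<in> I \<Longrightarrow> Dom C (\<iota> i) = X i"
  "\<And>i. i \<in> I \<Longrightarrow> Cod C (\<iota> i) = c"
 using assms by (auto simp: is_coproduct_def)

lemma coproduct_ex1:
 assumes "is_coproduct C I X c \<iota>" "d \<in> Obj C" "\<And>i. i \<in> I \<Longrightarrow> f i \<in> hom C (X i) d"
 shows "\<exists>!u. u \<in> hom C c d \<and> (\<forall>i\<in>I. u ** \<iota> i = f i)"
proof -
 have "\<forall>d\<in>Obj C. \<forall>f. (\<forall>i\<in>I. f i \<in> hom C (X i) d) \<longrightarrow>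
   (\<exists>!w. w \<in> hom C c d \<and> (\<forall>i\<in>I. w ** \<iota> i = f i))"
  using assms(1) unfolding is_coproduct_def by (elim conjE)
 from bspec[OF this assms(2), THEN spec, of f] show ?thesis using assms(3) by simp
qed

lemma coproduct_eqI:
 assumes "is_coproduct C I X c \<iota>" "u \<in> Arr C" "v \<in> Arr C" "Dom C u = c" "Dom C v = c"
  "Cod C u = Cod C v" "\<And>i. i \<in> I \<Longrightarrow> u ** \<iota> i = v ** \<iota> i"
 shows "u = v"
proof -
 note a = coproduct_facts[OF assms(1)]
 have "\<exists>!w. w \<in> hom C c (Cod C u) \<and> (\<forall>i\<in>I. w ** \<iota> i = u ** \<iota> i)"
  using a assms(2,4) by (intro coproduct_ex1[OF assms(1)]) auto
 then obtain w where w: "\<And>v. v \<in> hom C c (Cod C u) \<Longrightarrow> (\<And>i. i \<in> I \<Longrightarrow> v ** \<iota> i = u ** \<iota> i) \<Longrightarrow> v = w"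
  by blast
 show ?thesis using w[of u] w[of v] assms by simp
qed

lemma coproduct_lift:
 assumes "is_coproduct C I X c \<iota>" "d \<in> Obj C" "\<And>i. i \<in> I \<Longrightarrow> f i \<in> hom C (X i) d"
 obtains u where "u \<in> Arr C" "Dom C u = c" "Cod C u = d" "\<And>i. i \<in> I \<Longrightarrow> u ** \<iota> i = f i"
proof -
 from coproduct_ex1[OF assms] obtain u where "u \<in> hom C c d" "\<forall>i\<in>I. u ** \<iota> i = f i" by blast
 then show ?thesis using that[of u] by simp
qed

lemma coproductI:
 assumes "c \<in> Obj C" "\<And>i. i \<in> I \<Longrightarrow> \<iota> i \<in> hom C (X i) c"
  and "\<And>d f. d \<in> Obj C \<Longrightarrow> (\<And>i. i \<in> I \<Longrightarrow> f i \<in> hom C (X i) d) \<Longrightarrow>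
   \<exists>u\<in>hom C c d. \<forall>i\<in>I. u ** \<iota> i = f i"
  and "\<And>u v. \<lbrakk>u \<in> Arr C; v \<in> Arr C; Dom C u = c; Dom C v = c; Cod C u = Cod C v;
   \<And>i. i \<in> I \<Longrightarrow> u ** \<iota> i = v ** \<iota> i\<rbrakk> \<Longrightarrow> u = v"
 shows "is_coproduct C I X c \<iota>"
 unfolding is_coproduct_def
proof (intro conjI ballI allI impI)
 fix d f assume d: "d \<in> Obj C" and f: "\<forall>i\<in>I. f i \<in> hom C (X i) d"
 then obtain u where u: "u \<in> hom C c d" "\<forall>i\<in>I. u ** \<iota> i = f i" using assms(3)[of d f] by blast
 show "\<exists>!u. u \<in> hom C c d \<and> (\<forall>i\<in>I. u ** \<iota> i = f i)"
 proof (rule ex1I[of _ u])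
  fix v assume "v \<in> hom C c d \<and> (\<forall>i\<in>I. v ** \<iota> i = f i)"
  then show "v = u" using u by - (rule assms(4), auto)
 qed (use u in simp)
qed (use assms in simp_all)

lemma coproduct_cong:
 assumes "is_coproduct C I X c \<iota>" "\<And>i. i \<in> I \<Longrightarrow> X' i = X i" "\<And>i. i \<in> I \<Longrightarrow> \<iota>' i = \<iota> i"
 shows "is_coproduct C I X' c \<iota>'"
 using assms unfolding is_coproduct_def by simp

lemma coproduct_chosen:
 assumes "is_coproduct C I X c \<iota>"
 shows "is_coproduct C I X (coprod C I X) (coinj C I X)"
proof -
 have "case (SOME (c, \<iota>). is_coproduct C I X c \<iota>) of (c, \<iota>) \<Rightarrow> is_coproduct C I X c \<iota>"
  by (rule someI[of _ "(c, \<iota>)"]) (use assms in simp)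
 then show ?thesis unfolding coprod_def coinj_def by (simp add: case_prod_beta)
qed

lemma cotuple_facts:
 assumes "is_coproduct C I X c \<iota>" "d \<in> Obj C" "\<And>i. i \<in> I \<Longrightarrow> f i \<in> hom C (X i) d"
 shows "cotuple C I X d f \<in> Arr C" "Dom C (cotuple C I X d f) = coprod C I X"
  "Cod C (cotuple C I X d f) = d" "\<And>i. i \<in> I \<Longrightarrow> cotuple C I X d f ** coinj C I X i = f i"
proof -
 have "\<exists>!u. u \<in> hom C (coprod C I X) d \<and> (\<forall>i\<in>I. u ** coinj C I X i = f i)"
  by (rule coproduct_ex1[OF coproduct_chosen[OF assms(1)] assms(2,3)])
 from theI'[OF this]
 show "cotuple C I X d f \<in> Arr C" "Dom C (cotuple C I X d f) = coprod C I X"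
  "Cod C (cotuple C I X d f) = d" "\<And>i. i \<in> I \<Longrightarrow> cotuple C I X d f ** coinj C I X i = f i"
  unfolding cotuple_def by auto
qed

lemma coproduct_iso:
 assumes "is_coproduct C I X c \<iota>" "is_coproduct C I X d \<kappa>"
 obtains k k' where "k \<in> Arr C" "Dom C k = c" "Cod C k = d" "k' \<in> Arr C" "Dom C k' = d" "Cod C k' = c"
  "k' ** k = Ident C c" "k ** k' = Ident C d" "\<And>i. i \<in> I \<Longrightarrow> k ** \<iota> i = \<kappa> i"
  "\<And>i. i \<in> I \<Longrightarrow> k' ** \<kappa> i = \<iota> i"
proof -
 note a = coproduct_facts[OF assms(1)] and b = coproduct_facts[OF assms(2)]
 obtain k where k: "k \<in> Arr C" "Dom C k = c" "Cod C k = d" "\<And>i. i \<in> I \<Longrightarrow> k ** \<iota> i = \<kappa> i"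
  using coproduct_lift[OF assms(1), of d \<kappa>] b by auto
 obtain k' where k': "k' \<in> Arr C" "Dom C k' = d" "Cod C k' = c" "\<And>i. i \<in> I \<Longrightarrow> k' ** \<kappa> i = \<iota> i"
  using coproduct_lift[OF assms(2), of c \<iota>] a by auto
 have "k' ** k = Ident C c" using a b k k' by - (rule coproduct_eqI[OF assms(1)], auto)
 moreover have "k ** k' = Ident C d" using a b k k' by - (rule coproduct_eqI[OF assms(2)], auto)
 ultimately show ?thesis using that k k' by blast
qed

lemma coproduct_transfer:
 assumes co: "is_coproduct C I X c \<iota>" and k: "k \<in> Arr C" "Dom C k = c" "Cod C k = d" "k' \<in> Arr C"
  "Dom C k' = d" "Cod C k' = c" "k' ** k = Ident C c" "k ** k' = Ident C d"
 shows "is_coproduct C I X d (\<lambda>i. k ** \<iota> i)"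
proof -
 note a = coproduct_facts[OF co]
 have r: "k' ** k ** u = u" if "u \<in> Arr C" "Cod C u = c" for u
  using Comp_reassoc[OF k(7)] k that by simp
 show ?thesis
 proof (rule coproductI)
  fix e f assume "e \<in> Obj C" "\<And>i. i \<in> I \<Longrightarrow> f i \<in> hom C (X i) e"
  then obtain u where "u \<in> Arr C" "Dom C u = c" "Cod C u = e" "\<And>i. i \<in> I \<Longrightarrow> u ** \<iota> i = f i"
   using coproduct_lift[OF co, of e f] by metis
  then show "\<exists>u\<in>hom C d e. \<forall>i\<in>I. u ** k ** \<iota> i = f i"
   using a k r by (intro bexI[of _ "u ** k'"]) auto
 next
  fix u v assume uv: "u \<in> Arr C" "v \<in> Arr C" "Dom C u = d" "Dom C v = d" "Cod C u = Cod C v"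
   "\<And>i. i \<in> I \<Longrightarrow> u ** k ** \<iota> i = v ** k ** \<iota> i"
  have "u ** k = v ** k" using uv a k by - (rule coproduct_eqI[OF co], auto)
  then have "(u ** k) ** k' = (v ** k) ** k'" by simp
  then show "u = v" using uv k by simp
 qed (use a k in auto)
qed

text \<open>A coproduct of coproducts is one coproduct over a dependent sum. Iterates of \<Gamma>
  have index sets of this kind: the refinements depend on the path that they refine.\<close>

lemma coproduct_Sigma:
 assumes co: "is_coproduct C I Y c \<kappa>" and co': "\<And>i. i \<in> I \<Longrightarrow> is_coproduct C (J i) (X i) (Y i) (\<iota> i)"
 shows "is_coproduct C (Sigma I J) (\<lambda>(i, j). X i j) c (\<lambda>(i, j). \<kappa> i ** \<iota> i j)"
proof -
 note a = coproduct_facts[OF co] and b = coproduct_facts[OF co']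
 show ?thesis
 proof (rule coproductI)
  fix d f assume d: "d \<in> Obj C"
   and f: "\<And>x. x \<in> Sigma I J \<Longrightarrow> f x \<in> hom C (case x of (i, j) \<Rightarrow> X i j) d"
  have "\<exists>u. u \<in> hom C (Y i) d \<and> (\<forall>j\<in>J i. u ** \<iota> i j = f (i, j))" if i: "i \<in> I" for i
  proof -
   have "f (i, j) \<in> hom C (X i j) d" if "j \<in> J i" for j using f[of "(i, j)"] i that by simp
   from coproduct_ex1[OF co'[OF i] d, of "\<lambda>j. f (i, j)", OF this] show ?thesis by (rule ex1_implies_ex)
  qed
  then obtain u where u: "\<And>i. i \<in> I \<Longrightarrow> u i \<in> hom C (Y i) d"
    "\<And>i j. i \<in> I \<Longrightarrow> j \<in> J i \<Longrightarrow> u i ** \<iota> i j = f (i, j)" by metis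
  have u': "w ** \<kappa> i ** \<iota> i j = f (i, j)"
   if "w ** \<kappa> i = u i" "w \<in> Arr C" "Dom C w = c" "i \<in> I" "j \<in> J i" for w i j
   using Comp_reassoc[OF that(1), of "\<iota> i j"] that u(2) a b by simp
  obtain w where "w \<in> Arr C" "Dom C w = c" "Cod C w = d" "\<And>i. i \<in> I \<Longrightarrow> w ** \<kappa> i = u i"
   using coproduct_lift[OF co d u(1)] by metis
  then show "\<exists>u\<in>hom C c d. \<forall>x\<in>Sigma I J. u ** (case x of (i, j) \<Rightarrow> \<kappa> i ** \<iota> i j) = f x"
   using u' by (intro bexI[of _ w]) auto
 next
  fix u v assume uv: "u \<in> Arr C" "v \<in> Arr C" "Dom C u = c" "Dom C v = c" "Cod C u = Cod C v"
   "\<And>x. x \<in> Sigma I J \<Longrightarrow>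
    u ** (case x of (i, j) \<Rightarrow> \<kappa> i ** \<iota> i j) = v ** (case x of (i, j) \<Rightarrow> \<kappa> i ** \<iota> i j)"
  have "u ** \<kappa> i = v ** \<kappa> i" if i: "i \<in> I" for i
  proof (rule coproduct_eqI[OF co'[OF i]])
   fix j assume "j \<in> J i"
   then show "(u ** \<kappa> i) ** \<iota> i j = (v ** \<kappa> i) ** \<iota> i j" using uv(1-5) uv(6)[of "(i, j)"] i a b by simp
  qed (use uv a b i in auto)
  then show "u = v" using uv a b by - (rule coproduct_eqI[OF co], auto)
 qed (use a b in auto)
qed

lemma coproduct_reindex:
 assumes e: "bij_betw e J I" and co: "is_coproduct C I X c \<iota>"
 shows "is_coproduct C J (\<lambda>j. X (e j)) c (\<lambda>j. \<iota> (e j))"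
proof -
 note a = coproduct_facts[OF co]
 have eI: "e j \<in> I" if "j \<in> J" for j using e that by (auto simp: bij_betw_def)
 have e': "\<exists>j\<in>J. e j = i" if "i \<in> I" for i using e that by (auto simp: bij_betw_def)
 show ?thesis
 proof (rule coproductI)
  fix d f assume d: "d \<in> Obj C" and f: "\<And>j. j \<in> J \<Longrightarrow> f j \<in> hom C (X (e j)) d"
  define g where "g i = f (inv_into J e i)" for i
  have g: "g (e j) = f j" if "j \<in> J" for j
   using e that by (simp add: g_def bij_betw_def)
  have "g i \<in> hom C (X i) d" if "i \<in> I" for i using e'[OF that] f g by metis
  then obtain u where "u \<in> Arr C" "Dom C u = c" "Cod C u = d" "\<And>i. i \<in> I \<Longrightarrow> u ** \<iota> i = g i"
   using coproduct_lift[OF co d, of g] by metis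
  then show "\<exists>u\<in>hom C c d. \<forall>j\<in>J. u ** \<iota> (e j) = f j"
   using g eI by (intro bexI[of _ u]) auto
 next
  fix u v assume "u \<in> Arr C" "v \<in> Arr C" "Dom C u = c" "Dom C v = c" "Cod C u = Cod C v"
   "\<And>j. j \<in> J \<Longrightarrow> u ** \<iota> (e j) = v ** \<iota> (e j)"
  then show "u = v" using e' by - (rule coproduct_eqI[OF co], auto)
 qed (use a eI in auto)
qed

lemma coproduct_empty: "is_coproduct C {} X c \<iota> \<longleftrightarrow> initial C c"
 by (auto simp: is_coproduct_def initial_def)

lemma initial_eqI:
 "initial C x \<Longrightarrow> u \<in> Arr C \<Longrightarrow> v \<in> Arr C \<Longrightarrow> Dom C u = x \<Longrightarrow> Dom C v = x \<Longrightarrow> Cod C u = Cod C v \<Longrightarrow> u = v"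
 unfolding initial_def by (metis Cod_Obj hom_iff)

definition from_initial :: "'o \<Rightarrow> 'o \<Rightarrow> 'a" where
 "from_initial x d = (THE u. u \<in> hom C x d)"

lemma from_initial [simp]:
 assumes "initial C x" "d \<in> Obj C"
 shows "from_initial x d \<in> Arr C" "Dom C (from_initial x d) = x" "Cod C (from_initial x d) = d"
proof -
 have "\<exists>!u. u \<in> hom C x d" using assms by (auto simp: initial_def)
 from theI'[OF this]
 show "from_initial x d \<in> Arr C" "Dom C (from_initial x d) = x" "Cod C (from_initial x d) = d"
  by (simp_all add: from_initial_def)
qed

text \<open>A decomposition of \<open>w\<close> concentrated at the index \<open>i\<close>.
  Comparing two of these, at different indices, is what proves coproducts disjoint.\<close>

lemma coproduct_single:
 assumes w: "w \<in> Obj C" and z: "initial C z" and i: "i \<in> I"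
 shows "is_coproduct C I (\<lambda>j. if j = i then w else z) w
  (\<lambda>j. if j = i then Ident C w else from_initial z w)"
proof (rule coproductI)
 fix d f assume d: "d \<in> Obj C" and f: "\<And>j. j \<in> I \<Longrightarrow> f j \<in> hom C (if j = i then w else z) d"
 have "f i ** (if j = i then Ident C w else from_initial z w) = f j" if j: "j \<in> I" for j
  using f[OF i] f[OF j] w z by (cases "j = i") (auto intro: initial_eqI)
 then show "\<exists>u\<in>hom C w d. \<forall>j\<in>I. u ** (if j = i then Ident C w else from_initial z w) = f j"
  using f[OF i] by (intro bexI[of _ "f i"]) auto
next
 fix u v assume "u \<in> Arr C" "v \<in> Arr C" "Dom C u = w" "Dom C v = w"
  "\<And>j. j \<in> I \<Longrightarrow> u ** (if j = i then Ident C w else from_initial z w) =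
   v ** (if j = i then Ident C w else from_initial z w)"
 then show "u = v" using i by force
qed (use w z in auto)

text \<open>With all other summands initial, arrows out of the coproduct amount to arrows out of
  \<open>X i\<close>. The inverse \<open>k\<close> is the identity on \<open>X i\<close> and the
  unique arrow on the rest.\<close>

lemma coproduct_inj_iso:
 assumes co: "is_coproduct C I X c \<iota>" and i: "i \<in> I"
  and z: "\<And>j. j \<in> I \<Longrightarrow> j \<noteq> i \<Longrightarrow> initial C (X j)"
 obtains k where "k \<in> Arr C" "Dom C k = c" "Cod C k = X i" "k ** \<iota> i = Ident C (X i)" "\<iota> i ** k = Ident C c"
proof -
 note a = coproduct_facts[OF co]
 have Xi: "X i \<in> Obj C" using a i by (metis Dom_Obj)
 define f where "f j = (if j = i then Ident C (X i) else from_initial (X j) (X i))" for j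
 have "f j \<in> hom C (X j) (X i)" if "j \<in> I" for j using Xi z[OF that] by (auto simp: f_def)
 then obtain k where k: "k \<in> Arr C" "Dom C k = c" "Cod C k = X i" "\<And>j. j \<in> I \<Longrightarrow> k ** \<iota> j = f j"
  using coproduct_lift[OF co Xi, of f] by metis
 have "\<iota> i ** k = Ident C c"
 proof (rule coproduct_eqI[OF co])
  fix j assume j: "j \<in> I"
  show "(\<iota> i ** k) ** \<iota> j = Ident C c ** \<iota> j"
  proof (cases "j = i")
   case True then show ?thesis using a i k Xi by (simp add: f_def)
  next
   case False then show ?thesis using a i j k(1-3) Xi by - (rule initial_eqI[OF z[OF j False]], auto)
  qed
 qed (use a i k Xi in auto)
 moreover have "k ** \<iota> i = Ident C (X i)" using k i by (simp add: f_def)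
 ultimately show ?thesis using that k by blast
qed

end

section \<open>Equivalences\<close>

lemma equivalence_surj:
 assumes "is_equivalence C D F" "d \<in> Obj D"
 obtains x i where "x \<in> Obj C" "is_iso D i" "i \<in> hom D (FObj F x) d"
proof -
 obtain G \<eta> \<epsilon> where G: "is_functor D C G" and e: "is_nat_iso D D (comp_fctr D F G) (id_fctr D) \<epsilon>"
  using assms(1) by (auto simp: is_equivalence_def)
 have "FObj G d \<in> Obj C" using G assms(2) by (simp add: is_functor_def)
 moreover have "is_iso D (\<epsilon> d)" "\<epsilon> d \<in> hom D (FObj F (FObj G d)) d"
  using e assms(2) by (auto simp: is_nat_iso_def is_nat_def comp_fctr_def id_fctr_def)
 ultimately show ?thesis using that by blast
qed

text \<open>\<open>is_equivalence\<close> records two natural isomorphisms and no triangle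
  identities. Naturality of \<epsilon> makes \<open>G\<close> faithful. The candidate
  \<open>f\<close> is \<open>FArr G m\<close> conjugated by \<eta>; then \<open>G\<close> sends
  \<open>FArr F f\<close> and \<open>m\<close> to the same arrow, so these two are equal.\<close>

lemma equivalence_full:
 assumes eq: "is_equivalence C D F" and x: "x \<in> Obj C" and y: "y \<in> Obj C"
  and m: "m \<in> hom D (FObj F x) (FObj F y)"
 obtains f where "f \<in> hom C x y" "FArr F f = m"
proof -
 obtain G \<eta> \<epsilon> where F: "is_functor C D F" and G: "is_functor D C G"
  and h: "is_nat_iso C C (id_fctr C) (comp_fctr C G F) \<eta>"
  and e: "is_nat_iso D D (comp_fctr D F G) (id_fctr D) \<epsilon>"
  using eq by (auto simp: is_equivalence_def)
 interpret C: Category C using F by unfold_locales (simp add: is_functor_def)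
 interpret D: Category D using F by unfold_locales (simp add: is_functor_def)
 have F': "FObj F x \<in> Obj D" if "x \<in> Obj C" for x using F that by (simp add: is_functor_def)
 have F'': "FArr F f \<in> Arr D \<and> Dom D (FArr F f) = FObj F (Dom C f) \<and> Cod D (FArr F f) = FObj F (Cod C f)"
  if "f \<in> Arr C" for f using F that by (simp add: is_functor_def)
 have G': "FObj G x \<in> Obj C" if "x \<in> Obj D" for x using G that by (simp add: is_functor_def)
 have G'': "FArr G f \<in> Arr C \<and> Dom C (FArr G f) = FObj G (Dom D f) \<and> Cod C (FArr G f) = FObj G (Cod D f)"
  if "f \<in> Arr D" for f using G that by (simp add: is_functor_def)
 have h1: "\<eta> x \<in> Arr C \<and> Dom C (\<eta> x) = x \<and> Cod C (\<eta> x) = FObj G (FObj F x)" "is_iso C (\<eta> x)"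
  if "x \<in> Obj C" for x
  using h that by (auto simp: is_nat_iso_def is_nat_def comp_fctr_def id_fctr_def)
 have h2: "Comp C (FArr G (FArr F f)) (\<eta> (Dom C f)) = Comp C (\<eta> (Cod C f)) f" if "f \<in> Arr C" for f
  using h that by (auto simp: is_nat_iso_def is_nat_def comp_fctr_def id_fctr_def)
 have e1: "\<epsilon> x \<in> Arr D \<and> Dom D (\<epsilon> x) = FObj F (FObj G x) \<and> Cod D (\<epsilon> x) = x" "is_iso D (\<epsilon> x)"
  if "x \<in> Obj D" for x
  using e that by (auto simp: is_nat_iso_def is_nat_def comp_fctr_def id_fctr_def)
 have e2: "Comp D f (\<epsilon> (Dom D f)) = Comp D (\<epsilon> (Cod D f)) (FArr F (FArr G f))" if "f \<in> Arr D" for f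
  using e that by (auto simp: is_nat_iso_def is_nat_def comp_fctr_def id_fctr_def)
 have Gfaith: "u = v" if uv: "u \<in> Arr D" "v \<in> Arr D" "Dom D u = Dom D v" "Cod D u = Cod D v"
  "FArr G u = FArr G v" for u v
 proof -
  obtain k where k: "k \<in> Arr D" "Dom D k = Dom D u" "Cod D k = Dom D (\<epsilon> (Dom D u))"
    "Comp D (\<epsilon> (Dom D u)) k = Ident D (Dom D u)"
   using D.isoE[OF e1(2)[of "Dom D u"]] e1 uv by (metis D.Dom_Obj)
  have "Comp D u (\<epsilon> (Dom D u)) = Comp D v (\<epsilon> (Dom D u))" using e2 uv by metis
  then have "Comp D (Comp D u (\<epsilon> (Dom D u))) k = Comp D (Comp D v (\<epsilon> (Dom D u))) k" by simp
  then show ?thesis using k uv e1 by simp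
 qed
 obtain k where k: "k \<in> Arr C" "Dom C k = Cod C (\<eta> y)" "Cod C k = y" "Comp C k (\<eta> y) = Ident C y"
   "Comp C (\<eta> y) k = Ident C (Cod C (\<eta> y))"
  using C.isoE[OF h1(2)[OF y]] h1[OF y] by metis
 define f where "f = Comp C k (Comp C (FArr G m) (\<eta> x))"
 have f: "f \<in> Arr C" "Dom C f = x" "Cod C f = y"
  using k m h1[OF x] h1[OF y] G'' by (simp_all add: f_def)
 have "Comp C (\<eta> y) f = Comp C (FArr G m) (\<eta> x)"
  using C.Comp_reassoc[OF k(5)] k m h1[OF x] h1[OF y] G'' by (simp add: f_def)
 then have "Comp C (FArr G (FArr F f)) (\<eta> x) = Comp C (FArr G m) (\<eta> x)" using h2[OF f(1)] f by simp
 moreover obtain k' where k': "k' \<in> Arr C" "Dom C k' = Cod C (\<eta> x)" "Cod C k' = x"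
   "Comp C (\<eta> x) k' = Ident C (Cod C (\<eta> x))"
  using C.isoE[OF h1(2)[OF x]] h1[OF x] by metis
 ultimately have "Comp C (Comp C (FArr G (FArr F f)) (\<eta> x)) k' = Comp C (Comp C (FArr G m) (\<eta> x)) k'" by simp
 then have "FArr G (FArr F f) = FArr G m" using k' f m F'' G'' h1[OF x] by simp
 then have "FArr F f = m" using f m F'' by - (rule Gfaith, auto)
 then show ?thesis using that f by auto
qed

text \<open>The quasi-inverse sends \<open>d\<close> to a chosen object whose image is isomorphic to
  \<open>d\<close>, and an arrow to a preimage of its conjugate under the chosen isomorphisms.
  Equations in \<open>C\<close> are checked after applying \<open>F\<close>, which is why
  \<open>faith\<close> recurs.\<close>

lemma equivalenceI:
 assumes F: "is_functor C D F"
  and full: "\<And>x y m. x \<in> Obj C \<Longrightarrow> y \<in> Obj C \<Longrightarrow> m \<in> hom D (FObj F x) (FObj F y) \<Longrightarrow>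
   \<exists>f\<in>hom C x y. FArr F f = m"
  and faith: "\<And>f g. f \<in> Arr C \<Longrightarrow> g \<in> Arr C \<Longrightarrow> Dom C f = Dom C g \<Longrightarrow> Cod C f = Cod C g \<Longrightarrow>
   FArr F f = FArr F g \<Longrightarrow> f = g"
  and surj: "\<And>d. d \<in> Obj D \<Longrightarrow> \<exists>x\<in>Obj C. \<exists>i\<in>hom D (FObj F x) d. is_iso D i"
 shows "is_equivalence C D F"
proof -
 interpret C: Category C using F by unfold_locales (simp add: is_functor_def)
 interpret D: Category D using F by unfold_locales (simp add: is_functor_def)
 have F1 [simp]: "FObj F x \<in> Obj D" if "x \<in> Obj C" for x using F that by (simp add: is_functor_def)
 have F2 [simp]: "FArr F f \<in> Arr D" "Dom D (FArr F f) = FObj F (Dom C f)"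
  "Cod D (FArr F f) = FObj F (Cod C f)" if "f \<in> Arr C" for f using F that by (simp_all add: is_functor_def)
 have F3 [simp]: "FArr F (Ident C x) = Ident D (FObj F x)" if "x \<in> Obj C" for x
  using F that by (simp add: is_functor_def)
 have F4 [simp]: "FArr F (Comp C g f) = Comp D (FArr F g) (FArr F f)"
  if "f \<in> Arr C" "g \<in> Arr C" "Dom C g = Cod C f" for f g using F that by (simp add: is_functor_def)
 have "\<forall>d\<in>Obj D. \<exists>x e e'. x \<in> Obj C \<and> e \<in> hom D (FObj F x) d \<and> e' \<in> hom D d (FObj F x) \<and>
   Comp D e' e = Ident D (FObj F x) \<and> Comp D e e' = Ident D d"
  using surj unfolding is_iso_def by (metis hom_iff)
 then obtain X e e' where "\<forall>d\<in>Obj D. X d \<in> Obj C \<and> e d \<in> hom D (FObj F (X d)) d \<and>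
   e' d \<in> hom D d (FObj F (X d)) \<and>
   Comp D (e' d) (e d) = Ident D (FObj F (X d)) \<and> Comp D (e d) (e' d) = Ident D d"
  by metis
 then have X [simp]: "\<And>d. d \<in> Obj D \<Longrightarrow> X d \<in> Obj C"
  and e [simp]: "\<And>d. d \<in> Obj D \<Longrightarrow> e d \<in> Arr D" "\<And>d. d \<in> Obj D \<Longrightarrow> Dom D (e d) = FObj F (X d)"
   "\<And>d. d \<in> Obj D \<Longrightarrow> Cod D (e d) = d"
  and e' [simp]: "\<And>d. d \<in> Obj D \<Longrightarrow> e' d \<in> Arr D" "\<And>d. d \<in> Obj D \<Longrightarrow> Dom D (e' d) = d"
   "\<And>d. d \<in> Obj D \<Longrightarrow> Cod D (e' d) = FObj F (X d)"
  and ee [simp]: "\<And>d. d \<in> Obj D \<Longrightarrow> Comp D (e' d) (e d) = Ident D (FObj F (X d))"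
   "\<And>d. d \<in> Obj D \<Longrightarrow> Comp D (e d) (e' d) = Ident D d"
  by simp_all
 have ee2 [simp]: "Comp D (e d) (Comp D (e' d) f) = f" if "d \<in> Obj D" "f \<in> Arr D" "Cod D f = d" for d f
  using D.Comp_reassoc[OF ee(2)[OF that(1)], of f] that by simp
 have ee3 [simp]: "Comp D (e' d) (Comp D (e d) f) = f" if "d \<in> Obj D" "f \<in> Arr D" "Cod D f = FObj F (X d)" for d f
  using D.Comp_reassoc[OF ee(1)[OF that(1)], of f] that by simp
 \<comment> \<open>A choice of preimages under \<open>F\<close>; by faithfulness it respects
   identities and composites.\<close>
 define L where "L x y m = (SOME f. f \<in> hom C x y \<and> FArr F f = m)" for x y m
 have L: "L x y m \<in> hom C x y \<and> FArr F (L x y m) = m"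
  if "x \<in> Obj C" "y \<in> Obj C" "m \<in> Arr D" "Dom D m = FObj F x" "Cod D m = FObj F y" for x y m
  unfolding L_def by (rule someI_ex) (use full[of x y m] that in auto)
 then have L1 [simp]: "L x y m \<in> Arr C" "Dom C (L x y m) = x" "Cod C (L x y m) = y" "FArr F (L x y m) = m"
  if "x \<in> Obj C" "y \<in> Obj C" "m \<in> Arr D" "Dom D m = FObj F x" "Cod D m = FObj F y" for x y m
  using that by simp_all
 define G where "G = \<lparr>FObj = (\<lambda>d\<in>Obj D. X d),
  FArr = (\<lambda>m\<in>Arr D. L (X (Dom D m)) (X (Cod D m)) (Comp D (e' (Cod D m)) (Comp D m (e (Dom D m)))))\<rparr>"
 have G: "is_functor D C G"
  unfolding is_functor_def
 proof (intro conjI ballI impI)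
  fix f g assume fg: "f \<in> Arr D" "g \<in> Arr D" "Dom D g = Cod D f"
  show "FArr G (Comp D g f) = Comp C (FArr G g) (FArr G f)"
   using fg by - (rule faith, (simp_all add: G_def))
 qed (auto simp: G_def C.category D.category intro!: faith)
 define \<eta> where "\<eta> = (\<lambda>x\<in>Obj C. L x (X (FObj F x)) (e' (FObj F x)))"
 have "is_nat_iso C C (id_fctr C) (comp_fctr C G F) \<eta>"
  unfolding is_nat_iso_def is_nat_def
 proof (intro conjI ballI)
  fix x assume x: "x \<in> Obj C"
  show "is_iso C (\<eta> x)"
   unfolding is_iso_def
  proof (intro conjI bexI[of _ "L (X (FObj F x)) x (e (FObj F x))"])
   show "Comp C (L (X (FObj F x)) x (e (FObj F x))) (\<eta> x) = Ident C (Dom C (\<eta> x))"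
    using x by - (rule faith, (simp_all add: \<eta>_def))
   show "Comp C (\<eta> x) (L (X (FObj F x)) x (e (FObj F x))) = Ident C (Cod C (\<eta> x))"
    using x by - (rule faith, (simp_all add: \<eta>_def))
  qed (use x in \<open>simp_all add: \<eta>_def\<close>)
 next
  fix f assume f: "f \<in> Arr C"
  show "Comp C (FArr (comp_fctr C G F) f) (\<eta> (Dom C f)) = Comp C (\<eta> (Cod C f)) (FArr (id_fctr C) f)"
   using f by - (rule faith, (simp_all add: \<eta>_def G_def comp_fctr_def id_fctr_def))
 qed (simp_all add: \<eta>_def G_def comp_fctr_def id_fctr_def)
 moreover have "is_nat_iso D D (comp_fctr D F G) (id_fctr D) (\<lambda>d\<in>Obj D. e d)"
  unfolding is_nat_iso_def is_nat_def
 proof (intro conjI ballI)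
  fix d assume d: "d \<in> Obj D"
  then show "is_iso D ((\<lambda>d\<in>Obj D. e d) d)"
   unfolding is_iso_def by (intro conjI bexI[of _ "e' d"]) auto
 qed (simp_all add: G_def comp_fctr_def id_fctr_def)
 ultimately show ?thesis using F G unfolding is_equivalence_def by blast
qed

section \<open>Small index sets\<close>

text \<open>\<open>U\<close> consists of sets of vertices, but coproducts are indexed by lists of
  vertices and by pairs of lists; smallness has to make sense for sets of any type.\<close>

definition small :: "'i set set \<Rightarrow> 'j set \<Rightarrow> bool" where
 "small U J \<longleftrightarrow> (\<exists>e. inj_on e J \<and> e ` J \<in> U)"

text \<open>By induction on \<open>n\<close> there are at most as many lists of length
  \<open>n\<close> as elements of \<open>B\<close>, since a product of two sets no larger than the
  infinite \<open>B\<close> is no larger than \<open>B\<close>. All lists form a countable union of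
  these sets.\<close>

lemma card_of_lists_infinite:
 includes cardinal_syntax
 assumes "infinite B"
 shows "|lists B| \<le>o |B|"
proof -
 have "|{xs \<in> lists B. length xs = n}| \<le>o |B|" for n
 proof (induction n)
  case 0
  have "{xs \<in> lists B. length xs = 0} = {[]}" by auto
  then show ?case using assms by (metis card_of_singl_ordLeq finite.emptyI)
 next
  case (Suc n)
  have "{xs \<in> lists B. length xs = Suc n} \<subseteq> (\<lambda>(x, xs). x # xs) ` (B \<times> {xs \<in> lists B. length xs = n})"
   by (auto simp: length_Suc_conv)
  then have "|{xs \<in> lists B. length xs = Suc n}| \<le>o |B \<times> {xs \<in> lists B. length xs = n}|"
   by (rule surj_imp_ordLeq)
  moreover have "|B \<times> {xs \<in> lists B. length xs = n}| \<le>o |B|"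
   by (rule card_of_Times_ordLeq_infinite_Field)
    (use Suc assms in \<open>simp_all add: card_of_mono1 Field_card_of card_of_card_order_on\<close>)
  ultimately show ?case by (rule ordLeq_transitive)
 qed
 then have "|\<Union>n\<in>(UNIV :: nat set). {xs \<in> lists B. length xs = n}| \<le>o |B|"
  using assms by (intro card_of_UNION_ordLeq_infinite[OF assms] ballI) (simp_all add: infinite_iff_card_of_nat)
 moreover have "lists B = (\<Union>n\<in>(UNIV :: nat set). {xs \<in> lists B. length xs = n})" by auto
 ultimately show ?thesis by metis
qed

locale small_universe =
 fixes U :: "'i set set"
 assumes universe: "universe U"
begin

lemma universe_infinite: obtains A where "A \<in> U" "infinite A"
 using universe by (auto simp: universe_def)

lemma universe_UN: assumes "I \<in> U" "\<forall>i\<in>I. A i \<in> U" shows "(\<Union>i\<in>I. A i) \<in> U"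
proof -
 have "\<forall>I\<in>U. \<forall>A. (\<forall>i\<in>I. A i \<in> U) \<longrightarrow> (\<Union>i\<in>I. A i) \<in> U"
  using universe unfolding universe_def by (elim conjE)
 from bspec[OF this assms(1), THEN spec, of A] assms(2) show ?thesis by simp
qed

lemma universe_inj: assumes "A \<in> U" "inj_on g B" "g ` B \<subseteq> A" shows "B \<in> U"
proof -
 have "\<forall>A\<in>U. \<forall>B g. inj_on g B \<and> g ` B \<subseteq> A \<longrightarrow> B \<in> U"
  using universe unfolding universe_def by (elim conjE)
 from bspec[OF this assms(1)] assms(2,3) show ?thesis by blast
qed

lemma universe_subset: "A \<in> U \<Longrightarrow> B \<subseteq> A \<Longrightarrow> B \<in> U"
 by (rule universe_inj[of A "\<lambda>x. x"]) auto

text \<open>Closure under unions speaks of families indexed by a member of \<open>U\<close>; a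
  two-element subset of an infinite member serves as index set.\<close>

lemma universe_Un:
 assumes "S \<in> U" "T \<in> U"
 shows "S \<union> T \<in> U"
proof -
 obtain A where A: "A \<in> U" "infinite A" by (rule universe_infinite)
 obtain B where B: "B \<subseteq> A" "finite B" "card B = 2" using A infinite_arbitrarily_large by metis
 then obtain x y where xy: "B = {x, y}" "x \<noteq> y" by (meson card_2_iff)
 have "\<forall>i\<in>B. (if i = x then S else T) \<in> U" using assms by simp
 then have "(\<Union>i\<in>B. if i = x then S else T) \<in> U"
  by (rule universe_UN[OF universe_subset[OF A(1) B(1)]])
 moreover have "(\<Union>i\<in>B. if i = x then S else T) = S \<union> T" using xy by auto
 ultimately show ?thesis by simp
qed

lemma universe_finite:
 assumes "finite B" shows "B \<in> U"
proof -
 obtain A where A: "A \<in> U" "infinite A" by (rule universe_infinite)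
 obtain C where C: "C \<subseteq> A" "finite C" "card C = card B" using A infinite_arbitrarily_large by metis
 obtain g where "bij_betw g B C" using finite_same_card_bij[OF assms C(2)] C(3) by auto
 then show ?thesis using universe_inj[OF A(1), of g B] C by (auto simp: bij_betw_def)
qed

lemma small_in: "A \<in> U \<Longrightarrow> small U A"
 unfolding small_def by (metis image_ident inj_on_id2)

lemma small_inj:
 assumes "small U J" "inj_on e K" "e ` K \<subseteq> J"
 shows "small U K"
proof -
 obtain e' where e': "inj_on e' J" "e' ` J \<in> U" using assms by (auto simp: small_def)
 have "inj_on (e' \<circ> e) K" using assms e' by (meson comp_inj_on inj_on_subset)
 moreover have "(e' \<circ> e) ` K \<in> U"
  by (rule universe_subset[OF e'(2)]) (use assms in auto)
 ultimately show ?thesis by (auto simp: small_def)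
qed

lemma small_subset: "small U J \<Longrightarrow> K \<subseteq> J \<Longrightarrow> small U K"
 by (rule small_inj[of J "\<lambda>x. x"]) auto

lemma small_finite:
 assumes "finite J" shows "small U (J :: 'j set)"
proof -
 obtain A where A: "A \<in> U" "infinite A" by (rule universe_infinite)
 obtain C where C: "C \<subseteq> A" "finite C" "card C = card J" using A infinite_arbitrarily_large by metis
 obtain g where "bij_betw g J C" using finite_same_card_bij[OF assms C(2)] C(3) by auto
 then show ?thesis using universe_subset[OF A(1) C(1)] by (auto simp: small_def bij_betw_def)
qed

lemma small_lists:
 assumes "small U J" shows "small U (lists J)"
proof -
 obtain A where A: "A \<in> U" "infinite A" by (rule universe_infinite)
 obtain e where e: "inj_on e J" "e ` J \<in> U" using assms by (auto simp: small_def)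
 \<comment> \<open>The lists over a finite \<open>J\<close> do not inject into \<open>J\<close>;
   joining the infinite set \<open>A\<close> repairs this.\<close>
 define B where "B = e ` J \<union> A"
 have B: "B \<in> U" "infinite B" using universe_Un e A by (auto simp: B_def)
 obtain g where g: "inj_on g (lists B)" "g ` lists B \<subseteq> B"
  using card_of_lists_infinite[OF B(2)] card_of_ordLeq by metis
 have "small U (lists B)" using small_inj[OF small_in[OF B(1)] g] .
 then show ?thesis
 proof (rule small_inj[of _ "map e"])
  show "inj_on (map e) (lists J)"
   by (rule inj_onI) (metis e(1) in_listsD inj_on_def list.inj_map_strong)
  show "map e ` lists J \<subseteq> lists B" by (auto simp: B_def)
 qed
qed

end

section \<open>Extensive categories\<close>

locale extensive_category = small_universe U + Category V
 for U :: "'i set set" and V :: "('o, 'a) cat" +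
 assumes extensive: "extensive U V"
begin

notation cmp (infixr "**" 70)

text \<open>Moves a family to an index set inside the type of vertices, where extensivity is
  formulated.\<close>

lemma coproduct_small_reindex:
 assumes "inj_on e J" "is_coproduct V J X c \<iota>"
 shows "is_coproduct V (e ` J) (\<lambda>i. X (inv_into J e i)) c (\<lambda>i. \<iota> (inv_into J e i))"
 by (rule coproduct_reindex[OF _ assms(2)]) (simp add: assms(1) bij_betw_inv_into inj_on_imp_bij_betw)

lemma coproduct_exists:
 assumes "small U J" "\<And>j. j \<in> J \<Longrightarrow> X j \<in> Obj V"
 obtains c \<iota> where "is_coproduct V J X c \<iota>"
proof -
 obtain e where e: "inj_on e J" "e ` J \<in> U" using assms(1) by (auto simp: small_def)
 have "(\<lambda>i. X (inv_into J e i)) \<in> e ` J \<rightarrow> Obj V" using assms(2) e by auto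
 then obtain c \<iota> where c: "is_coproduct V (e ` J) (\<lambda>i. X (inv_into J e i)) c \<iota>"
  using extensive e(2) unfolding extensive_def has_small_coproducts_def by blast
 have "is_coproduct V J (\<lambda>j. X (inv_into J e (e j))) c (\<lambda>j. \<iota> (e j))"
  by (rule coproduct_reindex[OF _ c]) (simp add: e inj_on_imp_bij_betw)
 then have "is_coproduct V J X c (\<lambda>j. \<iota> (e j))" by (rule coproduct_cong) (use e in simp_all)
 then show ?thesis using that by blast
qed

text \<open>Fixed once and for all: it fills every hom of a test graph that does not belong to a
  step.\<close>

definition zero :: 'o where "zero = (SOME z. initial V z)"

lemma initial_zero [simp]: "initial V zero"
proof -
 obtain c \<iota> where "is_coproduct V ({} :: unit set) (\<lambda>_. undefined) c \<iota>"
  by (rule coproduct_exists[where J = "{} :: unit set" and X = "\<lambda>_. undefined", OF small_finite]) auto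
 then have "initial V c" by (simp add: coproduct_empty)
 then show ?thesis unfolding zero_def by (rule someI)
qed

lemma zero_Obj [simp]: "zero \<in> Obj V" using initial_zero unfolding initial_def by blast

section \<open>Extensivity in terms of decompositions\<close>

text \<open>Essential surjectivity of \<open>slice_coprod\<close>: as an object over the coproduct,
  \<open>f\<close> is isomorphic to the sum of a family \<open>g\<close> of arrows into the
  \<open>X i\<close>, and the isomorphism carries the coprojections to the domain of
  \<open>f\<close>. The arrow \<open>k\<close> intervenes because the slice is taken over the chosen
  coproduct, not over \<open>c\<close>.\<close>

lemma coproduct_split_aux:
 assumes I: "I \<in> U" and co: "is_coproduct V I X c \<iota>" and f: "f \<in> Arr V" "Cod V f = c"
 shows "\<exists>Y y g. is_coproduct V I Y (Dom V f) y \<and>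
  (\<forall>i\<in>I. g i \<in> hom V (Y i) (X i) \<and> f ** y i = \<iota> i ** g i)"
proof -
 note a = coproduct_facts[OF co]
 have X: "X \<in> I \<rightarrow> Obj V" using a by (metis Dom_Obj Pi_I)
 let ?P = "prod_cat I (\<lambda>i. slice V (X i))" and ?S = "slice V (coprod V I X)" and ?F = "slice_coprod V I X"
 have eq: "is_equivalence ?P ?S ?F" using extensive I X unfolding extensive_def by blast
 obtain k k' where k: "k \<in> Arr V" "Dom V k = c" "Cod V k = coprod V I X"
   "k' \<in> Arr V" "Dom V k' = coprod V I X" "Cod V k' = c" "k' ** k = Ident V c"
   "k ** k' = Ident V (coprod V I X)" "\<And>i. i \<in> I \<Longrightarrow> k ** \<iota> i = coinj V I X i"
   "\<And>i. i \<in> I \<Longrightarrow> k' ** coinj V I X i = \<iota> i"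
  using coproduct_iso[OF co coproduct_chosen[OF co]] by metis
 have "k ** f \<in> Obj ?S" using k f by (simp add: slice_def)
 then obtain g t where g: "g \<in> Obj ?P" and t: "is_iso ?S t" "t \<in> hom ?S (FObj ?F g) (k ** f)"
  by (rule equivalence_surj[OF eq])
 have gi: "g i \<in> Arr V" "Cod V (g i) = X i" if "i \<in> I" for i
  using g that by (auto simp: prod_cat_def slice_def PiE_iff)
 have Fg: "FObj ?F g = coprod_map V I (\<lambda>i. Dom V (g i)) X g"
  using g by (simp add: slice_coprod_def Let_def)
 define h where "h = snd (snd t)"
 have t': "t = (FObj ?F g, k ** f, h)" using t(2) by (cases t) (auto simp: slice_def h_def)
 obtain d \<delta> where d: "is_coproduct V I (\<lambda>i. Dom V (g i)) d \<delta>"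
  by (rule coproduct_exists[OF small_in[OF I], of "\<lambda>i. Dom V (g i)"]) (use gi in auto)
 note dc = coproduct_chosen[OF d] and b = coproduct_facts[OF coproduct_chosen[OF d]]
  and a' = coproduct_facts[OF coproduct_chosen[OF co]]
 have cm: "FObj ?F g \<in> Arr V" "Dom V (FObj ?F g) = coprod V I (\<lambda>i. Dom V (g i))"
  "\<And>i. i \<in> I \<Longrightarrow> FObj ?F g ** coinj V I (\<lambda>i. Dom V (g i)) i = coinj V I X i ** g i"
  unfolding Fg coprod_map_def using gi a'
  by (auto intro!: cotuple_facts[OF d])
 have h: "h \<in> Arr V" "Dom V h = coprod V I (\<lambda>i. Dom V (g i))" "Cod V h = Dom V f"
  "(k ** f) ** h = FObj ?F g"
  using t(2) k(1-3) f cm(2) unfolding t' by (auto simp: slice_def)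
 obtain t2 where t2: "t2 \<in> hom ?S (k ** f) (FObj ?F g)" "Comp ?S t2 t = Ident ?S (FObj ?F g)"
  "Comp ?S t t2 = Ident ?S (k ** f)"
  using t unfolding is_iso_def by auto
 define h2 where "h2 = snd (snd t2)"
 have t2': "t2 = (k ** f, FObj ?F g, h2)" using t2(1) by (cases t2) (auto simp: slice_def h2_def)
 have h2: "h2 \<in> Arr V" "Dom V h2 = Dom V f" "Cod V h2 = coprod V I (\<lambda>i. Dom V (g i))"
  using t2(1) k(1-3) f cm(2) unfolding t2' by (auto simp: slice_def)
 have hh: "h2 ** h = Ident V (coprod V I (\<lambda>i. Dom V (g i)))" "h ** h2 = Ident V (Dom V f)"
  using t2(2,3) k(1-3) f cm(2) unfolding t' t2' by (auto simp: slice_def)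
 have "is_coproduct V I (\<lambda>i. Dom V (g i)) (Dom V f) (\<lambda>i. h ** coinj V I (\<lambda>i. Dom V (g i)) i)"
  by (rule coproduct_transfer[OF dc h(1,2,3) h2 hh])
 moreover have "f ** h ** coinj V I (\<lambda>i. Dom V (g i)) i = \<iota> i ** g i" if i: "i \<in> I" for i
 proof -
  have fh: "f ** h = k' ** FObj ?F g"
   using Comp_reassoc[OF k(7), of "f ** h"] h(1-3) f k(1-6) unfolding h(4)[symmetric] by simp
  have "f ** h ** coinj V I (\<lambda>i. Dom V (g i)) i = (f ** h) ** coinj V I (\<lambda>i. Dom V (g i)) i"
   using h(1-3) f(1) b i by simp
  also have "\<dots> = k' ** FObj ?F g ** coinj V I (\<lambda>i. Dom V (g i)) i"
   unfolding fh using cm(1,2) b i k(4-6) t2(1) unfolding t2' by (auto simp: slice_def)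
  also have "\<dots> = (k' ** coinj V I X i) ** g i" using cm(3)[OF i] a' i gi k(4-6) by simp
  finally show ?thesis using k(10)[OF i] by simp
 qed
 ultimately show ?thesis
  using gi by (intro exI[of _ "\<lambda>i. Dom V (g i)"] exI[of _ "\<lambda>i. h ** coinj V I (\<lambda>i. Dom V (g i)) i"] exI[of _ g]) simp
qed

lemma coproduct_split:
 assumes J: "small U J" and co: "is_coproduct V J X c \<iota>" and f: "f \<in> Arr V" "Cod V f = c"
 obtains Y y g where "is_coproduct V J Y (Dom V f) y"
  "\<And>j. j \<in> J \<Longrightarrow> g j \<in> Arr V" "\<And>j. j \<in> J \<Longrightarrow> Dom V (g j) = Y j" "\<And>j. j \<in> J \<Longrightarrow> Cod V (g j) = X j"
  "\<And>j. j \<in> J \<Longrightarrow> f ** y j = \<iota> j ** g j"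
proof -
 obtain e where e: "inj_on e J" "e ` J \<in> U" using J by (auto simp: small_def)
 obtain Y y g where Y: "is_coproduct V (e ` J) Y (Dom V f) y"
  and g: "\<And>j. j \<in> J \<Longrightarrow> g (e j) \<in> hom V (Y (e j)) (X j) \<and> f ** y (e j) = \<iota> j ** g (e j)"
  using coproduct_split_aux[OF e(2) coproduct_small_reindex[OF e(1) co] f] e(1) by fastforce
 have "is_coproduct V J (\<lambda>j. Y (e j)) (Dom V f) (\<lambda>j. y (e j))"
  by (rule coproduct_reindex[OF _ Y]) (simp add: e inj_on_imp_bij_betw)
 then show ?thesis using that[of "\<lambda>j. Y (e j)" "\<lambda>j. y (e j)" "\<lambda>j. g (e j)"] g by simp
qed

text \<open>Fullness of \<open>slice_coprod\<close>: the families \<open>g\<close> and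
  \<open>g'\<close> are objects of the product of slices, \<open>m\<close> is an arrow over
  \<open>c\<close> between their sums, and a preimage of it is the family \<open>n\<close>. The
  arrows \<open>k\<close>, \<open>l\<close> and \<open>r\<close> translate between given and chosen
  coproducts.\<close>

lemma coproduct_full_aux:
 assumes I: "I \<in> U" and co: "is_coproduct V I X c \<iota>"
  and coY: "is_coproduct V I Y d y" and coY': "is_coproduct V I Y' d' y'"
  and g: "\<And>i. i \<in> I \<Longrightarrow> g i \<in> hom V (Y i) (X i)" and g': "\<And>i. i \<in> I \<Longrightarrow> g' i \<in> hom V (Y' i) (X i)"
  and m: "m \<in> hom V d d'" and q': "q' \<in> hom V d' c"
  and e: "\<And>i. i \<in> I \<Longrightarrow> q' ** m ** y i = \<iota> i ** g i" and e': "\<And>i. i \<in> I \<Longrightarrow> q' ** y' i = \<iota> i ** g' i"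
 shows "\<exists>n. \<forall>i\<in>I. n i \<in> hom V (Y i) (Y' i) \<and> m ** y i = y' i ** n i \<and> g' i ** n i = g i"
proof -
 note a = coproduct_facts[OF co] and aY = coproduct_facts[OF coY] and aY' = coproduct_facts[OF coY']
 have X: "X \<in> I \<rightarrow> Obj V" using a by (metis Dom_Obj Pi_I)
 let ?P = "prod_cat I (\<lambda>i. slice V (X i))" and ?S = "slice V (coprod V I X)" and ?F = "slice_coprod V I X"
 have eq: "is_equivalence ?P ?S ?F" using extensive I X unfolding extensive_def by blast
 \<comment> \<open>Objects of a product category are extensional functions, so the families are
   restricted to \<open>I\<close>.\<close>
 define G G' where "G = restrict g I" and "G' = restrict g' I"
 have GY: "is_coproduct V I (\<lambda>i. Dom V (G i)) d y"
  by (rule coproduct_cong[OF coY]) (use g in \<open>simp_all add: G_def\<close>)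
 have GY': "is_coproduct V I (\<lambda>i. Dom V (G' i)) d' y'"
  by (rule coproduct_cong[OF coY']) (use g' in \<open>simp_all add: G'_def\<close>)
 let ?D = "\<lambda>i. Dom V (G i)" and ?D' = "\<lambda>i. Dom V (G' i)"
 note cX = coproduct_chosen[OF co] and cY = coproduct_chosen[OF GY] and cY' = coproduct_chosen[OF GY']
 note bX = coproduct_facts[OF cX] and bY = coproduct_facts[OF cY] and bY' = coproduct_facts[OF cY']
 obtain k where k: "k \<in> Arr V" "Dom V k = c" "Cod V k = coprod V I X"
   "\<And>i. i \<in> I \<Longrightarrow> k ** \<iota> i = coinj V I X i"
  using coproduct_iso[OF co cX] by metis
 obtain l where l: "l \<in> Arr V" "Dom V l = coprod V I ?D" "Cod V l = d"
   "\<And>i. i \<in> I \<Longrightarrow> l ** coinj V I ?D i = y i"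
  using coproduct_iso[OF cY GY] by metis
 obtain r r' where r: "r \<in> Arr V" "Dom V r = d'" "Cod V r = coprod V I ?D'"
   "r' \<in> Arr V" "Dom V r' = coprod V I ?D'" "Cod V r' = d'" "r' ** r = Ident V d'"
   "\<And>i. i \<in> I \<Longrightarrow> r ** y' i = coinj V I ?D' i" "\<And>i. i \<in> I \<Longrightarrow> r' ** coinj V I ?D' i = y' i"
  using coproduct_iso[OF GY' cY'] by metis
 have Gi: "G i \<in> Arr V" "Dom V (G i) = Y i" "Cod V (G i) = X i" "G' i \<in> Arr V" "Dom V (G' i) = Y' i"
  "Cod V (G' i) = X i" if "i \<in> I" for i
  using g g' that by (auto simp: G_def G'_def)
 have GP: "G \<in> Obj ?P" "G' \<in> Obj ?P" using g g' by (auto simp: G_def G'_def prod_cat_def slice_def)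
 have FG: "FObj ?F G = coprod_map V I ?D X G" "FObj ?F G' = coprod_map V I ?D' X G'"
  using GP by (simp_all add: slice_coprod_def Let_def)
 have cm: "coprod_map V I ?D X G \<in> Arr V" "Dom V (coprod_map V I ?D X G) = coprod V I ?D"
  "Cod V (coprod_map V I ?D X G) = coprod V I X"
  "\<And>i. i \<in> I \<Longrightarrow> coprod_map V I ?D X G ** coinj V I ?D i = coinj V I X i ** G i"
  unfolding coprod_map_def using Gi bX by (auto intro!: cotuple_facts[OF GY])
 have cm': "coprod_map V I ?D' X G' \<in> Arr V" "Dom V (coprod_map V I ?D' X G') = coprod V I ?D'"
  "Cod V (coprod_map V I ?D' X G') = coprod V I X"
  "\<And>i. i \<in> I \<Longrightarrow> coprod_map V I ?D' X G' ** coinj V I ?D' i = coinj V I X i ** G' i"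
  unfolding coprod_map_def using Gi bX by (auto intro!: cotuple_facts[OF GY'])
 have cmr: "coprod_map V I ?D' X G' ** r = k ** q'"
 proof (rule coproduct_eqI[OF coY'])
  fix i assume i: "i \<in> I"
  have "(coprod_map V I ?D' X G' ** r) ** y' i = coprod_map V I ?D' X G' ** coinj V I ?D' i"
   using cm'(1-3) r(1-3) r(8)[OF i] aY' i by simp
  also have "\<dots> = (k ** \<iota> i) ** G' i" using cm'(4)[OF i] k(4)[OF i] by simp
  also have "\<dots> = k ** q' ** y' i" using e'[OF i] k(1-3) a i Gi by (simp add: G'_def)
  finally show "(coprod_map V I ?D' X G' ** r) ** y' i = (k ** q') ** y' i"
   using k(1-3) q' aY' i by simp
 qed (use cm' r(1-3) k(1-3) q' in auto)
 \<comment> \<open>This triangle makes the translated \<open>m\<close> an arrow of the slice over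
   the chosen coproduct.\<close>
 have tri: "coprod_map V I ?D' X G' ** r ** m ** l = coprod_map V I ?D X G"
 proof (rule coproduct_eqI[OF cY])
  fix i assume i: "i \<in> I"
  have "(coprod_map V I ?D' X G' ** r ** m ** l) ** coinj V I ?D i
    = (coprod_map V I ?D' X G' ** r) ** m ** y i"
   using cm'(1-3) r(1-3) m l(1-3) l(4)[OF i] bY i aY by simp
  also have "\<dots> = k ** q' ** m ** y i" unfolding cmr using k(1-3) q' m aY i by simp
  also have "\<dots> = (k ** \<iota> i) ** G i" using e[OF i] k(1-3) a i Gi by (simp add: G_def)
  also have "\<dots> = coprod_map V I ?D X G ** coinj V I ?D i" using cm(4)[OF i] k(4)[OF i] by simp
  finally show "(coprod_map V I ?D' X G' ** r ** m ** l) ** coinj V I ?D i =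
   coprod_map V I ?D X G ** coinj V I ?D i" .
 qed (use cm cm' r(1-3) m l(1-3) in auto)
 have "(FObj ?F G, FObj ?F G', r ** m ** l) \<in> hom ?S (FObj ?F G) (FObj ?F G')"
  using tri cm(1-3) cm'(1-3) r(1-3) m l(1-3) unfolding FG by (simp add: slice_def)
 then obtain t where t: "t \<in> hom ?P G G'" and Ft: "FArr ?F t = (FObj ?F G, FObj ?F G', r ** m ** l)"
  by (rule equivalence_full[OF eq GP])
 define n where "n i = snd (snd (t i))" for i
 have ti: "t i = (G i, G' i, n i)" "n i \<in> Arr V" "Dom V (n i) = Y i" "Cod V (n i) = Y' i" "G' i ** n i = G i"
  if i: "i \<in> I" for i
 proof -
  have tA: "t i \<in> Arr (slice V (X i))" using t i by (auto simp: prod_cat_def PiE_iff)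
  have "Dom ?P t = G" "Cod ?P t = G'" using t by auto
  from fun_cong[OF this(1), of i] fun_cong[OF this(2), of i]
  have "Dom (slice V (X i)) (t i) = G i" "Cod (slice V (X i)) (t i) = G' i"
   using i by (auto simp: prod_cat_def)
  moreover obtain x y z where xyz: "t i = (x, y, z)" by (cases "t i")
  ultimately have "x = G i" "y = G' i" by (simp_all add: slice_def)
  with xyz have "t i = (G i, G' i, n i)" by (simp add: n_def)
  with tA have "t i = (G i, G' i, n i) \<and> n i \<in> Arr V \<and> Dom V (n i) = Dom V (G i) \<and>
    Cod V (n i) = Dom V (G' i) \<and> G' i ** n i = G i"
   unfolding slice_def by simp
  then show "t i = (G i, G' i, n i)" "n i \<in> Arr V" "Dom V (n i) = Y i" "Cod V (n i) = Y' i" "G' i ** n i = G i"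
   unfolding Gi[OF i] by blast+
 qed
 have "n = (\<lambda>i. snd (snd (t i)))" by (rule ext) (simp add: n_def)
 then have "FArr ?F t = (FObj ?F G, FObj ?F G', coprod_map V I ?D ?D' n)"
  using t FG by (simp add: slice_coprod_def Let_def)
 then have rml: "r ** m ** l = coprod_map V I ?D ?D' n" using Ft by simp
 have cn: "\<And>i. i \<in> I \<Longrightarrow> coprod_map V I ?D ?D' n ** coinj V I ?D i = coinj V I ?D' i ** n i"
  unfolding coprod_map_def using Gi ti bY' by (auto intro!: cotuple_facts[OF GY])
 have "m ** y i = y' i ** n i" if i: "i \<in> I" for i
 proof -
  have "m ** y i = (r' ** r) ** m ** y i" using r(7) m aY i by simp
  also have "\<dots> = r' ** (r ** m ** l) ** coinj V I ?D i"
   using r(1-6) m l(1-3) l(4)[OF i] aY bY i by simp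
  also have "\<dots> = (r' ** coinj V I ?D' i) ** n i"
   unfolding rml cn[OF i] using r(4-6) bY' i Gi ti by simp
  finally show ?thesis using r(9)[OF i] by simp
 qed
 then show ?thesis using ti by (intro exI[of _ n]) (auto simp: G_def G'_def)
qed

lemma coproduct_full:
 assumes J: "small U J" and co: "is_coproduct V J X c \<iota>"
  and coY: "is_coproduct V J Y d y" and coY': "is_coproduct V J Y' d' y'"
  and g: "\<And>i. i \<in> J \<Longrightarrow> g i \<in> hom V (Y i) (X i)" and g': "\<And>i. i \<in> J \<Longrightarrow> g' i \<in> hom V (Y' i) (X i)"
  and m: "m \<in> hom V d d'" and q': "q' \<in> hom V d' c"
  and e: "\<And>i. i \<in> J \<Longrightarrow> q' ** m ** y i = \<iota> i ** g i" and e': "\<And>i. i \<in> J \<Longrightarrow> q' ** y' i = \<iota> i ** g' i"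
 obtains n where "\<And>i. i \<in> J \<Longrightarrow> n i \<in> hom V (Y i) (Y' i)" "\<And>i. i \<in> J \<Longrightarrow> m ** y i = y' i ** n i"
  "\<And>i. i \<in> J \<Longrightarrow> g' i ** n i = g i"
proof -
 obtain b where b: "inj_on b J" "b ` J \<in> U" using J by (auto simp: small_def)
 let ?b = "inv_into J b"
 have bb: "?b (b j) = j" if "j \<in> J" for j using b that by simp
 have bJ: "?b i \<in> J" if "i \<in> b ` J" for i using that by (rule inv_into_into)
 obtain n where n: "\<forall>i\<in>b ` J. n i \<in> hom V (Y (?b i)) (Y' (?b i)) \<and> m ** y (?b i) = y' (?b i) ** n i \<and>
   g' (?b i) ** n i = g (?b i)"
  using coproduct_full_aux[OF b(2) coproduct_small_reindex[OF b(1) co] coproduct_small_reindex[OF b(1) coY]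
    coproduct_small_reindex[OF b(1) coY'] g[OF bJ] g'[OF bJ] m q' e[OF bJ] e'[OF bJ]] by blast
 have "n (b i) \<in> hom V (Y i) (Y' i) \<and> m ** y i = y' i ** n (b i) \<and> g' i ** n (b i) = g i" if "i \<in> J" for i
  using bspec[OF n imageI[OF that]] unfolding bb[OF that] .
 then show ?thesis using that[of "\<lambda>i. n (b i)"] by blast
qed

text \<open>The empty case of the decomposition: over an empty coproduct the domain is an empty
  coproduct as well.\<close>

lemma initial_strict:
 assumes "f \<in> Arr V" "initial V (Cod V f)" shows "initial V (Dom V f)"
proof -
 have "is_coproduct V ({} :: unit set) undefined (Cod V f) undefined" using assms by (simp add: coproduct_empty)
 then obtain Y y where "is_coproduct V ({} :: unit set) Y (Dom V f) y"
  using coproduct_split[OF small_finite _ assms(1) refl] by (metis finite.emptyI)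
 then show ?thesis by (simp add: coproduct_empty)
qed

text \<open>Disjointness and monic coprojections in one statement. The domain of \<open>u\<close>
  and \<open>v\<close> decomposes with everything at \<open>i\<close>, via \<open>u\<close>, and
  with everything at \<open>j\<close>, via \<open>v\<close>. Both decompositions lie over
  \<open>c\<close> by the same arrow, so fullness applies to the identity. Its component at
  \<open>i\<close> is again an identity if \<open>i = j\<close>, and otherwise an arrow into
  \<open>zero\<close>, which makes the domain initial.\<close>

lemma coproduct_inj_eqD:
 assumes J: "small U J" and co: "is_coproduct V J X c \<iota>" and ij: "i \<in> J" "j \<in> J"
  and u: "u \<in> Arr V" "Cod V u = X i" and v: "v \<in> Arr V" "Cod V v = X j" "Dom V v = Dom V u"
  and e: "\<iota> i ** u = \<iota> j ** v"
 shows "initial V (Dom V u) \<or> i = j \<and> u = v"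
proof -
 note a = coproduct_facts[OF co]
 let ?w = "Dom V u"
 let ?W = "\<lambda>i k. if k = i then ?w else zero"
  and ?\<kappa> = "\<lambda>i k. if k = i then Ident V ?w else from_initial zero ?w"
  and ?g = "\<lambda>i u k. if k = i then u else from_initial zero (X k)"
 have W: "is_coproduct V J (?W i) ?w (?\<kappa> i)" if "i \<in> J" for i by (rule coproduct_single) (use u that in auto)
 have XO: "X j \<in> Obj V" if "j \<in> J" for j using a that by (metis Dom_Obj)
 have eq: "(\<iota> i ** u) ** ?\<kappa> l k = \<iota> k ** ?g l x k"
  if "k \<in> J" "x \<in> Arr V" "Dom V x = ?w" "Cod V x = X l" "\<iota> l ** x = \<iota> i ** u" "l \<in> J" for k x l
 proof (cases "k = l")
  case True then show ?thesis using that u a ij(1) by simp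
 next
  case False then show ?thesis using that(1-4,6) u a ij XO
   by - (rule initial_eqI[OF initial_zero], auto)
 qed
 have g: "?g l x k \<in> hom V (?W l k) (X k)" if "k \<in> J" "x \<in> Arr V" "Dom V x = ?w" "Cod V x = X l" for k x l
  using that XO by simp
 obtain n where n: "\<And>k. k \<in> J \<Longrightarrow> n k \<in> hom V (?W i k) (?W j k)"
   "\<And>k. k \<in> J \<Longrightarrow> Ident V ?w ** ?\<kappa> i k = ?\<kappa> j k ** n k" "\<And>k. k \<in> J \<Longrightarrow> ?g j v k ** n k = ?g i u k"
 proof (rule coproduct_full[OF J co W[OF ij(1)] W[OF ij(2)], of "?g i u" "?g j v" "Ident V ?w" "\<iota> i ** u"])
  fix k assume k: "k \<in> J"
  show "?g i u k \<in> hom V (?W i k) (X k)" by (rule g[OF k]) (use u in auto)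
  show "?g j v k \<in> hom V (?W j k) (X k)" by (rule g[OF k]) (use v in auto)
  show "(\<iota> i ** u) ** Ident V ?w ** ?\<kappa> i k = \<iota> k ** ?g i u k"
  proof -
   have "Ident V ?w ** ?\<kappa> i k = ?\<kappa> i k" using u by simp
   then show ?thesis using eq[OF k, of u i] u ij by simp
  qed
  show "(\<iota> i ** u) ** ?\<kappa> j k = \<iota> k ** ?g j v k" by (rule eq[OF k]) (use v ij e in auto)
 qed (use u a ij in auto)
 show ?thesis
 proof (cases "i = j")
  case True
  have "n i = Ident V ?w" using n(1)[OF ij(1)] n(2)[OF ij(1)] u(1) True by simp
  then show ?thesis using n(3)[OF ij(1)] u v True by simp
 next
  case False
  then have "n i \<in> hom V ?w zero" using n(1)[OF ij(1)] by simp
  then show ?thesis using initial_strict[of "n i"] by simp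
 qed
qed

text \<open>The case of equal indices; if the domain is initial, the two arrows agree
  anyway.\<close>

lemma coproduct_inj_mono:
 assumes J: "small U J" and co: "is_coproduct V J X c \<iota>" and i: "i \<in> J"
 shows "mono_arr V (\<iota> i)"
proof -
 note a = coproduct_facts(2,3)[OF co i]
 have "u = v" if "u \<in> Arr V" "v \<in> Arr V" "Dom V u = Dom V v" "Cod V u = Dom V (\<iota> i)"
  "Cod V v = Dom V (\<iota> i)" "\<iota> i ** u = \<iota> i ** v" for u v
 proof -
  have "initial V (Dom V u) \<or> i = i \<and> u = v" by (rule coproduct_inj_eqD[OF J co i i]) (use that a in simp_all)
  then show ?thesis using initial_eqI[OF _ that(1,2) refl that(3)[symmetric]] that(4,5) by metis
 qed
 then show ?thesis using a by (auto simp: mono_arr_def)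
qed

text \<open>Decompose \<open>w\<close> along \<open>h\<close>, and each piece along the restriction
  of \<open>k\<close>. Arrows out of \<open>w\<close> can thus be built and compared on pieces that
  lie over a single summand on both sides.\<close>

lemma coproduct_split2:
 assumes sm: "small U I" "small U J" and co: "is_coproduct V I X c \<iota>" "is_coproduct V J Y d \<kappa>"
  and h: "h \<in> hom V w c" and k: "k \<in> hom V w d"
 obtains B e a b where "is_coproduct V (I \<times> J) (\<lambda>(i, j). B i j) w (\<lambda>(i, j). e i j)"
  "\<And>i j. i \<in> I \<Longrightarrow> j \<in> J \<Longrightarrow> a i j \<in> hom V (B i j) (X i)" "\<And>i j. i \<in> I \<Longrightarrow> j \<in> J \<Longrightarrow> b i j \<in> hom V (B i j) (Y j)"
  "\<And>i j. i \<in> I \<Longrightarrow> j \<in> J \<Longrightarrow> h ** e i j = \<iota> i ** a i j" "\<And>i j. i \<in> I \<Longrightarrow> j \<in> J \<Longrightarrow> k ** e i j = \<kappa> j ** b i j"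
proof -
 note c = coproduct_facts[OF co(1)] and hk = h[unfolded hom_iff] k[unfolded hom_iff]
 obtain A y a where A: "is_coproduct V I A w y" "\<And>i. i \<in> I \<Longrightarrow> a i \<in> Arr V"
   "\<And>i. i \<in> I \<Longrightarrow> Dom V (a i) = A i" "\<And>i. i \<in> I \<Longrightarrow> Cod V (a i) = X i" "\<And>i. i \<in> I \<Longrightarrow> h ** y i = \<iota> i ** a i"
  using coproduct_split[OF sm(1) co(1), of h] hk by metis
 note y = coproduct_facts[OF A(1)]
 have "\<exists>B e b. is_coproduct V J B (A i) e \<and> (\<forall>j\<in>J. b j \<in> Arr V \<and> Dom V (b j) = B j \<and> Cod V (b j) = Y j \<and> (k ** y i) ** e j = \<kappa> j ** b j)"
  if i: "i \<in> I" for i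
 proof -
  have "k ** y i \<in> Arr V" "Cod V (k ** y i) = d" "Dom V (k ** y i) = A i" using hk y i by auto
  from coproduct_split[OF sm(2) co(2) this(1,2)] this(3) show ?thesis by metis
 qed
 then obtain B e b where B: "\<And>i. i \<in> I \<Longrightarrow> is_coproduct V J (B i) (A i) (e i)"
  "\<And>i j. i \<in> I \<Longrightarrow> j \<in> J \<Longrightarrow> b i j \<in> Arr V \<and> Dom V (b i j) = B i j \<and> Cod V (b i j) = Y j \<and> (k ** y i) ** e i j = \<kappa> j ** b i j"
  by metis
 note e = coproduct_facts[OF B(1)]
 show ?thesis
 proof (rule that[of B "\<lambda>i j. y i ** e i j" "\<lambda>i j. a i ** e i j" b, OF coproduct_Sigma[OF A(1) B(1)]])
  fix i j assume i: "i \<in> I" and j: "j \<in> J"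
  have "(h ** y i) ** e i j = h ** y i ** e i j" using hk y(2-4)[OF i] e(2-4)[OF i j] by simp
  then show "h ** y i ** e i j = \<iota> i ** a i ** e i j"
   unfolding A(5)[OF i] using c(2-4)[OF i] A(2-4)[OF i] e(2-4)[OF i j] by simp
  show "k ** y i ** e i j = \<kappa> j ** b i j" using B(2)[OF i j] hk y(2-4)[OF i] e(2-4)[OF i j] by simp
 qed (use A e B(2) in auto)
qed

section \<open>Pullback squares of coproducts\<close>

text \<open>Most proofs of cartesianness reduce to this. The square of index sets is a pullback by
  \<open>fg0\<close>, \<open>ex\<close> and \<open>uniq\<close>, and the squares of summands are
  pullbacks by \<open>pb\<close>. A cone is decomposed along both legs at once: a piece over
  \<open>i\<close> and \<open>j\<close> is initial, or else \<open>fI i = gI j\<close> and the piece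
  lifts through the summand of the corresponding index in \<open>IP\<close>. Uniqueness is proved in
  the same way, by decomposing along both candidates.\<close>

lemma coproduct_pullback:
 assumes sm: "small U IP" "small U IX" "small U IY" "small U IZ"
  and coP: "is_coproduct V IP P0 P \<iota>P" and coX: "is_coproduct V IX X0 X \<iota>X"
  and coY: "is_coproduct V IY Y0 Y \<iota>Y" and coZ: "is_coproduct V IZ Z0 Z \<iota>Z"
  and p: "p \<in> hom V P X" and q: "q \<in> hom V P Y" and f: "f \<in> hom V X Z" and g: "g \<in> hom V Y Z"
  and pI: "\<And>k. k \<in> IP \<Longrightarrow> pI k \<in> IX" and qI: "\<And>k. k \<in> IP \<Longrightarrow> qI k \<in> IY"
  and fI: "\<And>i. i \<in> IX \<Longrightarrow> fI i \<in> IZ" and gI: "\<And>j. j \<in> IY \<Longrightarrow> gI j \<in> IZ"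
  and ex: "\<And>i j. i \<in> IX \<Longrightarrow> j \<in> IY \<Longrightarrow> fI i = gI j \<Longrightarrow> \<exists>k\<in>IP. pI k = i \<and> qI k = j"
  and uniq: "\<And>k l. k \<in> IP \<Longrightarrow> l \<in> IP \<Longrightarrow> pI k = pI l \<Longrightarrow> qI k = qI l \<Longrightarrow> k = l"
  and pk: "\<And>k. k \<in> IP \<Longrightarrow> p ** \<iota>P k = \<iota>X (pI k) ** pk k"
  and qk: "\<And>k. k \<in> IP \<Longrightarrow> q ** \<iota>P k = \<iota>Y (qI k) ** qk k"
  and fi: "\<And>i. i \<in> IX \<Longrightarrow> f ** \<iota>X i = \<iota>Z (fI i) ** fi i"
  and gj: "\<And>j. j \<in> IY \<Longrightarrow> g ** \<iota>Y j = \<iota>Z (gI j) ** gj j"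
  and fi_hom: "\<And>i. i \<in> IX \<Longrightarrow> fi i \<in> hom V (X0 i) (Z0 (fI i))"
  and gj_hom: "\<And>j. j \<in> IY \<Longrightarrow> gj j \<in> hom V (Y0 j) (Z0 (gI j))"
  and fg0: "\<And>k. k \<in> IP \<Longrightarrow> fI (pI k) = gI (qI k)"
  and pb: "\<And>k. k \<in> IP \<Longrightarrow> is_pullback V (pk k) (qk k) (fi (pI k)) (gj (qI k))"
  and pk_dom: "\<And>k. k \<in> IP \<Longrightarrow> Dom V (pk k) = P0 k"
 shows "is_pullback V p q f g"
proof -
 note cP = coproduct_facts[OF coP] and cX = coproduct_facts[OF coX] and cY = coproduct_facts[OF coY]
  and cZ = coproduct_facts[OF coZ]
 have P: "p \<in> Arr V" "Dom V p = P" "Cod V p = X" "q \<in> Arr V" "Dom V q = P" "Cod V q = Y"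
  "f \<in> Arr V" "Dom V f = X" "Cod V f = Z" "g \<in> Arr V" "Dom V g = Y" "Cod V g = Z"
  using p q f g by auto
 have F: "fi i \<in> Arr V" "Dom V (fi i) = X0 i" "Cod V (fi i) = Z0 (fI i)" if "i \<in> IX" for i
  using fi_hom[OF that] by auto
 have G: "gj j \<in> Arr V" "Dom V (gj j) = Y0 j" "Cod V (gj j) = Z0 (gI j)" if "j \<in> IY" for j
  using gj_hom[OF that] by auto
 have K: "pk k \<in> Arr V" "qk k \<in> Arr V" "Dom V (pk k) = P0 k" "Dom V (qk k) = P0 k"
  "Cod V (pk k) = X0 (pI k)" "Cod V (qk k) = Y0 (qI k)" if "k \<in> IP" for k
  using pullback_facts(1-8)[OF pb[OF that]] pk_dom[OF that] F[OF pI[OF that]] G[OF qI[OF that]] by auto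
 have comm: "f ** p = g ** q"
 proof (rule coproduct_eqI[OF coP])
  fix k assume k: "k \<in> IP"
  note k0 = pI[OF k] qI[OF k]
  have "(f ** p) ** \<iota>P k = (f ** \<iota>X (pI k)) ** pk k" using pk[OF k] P cP k cX k0 K[OF k] by simp
  also have "\<dots> = \<iota>Z (fI (pI k)) ** fi (pI k) ** pk k"
   unfolding fi[OF k0(1)] using F[OF k0(1)] K[OF k] cZ fI[OF k0(1)] by simp
  also have "\<dots> = \<iota>Z (gI (qI k)) ** gj (qI k) ** qk k"
   using pullback_facts(9)[OF pb[OF k]] fg0[OF k] by simp
  also have "\<dots> = (g ** \<iota>Y (qI k)) ** qk k"
   unfolding gj[OF k0(2)] using G[OF k0(2)] K[OF k] cZ gI[OF k0(2)] by simp
  also have "\<dots> = (g ** q) ** \<iota>P k" using qk[OF k] P cP k cY k0 K[OF k] by simp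
  finally show "(f ** p) ** \<iota>P k = (g ** q) ** \<iota>P k" .
 qed (use P in auto)
 show ?thesis
 proof (rule pullbackI)
  fix h k assume hk: "h \<in> Arr V" "k \<in> Arr V" "Dom V h = Dom V k" "Cod V h = Dom V f"
   "Cod V k = Dom V g" "f ** h = g ** k"
  obtain B e a b where B: "is_coproduct V (IX \<times> IY) (\<lambda>(i, j). B i j) (Dom V h) (\<lambda>(i, j). e i j)"
   and a: "\<And>i j. i \<in> IX \<Longrightarrow> j \<in> IY \<Longrightarrow> a i j \<in> hom V (B i j) (X0 i)" and b: "\<And>i j. i \<in> IX \<Longrightarrow> j \<in> IY \<Longrightarrow> b i j \<in> hom V (B i j) (Y0 j)"
   and ha: "\<And>i j. i \<in> IX \<Longrightarrow> j \<in> IY \<Longrightarrow> h ** e i j = \<iota>X i ** a i j" and kb: "\<And>i j. i \<in> IX \<Longrightarrow> j \<in> IY \<Longrightarrow> k ** e i j = \<iota>Y j ** b i j"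
   by (rule coproduct_split2[OF sm(2,3) coX coY, of h "Dom V h" k]) (use hk P in auto)
  \<comment> \<open>The lift is found on each piece separately; the coproduct property of the pieces
    then assembles \<open>w\<close>.\<close>
  have "\<exists>u. u \<in> hom V (B i j) P \<and> p ** u = h ** e i j \<and> q ** u = k ** e i j" if ij: "i \<in> IX" "j \<in> IY" for i j
  proof -
   note x = cX(2-4)[OF ij(1)] and y = cY(2-4)[OF ij(2)] and z = cZ(2-4)[OF fI[OF ij(1)]] cZ(2-4)[OF gI[OF ij(2)]]
    and fg = F[OF ij(1)] G[OF ij(2)] and ab = a[OF ij, unfolded hom_iff] b[OF ij, unfolded hom_iff]
   have e: "e i j \<in> Arr V" "Dom V (e i j) = B i j" "Cod V (e i j) = Dom V h" using coproduct_facts(2-4)[OF B, of "(i, j)"] ij by auto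
   have "f ** h ** e i j = g ** k ** e i j" by (rule Comp_swap[OF hk(6)]) (use hk e P in simp_all)
   moreover have "f ** \<iota>X i ** a i j = \<iota>Z (fI i) ** fi i ** a i j" by (rule Comp_swap[OF fi[OF ij(1)]]) (use x z fg ab P in simp_all)
   moreover have "g ** \<iota>Y j ** b i j = \<iota>Z (gI j) ** gj j ** b i j" by (rule Comp_swap[OF gj[OF ij(2)]]) (use y z fg ab P in simp_all)
   ultimately have "\<iota>Z (fI i) ** fi i ** a i j = \<iota>Z (gI j) ** gj j ** b i j" by (simp only: ha[OF ij] kb[OF ij])
   then have "initial V (Dom V (fi i ** a i j)) \<or> fI i = gI j \<and> fi i ** a i j = gj j ** b i j"
    by - (rule coproduct_inj_eqD[OF sm(4) coZ fI[OF ij(1)] gI[OF ij(2)]], use fg ab in auto)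
   then consider "initial V (B i j)" | "fI i = gI j" "fi i ** a i j = gj j ** b i j" using fg ab by auto
   then show ?thesis
   proof cases
    case 1
    note i = from_initial[OF 1 cP(1)]
    have "p ** from_initial (B i j) P = h ** e i j" "q ** from_initial (B i j) P = k ** e i j"
     by (rule initial_eqI[OF 1]; use i P e hk in simp)+
    then show ?thesis using i by auto
   next
    case 2
    obtain l where l: "l \<in> IP" "pI l = i" "qI l = j" using ex[OF ij 2(1)] by blast
    note kl = K[OF l(1), unfolded l(2,3)] and pl = cP(2-4)[OF l(1)]
    obtain u where u: "u \<in> Arr V" "Dom V u = B i j" "Cod V u = P0 l" "pk l ** u = a i j" "qk l ** u = b i j"
     using pullback_lift[OF pb[OF l(1)], of "a i j" "b i j"] 2(2) ab fg kl l by metis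
    have "p ** \<iota>P l ** u = \<iota>X i ** pk l ** u" by (rule Comp_swap[OF pk[OF l(1), unfolded l(2)]]) (use u kl pl x P in simp_all)
    moreover have "q ** \<iota>P l ** u = \<iota>Y j ** qk l ** u" by (rule Comp_swap[OF qk[OF l(1), unfolded l(3)]]) (use u kl pl y P in simp_all)
    ultimately have "p ** \<iota>P l ** u = h ** e i j" "q ** \<iota>P l ** u = k ** e i j" by (simp_all only: u(4,5) ha[OF ij] kb[OF ij])
    then show ?thesis using u pl by (intro exI[of _ "\<iota>P l ** u"]) simp
   qed
  qed
  then obtain u where u: "\<And>i j. i \<in> IX \<Longrightarrow> j \<in> IY \<Longrightarrow> u i j \<in> hom V (B i j) P \<and> p ** u i j = h ** e i j \<and> q ** u i j = k ** e i j" by metis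
  obtain w where w: "w \<in> Arr V" "Dom V w = Dom V h" "Cod V w = P"
    "\<And>x. x \<in> IX \<times> IY \<Longrightarrow> w ** (case x of (i, j) \<Rightarrow> e i j) = (case x of (i, j) \<Rightarrow> u i j)"
   by (rule coproduct_lift[OF B cP(1), of "\<lambda>(i, j). u i j"]) (use u in auto)
  have "(r ** w) ** (case x of (i, j) \<Rightarrow> e i j) = r ** (case x of (i, j) \<Rightarrow> u i j)"
   if "x \<in> IX \<times> IY" "r \<in> Arr V" "Dom V r = P" for x r
   unfolding w(4)[OF that(1), symmetric] by (rule Comp_assoc) (use that w coproduct_facts(2-4)[OF B that(1)] in simp_all)
  then have "p ** w = h" "q ** w = k"
   by - (rule coproduct_eqI[OF B]; use w u P hk in auto)+
  then show "\<exists>u\<in>Arr V. Dom V u = Dom V h \<and> Cod V u = Dom V p \<and> p ** u = h \<and> q ** u = k"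
   using w P by (intro bexI[of _ w]) auto
 next
  fix u v assume uv: "u \<in> Arr V" "v \<in> Arr V" "Dom V u = Dom V v" "Cod V u = Dom V p"
   "Cod V v = Dom V p" "p ** u = p ** v" "q ** u = q ** v"
  obtain B e a b where B: "is_coproduct V (IP \<times> IP) (\<lambda>(i, j). B i j) (Dom V u) (\<lambda>(i, j). e i j)"
   and a: "\<And>i j. i \<in> IP \<Longrightarrow> j \<in> IP \<Longrightarrow> a i j \<in> hom V (B i j) (P0 i)" and b: "\<And>i j. i \<in> IP \<Longrightarrow> j \<in> IP \<Longrightarrow> b i j \<in> hom V (B i j) (P0 j)"
   and ha: "\<And>i j. i \<in> IP \<Longrightarrow> j \<in> IP \<Longrightarrow> u ** e i j = \<iota>P i ** a i j" and kb: "\<And>i j. i \<in> IP \<Longrightarrow> j \<in> IP \<Longrightarrow> v ** e i j = \<iota>P j ** b i j"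
   by (rule coproduct_split2[OF sm(1,1) coP coP, of u "Dom V u" v]) (use uv P in auto)
  have "u ** e i j = v ** e i j" if ij: "i \<in> IP" "j \<in> IP" for i j
  proof -
   have e: "e i j \<in> Arr V" "Dom V (e i j) = B i j" "Cod V (e i j) = Dom V u" using coproduct_facts(2-4)[OF B, of "(i, j)"] ij by auto
   note ab = a[OF ij, unfolded hom_iff] b[OF ij, unfolded hom_iff] and k = K[OF ij(1)] K[OF ij(2)] and c = cP(2-4)[OF ij(1)] cP(2-4)[OF ij(2)]
   \<comment> \<open>One computation for both projections: \<open>x\<close> stands for
     \<open>p\<close> or \<open>q\<close>, \<open>s\<close> for the map of indices and
     \<open>r\<close> for the arrows on summands.\<close>
   have key: "initial V (B i j) \<or> s i = s j \<and> r i ** a i j = r j ** b i j"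
    if R: "small U J" "is_coproduct V J Y' y \<kappa>" "s i \<in> J" "s j \<in> J" "x \<in> Arr V" "Dom V x = P" "x ** u = x ** v"
     "r i \<in> hom V (P0 i) (Y' (s i))" "r j \<in> hom V (P0 j) (Y' (s j))" "x ** \<iota>P i = \<kappa> (s i) ** r i" "x ** \<iota>P j = \<kappa> (s j) ** r j"
    for J Y' y and \<kappa> :: "'j \<Rightarrow> 'a" and s r x
   proof -
    note y = coproduct_facts(2-4)[OF R(2,3)] coproduct_facts(2-4)[OF R(2,4)]
    have "x ** u ** e i j = x ** v ** e i j" by (rule Comp_swap[OF R(7)]) (use R(5,6) uv P e in simp_all)
    moreover have "x ** \<iota>P i ** a i j = \<kappa> (s i) ** r i ** a i j" by (rule Comp_swap[OF R(10)]) (use R y c ab in simp_all)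
    moreover have "x ** \<iota>P j ** b i j = \<kappa> (s j) ** r j ** b i j" by (rule Comp_swap[OF R(11)]) (use R y c ab in simp_all)
    ultimately have "\<kappa> (s i) ** r i ** a i j = \<kappa> (s j) ** r j ** b i j" by (simp only: ha[OF ij] kb[OF ij])
    then have "initial V (Dom V (r i ** a i j)) \<or> s i = s j \<and> r i ** a i j = r j ** b i j"
     by - (rule coproduct_inj_eqD[OF R(1-4)], use R(8,9) ab in auto)
    then show ?thesis using R(8) ab by simp
   qed
   have "initial V (B i j) \<or> pI i = pI j \<and> pk i ** a i j = pk j ** b i j"
    by (rule key[OF sm(2) coX pI[OF ij(1)] pI[OF ij(2)] P(1,2) uv(6) _ _ pk[OF ij(1)] pk[OF ij(2)]]) (use k in simp_all)
   moreover have "initial V (B i j) \<or> qI i = qI j \<and> qk i ** a i j = qk j ** b i j"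
    by (rule key[OF sm(3) coY qI[OF ij(1)] qI[OF ij(2)] P(4,5) uv(7) _ _ qk[OF ij(1)] qk[OF ij(2)]]) (use k in simp_all)
   \<comment> \<open>Indices that agree under both projections are equal by \<open>uniq\<close>;
     within one summand \<open>pb\<close> decides.\<close>
   ultimately consider "initial V (B i j)" | "i = j" "pk j ** a i j = pk j ** b i j" "qk j ** a i j = qk j ** b i j"
    using uniq[OF ij] by metis
   then show ?thesis
   proof cases
    case 1 show ?thesis by (rule initial_eqI[OF 1]) (use uv e in simp_all)
   next
    case 2
    have "a i j = b i j" by (rule pullback_eqI[OF pb[OF ij(2)] _ _ _ _ _ 2(2,3)]) (use ab k 2(1) in simp_all)
    then show ?thesis using ha[OF ij] kb[OF ij] 2(1) by simp
   qed
  qed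
  then show "u = v" by - (rule coproduct_eqI[OF B], use uv in auto)
 qed (use P comm in simp_all)
qed

lemma coproduct_singleton:
 assumes "w \<in> Obj V" shows "is_coproduct V {x} (\<lambda>_. w) w (\<lambda>_. Ident V w)"
 by (rule coproduct_cong[OF coproduct_single[OF assms initial_zero, of x]]) auto

text \<open>The hypothesis \<open>inj\<close> makes the square of index sets over \<open>i\<close> a pullback.\<close>

lemma coproduct_inj_pullback:
 assumes sm: "small U I" "small U I'" and co: "is_coproduct V I X c \<iota>" and co': "is_coproduct V I' X' c' \<iota>'"
  and f: "f \<in> hom V c c'" and fI: "\<And>i. i \<in> I \<Longrightarrow> fI i \<in> I'" and fi: "\<And>i. i \<in> I \<Longrightarrow> fi i \<in> hom V (X i) (X' (fI i))"
  and ff: "\<And>i. i \<in> I \<Longrightarrow> f ** \<iota> i = \<iota>' (fI i) ** fi i"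
  and i: "i \<in> I" and inj: "\<And>j. j \<in> I \<Longrightarrow> fI j = fI i \<Longrightarrow> j = i"
 shows "is_pullback V (\<iota> i) (fi i) f (\<iota>' (fI i))"
proof -
 note a = coproduct_facts[OF co] and a' = coproduct_facts[OF co']
 have inj': "i = j" if "j \<in> I" "fI j = fI i" for j using inj[OF that] by simp
 have XO: "X i \<in> Obj V" "X' (fI i) \<in> Obj V" using a(2,3)[OF i] a'(2,3)[OF fI[OF i]] by (metis Dom_Obj)+
 show ?thesis
 proof (rule coproduct_pullback[OF small_finite sm(1) small_finite sm(2) coproduct_singleton[OF XO(1), where x = "()"] co
    coproduct_singleton[OF XO(2), where x = "()"] co', where pI="\<lambda>_. i" and qI="\<lambda>x. x" and fI=fI and gI="\<lambda>_. fI i"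
    and pk="\<lambda>_. Ident V (X i)" and qk="\<lambda>_. fi i" and fi=fi and gj="\<lambda>_. Ident V (X' (fI i))"])
  show "is_pullback V (Ident V (X i)) (fi i) (fi i) (Ident V (X' (fI i)))"
   using pullback_Ident[of "fi i"] fi[OF i] by simp
 qed (use a a' f fI fi ff i inj' XO in auto)
qed

text \<open>The decomposition of \<open>Dom V f\<close> supplied by extensivity consists of pullback
  squares too. Its pieces are therefore isomorphic, over \<open>Dom V f\<close>, to the given ones,
  and the coproduct property passes along these isomorphisms.\<close>

lemma coproduct_universal:
 assumes J: "small U J" and co: "is_coproduct V J X c \<iota>" and f: "f \<in> Arr V" "Cod V f = c"
  and pb: "\<And>j. j \<in> J \<Longrightarrow> is_pullback V (g j) (y j) (\<iota> j) f"
 shows "is_coproduct V J (\<lambda>j. Dom V (y j)) (Dom V f) y"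
proof -
 note a = coproduct_facts[OF co]
 obtain A a g' where A: "is_coproduct V J A (Dom V f) a" "\<And>i. i \<in> J \<Longrightarrow> g' i \<in> Arr V"
    "\<And>i. i \<in> J \<Longrightarrow> Dom V (g' i) = A i" "\<And>i. i \<in> J \<Longrightarrow> Cod V (g' i) = X i"
    "\<And>i. i \<in> J \<Longrightarrow> f ** a i = \<iota> i ** g' i"
  using coproduct_split[OF J co f] by metis
 note cA = coproduct_facts[OF A(1)]
 have pb': "is_pullback V (g' j) (a j) (\<iota> j) f" if j: "j \<in> J" for j
  by (rule pullback_sym[OF coproduct_inj_pullback[OF J J A(1) co, of f "\<lambda>j. j" g' j]]) (use A f j in auto)
 have "\<exists>k k'. k \<in> hom V (A j) (Dom V (y j)) \<and> k' \<in> hom V (Dom V (y j)) (A j) \<and>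
   y j ** k = a j \<and> a j ** k' = y j \<and> k' ** k = Ident V (A j) \<and> k ** k' = Ident V (Dom V (y j))" if j: "j \<in> J" for j
 proof -
  note p = pullback_facts[OF pb[OF j]] and p' = pullback_facts[OF pb'[OF j]]
  obtain k where k: "k \<in> Arr V" "Dom V k = A j" "Cod V k = Dom V (g j)" "g j ** k = g' j" "y j ** k = a j"
   using pullback_lift[OF pb[OF j], of "g' j" "a j"] p'(1-9) A(3)[OF j] by metis
  obtain k' where k': "k' \<in> Arr V" "Dom V k' = Dom V (g j)" "Cod V k' = A j" "g' j ** k' = g j" "a j ** k' = y j"
   using pullback_lift[OF pb'[OF j], of "g j" "y j"] p(1-9) A(3)[OF j] by metis
  have r: "g j ** k ** k' = g' j ** k'" "y j ** k ** k' = a j ** k'"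
   "g' j ** k' ** k = g j ** k" "a j ** k' ** k = y j ** k"
   using Comp_reassoc[OF k(4), of k'] Comp_reassoc[OF k(5), of k'] Comp_reassoc[OF k'(4), of k]
    Comp_reassoc[OF k'(5), of k] k(1-3) k'(1-3) p(1-8) p'(1-8) A(3)[OF j] by simp_all
  have "k ** k' = Ident V (Dom V (g j))"
   by (rule pullback_eqI[OF pb[OF j]]) (use r k k' p(1-8) in simp_all)
  moreover have "k' ** k = Ident V (A j)"
   by (rule pullback_eqI[OF pb'[OF j]]) (use r k k' p'(1-8) A(3)[OF j] in simp_all)
  ultimately show ?thesis using k k' p(5) by (intro exI[of _ k] exI[of _ k']) simp
 qed
 then obtain k k' where k: "\<And>j. j \<in> J \<Longrightarrow> k j \<in> hom V (A j) (Dom V (y j)) \<and> k' j \<in> hom V (Dom V (y j)) (A j) \<and>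
   y j ** k j = a j \<and> a j ** k' j = y j \<and> k' j ** k j = Ident V (A j) \<and> k j ** k' j = Ident V (Dom V (y j))"
  by metis
 have kk: "k j \<in> Arr V" "Dom V (k j) = A j" "Cod V (k j) = Dom V (y j)" "k' j \<in> Arr V"
   "Dom V (k' j) = Dom V (y j)" "Cod V (k' j) = A j" "y j ** k j = a j" "a j ** k' j = y j"
   "k j ** k' j = Ident V (Dom V (y j))" if "j \<in> J" for j
  using k[OF that] by simp_all
 have yj: "y j \<in> Arr V" "Cod V (y j) = Dom V f" if "j \<in> J" for j using pullback_facts[OF pb[OF that]] by auto
 show ?thesis
 proof (rule coproductI)
  fix d h assume d: "d \<in> Obj V" and h: "\<And>i. i \<in> J \<Longrightarrow> h i \<in> hom V (Dom V (y i)) d"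
  obtain u where u: "u \<in> Arr V" "Dom V u = Dom V f" "Cod V u = d" "\<And>j. j \<in> J \<Longrightarrow> u ** a j = h j ** k j"
   by (rule coproduct_lift[OF A(1) d, of "\<lambda>j. h j ** k j"]) (use h kk in auto)
  have "u ** y j = h j" if j: "j \<in> J" for j
  proof -
   have "u ** a j ** k' j = h j ** k j ** k' j"
    using Comp_swap[OF u(4)[OF j], of "k' j"] u(1-3) kk(1-6)[OF j] h[OF j] cA j by simp
   then show ?thesis using kk(8,9)[OF j] h[OF j] by simp
  qed
  then show "\<exists>u\<in>hom V (Dom V f) d. \<forall>i\<in>J. u ** y i = h i" using u by (intro bexI[of _ u]) auto
 next
  fix u v assume uv: "u \<in> Arr V" "v \<in> Arr V" "Dom V u = Dom V f" "Dom V v = Dom V f" "Cod V u = Cod V v"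
   "\<And>i. i \<in> J \<Longrightarrow> u ** y i = v ** y i"
  show "u = v"
  proof (rule coproduct_eqI[OF A(1)])
   fix j assume j: "j \<in> J"
   have "u ** y j ** k j = (u ** y j) ** k j" using uv(1,3) kk(1-3)[OF j] yj[OF j] by simp
   also have "\<dots> = v ** y j ** k j" unfolding uv(6)[OF j] using uv(2,4) kk(1-3)[OF j] yj[OF j] by simp
   finally have "u ** y j ** k j = v ** y j ** k j" .
   then show "u ** a j = v ** a j" using kk(7)[OF j] by simp
  qed (use uv in auto)
 qed (use f yj in auto)
qed

end

section \<open>Paths and refinements\<close>

lemma steps_simps [simp]: "steps [] = []" "steps [x] = []" "steps (x # y # p) = (x, y) # steps (y # p)"
 by (simp_all add: steps_def)

lemma length_steps [simp]: "length (steps p) = length p - 1"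
 by (simp add: steps_def)

lemma steps_map: "steps (map f p) = map (map_prod f f) (steps p)"
 by (simp add: steps_def map_tl[symmetric] zip_map_map map_prod_def split_beta')

lemma nth_steps: "Suc i < length p \<Longrightarrow> steps p ! i = (p ! i, p ! Suc i)"
 by (simp add: steps_def nth_tl)

lemma steps_subset: "p \<in> lists S \<Longrightarrow> set (steps p) \<subseteq> S \<times> S"
 by (induction p rule: induct_list012) auto

lemma steps_mem: "p \<in> lists S \<Longrightarrow> s \<in> set (steps p) \<Longrightarrow> fst s \<in> S \<and> snd s \<in> S"
 using steps_subset[of p S] by (cases s) auto

lemma steps_append: "p \<noteq> [] \<Longrightarrow> q \<noteq> [] \<Longrightarrow> hd q = last p \<Longrightarrow> steps (p @ tl q) = steps p @ steps q"
proof (induction p rule: list_nonempty_induct)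
 case (single x)
 then show ?case by (cases q) auto
next
 case (cons x xs)
 then show ?case by (cases xs) auto
qed

lemma pathsD:
 assumes "p \<in> paths S a b" shows "p \<in> lists S" "p \<noteq> []" "hd p = a" "last p = b" "a \<in> S" "b \<in> S"
 using assms by (auto simp: paths_def)

lemma pathsI: "p \<in> lists S \<Longrightarrow> p \<noteq> [] \<Longrightarrow> p \<in> paths S (hd p) (last p)"
 by (simp add: paths_def)

lemma paths_map: "p \<in> paths S a b \<Longrightarrow> f ` S \<subseteq> S' \<Longrightarrow> map f p \<in> paths S' (f a) (f b)"
 by (auto simp: paths_def hd_map last_map image_subset_iff)

lemma paths_pair [simp]: "a \<in> S \<Longrightarrow> b \<in> S \<Longrightarrow> [a, b] \<in> paths S a b"
 by (simp add: paths_def)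

lemma refinements_single [simp]: "refinements S [a] = {[]}"
 by (auto simp: refinements_def)

lemma refinements_Cons:
 "qs' \<in> refinements S (x # y # p) \<longleftrightarrow> (\<exists>q qs. qs' = q # qs \<and> q \<in> paths S x y \<and> qs \<in> refinements S (y # p))"
 by (auto simp: refinements_def list_all2_Cons2)

lemma refinements_induct [consumes 2, case_names single Cons]:
 assumes "qs \<in> refinements S p" "p \<noteq> []"
  and "\<And>a. P [a] []"
  and "\<And>x y p q qs. q \<in> paths S x y \<Longrightarrow> qs \<in> refinements S (y # p) \<Longrightarrow> P (y # p) qs \<Longrightarrow>
   P (x # y # p) (q # qs)"
 shows "P p qs"
 using assms(2,1)
proof (induction p arbitrary: qs rule: list_nonempty_induct)
 case (single x)
 then show ?case using assms(3) by simp
next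
 case (cons x xs)
 then obtain y p where "xs = y # p" by (cases xs) auto
 with cons obtain q qs' where "qs = q # qs'" "q \<in> paths S x y" "qs' \<in> refinements S (y # p)"
  by (auto simp: refinements_Cons)
 then show ?case using cons.IH assms(4) \<open>xs = y # p\<close> by blast
qed

text \<open>Replaces the parallel recursion over pieces and steps by a single equation between lists
  of end points, which behaves well under \<open>map\<close> and \<open>concat\<close>.\<close>

lemma refinements_iff:
 "qs \<in> refinements S p \<longleftrightarrow> set qs \<subseteq> lists S - {[]} \<and> map (\<lambda>q. (hd q, last q)) qs = steps p"
proof -
 have "list_all2 (\<lambda>q (x, y). q \<in> paths S x y) qs ss \<longleftrightarrow>
   set qs \<subseteq> lists S - {[]} \<and> map (\<lambda>q. (hd q, last q)) qs = ss" for ss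
 proof (induction qs arbitrary: ss)
  case (Cons q qs)
  then show ?case by (cases ss) (auto simp: paths_def)
 qed auto
 then show ?thesis by (simp add: refinements_def)
qed

lemma refinements_ends: "qs \<in> refinements S p \<Longrightarrow> map (\<lambda>q. (hd q, last q)) qs = steps p"
 by (simp add: refinements_iff)

lemma refinements_paths: "qs \<in> refinements S p \<Longrightarrow> q \<in> set qs \<Longrightarrow> q \<in> paths S (hd q) (last q)"
 by (auto simp: refinements_iff paths_def)

lemma refinements_lists: "qs \<in> refinements S p \<Longrightarrow> qs \<in> lists (lists S)"
 using refinements_paths pathsD(1) by (metis in_listsI)

lemma refinements_map:
 assumes "qs \<in> refinements S p" "f ` S \<subseteq> S'"
 shows "map (map f) qs \<in> refinements S' (map f p)"
proof -
 have "map (map_prod f f) (map (\<lambda>q. (hd q, last q)) qs) = map (map_prod f f) (steps p)"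
  using refinements_ends[OF assms(1)] by simp
 moreover have "map (map_prod f f) (map (\<lambda>q. (hd q, last q)) qs) = map (\<lambda>q. (hd q, last q)) (map (map f) qs)"
 proof -
  have "q \<noteq> []" if "q \<in> set qs" for q using assms(1) that by (auto simp: refinements_iff)
  then show ?thesis by (auto simp: hd_map last_map)
 qed
 ultimately have "map (\<lambda>q. (hd q, last q)) (map (map f) qs) = steps (map f p)" by (simp only: steps_map)
 moreover have "set (map (map f) qs) \<subseteq> lists S' - {[]}"
  using assms by (fastforce simp: refinements_iff in_lists_conv_set)
 ultimately show ?thesis unfolding refinements_iff by blast
qed

lemma glue_single [simp]: "glue [a] [] = [a]"
 by (simp add: glue_def)

lemma glue_Cons: "q \<in> paths S x y \<Longrightarrow> glue (x # y # p) (q # qs) = q @ tl (glue (y # p) qs)"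
 by (auto simp: glue_def paths_def)

lemma glue_nonempty [simp]: "glue p qs \<noteq> []" and hd_glue [simp]: "hd (glue p qs) = hd p"
 by (simp_all add: glue_def)

lemma
 assumes "qs \<in> refinements S p" "p \<noteq> []"
 shows last_glue: "last (glue p qs) = last p"
  and steps_glue: "steps (glue p qs) = concat (map steps qs)"
 using assms
proof (induction rule: refinements_induct)
 case (Cons x y p q qs)
 { case 1
  have "last (q @ tl (glue (y # p) qs)) = last (glue (y # p) qs)"
   using Cons(1,3) pathsD(2,4)[OF Cons(1)] hd_glue[of "y # p" qs] glue_nonempty[of "y # p" qs]
   by (cases "glue (y # p) qs") auto
  then show ?case using Cons by (simp add: glue_Cons) }
 { case 2
  then show ?case using Cons steps_append[of q "glue (y # p) qs"] pathsD[OF Cons(1)] by (simp add: glue_Cons) }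
qed simp_all

lemma glue_lists: "qs \<in> refinements S p \<Longrightarrow> p \<in> lists S \<Longrightarrow> p \<noteq> [] \<Longrightarrow> glue p qs \<in> lists S"
 by (cases p) (auto simp: glue_def refinements_iff subset_iff in_lists_conv_set dest!: list.set_sel(2)[rotated])

lemma glue_paths: "p \<in> paths S a b \<Longrightarrow> qs \<in> refinements S p \<Longrightarrow> glue p qs \<in> paths S a b"
 using glue_lists last_glue unfolding paths_def by fastforce

lemma glue_map: "qs \<in> refinements S p \<Longrightarrow> p \<noteq> [] \<Longrightarrow> map f (glue p qs) = glue (map f p) (map (map f) qs)"
 by (cases p) (simp_all add: glue_def map_concat map_tl comp_def)

lemma glue_pair: "q \<in> paths S a b \<Longrightarrow> glue [a, b] [q] = q"
 by (auto simp: glue_def paths_def)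

lemma refinements_pair: "q \<in> paths S a b \<Longrightarrow> [q] \<in> refinements S [a, b]"
 by (simp add: refinements_def)

text \<open>Every step is refined by itself. This is the refinement behind the right unit
  law.\<close>

lemma glue_steps: "p \<noteq> [] \<Longrightarrow> glue p (map (\<lambda>(x, y). [x, y]) (steps p)) = p"
 by (induction p rule: list_nonempty_induct) (auto simp: glue_def neq_Nil_conv)

lemma refinements_steps: "p \<in> lists S \<Longrightarrow> map (\<lambda>(x, y). [x, y]) (steps p) \<in> refinements S p"
 using steps_subset[of p S] by (auto simp: refinements_iff split_beta' intro!: map_idI)

text \<open>Associativity of gluing. Here \<open>ts\<close> pairs each piece \<open>q\<close> of a
  refinement of \<open>p\<close> with a refinement \<open>rs\<close> of \<open>q\<close>. It
  identifies the summands in which the two sides of the associative law end.\<close>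

lemma glue_glue:
 assumes "map fst ts \<in> refinements S p" "p \<noteq> []" "\<And>q rs. (q, rs) \<in> set ts \<Longrightarrow> rs \<in> refinements S q"
 shows "glue p (map (\<lambda>(q, rs). glue q rs) ts) = glue (glue p (map fst ts)) (concat (map snd ts))"
  and "concat (map snd ts) \<in> refinements S (glue p (map fst ts))"
  and "map (\<lambda>(q, rs). glue q rs) ts \<in> refinements S p"
proof -
 show "glue p (map (\<lambda>(q, rs). glue q rs) ts) = glue (glue p (map fst ts)) (concat (map snd ts))"
  by (simp add: glue_def split_beta' map_concat comp_def) (induction ts; simp)
 have ne: "fst t \<in> lists S" "fst t \<noteq> []" "snd t \<in> refinements S (fst t)" if "t \<in> set ts" for t
  using assms(1) assms(3)[of "fst t" "snd t"] that by (auto simp: refinements_iff subset_iff)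
 have "map (\<lambda>r. (hd r, last r)) (concat (map snd ts)) = concat (map (\<lambda>t. steps (fst t)) ts)"
  using refinements_ends[OF ne(3)] by (simp add: map_concat comp_def cong: map_cong)
 moreover have "set (concat (map snd ts)) \<subseteq> lists S - {[]}"
  using ne(3) unfolding refinements_iff by fastforce
 ultimately show "concat (map snd ts) \<in> refinements S (glue p (map fst ts))"
  by (simp add: refinements_iff steps_glue[OF assms(1,2)] comp_def)
 have "map (\<lambda>q. (hd q, last q)) (map (\<lambda>(q, rs). glue q rs) ts) = map (\<lambda>q. (hd q, last q)) (map fst ts)"
  using ne last_glue[OF ne(3) ne(2)] by (auto simp: split_beta')
 then have "map (\<lambda>q. (hd q, last q)) (map (\<lambda>(q, rs). glue q rs) ts) = steps p"
  using refinements_ends[OF assms(1)] by (simp only:)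
 moreover have "set (map (\<lambda>(q, rs). glue q rs) ts) \<subseteq> lists S - {[]}"
  using glue_lists[OF ne(3,1,2)] by (auto simp: split_beta')
 ultimately show "map (\<lambda>(q, rs). glue q rs) ts \<in> refinements S p"
  unfolding refinements_iff by blast
qed

lemma path_split:
 assumes "r \<in> lists S" "r \<noteq> []" "sum_list ns = length r - 1"
 obtains p qs where "p \<in> paths S (hd r) (last r)" "qs \<in> refinements S p" "glue p qs = r"
  "map (\<lambda>q. length q - 1) qs = ns"
proof -
 have "\<exists>p qs. p \<in> paths S (hd r) (last r) \<and> qs \<in> refinements S p \<and> glue p qs = r \<and>
   map (\<lambda>q. length q - 1) qs = ns"
  using assms
 proof (induction ns arbitrary: r)
  case Nil
  then obtain a where "r = [a]" by (cases r) auto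
  then show ?case using Nil by (intro exI[of _ "[a]"] exI[of _ "[]"]) (auto simp: paths_def)
 next
  case (Cons n ns)
  \<comment> \<open>The two parts share the vertex \<open>r ! n\<close>, since a piece with
    \<open>n\<close> steps has \<open>n + 1\<close> vertices. For \<open>n = 0\<close> the piece is
    a single vertex.\<close>
  let ?q = "take (Suc n) r" and ?r = "drop n r"
  have n: "n < length r" using Cons.prems by (cases r) auto
  have r': "?r \<in> lists S" "?r \<noteq> []" "sum_list ns = length ?r - 1" "last ?r = last r"
   using Cons.prems n by (auto simp: in_lists_conv_set dest: in_set_dropD)
  from Cons.IH[OF r'(1-3)] obtain p qs where p: "p \<in> paths S (hd ?r) (last ?r)" "qs \<in> refinements S p"
    "glue p qs = ?r" "map (\<lambda>q. length q - 1) qs = ns" by blast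
  obtain p' where p': "p = hd ?r # p'" using pathsD(2,3)[OF p(1)] by (cases p) auto
  have q: "?q \<in> paths S (hd r) (hd ?r)"
   using Cons.prems n by (auto simp: paths_def in_lists_conv_set hd_drop_conv_nth last_conv_nth dest: in_set_takeD)
  have "hd r # p \<in> paths S (hd r) (last r)"
   using pathsD[OF p(1)] r'(4) Cons.prems by (auto simp: paths_def)
  moreover have "?q # qs \<in> refinements S (hd r # p)" using q p(2) p' by (simp add: refinements_Cons)
  moreover have "glue (hd r # p) (?q # qs) = r"
  proof -
   have "glue (hd r # p) (?q # qs) = ?q @ tl ?r" using q p' p(3) by (simp add: glue_Cons)
   then show ?thesis by (simp add: drop_Suc[symmetric] tl_drop)
  qed
  moreover have "map (\<lambda>q. length q - 1) (?q # qs) = n # ns" using p(4) n by simp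
  ultimately show ?case by (intro exI[of _ "hd r # p"] exI[of _ "?q # qs"]) (simp only:)
 qed
 then show ?thesis using that by blast
qed

lemma path_split2:
 assumes "r \<in> lists S" "r \<noteq> []" "sum_list (map sum_list nss) = length r - 1"
 obtains p ts where "p \<in> paths S (hd r) (last r)" "map fst ts \<in> refinements S p"
  "\<And>q rs. (q, rs) \<in> set ts \<Longrightarrow> rs \<in> refinements S q"
  "glue p (map (\<lambda>(q, rs). glue q rs) ts) = r"
  "map (\<lambda>(q, rs). map (\<lambda>r. length r - 1) rs) ts = nss"
proof -
 obtain p gs where p: "p \<in> paths S (hd r) (last r)" "gs \<in> refinements S p" "glue p gs = r"
  "map (\<lambda>q. length q - 1) gs = map sum_list nss" by (rule path_split[OF assms])
 have len: "length gs = length nss" using arg_cong[OF p(4), of length] by simp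
 have "\<exists>t. fst t \<in> paths S (hd (gs ! i)) (last (gs ! i)) \<and> snd t \<in> refinements S (fst t) \<and>
   glue (fst t) (snd t) = gs ! i \<and> map (\<lambda>r. length r - 1) (snd t) = nss ! i" if i: "i < length gs" for i
 proof -
  have g: "gs ! i \<in> lists S" "gs ! i \<noteq> []" using pathsD(1,2)[OF refinements_paths[OF p(2) nth_mem[OF i]]] by auto
  have "sum_list (nss ! i) = length (gs ! i) - 1"
   using arg_cong[OF p(4), of "\<lambda>xs. xs ! i"] i len by simp
  from path_split[OF g this] show ?thesis by (metis fst_conv snd_conv)
 qed
 then obtain ts where ts: "length ts = length gs"
  "\<And>i. i < length gs \<Longrightarrow> fst (ts ! i) \<in> paths S (hd (gs ! i)) (last (gs ! i)) \<and>
   snd (ts ! i) \<in> refinements S (fst (ts ! i)) \<and> glue (fst (ts ! i)) (snd (ts ! i)) = gs ! i \<and>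
   map (\<lambda>r. length r - 1) (snd (ts ! i)) = nss ! i"
  using Skolem_list_nth[of "length gs" "\<lambda>i t. fst t \<in> paths S (hd (gs ! i)) (last (gs ! i)) \<and>
   snd t \<in> refinements S (fst t) \<and> glue (fst t) (snd t) = gs ! i \<and> map (\<lambda>r. length r - 1) (snd t) = nss ! i"]
  by blast
 have gl: "map (\<lambda>(q, rs). glue q rs) ts = gs" by (rule nth_equalityI) (use ts in \<open>auto simp: split_beta'\<close>)
 have ns: "map (\<lambda>(q, rs). map (\<lambda>r. length r - 1) rs) ts = nss"
  by (rule nth_equalityI) (use ts len in \<open>auto simp: split_beta'\<close>)
 have "map (\<lambda>q. (hd q, last q)) (map fst ts) = map (\<lambda>q. (hd q, last q)) gs"
  by (rule nth_equalityI) (use ts in \<open>auto simp: paths_def\<close>)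
 moreover have "set (map fst ts) \<subseteq> lists S - {[]}"
 proof -
  have "fst t \<in> lists S \<and> fst t \<noteq> []" if "t \<in> set ts" for t
   using that ts pathsD(1,2) by (metis in_set_conv_nth)
  then show ?thesis by auto
 qed
 ultimately have 1: "map fst ts \<in> refinements S p"
  using p(2) by (simp add: refinements_iff)
 have 2: "rs \<in> refinements S q" if "(q, rs) \<in> set ts" for q rs
  using that ts by (metis in_set_conv_nth fst_conv snd_conv)
 show ?thesis by (rule that[OF p(1) 1 2 _ ns]) (simp_all add: gl p(3))
qed

section \<open>Enriched graphs\<close>

context extensive_category
begin

abbreviation Gr :: "(('i, 'o) vgraph, ('i, 'o, 'a) vgmap) cat" where "Gr \<equiv> Graphs U V"

lemma Graphs_simps [simp]: "Obj Gr = vgraphs U V" "Arr Gr = vgmaps U V" "Dom Gr = GDom" "Cod Gr = GCod"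
 by (simp_all add: Graphs_def)

lemma Graphs_Ident_simps [simp]: "GDom (Ident Gr X) = X" "GCod (Ident Gr X) = X"
  "OMap (Ident Gr X) = (\<lambda>a\<in>Vert X. a)" "HMap (Ident Gr X) = (\<lambda>p\<in>Vert X \<times> Vert X. Ident V (VHom X p))"
 by (simp_all add: Graphs_def)

lemma Graphs_Comp_simps [simp]: "GDom (Comp Gr g f) = GDom f" "GCod (Comp Gr g f) = GCod g"
  "a \<in> Vert (GDom f) \<Longrightarrow> OMap (Comp Gr g f) a = OMap g (OMap f a)"
  "a \<in> Vert (GDom f) \<Longrightarrow> b \<in> Vert (GDom f) \<Longrightarrow>
   HMap (Comp Gr g f) (a, b) = HMap g (OMap f a, OMap f b) ** HMap f (a, b)"
 by (simp_all add: Graphs_def)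

lemma vgraph_facts:
 assumes "X \<in> vgraphs U V"
 shows "Vert X \<in> U" "a \<in> Vert X \<Longrightarrow> b \<in> Vert X \<Longrightarrow> VHom X (a, b) \<in> Obj V"
 using assms by (auto simp: vgraphs_def)

lemma vgmap_facts:
 assumes "f \<in> vgmaps U V"
 shows "GDom f \<in> vgraphs U V" "GCod f \<in> vgraphs U V" "a \<in> Vert (GDom f) \<Longrightarrow> OMap f a \<in> Vert (GCod f)"
  "a \<in> Vert (GDom f) \<Longrightarrow> b \<in> Vert (GDom f) \<Longrightarrow> HMap f (a, b) \<in> Arr V"
  "a \<in> Vert (GDom f) \<Longrightarrow> b \<in> Vert (GDom f) \<Longrightarrow> Dom V (HMap f (a, b)) = VHom (GDom f) (a, b)"
  "a \<in> Vert (GDom f) \<Longrightarrow> b \<in> Vert (GDom f) \<Longrightarrow> Cod V (HMap f (a, b)) = VHom (GCod f) (OMap f a, OMap f b)"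
proof -
 show "GDom f \<in> vgraphs U V" "GCod f \<in> vgraphs U V" "a \<in> Vert (GDom f) \<Longrightarrow> OMap f a \<in> Vert (GCod f)"
  using assms by (auto simp: vgmaps_def)
 assume "a \<in> Vert (GDom f)" "b \<in> Vert (GDom f)"
 moreover have "HMap f \<in> (\<Pi>\<^sub>E (a, b)\<in>Vert (GDom f) \<times> Vert (GDom f).
    hom V (VHom (GDom f) (a, b)) (VHom (GCod f) (OMap f a, OMap f b)))"
  using assms by (simp add: vgmaps_def)
 ultimately have "HMap f (a, b) \<in> hom V (VHom (GDom f) (a, b)) (VHom (GCod f) (OMap f a, OMap f b))"
  using PiE_mem[where x = "(a, b)"] by fastforce
 then show "HMap f (a, b) \<in> Arr V" "Dom V (HMap f (a, b)) = VHom (GDom f) (a, b)"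
  "Cod V (HMap f (a, b)) = VHom (GCod f) (OMap f a, OMap f b)" by auto
qed

lemma vgmapI:
 assumes "X \<in> vgraphs U V" "Y \<in> vgraphs U V" "GDom f = X" "GCod f = Y"
  "OMap f \<in> extensional (Vert X)" "HMap f \<in> extensional (Vert X \<times> Vert X)"
  "\<And>a. a \<in> Vert X \<Longrightarrow> OMap f a \<in> Vert Y"
  "\<And>a b. a \<in> Vert X \<Longrightarrow> b \<in> Vert X \<Longrightarrow> HMap f (a, b) \<in> hom V (VHom X (a, b)) (VHom Y (OMap f a, OMap f b))"
 shows "f \<in> vgmaps U V"
 using assms unfolding vgmaps_def by (auto simp: PiE_iff)

lemma vgmap_eqI:
 assumes "f \<in> vgmaps U V" "g \<in> vgmaps U V" "GDom f = X" "GDom g = X" "GCod f = GCod g"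
  "\<And>a. a \<in> Vert X \<Longrightarrow> OMap f a = OMap g a"
  "\<And>a b. a \<in> Vert X \<Longrightarrow> b \<in> Vert X \<Longrightarrow> HMap f (a, b) = HMap g (a, b)"
 shows "f = g"
proof -
 have "OMap f = OMap g"
  using assms by (intro extensionalityI[of _ "Vert X"]) (auto simp: vgmaps_def PiE_iff)
 moreover have "HMap f = HMap g"
  using assms by (intro extensionalityI[of _ "Vert X \<times> Vert X"]) (auto simp: vgmaps_def PiE_iff)
 ultimately show ?thesis using assms by (intro vgmap.equality) auto
qed

lemma Ident_vgmap: assumes "X \<in> vgraphs U V" shows "Ident Gr X \<in> vgmaps U V"
 by (rule vgmapI[OF assms assms]) (use vgraph_facts[OF assms] in auto)

lemma Comp_vgmap:
 assumes f: "f \<in> vgmaps U V" and g: "g \<in> vgmaps U V" and "GDom g = GCod f"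
 shows "Comp Gr g f \<in> vgmaps U V"
proof (rule vgmapI[OF vgmap_facts(1)[OF f] vgmap_facts(2)[OF g]])
 show "OMap (Comp Gr g f) \<in> extensional (Vert (GDom f))"
  "HMap (Comp Gr g f) \<in> extensional (Vert (GDom f) \<times> Vert (GDom f))"
  by (simp_all add: Graphs_def)
qed (use vgmap_facts[OF f] vgmap_facts[OF g] assms(3) in auto)

lemma Graphs_category: "category Gr"
 unfolding category_def
proof (intro conjI ballI impI)
 fix f g assume "f \<in> Arr Gr" "g \<in> Arr Gr" "Dom Gr g = Cod Gr f"
 then show "Comp Gr g f \<in> hom Gr (Dom Gr f) (Cod Gr g)" by (simp add: Comp_vgmap)
next
 fix f g h assume A: "f \<in> Arr Gr" "g \<in> Arr Gr" "h \<in> Arr Gr" "Dom Gr g = Cod Gr f" "Dom Gr h = Cod Gr g"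
 then show "Comp Gr h (Comp Gr g f) = Comp Gr (Comp Gr h g) f"
  by (intro vgmap_eqI[of _ _ "GDom f"]) (simp_all add: Comp_vgmap vgmap_facts)
next
 fix f assume f: "f \<in> Arr Gr"
 then show "Comp Gr f (Ident Gr (Dom Gr f)) = f"
  by (intro vgmap_eqI[of _ _ "GDom f"]) (simp_all add: Comp_vgmap Ident_vgmap vgmap_facts)
 from f show "Comp Gr (Ident Gr (Cod Gr f)) f = f"
  by (intro vgmap_eqI[of _ _ "GDom f"]) (simp_all add: Comp_vgmap Ident_vgmap vgmap_facts)
qed (simp_all add: vgmap_facts Ident_vgmap)

section \<open>Test graphs and the maps out of them\<close>

text \<open>Test graphs need vertices of type \<open>'i\<close>. An infinite member of
  \<open>U\<close> makes this type infinite, and any embedding of the natural numbers will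
  do.\<close>

definition node :: "nat \<Rightarrow> 'i" where "node = (SOME f. inj f)"

lemma inj_node: "inj node"
proof -
 obtain A :: "'i set" where "infinite A" using universe_infinite by blast
 then have "infinite (UNIV :: 'i set)" by (meson finite_subset subset_UNIV)
 then have "\<exists>f :: nat \<Rightarrow> 'i. inj f" using infinite_countable_subset by blast
 then show ?thesis unfolding node_def by (rule someI_ex)
qed

lemma inv_node [simp]: "inv node (node n) = n" by (simp add: inj_node)

lemma node_eq [simp]: "node m = node n \<longleftrightarrow> m = n" by (simp add: inj_node inj_eq)

lemma node_image [simp]: "node i \<in> node ` A \<longleftrightarrow> i \<in> A" by auto

text \<open>The argument counts steps, so there is one more vertex.\<close>

definition std :: "nat \<Rightarrow> 'i list" where "std n = map node [0..<Suc n]"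

lemma length_std [simp]: "length (std n) = Suc n" by (simp add: std_def)

lemma nth_std [simp]: "i \<le> n \<Longrightarrow> std n ! i = node i"
 by (simp add: std_def del: upt_Suc)

lemma std_nonempty [simp]: "std n \<noteq> []" by (simp add: std_def)

lemma hd_std [simp]: "hd (std n) = node 0" by (simp add: hd_conv_nth)

lemma last_std [simp]: "last (std n) = node n" by (simp add: last_conv_nth)

lemma nth_steps_std [simp]: "i < n \<Longrightarrow> steps (std n) ! i = (node i, node (Suc i))"
 by (simp add: nth_steps)

text \<open>\<open>gr Z\<close> is the free graph on a path whose steps carry the objects of \<open>Z\<close>.\<close>

definition gr :: "'o list \<Rightarrow> ('i, 'o) vgraph" where
 "gr Z = \<lparr>Vert = node ` {..length Z}, VHom = (\<lambda>(x, y)\<in>node ` {..length Z} \<times> node ` {..length Z}.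
   if inv node y = Suc (inv node x) then Z ! inv node x else zero)\<rparr>"

lemma Vert_gr [simp]: "Vert (gr Z) = node ` {..length Z}" by (simp add: gr_def)

lemma VHom_gr: "i \<le> length Z \<Longrightarrow> j \<le> length Z \<Longrightarrow>
  VHom (gr Z) (node i, node j) = (if j = Suc i then Z ! i else zero)"
 by (simp add: gr_def)

lemma gr_vgraph [simp]:
 assumes "Z \<in> lists (Obj V)" shows "gr Z \<in> vgraphs U V"
proof -
 have "node ` {..length Z} \<in> U" by (rule universe_finite) simp
 moreover have "VHom (gr Z) \<in> extensional (node ` {..length Z} \<times> node ` {..length Z})" by (simp add: gr_def)
 moreover have "VHom (gr Z) (node i, node j) \<in> Obj V" if "i \<le> length Z" "j \<le> length Z" for i j
  using that assms by (auto simp: VHom_gr in_lists_conv_set)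
 ultimately show ?thesis by (auto simp: vgraphs_def PiE_iff)
qed

lemma std_lists [simp]: "std (length Z) \<in> lists (Vert (gr Z))" by (auto simp: std_def)

lemma std_paths [simp]: "std (length Z) \<in> paths (Vert (gr Z)) (node 0) (node (length Z))"
 using pathsI[OF std_lists std_nonempty] by simp

lemma map_VHom_gr [simp]: "map (VHom (gr Z)) (steps (std (length Z))) = Z"
 by (rule nth_equalityI) (simp_all add: VHom_gr)

text \<open>Homs of \<open>gr Z\<close> off the steps are initial and carry no information;
  agreement on the vertices and on the steps is enough.\<close>

lemma gr_map_eqI:
 assumes f: "f \<in> vgmaps U V" "GDom f = gr Z" and g: "g \<in> vgmaps U V" "GDom g = gr Z" and "GCod f = GCod g"
  and o: "map (OMap f) (std (length Z)) = map (OMap g) (std (length Z))"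
  and h: "map (HMap f) (steps (std (length Z))) = map (HMap g) (steps (std (length Z)))"
 shows "f = g"
proof -
 have o': "OMap f (node i) = OMap g (node i)" if "i \<le> length Z" for i
  using arg_cong[OF o, of "\<lambda>xs. xs ! i"] that by simp
 have h': "HMap f (node i, node (Suc i)) = HMap g (node i, node (Suc i))" if "i < length Z" for i
  using arg_cong[OF h, of "\<lambda>xs. xs ! i"] that by simp
 note F = vgmap_facts[OF f(1)] and G = vgmap_facts[OF g(1)]
 show ?thesis
 proof (rule vgmap_eqI[OF f(1) g(1) f(2) g(2) assms(5)])
  fix a assume "a \<in> Vert (gr Z)"
  then show "OMap f a = OMap g a" using o' by auto
 next
  fix a b assume "a \<in> Vert (gr Z)" "b \<in> Vert (gr Z)"
  then obtain i j where ij: "a = node i" "b = node j" "i \<le> length Z" "j \<le> length Z" by auto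
  show "HMap f (a, b) = HMap g (a, b)"
  proof (cases "j = Suc i")
   case True then show ?thesis using h'[of i] ij by simp
  next
   case False
   then have "VHom (gr Z) (a, b) = zero" using ij by (simp add: VHom_gr)
   then show ?thesis using F(4-6)[of a b] G(4-6)[of a b] f(2) g(2) ij o' assms(5)
    by - (rule initial_eqI[OF initial_zero], auto)
  qed
 qed
qed

text \<open>One half of the universal property of \<open>gr\<close>: a path of \<open>X\<close> with
  an arrow into the hom of each of its steps gives a map to \<open>X\<close> from the graph of the
  domains of these arrows. On the remaining pairs the only possible value is the arrow out of the
  initial object.\<close>

definition grmap :: "('i, 'o) vgraph \<Rightarrow> 'i list \<Rightarrow> 'a list \<Rightarrow> ('i, 'o, 'a) vgmap" where
 "grmap X p fs = \<lparr>GDom = gr (map (Dom V) fs), GCod = X,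
   OMap = (\<lambda>x\<in>node ` {..length fs}. p ! inv node x),
   HMap = (\<lambda>(x, y)\<in>node ` {..length fs} \<times> node ` {..length fs}.
    if inv node y = Suc (inv node x) then fs ! inv node x
    else from_initial zero (VHom X (p ! inv node x, p ! inv node y)))\<rparr>"

lemma grmap_simps [simp]: "GDom (grmap X p fs) = gr (map (Dom V) fs)" "GCod (grmap X p fs) = X"
 "i \<le> length fs \<Longrightarrow> OMap (grmap X p fs) (node i) = p ! i"
 "i < length fs \<Longrightarrow> HMap (grmap X p fs) (node i, node (Suc i)) = fs ! i"
 by (simp_all add: grmap_def)

lemma grmap_std [simp]:
 "length p = Suc (length fs) \<Longrightarrow> map (OMap (grmap X p fs)) (std (length fs)) = p"
 "map (HMap (grmap X p fs)) (steps (std (length fs))) = fs"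
 by (auto intro!: nth_equalityI)

lemma grmap_vgmap:
 assumes X: "X \<in> vgraphs U V" and p: "p \<in> lists (Vert X)" "length p = Suc (length fs)"
  and fs: "fs \<in> lists (Arr V)" "map (Cod V) fs = map (VHom X) (steps p)"
 shows "grmap X p fs \<in> vgmaps U V"
proof (rule vgmapI)
 show "gr (map (Dom V) fs) \<in> vgraphs U V" using fs(1) by (intro gr_vgraph) (auto simp: in_lists_conv_set)
 have pX: "p ! i \<in> Vert X" if "i \<le> length fs" for i using p that by (simp add: in_lists_conv_set)
 fix a b assume "a \<in> Vert (gr (map (Dom V) fs))" "b \<in> Vert (gr (map (Dom V) fs))"
 then obtain i j where ij: "a = node i" "b = node j" "i \<le> length fs" "j \<le> length fs" by auto
 show "HMap (grmap X p fs) (a, b) \<in> hom V (VHom (gr (map (Dom V) fs)) (a, b))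
   (VHom X (OMap (grmap X p fs) a, OMap (grmap X p fs) b))"
 proof (cases "j = Suc i")
  case True
  then have i: "i < length fs" using ij by simp
  have "Cod V (fs ! i) = VHom X (p ! i, p ! Suc i)"
   using arg_cong[OF fs(2), of "\<lambda>xs. xs ! i"] i p by (simp add: nth_steps)
  moreover have "fs ! i \<in> Arr V" using fs(1) i by (simp add: in_lists_conv_set)
  ultimately show ?thesis using ij True i by (simp add: VHom_gr)
 next
  case False
  then show ?thesis using ij pX[of i] pX[of j] vgraph_facts(2)[OF X, of "p ! i" "p ! j"]
   by (simp add: VHom_gr) (simp add: grmap_def)
 qed
qed (use X p in \<open>auto simp: in_lists_conv_set grmap_def\<close>)

lemma map_OMap_Comp:
 "p \<in> lists (Vert (GDom f)) \<Longrightarrow> map (OMap (Comp Gr g f)) p = map (OMap g) (map (OMap f) p)"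
 by (auto simp: in_lists_conv_set)

lemma map_HMap_Comp:
 "p \<in> lists (Vert (GDom f)) \<Longrightarrow> map (HMap (Comp Gr g f)) (steps p) =
  map2 (Comp V) (map (HMap g) (steps (map (OMap f) p))) (map (HMap f) (steps p))"
 using steps_subset[of p "Vert (GDom f)"]
 by (auto simp: steps_map map2_map_map comp_def intro!: map_cong)

text \<open>Composition moves the path and composes the arrows step by step, so that maps out of
  test graphs can be computed with as lists.\<close>

lemma Comp_grmap:
 assumes g: "g \<in> vgmaps U V" "GDom g = X"
  and p: "p \<in> lists (Vert X)" "length p = Suc (length fs)"
  and fs: "fs \<in> lists (Arr V)" "map (Cod V) fs = map (VHom X) (steps p)"
 shows "Comp Gr g (grmap X p fs) = grmap (GCod g) (map (OMap g) p) (map2 (Comp V) (map (HMap g) (steps p)) fs)"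
proof -
 have X: "X \<in> vgraphs U V" using vgmap_facts(1)[OF g(1)] g(2) by simp
 note gm = grmap_vgmap[OF X p fs]
 have len: "length (steps p) = length fs" using p by simp
 define gs where "gs = map2 (Comp V) (map (HMap g) (steps p)) fs"
 have pX: "p ! i \<in> Vert X" if "i \<le> length fs" for i using p that by (simp add: in_lists_conv_set)
 have cf: "fs ! i \<in> Arr V" "Cod V (fs ! i) = VHom X (p ! i, p ! Suc i)" if "i < length fs" for i
  using arg_cong[OF fs(2), of "\<lambda>xs. xs ! i"] that p fs(1) by (simp_all add: nth_steps in_lists_conv_set)
 have gi: "gs ! i = HMap g (p ! i, p ! Suc i) ** fs ! i" if "i < length fs" for i
  using that p by (simp add: gs_def nth_steps)
 have lg: "length gs = length fs" using p by (simp add: gs_def)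
 have gA: "gs ! i \<in> Arr V \<and> Dom V (gs ! i) = Dom V (fs ! i) \<and>
   Cod V (gs ! i) = VHom (GCod g) (OMap g (p ! i), OMap g (p ! Suc i))" if i: "i < length fs" for i
  using gi[OF i] cf[OF i] vgmap_facts[OF g(1)] g(2) pX[of i] pX[of "Suc i"] i by simp
 have d: "map (Dom V) gs = map (Dom V) fs" using gA lg by (intro nth_equalityI) auto
 have gm': "grmap (GCod g) (map (OMap g) p) gs \<in> vgmaps U V"
 proof (rule grmap_vgmap)
  show "gs \<in> lists (Arr V)" using gA lg by (metis in_listsI in_set_conv_nth)
  show "map (Cod V) gs = map (VHom (GCod g)) (steps (map (OMap g) p))"
   by (rule nth_equalityI) (use gA lg p in \<open>auto simp: nth_steps\<close>)
 qed (use vgmap_facts[OF g(1)] g(2) p lg in \<open>auto simp: in_lists_conv_set\<close>)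
 have "Comp Gr g (grmap X p fs) = grmap (GCod g) (map (OMap g) p) gs"
 proof (rule gr_map_eqI[where Z = "map (Dom V) fs"])
  show "map (OMap (Comp Gr g (grmap X p fs))) (std (length (map (Dom V) fs))) =
   map (OMap (grmap (GCod g) (map (OMap g) p) gs)) (std (length (map (Dom V) fs)))"
   using grmap_std(1)[of p fs X] grmap_std(1)[of "map (OMap g) p" gs "GCod g"] p lg
   by (subst map_OMap_Comp) (auto simp del: map_map simp: std_def)
  show "map (HMap (Comp Gr g (grmap X p fs))) (steps (std (length (map (Dom V) fs)))) =
   map (HMap (grmap (GCod g) (map (OMap g) p) gs)) (steps (std (length (map (Dom V) fs))))"
   using grmap_std(1)[of p fs X] grmap_std(2)[of X p fs] grmap_std(2)[of "GCod g" "map (OMap g) p" gs] p lg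
   by (subst map_HMap_Comp) (auto simp: std_def gs_def)
 qed (use gm gm' g d in \<open>simp_all add: Comp_vgmap\<close>)
 then show ?thesis by (simp add: gs_def)
qed

section \<open>Pullbacks of graphs, computed on vertices and on homs\<close>

lemma pullback_graphsI:
 assumes p: "p \<in> vgmaps U V" and q: "q \<in> vgmaps U V" and f: "f \<in> vgmaps U V" and g: "g \<in> vgmaps U V"
  and c: "GDom q = GDom p" "GCod p = GDom f" "GCod q = GDom g" "GCod f = GCod g"
  and o: "\<And>a. a \<in> Vert (GDom p) \<Longrightarrow> OMap f (OMap p a) = OMap g (OMap q a)"
  and ex: "\<And>x y. x \<in> Vert (GDom f) \<Longrightarrow> y \<in> Vert (GDom g) \<Longrightarrow> OMap f x = OMap g y \<Longrightarrow>
   \<exists>a\<in>Vert (GDom p). OMap p a = x \<and> OMap q a = y"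
  and uniq: "\<And>a b. a \<in> Vert (GDom p) \<Longrightarrow> b \<in> Vert (GDom p) \<Longrightarrow> OMap p a = OMap p b \<Longrightarrow> OMap q a = OMap q b \<Longrightarrow> a = b"
  and pb: "\<And>a b. a \<in> Vert (GDom p) \<Longrightarrow> b \<in> Vert (GDom p) \<Longrightarrow>
   is_pullback V (HMap p (a, b)) (HMap q (a, b)) (HMap f (OMap p a, OMap p b)) (HMap g (OMap q a, OMap q b))"
 shows "is_pullback Gr p q f g"
proof -
 interpret G: Category Gr by unfold_locales (rule Graphs_category)
 note P = vgmap_facts[OF p] and Q = vgmap_facts[OF q] and F = vgmap_facts[OF f] and G = vgmap_facts[OF g]
 show ?thesis
 proof (rule G.pullbackI)
  show "Comp Gr f p = Comp Gr g q"
  proof (rule vgmap_eqI[where X = "GDom p"])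
   fix a b assume ab: "a \<in> Vert (GDom p)" "b \<in> Vert (GDom p)"
   then show "HMap (Comp Gr f p) (a, b) = HMap (Comp Gr g q) (a, b)"
    using pullback_facts(9)[OF pb[OF ab]] c by simp
  qed (use p q f g c o in \<open>simp_all add: Comp_vgmap\<close>)
 next
  fix h k assume h: "h \<in> Arr Gr" and k: "k \<in> Arr Gr" and hk: "Dom Gr h = Dom Gr k" "Cod Gr h = Dom Gr f"
   "Cod Gr k = Dom Gr g" and e: "Comp Gr f h = Comp Gr g k"
  note hk' = hk[unfolded Graphs_simps] and H = vgmap_facts[OF h[unfolded Graphs_simps]]
   and K = vgmap_facts[OF k[unfolded Graphs_simps]]
  let ?W = "GDom h"
  have oe: "OMap f (OMap h w) = OMap g (OMap k w)" if "w \<in> Vert ?W" for w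
   using arg_cong[OF e, of "\<lambda>f. OMap f w"] that hk' by simp
  have "\<exists>a. a \<in> Vert (GDom p) \<and> OMap p a = OMap h w \<and> OMap q a = OMap k w" if "w \<in> Vert ?W" for w
   using ex[OF _ _ oe[OF that]] H(3)[OF that] K(3)[of w] that hk' by auto
  then obtain vo where vo: "\<And>w. w \<in> Vert ?W \<Longrightarrow> vo w \<in> Vert (GDom p) \<and> OMap p (vo w) = OMap h w \<and> OMap q (vo w) = OMap k w"
   by metis
  have "\<exists>m. m \<in> Arr V \<and> Dom V m = VHom ?W (w, w') \<and> Cod V m = VHom (GDom p) (vo w, vo w') \<and>
    HMap p (vo w, vo w') ** m = HMap h (w, w') \<and> HMap q (vo w, vo w') ** m = HMap k (w, w')"
   if w: "w \<in> Vert ?W" "w' \<in> Vert ?W" for w w'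
  proof -
   have e': "HMap f (OMap h w, OMap h w') ** HMap h (w, w') = HMap g (OMap k w, OMap k w') ** HMap k (w, w')"
    using arg_cong[OF e, of "\<lambda>f. HMap f (w, w')"] w hk' by simp
   note ow = vo[OF w(1)] vo[OF w(2)]
   show ?thesis
    by (rule pullback_lift[OF pb[of "vo w" "vo w'"], of "HMap h (w, w')" "HMap k (w, w')"])
     (use ow w hk' H(3-6) K(3-6) F G P e' c in auto)
  qed
  then obtain m where m: "\<And>w w'. w \<in> Vert ?W \<Longrightarrow> w' \<in> Vert ?W \<Longrightarrow> m w w' \<in> Arr V \<and> Dom V (m w w') = VHom ?W (w, w') \<and>
    Cod V (m w w') = VHom (GDom p) (vo w, vo w') \<and>
    HMap p (vo w, vo w') ** m w w' = HMap h (w, w') \<and> HMap q (vo w, vo w') ** m w w' = HMap k (w, w')"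
   by metis
  define u where "u = \<lparr>GDom = ?W, GCod = GDom p, OMap = (\<lambda>w\<in>Vert ?W. vo w),
   HMap = (\<lambda>(w, w')\<in>Vert ?W \<times> Vert ?W. m w w')\<rparr>"
  have u: "u \<in> vgmaps U V" by (rule vgmapI[OF H(1) P(1)]) (use vo m in \<open>auto simp: u_def\<close>)
  have "Comp Gr p u = h"
   by (rule vgmap_eqI[where X = ?W])
    (use u p h hk' c vo m in \<open>auto simp: u_def intro!: Comp_vgmap\<close>)
  moreover have "Comp Gr q u = k"
   by (rule vgmap_eqI[where X = ?W])
    (use u q k hk' c vo m in \<open>auto simp: u_def intro!: Comp_vgmap\<close>)
  ultimately show "\<exists>u\<in>Arr Gr. Dom Gr u = Dom Gr h \<and> Cod Gr u = Dom Gr p \<and> Comp Gr p u = h \<and> Comp Gr q u = k"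
   using u by (intro bexI[of _ u]) (auto simp: u_def)
 next
  fix u v assume u: "u \<in> Arr Gr" and v: "v \<in> Arr Gr" and uv: "Dom Gr u = Dom Gr v" "Cod Gr u = Dom Gr p"
   "Cod Gr v = Dom Gr p" and e1: "Comp Gr p u = Comp Gr p v" and e2: "Comp Gr q u = Comp Gr q v"
  note uv' = uv[unfolded Graphs_simps] and UF = vgmap_facts[OF u[unfolded Graphs_simps]]
   and VF = vgmap_facts[OF v[unfolded Graphs_simps]]
  have o: "OMap u w = OMap v w" if "w \<in> Vert (GDom u)" for w
  proof (rule uniq)
   show "OMap p (OMap u w) = OMap p (OMap v w)" using arg_cong[OF e1, of "\<lambda>f. OMap f w"] that uv' by simp
   show "OMap q (OMap u w) = OMap q (OMap v w)" using arg_cong[OF e2, of "\<lambda>f. OMap f w"] that uv' by simp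
  qed (use UF(3) VF(3) uv' that in auto)
  show "u = v"
  proof (rule vgmap_eqI[where X = "GDom u"])
   fix a b assume ab: "a \<in> Vert (GDom u)" "b \<in> Vert (GDom u)"
   have 1: "HMap p (OMap u a, OMap u b) ** HMap u (a, b) = HMap p (OMap u a, OMap u b) ** HMap v (a, b)"
    using arg_cong[OF e1, of "\<lambda>f. HMap f (a, b)"] ab uv' o by simp
   have 2: "HMap q (OMap u a, OMap u b) ** HMap u (a, b) = HMap q (OMap u a, OMap u b) ** HMap v (a, b)"
    using arg_cong[OF e2, of "\<lambda>f. HMap f (a, b)"] ab uv' o by simp
   show "HMap u (a, b) = HMap v (a, b)"
    by (rule pullback_eqI[OF pb[of "OMap u a" "OMap u b"] _ _ _ _ _ 1 2])
     (use UF(3-6) VF(3)[of a] VF(3)[of b] VF(4-6)[of a b] ab uv' P o in auto)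
  qed (use u v uv' o in auto)
 qed (use p q f g c in auto)
qed

lemma gr_Nil_map:
 assumes "X \<in> vgraphs U V" "x \<in> Vert X"
 shows "grmap X [x] [] \<in> vgmaps U V"
 by (rule grmap_vgmap) (use assms in auto)

lemma gr_single_map:
 assumes "X \<in> vgraphs U V" "x \<in> Vert X" "y \<in> Vert X" "h \<in> hom V z (VHom X (x, y))"
 shows "grmap X [x, y] [h] \<in> vgmaps U V"
 by (rule grmap_vgmap) (use assms in auto)

text \<open>Vertices of a graph are the maps to it from the one-vertex graph \<open>gr []\<close>,
  whose only hom is initial. The universal property is tested on that graph.\<close>

lemma pullback_graphs_vertex:
 assumes pb: "is_pullback Gr p q f g" and x: "x \<in> Vert (GDom f)" and y: "y \<in> Vert (GDom g)" and e: "OMap f x = OMap g y"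
 shows "\<exists>a\<in>Vert (GDom p). OMap p a = x \<and> OMap q a = y"
proof -
 interpret G: Category Gr by unfold_locales (rule Graphs_category)
 note c = G.pullback_facts[OF pb, unfolded Graphs_simps]
 note F = vgmap_facts[OF c(3)] and G = vgmap_facts[OF c(4)]
 have "Comp Gr f (grmap (GDom f) [x] []) = Comp Gr g (grmap (GDom g) [y] [])"
  using Comp_grmap[OF c(3) refl, of "[x]" "[]"] Comp_grmap[OF c(4) refl, of "[y]" "[]"] x y e c(8) by simp
 then obtain u where u: "u \<in> Arr Gr" "Dom Gr u = Dom Gr (grmap (GDom f) [x] [])" "Cod Gr u = Dom Gr p"
   "Comp Gr p u = grmap (GDom f) [x] []" "Comp Gr q u = grmap (GDom g) [y] []"
  using G.pullback_lift[OF pb, of "grmap (GDom f) [x] []" "grmap (GDom g) [y] []"] gr_Nil_map[OF F(1) x] gr_Nil_map[OF G(1) y]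
  by (auto simp del: grmap_simps(3))
 have n: "node 0 \<in> Vert (GDom u)" using u(2) by simp
 show ?thesis
  using vgmap_facts(3)[OF u(1)[unfolded Graphs_simps] n] u(3) arg_cong[OF u(4), of "\<lambda>f. OMap f (node 0)"]
   arg_cong[OF u(5), of "\<lambda>f. OMap f (node 0)"] n by (intro bexI[of _ "OMap u (node 0)"]) auto
qed

lemma pullback_graphs_vertex_unique:
 assumes pb: "is_pullback Gr p q f g" and ab: "a \<in> Vert (GDom p)" "b \<in> Vert (GDom p)"
  and e: "OMap p a = OMap p b" "OMap q a = OMap q b"
 shows "a = b"
proof -
 interpret G: Category Gr by unfold_locales (rule Graphs_category)
 note c = G.pullback_facts[OF pb, unfolded Graphs_simps]
 note P = vgmap_facts[OF c(1)]
 have "grmap (GDom p) [a] [] = grmap (GDom p) [b] []"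
 proof (rule G.pullback_eqI[OF pb])
  show "Comp Gr p (grmap (GDom p) [a] []) = Comp Gr p (grmap (GDom p) [b] [])"
   using Comp_grmap[OF c(1) refl, of "[a]" "[]"] Comp_grmap[OF c(1) refl, of "[b]" "[]"] ab e by simp
  show "Comp Gr q (grmap (GDom p) [a] []) = Comp Gr q (grmap (GDom p) [b] [])"
   using Comp_grmap[OF c(2), of "GDom p" "[a]" "[]"] Comp_grmap[OF c(2), of "GDom p" "[b]" "[]"] ab e c(5) by simp
 qed (use gr_Nil_map[OF P(1)] ab in auto)
 from arg_cong[OF this, of "\<lambda>f. OMap f (node 0)"] show ?thesis by simp
qed

text \<open>Tested on a graph with one step: an arrow from \<open>z\<close> into
  \<open>VHom X (x, y)\<close> is a map to \<open>X\<close> from \<open>gr [z]\<close> with ends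
  \<open>x\<close> and \<open>y\<close>.\<close>

lemma pullback_graphs_hom:
 assumes pb: "is_pullback Gr p q f g" and ab: "a \<in> Vert (GDom p)" "b \<in> Vert (GDom p)"
 shows "is_pullback V (HMap p (a, b)) (HMap q (a, b)) (HMap f (OMap p a, OMap p b)) (HMap g (OMap q a, OMap q b))"
proof -
 interpret G: Category Gr by unfold_locales (rule Graphs_category)
 note c = G.pullback_facts[OF pb, unfolded Graphs_simps]
 note P = vgmap_facts[OF c(1)] and Q = vgmap_facts[OF c(2)] and F = vgmap_facts[OF c(3)] and G = vgmap_facts[OF c(4)]
 have o: "OMap f (OMap p a) = OMap g (OMap q a)" if "a \<in> Vert (GDom p)" for a
  using arg_cong[OF c(9), of "\<lambda>f. OMap f a"] that c(5) by simp
 let ?f = "HMap f (OMap p a, OMap p b)" and ?g = "HMap g (OMap q a, OMap q b)"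
 have vs: "OMap p a \<in> Vert (GDom f)" "OMap p b \<in> Vert (GDom f)" "OMap q a \<in> Vert (GDom g)" "OMap q b \<in> Vert (GDom g)"
  using P(3) Q(3) ab c(5-8) by auto
 show ?thesis
 proof (rule pullbackI)
  show "?f ** HMap p (a, b) = ?g ** HMap q (a, b)"
   using arg_cong[OF c(9), of "\<lambda>f. HMap f (a, b)"] ab c(5) by simp
 next
  fix h k assume hk: "h \<in> Arr V" "k \<in> Arr V" "Dom V h = Dom V k" "Cod V h = Dom V ?f"
   "Cod V k = Dom V ?g" "?f ** h = ?g ** k"
  let ?h = "grmap (GDom f) [OMap p a, OMap p b] [h]" and ?k = "grmap (GDom g) [OMap q a, OMap q b] [k]"
  have hA: "?h \<in> vgmaps U V" by (rule gr_single_map[OF F(1)]) (use vs hk F in auto)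
  have kA: "?k \<in> vgmaps U V" by (rule gr_single_map[OF G(1)]) (use vs hk G in auto)
  have "Comp Gr f ?h = Comp Gr g ?k"
   using Comp_grmap[OF c(3) refl, of "[OMap p a, OMap p b]" "[h]"]
    Comp_grmap[OF c(4) refl, of "[OMap q a, OMap q b]" "[k]"] vs hk F(5) G(5) c(8) o ab by simp
  then obtain u where u: "u \<in> Arr Gr" "Dom Gr u = Dom Gr ?h" "Cod Gr u = Dom Gr p"
    "Comp Gr p u = ?h" "Comp Gr q u = ?k"
   using G.pullback_lift[OF pb, of ?h ?k] hA kA hk(3) by (auto simp del: grmap_simps(3,4))
  note UF = vgmap_facts[OF u(1)[unfolded Graphs_simps]]
  have n: "node i \<in> Vert (GDom u)" if "i \<le> 1" for i using u(2) that by simp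
  \<comment> \<open>The lift is obtained as a map of graphs; uniqueness on vertices shows that its
    ends are \<open>a\<close> and, below, \<open>b\<close>.\<close>
  have o0: "OMap u (node 0) = a"
  proof (rule pullback_graphs_vertex_unique[OF pb _ ab(1)])
   show "OMap p (OMap u (node 0)) = OMap p a"
    using arg_cong[OF u(4), of "\<lambda>f. OMap f (node 0)"] n[of 0] by simp
   show "OMap q (OMap u (node 0)) = OMap q a"
    using arg_cong[OF u(5), of "\<lambda>f. OMap f (node 0)"] n[of 0] by simp
  qed (use UF(3)[OF n[of 0]] u(3) in simp)
  have o1: "OMap u (node 1) = b"
  proof (rule pullback_graphs_vertex_unique[OF pb _ ab(2)])
   show "OMap p (OMap u (node 1)) = OMap p b"
    using arg_cong[OF u(4), of "\<lambda>f. OMap f (node 1)"] n[of 1] by simp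
   show "OMap q (OMap u (node 1)) = OMap q b"
    using arg_cong[OF u(5), of "\<lambda>f. OMap f (node 1)"] n[of 1] by simp
  qed (use UF(3)[OF n[of 1]] u(3) in simp)
  let ?u = "HMap u (node 0, node 1)"
  have "HMap p (a, b) ** ?u = h"
   using arg_cong[OF u(4), of "\<lambda>f. HMap f (node 0, node 1)"] n[of 0] n[of 1] o0 o1 grmap_simps(4)[of 0 "[h]"] by simp
  moreover have "HMap q (a, b) ** ?u = k"
   using arg_cong[OF u(5), of "\<lambda>f. HMap f (node 0, node 1)"] n[of 0] n[of 1] o0 o1 grmap_simps(4)[of 0 "[k]"] by simp
  moreover have "?u \<in> Arr V" "Cod V ?u = VHom (GDom p) (a, b)"
   using UF(4-6)[OF n[of 0] n[of 1]] u(3) o0 o1 by simp_all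
  moreover have "Dom V ?u = Dom V h"
   using UF(5)[OF n[of 0] n[of 1]] u(2) VHom_gr[of 0 "[Dom V h]" 1] by simp
  ultimately show "\<exists>u\<in>Arr V. Dom V u = Dom V h \<and> Cod V u = Dom V (HMap p (a, b)) \<and>
    HMap p (a, b) ** u = h \<and> HMap q (a, b) ** u = k"
   using P(5)[OF ab] by (intro bexI[of _ ?u]) simp_all
 next
  fix u v assume uv: "u \<in> Arr V" "v \<in> Arr V" "Dom V u = Dom V v" "Cod V u = Dom V (HMap p (a, b))"
   "Cod V v = Dom V (HMap p (a, b))" "HMap p (a, b) ** u = HMap p (a, b) ** v" "HMap q (a, b) ** u = HMap q (a, b) ** v"
  let ?u = "grmap (GDom p) [a, b] [u]" and ?v = "grmap (GDom p) [a, b] [v]"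
  have uvA: "?u \<in> vgmaps U V" "?v \<in> vgmaps U V" by (rule gr_single_map[OF P(1) ab]; use uv P(5)[OF ab] in simp)+
  have "?u = ?v"
  proof (rule G.pullback_eqI[OF pb])
   show "Comp Gr p ?u = Comp Gr p ?v"
    using Comp_grmap[OF c(1) refl, of "[a, b]" "[u]"] Comp_grmap[OF c(1) refl, of "[a, b]" "[v]"] ab uv P(5)[OF ab] by simp
   show "Comp Gr q ?u = Comp Gr q ?v"
    using Comp_grmap[OF c(2), of "GDom p" "[a, b]" "[u]"] Comp_grmap[OF c(2), of "GDom p" "[a, b]" "[v]"]
     ab uv P(5)[OF ab] c(5) by simp
  qed (use uvA uv in auto)
  from arg_cong[OF this, of "\<lambda>f. HMap f (node 0, node (Suc 0))"] show "u = v" by simp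
 qed (use P Q F G ab vs c(5-8) o in auto)
qed

end

section \<open>Multitensors with distributivity\<close>

lemma map2_map2_same: "map2 h (map f xs) (map g xs) = map (\<lambda>x. h (f x) (g x)) xs"
 by (induction xs) auto

context extensive_category
begin

lemma lab_lists:
 assumes "X \<in> vgraphs U V" "p \<in> lists (Vert X)" shows "map (VHom X) (steps p) \<in> lists (Obj V)"
 using steps_subset[OF assms(2)] vgraph_facts(2)[OF assms(1)] by (fastforce simp: in_lists_conv_set)

lemma small_paths: "X \<in> vgraphs U V \<Longrightarrow> small U (paths (Vert X) a b)"
 by (rule small_subset[OF small_lists[OF small_in]]) (auto simp: vgraphs_def paths_def)

lemma small_Sigma_paths:
 assumes "X \<in> vgraphs U V" shows "small U (Sigma (paths (Vert X) a b) (refinements (Vert X)))"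
proof (rule small_inj[of "lists (lists (Vert X))" "\<lambda>(p, qs). p # qs"])
 show "small U (lists (lists (Vert X)))" using assms by (intro small_lists small_in) (simp add: vgraphs_def)
 show "(\<lambda>(p, qs). p # qs) ` Sigma (paths (Vert X) a b) (refinements (Vert X)) \<subseteq> lists (lists (Vert X))"
 proof (rule image_subsetI)
  fix t assume "t \<in> Sigma (paths (Vert X) a b) (refinements (Vert X))"
  then obtain p qs where "t = (p, qs)" "p \<in> paths (Vert X) a b" "qs \<in> refinements (Vert X) p" by auto
  then show "(\<lambda>(p, qs). p # qs) t \<in> lists (lists (Vert X))"
   using lists.Cons[OF pathsD(1) refinements_lists] by simp
 qed
qed (auto simp: inj_on_def)

lemma map_HMap_facts:
 assumes f: "f \<in> vgmaps U V" and p: "p \<in> lists (Vert (GDom f))"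
 shows "map (HMap f) (steps p) \<in> lists (Arr V)" "map (Dom V) (map (HMap f) (steps p)) = map (VHom (GDom f)) (steps p)"
  "map (Cod V) (map (HMap f) (steps p)) = map (VHom (GCod f)) (steps (map (OMap f) p))"
proof -
 have st: "\<exists>a b. s = (a, b) \<and> a \<in> Vert (GDom f) \<and> b \<in> Vert (GDom f)" if "s \<in> set (steps p)" for s
  using steps_mem[OF p that] by (cases s) auto
 show "map (HMap f) (steps p) \<in> lists (Arr V)" "map (Dom V) (map (HMap f) (steps p)) = map (VHom (GDom f)) (steps p)"
  "map (Cod V) (map (HMap f) (steps p)) = map (VHom (GCod f)) (steps (map (OMap f) p))"
  using st vgmap_facts[OF f] by (force simp: in_lists_conv_set steps_map)+
qed

lemma paths_vgmap: "f \<in> vgmaps U V \<Longrightarrow> p \<in> paths (Vert (GDom f)) a b \<Longrightarrow>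
  map (OMap f) p \<in> paths (Vert (GCod f)) (OMap f a) (OMap f b)"
 by (rule paths_map) (auto simp: vgmap_facts)

lemma refinements_vgmap: "f \<in> vgmaps U V \<Longrightarrow> qs \<in> refinements (Vert (GDom f)) p \<Longrightarrow>
  map (map (OMap f)) qs \<in> refinements (Vert (GCod f)) (map (OMap f) p)"
 by (rule refinements_map) (auto simp: vgmap_facts)

end

text \<open>Unit and substitution are kept apart: the decompositions into coproducts involve the
  functor and distributivity, and they must be available for the multitensor of an operad before its
  substitution is analysed.\<close>

locale tensor_functor = extensive_category U V
 for U :: "'i set set" and V :: "('o, 'a) cat" +
 fixes E :: "('o, 'a) multitensor"
 assumes E_functor: "is_functor (seq_cat V) V (EFun E)"
  and E_distributive: "is_distributive U V E"
begin

abbreviation EO :: "'o list \<Rightarrow> 'o" where "EO \<equiv> FObj (EFun E)"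
abbreviation EA :: "'a list \<Rightarrow> 'a" where "EA \<equiv> FArr (EFun E)"

lemma EO_Obj: "xs \<in> lists (Obj V) \<Longrightarrow> EO xs \<in> Obj V"
 using E_functor by (simp add: is_functor_def seq_cat_def)

lemma EA_Arr:
 assumes "fs \<in> lists (Arr V)"
 shows "EA fs \<in> Arr V" "Dom V (EA fs) = EO (map (Dom V) fs)" "Cod V (EA fs) = EO (map (Cod V) fs)"
 using E_functor assms by (simp_all add: is_functor_def seq_cat_def)

lemma EA_map_Arr:
 assumes "\<And>x. x \<in> set xs \<Longrightarrow> f x \<in> Arr V"
 shows "EA (map f xs) \<in> Arr V" "Dom V (EA (map f xs)) = EO (map (\<lambda>x. Dom V (f x)) xs)"
  "Cod V (EA (map f xs)) = EO (map (\<lambda>x. Cod V (f x)) xs)"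
 using EA_Arr[of "map f xs"] assms by (simp_all add: in_lists_conv_set comp_def image_subset_iff)

lemma EA_Ident: "xs \<in> lists (Obj V) \<Longrightarrow> EA (map (Ident V) xs) = Ident V (EO xs)"
 using E_functor by (simp add: is_functor_def seq_cat_def)

lemma EA_Comp:
 assumes "fs \<in> lists (Arr V)" "gs \<in> lists (Arr V)" "map (Dom V) gs = map (Cod V) fs"
 shows "EA gs ** EA fs = EA (map2 (Comp V) gs fs)"
 using E_functor assms by (simp add: is_functor_def seq_cat_def)

lemma EA_Comp_map:
 assumes "\<And>x. x \<in> set xs \<Longrightarrow> f x \<in> Arr V \<and> g x \<in> Arr V \<and> Dom V (g x) = Cod V (f x)"
 shows "EA (map g xs) ** EA (map f xs) = EA (map (\<lambda>x. g x ** f x) xs)"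
 using EA_Comp[of "map f xs" "map g xs"] assms by (simp add: in_lists_conv_set map2_map2_same)

lemma Dom_lists: "fs \<in> lists (Arr V) \<Longrightarrow> map (Dom V) fs \<in> lists (Obj V)"
 and Cod_lists: "fs \<in> lists (Arr V) \<Longrightarrow> map (Cod V) fs \<in> lists (Obj V)"
 and Ident_lists: "xs \<in> lists (Obj V) \<Longrightarrow> map (Ident V) xs \<in> lists (Arr V)"
 by (auto simp: in_lists_conv_set)

lemma map_Ident_Comp:
 "map (Dom V) (map (Ident V) xs) = xs" "map (Cod V) (map (Ident V) xs) = xs" if "xs \<in> lists (Obj V)"
 using that by (induction xs) auto

lemma map2_Comp_Ident:
 "map2 (Comp V) (map (Ident V) xs) (map (Ident V) xs) = map (Ident V) xs" if "xs \<in> lists (Obj V)"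
 using that by (induction xs) auto

lemma map2_Comp_Ident_left:
 "fs \<in> lists (Arr V) \<Longrightarrow> map (Cod V) fs = xs \<Longrightarrow> map2 (Comp V) (map (Ident V) xs) fs = fs"
 by (induction fs arbitrary: xs) auto

lemma distributive_small:
 assumes "xs \<in> lists (Obj V)" "ys \<in> lists (Obj V)" and J: "small U J" and co: "is_coproduct V J X c \<iota>"
 shows "is_coproduct V J (\<lambda>j. EO (xs @ [X j] @ ys)) (EO (xs @ [c] @ ys))
  (\<lambda>j. EA (map (Ident V) xs @ [\<iota> j] @ map (Ident V) ys))"
proof -
 obtain e where e: "inj_on e J" "e ` J \<in> U" using J by (auto simp: small_def)
 let ?b = "inv_into J e"
 have b: "?b (e j) = j" if "j \<in> J" for j using e that by simp
 have "X j \<in> Obj V" if "j \<in> J" for j using coproduct_facts[OF co] that by (metis Dom_Obj)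
 then have "(\<lambda>i. X (?b i)) \<in> e ` J \<rightarrow> Obj V" using b by auto
 then have "is_coproduct V (e ` J) (\<lambda>i. EO (xs @ [X (?b i)] @ ys)) (EO (xs @ [c] @ ys))
   (\<lambda>i. EA (map (Ident V) xs @ [\<iota> (?b i)] @ map (Ident V) ys))"
  by (rule E_distributive[unfolded is_distributive_def, THEN bspec, OF assms(1), THEN bspec, OF assms(2), THEN bspec,
    OF e(2), THEN bspec, THEN spec, THEN spec, THEN mp, OF _ coproduct_small_reindex[OF e(1) co]])
 from coproduct_reindex[OF inj_on_imp_bij_betw[OF e(1)] this]
 show ?thesis by (rule coproduct_cong) (simp_all add: b)
qed

text \<open>Distributivity for the empty family, in the position of \<open>z\<close>.\<close>

lemma EO_initial:
 assumes "xs \<in> lists (Obj V)" "z \<in> set xs" "initial V z"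
 shows "initial V (EO xs)"
proof -
 obtain ys zs where xs: "xs = ys @ z # zs" using split_list[OF assms(2)] by blast
 have "is_coproduct V ({} :: unit set) undefined z undefined" using assms(3) by (simp add: coproduct_empty)
 from distributive_small[OF _ _ small_finite this, of ys zs] show ?thesis
  using assms(1) xs by (simp add: coproduct_empty)
qed

text \<open>One variable at a time. Entries that are already expanded stay in the constant prefix
  \<open>xs\<close>, so the induction hypothesis is applied to the prefix extended by
  \<open>Y j\<close>; the two levels combine to a coproduct over pairs of a head and a tail.\<close>

lemma nary_distributive_aux:
 assumes "xs \<in> lists (Obj V)" "\<And>s. s \<in> set ss \<Longrightarrow> small U (J s) \<and> is_coproduct V (J s) Y (c s) \<iota>"
 shows "is_coproduct V {js. list_all2 (\<lambda>j s. j \<in> J s) js ss} (\<lambda>js. EO (xs @ map Y js)) (EO (xs @ map c ss))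
  (\<lambda>js. EA (map (Ident V) xs @ map \<iota> js))"
 using assms
proof (induction ss arbitrary: xs)
 case Nil
 have "{js. list_all2 (\<lambda>j s. j \<in> J s) js []} = {[]}" by auto
 then show ?case using coproduct_singleton[OF EO_Obj[OF Nil(1)]] EA_Ident[OF Nil(1)]
  by (auto intro!: coproduct_cong[OF coproduct_singleton[OF EO_Obj[OF Nil(1)]]])
next
 case (Cons s ss)
 have s: "small U (J s)" "is_coproduct V (J s) Y (c s) \<iota>" using Cons.prems(2) by auto
 note S = coproduct_facts[OF s(2)]
 have cO: "map c ss \<in> lists (Obj V)"
 proof -
  have "c s' \<in> Obj V" if "s' \<in> set ss" for s' using coproduct_facts(1) Cons.prems(2)[of s'] that by auto
  then show ?thesis by (auto simp: in_lists_conv_set)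
 qed
 have Y: "Y j \<in> Obj V" if "j \<in> J s" for j using S that by (metis Dom_Obj)
 let ?K = "{js. list_all2 (\<lambda>j s. j \<in> J s) js ss}"
 have \<iota>js: "map \<iota> js \<in> lists (Arr V)" "map (Dom V) (map \<iota> js) = map Y js" "map (Cod V) (map \<iota> js) = map c ss"
  if "js \<in> ?K" for js
 proof -
  have "list_all2 (\<lambda>j s. j \<in> J s) js ss" using that by simp
  moreover have "\<And>s. s \<in> set ss \<Longrightarrow> is_coproduct V (J s) Y (c s) \<iota>" using Cons.prems(2) by simp
  ultimately have "map \<iota> js \<in> lists (Arr V) \<and> map (Dom V) (map \<iota> js) = map Y js \<and> map (Cod V) (map \<iota> js) = map c ss"
   by (induction rule: list_all2_induct) (auto dest: coproduct_facts)
  then show "map \<iota> js \<in> lists (Arr V)" "map (Dom V) (map \<iota> js) = map Y js" "map (Cod V) (map \<iota> js) = map c ss"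
   by simp_all
 qed
 have 1: "is_coproduct V (J s) (\<lambda>j. EO (xs @ [Y j] @ map c ss)) (EO (xs @ [c s] @ map c ss))
   (\<lambda>j. EA (map (Ident V) xs @ [\<iota> j] @ map (Ident V) (map c ss)))"
  by (rule distributive_small[OF Cons.prems(1) cO s])
 have 2: "is_coproduct V ?K (\<lambda>js. EO (xs @ [Y j] @ map Y js)) (EO (xs @ [Y j] @ map c ss))
   (\<lambda>js. EA (map (Ident V) xs @ [Ident V (Y j)] @ map \<iota> js))" if j: "j \<in> J s" for j
  using Cons.IH[of "xs @ [Y j]"] Cons.prems Y[OF j] by simp
 have 3: "EA (map (Ident V) xs @ [\<iota> j] @ map (Ident V) (map c ss)) **
   EA (map (Ident V) xs @ [Ident V (Y j)] @ map \<iota> js) = EA (map (Ident V) xs @ \<iota> j # map \<iota> js)"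
  if "j \<in> J s" "js \<in> ?K" for j js
 proof -
  have "EA (map (Ident V) xs @ [\<iota> j] @ map (Ident V) (map c ss)) **
    EA (map (Ident V) xs @ [Ident V (Y j)] @ map \<iota> js) =
   EA (map2 (Comp V) (map (Ident V) xs @ [\<iota> j] @ map (Ident V) (map c ss)) (map (Ident V) xs @ [Ident V (Y j)] @ map \<iota> js))"
   by (rule EA_Comp) (use \<iota>js[OF that(2)] S Y that Cons.prems(1) cO map_Ident_Comp[OF Cons.prems(1)]
    map_Ident_Comp[OF cO] Ident_lists in \<open>auto simp del: map_map\<close>)
  also have "map2 (Comp V) (map (Ident V) xs @ [\<iota> j] @ map (Ident V) (map c ss)) (map (Ident V) xs @ [Ident V (Y j)] @ map \<iota> js)
   = map (Ident V) xs @ \<iota> j # map \<iota> js"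
   using map2_Comp_Ident[OF Cons.prems(1)] map2_Comp_Ident_left[OF \<iota>js(1,3)[OF that(2)]] S that
   by (simp del: map_map)
  finally show ?thesis .
 qed
 have e: "bij_betw (\<lambda>js. (hd js, tl js)) {js. list_all2 (\<lambda>j s. j \<in> J s) js (s # ss)} (J s \<times> ?K)"
  by (rule bij_betw_byWitness[where f' = "\<lambda>(j, js). j # js"]) (auto simp: list_all2_Cons2)
 have eqc: "EO (xs @ map c (s # ss)) = EO (xs @ [c s] @ map c ss)" by simp
 show ?case unfolding eqc
  by (rule coproduct_cong[OF coproduct_reindex[OF e coproduct_Sigma[OF 1 2]]])
   (use 3 in \<open>auto simp: list_all2_Cons2\<close>)
qed

lemma nary_distributive:
 assumes "\<And>s. s \<in> set ss \<Longrightarrow> small U (J s)" "\<And>s. s \<in> set ss \<Longrightarrow> is_coproduct V (J s) Y (c s) \<iota>"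
 shows "is_coproduct V {js. list_all2 (\<lambda>j s. j \<in> J s) js ss} (\<lambda>js. EO (map Y js)) (EO (map c ss)) (\<lambda>js. EA (map \<iota> js))"
 using nary_distributive_aux[of "[]" ss J Y c \<iota>] assms by simp

end

text \<open>Typing of unit and substitution without the laws. For the multitensor of an operad this
  is what is checked directly; its laws are deduced from those of the monad.\<close>

locale multitensor_data = tensor_functor U V E
 for U :: "'i set set" and V :: "('o, 'a) cat" and E :: "('o, 'a) multitensor" +
 assumes E_unit: "\<And>z. z \<in> Obj V \<Longrightarrow> EUnit E z \<in> hom V z (FObj (EFun E) [z])"
  and E_subst: "\<And>Z. Z \<in> lists (lists (Obj V)) \<Longrightarrow>
   ESubst E Z \<in> hom V (FObj (EFun E) (map (FObj (EFun E)) Z)) (FObj (EFun E) (concat Z))"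
  and E_unit_ext: "EUnit E \<in> extensional (Obj V)"
  and E_subst_ext: "ESubst E \<in> extensional (lists (lists (Obj V)))"
begin

lemma unit_nat_iff:
 "is_nat V V (id_fctr V) (unary_part V E) (EUnit E) \<longleftrightarrow>
  (\<forall>f\<in>Arr V. EA [f] ** EUnit E (Dom V f) = EUnit E (Cod V f) ** f)"
 unfolding is_nat_def using E_unit E_unit_ext
 by (simp add: id_fctr_def unary_part_def comp_fctr_def seq_unit_def)

lemma subst_nat_iff:
 "is_nat (seq_cat (seq_cat V)) V (nested V E) (flattened V E) (ESubst E) \<longleftrightarrow>
  (\<forall>fss\<in>lists (lists (Arr V)). EA (concat fss) ** ESubst E (map (map (Dom V)) fss) =
   ESubst E (map (map (Cod V)) fss) ** EA (map EA fss))"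
 unfolding is_nat_def using E_subst E_subst_ext
 by (simp add: nested_def flattened_def comp_fctr_def seq_concat_def seq_map_def seq_cat_def)

lemma is_multitensor_iff:
 "is_multitensor V E \<longleftrightarrow>
  (\<forall>f\<in>Arr V. EA [f] ** EUnit E (Dom V f) = EUnit E (Cod V f) ** f) \<and>
  (\<forall>fss\<in>lists (lists (Arr V)). EA (concat fss) ** ESubst E (map (map (Dom V)) fss) =
   ESubst E (map (map (Cod V)) fss) ** EA (map EA fss)) \<and>
  (\<forall>Z\<in>lists (Obj V). ESubst E [Z] ** EUnit E (EO Z) = Ident V (EO Z)) \<and>
  (\<forall>Z\<in>lists (Obj V). ESubst E (map (\<lambda>z. [z]) Z) ** EA (map (EUnit E) Z) = Ident V (EO Z)) \<and>
  (\<forall>Z\<in>lists (lists (lists (Obj V))). ESubst E (concat Z) ** ESubst E (map (map EO) Z) =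
    ESubst E (map concat Z) ** EA (map (ESubst E) Z))"
 unfolding is_multitensor_def unit_nat_iff subst_nat_iff using E_functor by blast

lemma E_subst_facts:
 assumes "\<And>z. z \<in> set Z \<Longrightarrow> z \<in> lists (Obj V)"
 shows "ESubst E Z \<in> Arr V" "Dom V (ESubst E Z) = EO (map EO Z)" "Cod V (ESubst E Z) = EO (concat Z)"
 using E_subst[of Z] assms by (auto simp: in_lists_conv_set)

end

section \<open>Monads presented by multitensors\<close>

text \<open>
 In a presentation every hom-object \<open>T X (a, b)\<close> is a coproduct of the objects \<open>E\<^sub>i X(x\<^sub>i\<^sub>-\<^sub>1, x\<^sub>i)\<close>, for
 arbitrary coprojections.  Both \<open>\<Gamma> E\<close> and every operad over some \<open>\<Gamma> E\<close> have one, and the laws of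
 the monad and those of the multitensor determine each other summand by summand.
\<close>

locale presented_functor = tensor_functor U V E
 for U :: "'i set set" and V :: "('o, 'a) cat" and E :: "('o, 'a) multitensor" +
 fixes T :: "(('i, 'o) vgraph, ('i, 'o, 'a) vgmap) monad"
  and inj :: "('i, 'o) vgraph \<Rightarrow> 'i list \<Rightarrow> 'a"
 assumes T_functor: "is_functor (Graphs U V) (Graphs U V) (MFun T)"
  and T_Vert: "\<And>X. X \<in> vgraphs U V \<Longrightarrow> Vert (FObj (MFun T) X) = Vert X"
  and T_OMap: "\<And>f. f \<in> vgmaps U V \<Longrightarrow> OMap (FArr (MFun T) f) = OMap f"
  and inj_coproduct: "\<And>X a b. X \<in> vgraphs U V \<Longrightarrow> a \<in> Vert X \<Longrightarrow> b \<in> Vert X \<Longrightarrow>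
   is_coproduct V (paths (Vert X) a b) (path_tensor E X) (VHom (FObj (MFun T) X) (a, b)) (inj X)"
  and inj_natural: "\<And>f p. f \<in> vgmaps U V \<Longrightarrow> p \<in> lists (Vert (GDom f)) \<Longrightarrow> p \<noteq> [] \<Longrightarrow>
   Comp V (HMap (FArr (MFun T) f) (hd p, last p)) (inj (GDom f) p) =
   Comp V (inj (GCod f) (map (OMap f) p)) (FArr (EFun E) (map (HMap f) (steps p)))"
begin

abbreviation TO :: "('i, 'o) vgraph \<Rightarrow> ('i, 'o) vgraph" where "TO \<equiv> FObj (MFun T)"
abbreviation TA :: "('i, 'o, 'a) vgmap \<Rightarrow> ('i, 'o, 'a) vgmap" where "TA \<equiv> FArr (MFun T)"
abbreviation lab :: "('i, 'o) vgraph \<Rightarrow> 'i list \<Rightarrow> 'o list" where "lab X p \<equiv> map (VHom X) (steps p)"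

lemma TO_vgraph [simp]: "X \<in> vgraphs U V \<Longrightarrow> TO X \<in> vgraphs U V"
 using T_functor by (simp add: is_functor_def)

lemma TA_vgmap:
 assumes "f \<in> vgmaps U V"
 shows "TA f \<in> vgmaps U V" "GDom (TA f) = TO (GDom f)" "GCod (TA f) = TO (GCod f)"
 using T_functor assms by (simp_all add: is_functor_def)

lemma inj_facts:
 assumes "X \<in> vgraphs U V" "p \<in> paths (Vert X) a b"
 shows "inj X p \<in> Arr V" "Dom V (inj X p) = EO (lab X p)" "Cod V (inj X p) = VHom (TO X) (a, b)"
 using coproduct_facts[OF inj_coproduct[OF assms(1) pathsD(5,6)[OF assms(2)]]] assms(2)
 by (simp_all add: path_tensor_def)

lemma inj_mono:
 assumes "X \<in> vgraphs U V" "p \<in> paths (Vert X) a b" shows "mono_arr V (inj X p)"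
 by (rule coproduct_inj_mono[OF small_paths inj_coproduct[OF _ pathsD(5,6)[OF assms(2)]] assms(2)]) (use assms in auto)

lemma map_inj_facts:
 assumes X: "X \<in> vgraphs U V" and qs: "qs \<in> refinements (Vert X) p"
 shows "map (inj X) qs \<in> lists (Arr V)" "map (Dom V) (map (inj X) qs) = map EO (map (lab X) qs)"
  "map (Cod V) (map (inj X) qs) = lab (TO X) p"
proof -
 note f = inj_facts[OF X refinements_paths[OF qs]]
 show "map (inj X) qs \<in> lists (Arr V)" "map (Dom V) (map (inj X) qs) = map EO (map (lab X) qs)"
  using f by (auto simp: in_lists_conv_set)
 have "map (Cod V) (map (inj X) qs) = map (VHom (TO X)) (map (\<lambda>q. (hd q, last q)) qs)" using f by simp
 then show "map (Cod V) (map (inj X) qs) = lab (TO X) p" unfolding refinements_ends[OF qs] .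
qed

lemma EA_inj_facts:
 assumes X: "X \<in> vgraphs U V" and qs: "qs \<in> refinements (Vert X) p"
 shows "EA (map (inj X) qs) \<in> Arr V" "Dom V (EA (map (inj X) qs)) = EO (map EO (map (lab X) qs))"
  "Cod V (EA (map (inj X) qs)) = EO (lab (TO X) p)"
 using EA_Arr[OF map_inj_facts(1)[OF assms]] unfolding map_inj_facts(2,3)[OF assms] .

text \<open>Distributivity in all steps of \<open>p\<close> at once: to choose a summand for every
  step is to choose a refinement of \<open>p\<close>.\<close>

lemma refinement_coproduct:
 assumes X: "X \<in> vgraphs U V" and p: "p \<in> lists (Vert X)"
 shows "is_coproduct V (refinements (Vert X) p) (\<lambda>qs. EO (map EO (map (lab X) qs))) (EO (lab (TO X) p))
  (\<lambda>qs. EA (map (inj X) qs))"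
proof -
 have eq: "refinements (Vert X) p = {qs. list_all2 (\<lambda>q s. q \<in> paths (Vert X) (fst s) (snd s)) qs (steps p)}"
  by (simp add: refinements_def split_beta')
 have st: "fst s \<in> Vert X \<and> snd s \<in> Vert X" if "s \<in> set (steps p)" for s
  using steps_mem[OF p that] .
 have "is_coproduct V {qs. list_all2 (\<lambda>q s. q \<in> paths (Vert X) (fst s) (snd s)) qs (steps p)}
  (\<lambda>qs. EO (map (path_tensor E X) qs)) (EO (lab (TO X) p)) (\<lambda>qs. EA (map (inj X) qs))"
 proof (rule nary_distributive)
  fix s assume "s \<in> set (steps p)"
  then show "is_coproduct V (paths (Vert X) (fst s) (snd s)) (path_tensor E X) (VHom (TO X) s) (inj X)"
   using inj_coproduct[OF X, of "fst s" "snd s"] st by simp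
 qed (rule small_paths[OF X])
 then show ?thesis unfolding eq by (rule coproduct_cong) (simp_all add: path_tensor_def[abs_def] comp_def)
qed

text \<open>A coproduct over paths of coproducts over refinements. Equations about multiplications
  are tested on these summands.\<close>

lemma TTO_coproduct:
 assumes X: "X \<in> vgraphs U V" and ab: "a \<in> Vert X" "b \<in> Vert X"
 shows "is_coproduct V (Sigma (paths (Vert X) a b) (refinements (Vert X))) (\<lambda>(p, qs). EO (map EO (map (lab X) qs)))
  (VHom (TO (TO X)) (a, b)) (\<lambda>(p, qs). inj (TO X) p ** EA (map (inj X) qs))"
proof (rule coproduct_Sigma)
 show "is_coproduct V (paths (Vert X) a b) (path_tensor E (TO X)) (VHom (TO (TO X)) (a, b)) (inj (TO X))"
  using inj_coproduct[OF TO_vgraph[OF X], of a b] ab T_Vert[OF X] by simp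
 fix p assume "p \<in> paths (Vert X) a b"
 then show "is_coproduct V (refinements (Vert X) p) (\<lambda>qs. EO (map EO (map (lab X) qs))) (path_tensor E (TO X) p)
   (\<lambda>qs. EA (map (inj X) qs))"
  using refinement_coproduct[OF X pathsD(1)] by (simp add: path_tensor_def)
qed

text \<open>The indices for the threefold iterate: every step of \<open>p\<close> receives a path
  together with a refinement of that path.\<close>

definition refinements2 :: "'i set \<Rightarrow> 'i list \<Rightarrow> ('i list \<times> 'i list list) list set" where
 "refinements2 S p = {ts. list_all2 (\<lambda>t s. t \<in> Sigma (paths S (fst s) (snd s)) (refinements S)) ts (steps p)}"

lemma refinements2_iff:
 "ts \<in> refinements2 S p \<longleftrightarrow> map fst ts \<in> refinements S p \<and> (\<forall>t\<in>set ts. snd t \<in> refinements S (fst t))"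
proof -
 have "list_all2 (\<lambda>t s. t \<in> Sigma (paths S (fst s) (snd s)) (refinements S)) ts ss \<longleftrightarrow>
   list_all2 (\<lambda>q (x, y). q \<in> paths S x y) (map fst ts) ss \<and> (\<forall>t\<in>set ts. snd t \<in> refinements S (fst t))" for ss
 proof (induction ts arbitrary: ss)
  case (Cons t ts)
  then show ?case by (cases ss; cases t) auto
 qed auto
 then show ?thesis unfolding refinements2_def refinements_def[of S p] by simp
qed

abbreviation inj2 :: "('i, 'o) vgraph \<Rightarrow> 'i list \<times> 'i list list \<Rightarrow> 'a" where
 "inj2 X t \<equiv> inj (TO X) (fst t) ** EA (map (inj X) (snd t))"

text \<open>Distributivity is applied here to the decomposition of the twofold iterate, one hom for
  each step of the outer path.\<close>

lemma TTTO_coproduct: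
 assumes X: "X \<in> vgraphs U V" and ab: "a \<in> Vert X" "b \<in> Vert X"
 shows "is_coproduct V (Sigma (paths (Vert X) a b) (refinements2 (Vert X)))
  (\<lambda>(p, ts). EO (map (\<lambda>t. EO (map EO (map (lab X) (snd t)))) ts))
  (VHom (TO (TO (TO X))) (a, b)) (\<lambda>(p, ts). inj (TO (TO X)) p ** EA (map (inj2 X) ts))"
proof (rule coproduct_Sigma)
 show "is_coproduct V (paths (Vert X) a b) (path_tensor E (TO (TO X))) (VHom (TO (TO (TO X))) (a, b)) (inj (TO (TO X)))"
  using inj_coproduct[OF TO_vgraph[OF TO_vgraph[OF X]], of a b] ab T_Vert X by simp
 fix p assume p: "p \<in> paths (Vert X) a b"
 have st: "fst s \<in> Vert X \<and> snd s \<in> Vert X" if "s \<in> set (steps p)" for s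
  using steps_mem[OF pathsD(1)[OF p] that] .
 have "is_coproduct V {ts. list_all2 (\<lambda>t s. t \<in> Sigma (paths (Vert X) (fst s) (snd s)) (refinements (Vert X))) ts (steps p)}
  (\<lambda>ts. EO (map (\<lambda>t. EO (map EO (map (lab X) (snd t)))) ts)) (EO (lab (TO (TO X)) p)) (\<lambda>ts. EA (map (inj2 X) ts))"
 proof (rule nary_distributive)
  fix s assume "s \<in> set (steps p)"
  then have "is_coproduct V (Sigma (paths (Vert X) (fst s) (snd s)) (refinements (Vert X)))
   (\<lambda>(p, qs). EO (map EO (map (lab X) qs))) (VHom (TO (TO X)) s) (\<lambda>(p, qs). inj (TO X) p ** EA (map (inj X) qs))"
   using TTO_coproduct[OF X, of "fst s" "snd s"] st by simp
  then show "is_coproduct V (Sigma (paths (Vert X) (fst s) (snd s)) (refinements (Vert X)))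
   (\<lambda>t. EO (map EO (map (lab X) (snd t)))) (VHom (TO (TO X)) s) (inj2 X)"
   by (rule coproduct_cong) auto
 qed (rule small_Sigma_paths[OF X])
 then show "is_coproduct V (refinements2 (Vert X) p) (\<lambda>ts. EO (map (\<lambda>t. EO (map EO (map (lab X) (snd t)))) ts))
   (path_tensor E (TO (TO X)) p) (\<lambda>ts. EA (map (inj2 X) ts))"
  by (simp add: path_tensor_def refinements2_def)
qed

lemma EA_HMap_facts:
 assumes f: "f \<in> vgmaps U V" and p: "p \<in> lists (Vert (GDom f))"
 shows "EA (map (HMap f) (steps p)) \<in> Arr V" "Dom V (EA (map (HMap f) (steps p))) = EO (lab (GDom f) p)"
  "Cod V (EA (map (HMap f) (steps p))) = EO (lab (GCod f) (map (OMap f) p))"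
 using EA_Arr[OF map_HMap_facts(1)[OF assms]] unfolding map_HMap_facts(2,3)[OF assms] .

lemma inj_natural':
 "f \<in> vgmaps U V \<Longrightarrow> p \<in> paths (Vert (GDom f)) a b \<Longrightarrow>
  HMap (TA f) (a, b) ** inj (GDom f) p = inj (GCod f) (map (OMap f) p) ** EA (map (HMap f) (steps p))"
 using inj_natural pathsD(1-4) by metis

lemma TA_facts:
 assumes f: "f \<in> vgmaps U V" and ab: "a \<in> Vert (GDom f)" "b \<in> Vert (GDom f)"
 shows "HMap (TA f) (a, b) \<in> Arr V" "Dom V (HMap (TA f) (a, b)) = VHom (TO (GDom f)) (a, b)"
  "Cod V (HMap (TA f) (a, b)) = VHom (TO (GCod f)) (OMap f a, OMap f b)"
 using vgmap_facts(4-6)[OF TA_vgmap(1)[OF f], of a b] TA_vgmap(2,3)[OF f] T_Vert T_OMap[OF f]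
  vgmap_facts(1)[OF f] ab by simp_all

lemma inj2_facts:
 assumes X: "X \<in> vgraphs U V" and p: "p \<in> paths (Vert X) a b" and qs: "qs \<in> refinements (Vert X) p"
 shows "inj2 X (p, qs) \<in> Arr V" "Dom V (inj2 X (p, qs)) = EO (map EO (map (lab X) qs))"
  "Cod V (inj2 X (p, qs)) = VHom (TO (TO X)) (a, b)"
 using coproduct_facts(2-4)[OF TTO_coproduct[OF X pathsD(5,6)[OF p]], of "(p, qs)"] p qs by simp_all

text \<open>Naturality of the coprojections is used twice, once for \<open>TA f\<close> and once for
  \<open>f\<close> inside \<open>EA\<close>, so the summand of \<open>(p, qs)\<close> goes to the
  summand of its image.\<close>

lemma TTA_inj2:
 assumes f: "f \<in> vgmaps U V" and p: "p \<in> paths (Vert (GDom f)) a b" and qs: "qs \<in> refinements (Vert (GDom f)) p"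
 shows "HMap (TA (TA f)) (a, b) ** inj2 (GDom f) (p, qs) =
  inj2 (GCod f) (map (OMap f) p, map (map (OMap f)) qs) ** EA (map (\<lambda>q. EA (map (HMap f) (steps q))) qs)"
proof -
 let ?X = "GDom f" and ?Y = "GCod f"
 have X: "?X \<in> vgraphs U V" and Y: "?Y \<in> vgraphs U V" using vgmap_facts[OF f] by auto
 have pT: "p \<in> paths (Vert (GDom (TA f))) a b" using p TA_vgmap[OF f] T_Vert[OF X] by simp
 have fp: "map (OMap f) p \<in> paths (Vert (TO ?Y)) (OMap f a) (OMap f b)" using paths_vgmap[OF f p] T_Vert[OF Y] by simp
 have q: "q \<in> paths (Vert ?X) (hd q) (last q)" if "q \<in> set qs" for q using refinements_paths[OF qs that] .
 have fqs: "map (map (OMap f)) qs \<in> refinements (Vert ?Y) (map (OMap f) p)" by (rule refinements_vgmap[OF f qs])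
 have i: "inj (TO ?X) p \<in> Arr V" "Dom V (inj (TO ?X) p) = EO (lab (TO ?X) p)" "Cod V (inj (TO ?X) p) = VHom (TO (TO ?X)) (a, b)"
  using inj_facts[OF TO_vgraph[OF X], of p a b] p T_Vert[OF X] by simp_all
 have abX: "a \<in> Vert ?X" "b \<in> Vert ?X" using pathsD[OF p] by auto
 have TT: "HMap (TA (TA f)) (a, b) \<in> Arr V" "Dom V (HMap (TA (TA f)) (a, b)) = VHom (TO (TO ?X)) (a, b)"
  using TA_facts[OF TA_vgmap(1)[OF f], of a b] TA_vgmap[OF f] T_Vert[OF X] abX by simp_all
 have "HMap (TA (TA f)) (a, b) ** inj2 ?X (p, qs) = (HMap (TA (TA f)) (a, b) ** inj (TO ?X) p) ** EA (map (inj ?X) qs)"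
  using TT i EA_inj_facts[OF X qs] by simp
 also have "\<dots> = (inj (TO ?Y) (map (OMap f) p) ** EA (map (HMap (TA f)) (steps p))) ** EA (map (inj ?X) qs)"
  using inj_natural'[OF TA_vgmap(1)[OF f] pT] TA_vgmap[OF f] T_OMap[OF f] by simp
 also have "\<dots> = inj (TO ?Y) (map (OMap f) p) ** EA (map (HMap (TA f)) (steps p)) ** EA (map (inj ?X) qs)"
  using inj_facts[OF TO_vgraph[OF Y] fp] EA_HMap_facts[OF TA_vgmap(1)[OF f] pathsD(1)[OF pT]] EA_inj_facts[OF X qs]
   TA_vgmap[OF f] T_OMap[OF f] by simp
 also have "EA (map (HMap (TA f)) (steps p)) ** EA (map (inj ?X) qs) =
   EA (map (\<lambda>q. HMap (TA f) (hd q, last q) ** inj ?X q) qs)"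
  unfolding refinements_ends[OF qs, symmetric] map_map comp_def
  by (rule EA_Comp_map) (use inj_facts[OF X q] TA_facts[OF f pathsD(5,6)[OF q]] in auto)
 also have "map (\<lambda>q. HMap (TA f) (hd q, last q) ** inj ?X q) qs =
   map (\<lambda>q. inj ?Y (map (OMap f) q) ** EA (map (HMap f) (steps q))) qs"
  using inj_natural'[OF f q] by simp
 also have "EA \<dots> = EA (map (inj ?Y) (map (map (OMap f)) qs)) ** EA (map (\<lambda>q. EA (map (HMap f) (steps q))) qs)"
  unfolding map_map comp_def
  by (rule EA_Comp_map[symmetric])
   (use inj_facts[OF Y paths_vgmap[OF f q]] EA_HMap_facts[OF f pathsD(1)[OF q]] in auto)
 also have "inj (TO ?Y) (map (OMap f) p) ** \<dots> =
   inj2 ?Y (map (OMap f) p, map (map (OMap f)) qs) ** EA (map (\<lambda>q. EA (map (HMap f) (steps q))) qs)"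
 proof -
  have "EA (map (\<lambda>q. EA (map (HMap f) (steps q))) qs) \<in> Arr V"
   "Cod V (EA (map (\<lambda>q. EA (map (HMap f) (steps q))) qs)) = EO (map EO (map (lab ?Y) (map (map (OMap f)) qs)))"
   using EA_map_Arr[of qs "\<lambda>q. EA (map (HMap f) (steps q))"] EA_HMap_facts[OF f pathsD(1)[OF q]]
   by (simp_all add: comp_def cong: map_cong)
  then show ?thesis using inj_facts[OF TO_vgraph[OF Y] fp] EA_inj_facts[OF Y fqs] by simp
 qed
 finally show ?thesis .
qed

end

text \<open>\<open>inj_unit\<close> and \<open>inj_mult\<close> express unit and multiplication of
  \<open>T\<close> through those of \<open>E\<close>. Apart from functoriality, distributivity and
  the conditions on coprojections no law is assumed on either side, so the laws of each side can be
  derived from those of the other.\<close>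

locale presentation = presented_functor U V E T inj + multitensor_data U V E
 for U :: "'i set set" and V :: "('o, 'a) cat" and E :: "('o, 'a) multitensor" and T and inj +
 assumes T_unit: "\<And>X. X \<in> vgraphs U V \<Longrightarrow> MUnit T X \<in> vgmaps U V \<and> GDom (MUnit T X) = X \<and>
   GCod (MUnit T X) = FObj (MFun T) X \<and> OMap (MUnit T X) = (\<lambda>a\<in>Vert X. a)"
  and T_mult: "\<And>X. X \<in> vgraphs U V \<Longrightarrow> MMult T X \<in> vgmaps U V \<and>
   GDom (MMult T X) = FObj (MFun T) (FObj (MFun T) X) \<and>
   GCod (MMult T X) = FObj (MFun T) X \<and> OMap (MMult T X) = (\<lambda>a\<in>Vert X. a)"
  and T_unit_ext: "MUnit T \<in> extensional (vgraphs U V)"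
  and T_mult_ext: "MMult T \<in> extensional (vgraphs U V)"
  and inj_unit: "\<And>X a b. X \<in> vgraphs U V \<Longrightarrow> a \<in> Vert X \<Longrightarrow> b \<in> Vert X \<Longrightarrow>
   HMap (MUnit T X) (a, b) = Comp V (inj X [a, b]) (EUnit E (VHom X (a, b)))"
  and inj_mult: "\<And>X p qs a b. X \<in> vgraphs U V \<Longrightarrow> p \<in> paths (Vert X) a b \<Longrightarrow> qs \<in> refinements (Vert X) p \<Longrightarrow>
   Comp V (HMap (MMult T X) (a, b)) (Comp V (inj (FObj (MFun T) X) p) (FArr (EFun E) (map (inj X) qs))) =
   Comp V (inj X (glue p qs)) (ESubst E (map (\<lambda>q. map (VHom X) (steps q)) qs))"
begin

lemma unit_facts:
 assumes X: "X \<in> vgraphs U V" and ab: "a \<in> Vert X" "b \<in> Vert X"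
 shows "HMap (MUnit T X) (a, b) \<in> Arr V" "Dom V (HMap (MUnit T X) (a, b)) = VHom X (a, b)"
  "Cod V (HMap (MUnit T X) (a, b)) = VHom (TO X) (a, b)"
 using vgmap_facts(4-6)[of "MUnit T X" a b] T_unit[OF X] ab by simp_all

lemma mult_facts:
 assumes X: "X \<in> vgraphs U V" and ab: "a \<in> Vert X" "b \<in> Vert X"
 shows "HMap (MMult T X) (a, b) \<in> Arr V" "Dom V (HMap (MMult T X) (a, b)) = VHom (TO (TO X)) (a, b)"
  "Cod V (HMap (MMult T X) (a, b)) = VHom (TO X) (a, b)"
 using vgmap_facts(4-6)[of "MMult T X" a b] T_mult[OF X] T_Vert X ab by simp_all

end

lemma concat_eq_lengths:
 "concat xss = concat yss \<Longrightarrow> map length xss = map length yss \<Longrightarrow> xss = yss"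
proof (induction xss arbitrary: yss)
 case (Cons xs xss)
 then show ?case by (cases yss) auto
qed simp

lemma concat_map_concat: "concat (map concat xsss) = concat (concat xsss)"
 by (induction xsss) auto

context extensive_category
begin

text \<open>The action of \<open>gr\<close> on arrows of the category of sequences.\<close>

definition grf :: "'a list \<Rightarrow> ('i, 'o, 'a) vgmap" where
 "grf fs = grmap (gr (map (Cod V) fs)) (std (length fs)) fs"

lemma grf:
 assumes "fs \<in> lists (Arr V)"
 shows "grf fs \<in> vgmaps U V" "GDom (grf fs) = gr (map (Dom V) fs)" "GCod (grf fs) = gr (map (Cod V) fs)"
  "\<And>i. i \<le> length fs \<Longrightarrow> OMap (grf fs) (node i) = node i"
  "map (HMap (grf fs)) (steps (std (length fs))) = fs"
proof -
 have c: "map (Cod V) fs \<in> lists (Obj V)" using assms by (auto simp: in_lists_conv_set)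
 show "grf fs \<in> vgmaps U V" unfolding grf_def
  using map_VHom_gr[of "map (Cod V) fs"] std_lists[of "map (Cod V) fs"]
  by (intro grmap_vgmap gr_vgraph c assms) simp_all
qed (simp_all add: grf_def)

lemma grf_path:
 assumes "fs \<in> lists (Arr V)" "p \<in> lists (Vert (gr (map (Dom V) fs)))"
 shows "map (OMap (grf fs)) p = p"
 by (rule map_idI) (use assms(2) grf(4)[OF assms(1)] in \<open>auto simp: in_lists_conv_set\<close>)

end

context presentation
begin

lemma unit_nat_T_iff:
 "is_nat Gr Gr (id_fctr Gr) (MFun T) (MUnit T) \<longleftrightarrow>
  (\<forall>f\<in>vgmaps U V. Comp Gr (TA f) (MUnit T (GDom f)) = Comp Gr (MUnit T (GCod f)) f)"
 unfolding is_nat_def using T_unit T_unit_ext by (auto simp: id_fctr_def)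

lemma mult_nat_T_iff:
 "is_nat Gr Gr (comp_fctr Gr (MFun T) (MFun T)) (MFun T) (MMult T) \<longleftrightarrow>
  (\<forall>f\<in>vgmaps U V. Comp Gr (TA f) (MMult T (GDom f)) = Comp Gr (MMult T (GCod f)) (TA (TA f)))"
 unfolding is_nat_def using T_mult T_mult_ext by (auto simp: comp_fctr_def)

lemma is_monad_iff:
 "is_monad Gr T \<longleftrightarrow>
  (\<forall>f\<in>vgmaps U V. Comp Gr (TA f) (MUnit T (GDom f)) = Comp Gr (MUnit T (GCod f)) f) \<and>
  (\<forall>f\<in>vgmaps U V. Comp Gr (TA f) (MMult T (GDom f)) = Comp Gr (MMult T (GCod f)) (TA (TA f))) \<and>
  (\<forall>X\<in>vgraphs U V. Comp Gr (MMult T X) (MUnit T (TO X)) = Ident Gr (TO X)) \<and>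
  (\<forall>X\<in>vgraphs U V. Comp Gr (MMult T X) (TA (MUnit T X)) = Ident Gr (TO X)) \<and>
  (\<forall>X\<in>vgraphs U V. Comp Gr (MMult T X) (MMult T (TO X)) = Comp Gr (MMult T X) (TA (MMult T X)))"
 unfolding is_monad_def unit_nat_T_iff mult_nat_T_iff using T_functor by auto

lemma E_unit_facts:
 assumes "z \<in> Obj V"
 shows "EUnit E z \<in> Arr V" "Dom V (EUnit E z) = z" "Cod V (EUnit E z) = EO [z]"
 using E_unit[OF assms] by auto

lemma subst_lab_facts:
 assumes "X \<in> vgraphs U V" "qs \<in> refinements (Vert X) p"
 shows "ESubst E (map (lab X) qs) \<in> Arr V" "Dom V (ESubst E (map (lab X) qs)) = EO (map EO (map (lab X) qs))"
  "Cod V (ESubst E (map (lab X) qs)) = EO (concat (map (lab X) qs))"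
 using E_subst_facts[of "map (lab X) qs"] lab_lists[OF assms(1)] refinements_lists[OF assms(2)] by auto

lemma lab_glue: "qs \<in> refinements S p \<Longrightarrow> p \<noteq> [] \<Longrightarrow> lab X (glue p qs) = concat (map (lab X) qs)"
 by (simp add: steps_glue map_concat comp_def)

lemma inj_glue_facts:
 assumes "X \<in> vgraphs U V" "p \<in> paths (Vert X) a b" "qs \<in> refinements (Vert X) p"
 shows "inj X (glue p qs) \<in> Arr V" "Dom V (inj X (glue p qs)) = EO (concat (map (lab X) qs))"
  "Cod V (inj X (glue p qs)) = VHom (TO X) (a, b)"
 using inj_facts[OF assms(1) glue_paths[OF assms(2,3)]] lab_glue[OF assms(3) pathsD(2)[OF assms(2)]] by simp_all

lemma inj_mult':
 assumes "X \<in> vgraphs U V" "p \<in> paths (Vert X) a b" "qs \<in> refinements (Vert X) p"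
 shows "HMap (MMult T X) (a, b) ** inj2 X (p, qs) = inj X (glue p qs) ** ESubst E (map (lab X) qs)"
 using inj_mult[OF assms] by simp

section \<open>Naturality of the units\<close>

lemma unit_natural_left:
 assumes f: "f \<in> vgmaps U V" and ab: "a \<in> Vert (GDom f)" "b \<in> Vert (GDom f)"
 shows "HMap (TA f) (a, b) ** HMap (MUnit T (GDom f)) (a, b) =
  inj (GCod f) [OMap f a, OMap f b] ** EA [HMap f (a, b)] ** EUnit E (VHom (GDom f) (a, b))"
proof -
 let ?X = "GDom f" and ?Y = "GCod f"
 have X: "?X \<in> vgraphs U V" and Y: "?Y \<in> vgraphs U V" using vgmap_facts[OF f] by auto
 have p: "[a, b] \<in> paths (Vert ?X) a b" using ab by simp
 note u = E_unit_facts[OF vgraph_facts(2)[OF X ab]]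
 have "HMap (TA f) (a, b) ** HMap (MUnit T ?X) (a, b) = (HMap (TA f) (a, b) ** inj ?X [a, b]) ** EUnit E (VHom ?X (a, b))"
  unfolding inj_unit[OF X ab] using TA_facts[OF f ab] inj_facts[OF X p] u by simp
 also have "HMap (TA f) (a, b) ** inj ?X [a, b] = inj ?Y [OMap f a, OMap f b] ** EA [HMap f (a, b)]"
  using inj_natural'[OF f p] by simp
 also have "\<dots> ** EUnit E (VHom ?X (a, b)) = inj ?Y [OMap f a, OMap f b] ** EA [HMap f (a, b)] ** EUnit E (VHom ?X (a, b))"
  using inj_facts[OF Y paths_vgmap[OF f p]] EA_HMap_facts[OF f pathsD(1)[OF p]] u by simp
 finally show ?thesis .
qed

lemma unit_natural_right:
 assumes f: "f \<in> vgmaps U V" and ab: "a \<in> Vert (GDom f)" "b \<in> Vert (GDom f)"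
 shows "HMap (MUnit T (GCod f)) (OMap f a, OMap f b) ** HMap f (a, b) =
  inj (GCod f) [OMap f a, OMap f b] ** EUnit E (VHom (GCod f) (OMap f a, OMap f b)) ** HMap f (a, b)"
proof -
 let ?Y = "GCod f"
 have Y: "?Y \<in> vgraphs U V" and fab: "OMap f a \<in> Vert ?Y" "OMap f b \<in> Vert ?Y" using vgmap_facts[OF f] ab by auto
 have p: "[OMap f a, OMap f b] \<in> paths (Vert ?Y) (OMap f a) (OMap f b)" using fab by simp
 show ?thesis unfolding inj_unit[OF Y fab]
  using inj_facts[OF Y p] E_unit_facts[OF vgraph_facts(2)[OF Y fab]] vgmap_facts(4-6)[OF f ab] by simp
qed

text \<open>On the hom \<open>(a, b)\<close> both composites factor through the coprojection of the
  one-step path from \<open>OMap f a\<close> to \<open>OMap f b\<close>. The multitensor law for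
  \<open>HMap f (a, b)\<close> therefore gives the monad law. Conversely, the monad law is tested on
  \<open>grf [f]\<close>, and the coprojection is cancelled because it is monic. The laws below are
  compared in the same manner.\<close>

lemma unit_natural_iff:
 "(\<forall>f\<in>vgmaps U V. Comp Gr (TA f) (MUnit T (GDom f)) = Comp Gr (MUnit T (GCod f)) f) \<longleftrightarrow>
  (\<forall>f\<in>Arr V. EA [f] ** EUnit E (Dom V f) = EUnit E (Cod V f) ** f)" (is "?T \<longleftrightarrow> ?E")
proof
 assume E: ?E
 show ?T
 proof
  fix f assume f: "f \<in> vgmaps U V"
  note F = vgmap_facts[OF f]
  show "Comp Gr (TA f) (MUnit T (GDom f)) = Comp Gr (MUnit T (GCod f)) f"
  proof (rule vgmap_eqI[where X = "GDom f"])
   fix a b assume ab: "a \<in> Vert (GDom f)" "b \<in> Vert (GDom f)"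
   show "HMap (Comp Gr (TA f) (MUnit T (GDom f))) (a, b) = HMap (Comp Gr (MUnit T (GCod f)) f) (a, b)"
    using unit_natural_left[OF f ab] unit_natural_right[OF f ab] bspec[OF E F(4)[OF ab]] F(5,6)[OF ab] T_unit[OF F(1)] ab
    by simp
  qed (use f F T_unit TA_vgmap T_OMap in \<open>auto intro!: Comp_vgmap\<close>)
 qed
next
 assume T: ?T
 show ?E
 proof
  fix f assume fA: "f \<in> Arr V"
  have l: "[f] \<in> lists (Arr V)" using fA by simp
  note g = grf[OF l]
  have ab: "node 0 \<in> Vert (GDom (grf [f]))" "node 1 \<in> Vert (GDom (grf [f]))" using g(2) by auto
  have X: "GDom (grf [f]) \<in> vgraphs U V" "GCod (grf [f]) \<in> vgraphs U V" using vgmap_facts[OF g(1)] by auto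
  have o: "OMap (grf [f]) (node 0) = node 0" "OMap (grf [f]) (node 1) = node 1" using g(4)[of 0] g(4)[of 1] by auto
  have h: "HMap (grf [f]) (node 0, node 1) = f" using g(5) by (simp add: std_def)
  have v: "VHom (GDom (grf [f])) (node 0, node 1) = Dom V f" "VHom (GCod (grf [f])) (node 0, node 1) = Cod V f"
   using g(2,3) VHom_gr[of 0 "[Dom V f]" 1] VHom_gr[of 0 "[Cod V f]" 1] by simp_all
  have "HMap (Comp Gr (TA (grf [f])) (MUnit T (GDom (grf [f])))) (node 0, node 1) =
    HMap (Comp Gr (MUnit T (GCod (grf [f]))) (grf [f])) (node 0, node 1)"
   using bspec[OF T g(1)] by simp
  then have e: "inj (GCod (grf [f])) [node 0, node 1] ** EA [f] ** EUnit E (Dom V f) =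
    inj (GCod (grf [f])) [node 0, node 1] ** EUnit E (Cod V f) ** f"
   using unit_natural_left[OF g(1) ab] unit_natural_right[OF g(1) ab] T_unit[OF X(1)] ab o h v by simp
  have p: "[node 0, node 1] \<in> paths (Vert (GCod (grf [f]))) (node 0) (node 1)" using g(3) by simp
  show "EA [f] ** EUnit E (Dom V f) = EUnit E (Cod V f) ** f"
   by (rule mono_arrD[OF inj_mono[OF X(2) p] e])
    (use E_unit_facts[of "Dom V f"] E_unit_facts[of "Cod V f"] EA_Arr[OF l] fA inj_facts[OF X(2) p] v in auto)
 qed
qed

section \<open>Naturality of multiplication and substitution\<close>

lemma mult_natural_left:
 assumes f: "f \<in> vgmaps U V" and p: "p \<in> paths (Vert (GDom f)) a b" and qs: "qs \<in> refinements (Vert (GDom f)) p"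
 shows "HMap (TA f) (a, b) ** HMap (MMult T (GDom f)) (a, b) ** inj2 (GDom f) (p, qs) =
  inj (GCod f) (map (OMap f) (glue p qs)) ** EA (concat (map (\<lambda>q. map (HMap f) (steps q)) qs)) **
   ESubst E (map (lab (GDom f)) qs)"
proof -
 let ?X = "GDom f" and ?Y = "GCod f"
 have X: "?X \<in> vgraphs U V" and Y: "?Y \<in> vgraphs U V" using vgmap_facts[OF f] by auto
 have ab: "a \<in> Vert ?X" "b \<in> Vert ?X" using pathsD[OF p] by auto
 note g = glue_paths[OF p qs]
 have c: "map (HMap f) (steps (glue p qs)) = concat (map (\<lambda>q. map (HMap f) (steps q)) qs)"
  using steps_glue[OF qs pathsD(2)[OF p]] by (simp add: map_concat comp_def)
 note t1 = TA_facts[OF f ab] and t2 = mult_facts[OF X ab] and t3 = inj2_facts[OF X p qs]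
  and t4 = inj_glue_facts[OF X p qs] and t5 = subst_lab_facts[OF X qs]
  and t6 = inj_facts[OF Y paths_vgmap[OF f g]] and t7 = EA_HMap_facts[OF f pathsD(1)[OF g]]
 have "HMap (TA f) (a, b) ** HMap (MMult T ?X) (a, b) ** inj2 ?X (p, qs) =
   (HMap (TA f) (a, b) ** inj ?X (glue p qs)) ** ESubst E (map (lab ?X) qs)"
  unfolding inj_mult'[OF X p qs] using t1 t4 t5 by simp
 also have "\<dots> = inj ?Y (map (OMap f) (glue p qs)) ** EA (map (HMap f) (steps (glue p qs))) ** ESubst E (map (lab ?X) qs)"
  unfolding inj_natural'[OF f g] using t5 t6 t7 lab_glue[OF qs pathsD(2)[OF p]] by simp
 finally show ?thesis unfolding c .
qed

lemma mult_natural_right: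
 assumes f: "f \<in> vgmaps U V" and p: "p \<in> paths (Vert (GDom f)) a b" and qs: "qs \<in> refinements (Vert (GDom f)) p"
 shows "HMap (MMult T (GCod f)) (OMap f a, OMap f b) ** HMap (TA (TA f)) (a, b) ** inj2 (GDom f) (p, qs) =
  inj (GCod f) (map (OMap f) (glue p qs)) ** ESubst E (map (\<lambda>q. map (Cod V) (map (HMap f) (steps q))) qs) **
   EA (map (\<lambda>q. EA (map (HMap f) (steps q))) qs)"
proof -
 let ?X = "GDom f" and ?Y = "GCod f"
 have X: "?X \<in> vgraphs U V" and Y: "?Y \<in> vgraphs U V" using vgmap_facts[OF f] by auto
 have fp: "map (OMap f) p \<in> paths (Vert ?Y) (OMap f a) (OMap f b)" by (rule paths_vgmap[OF f p])
 have fqs: "map (map (OMap f)) qs \<in> refinements (Vert ?Y) (map (OMap f) p)" by (rule refinements_vgmap[OF f qs])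
 have q: "q \<in> lists (Vert ?X)" if "q \<in> set qs" for q using refinements_lists[OF qs] that by auto
 have c: "map (lab ?Y) (map (map (OMap f)) qs) = map (\<lambda>q. map (Cod V) (map (HMap f) (steps q))) qs"
  using map_HMap_facts(3)[OF f q] by simp
 note t1 = mult_facts[OF Y pathsD(5,6)[OF fp]] and t2 = inj2_facts[OF Y fp fqs]
  and t3 = subst_lab_facts[OF Y fqs] and t4 = inj_glue_facts[OF Y fp fqs]
 have t5: "EA (map (\<lambda>q. EA (map (HMap f) (steps q))) qs) \<in> Arr V"
  "Cod V (EA (map (\<lambda>q. EA (map (HMap f) (steps q))) qs)) = EO (map EO (map (lab ?Y) (map (map (OMap f)) qs)))"
  using EA_map_Arr[of qs "\<lambda>q. EA (map (HMap f) (steps q))"] EA_HMap_facts[OF f q]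
  by (simp_all add: comp_def cong: map_cong)
 have "HMap (MMult T ?Y) (OMap f a, OMap f b) ** HMap (TA (TA f)) (a, b) ** inj2 ?X (p, qs) =
   (HMap (MMult T ?Y) (OMap f a, OMap f b) ** inj2 ?Y (map (OMap f) p, map (map (OMap f)) qs)) **
    EA (map (\<lambda>q. EA (map (HMap f) (steps q))) qs)"
  unfolding TTA_inj2[OF f p qs] using Comp_assoc[OF t5(1) t2(1) t1(1)] t1(2) t2(2,3) t5(2) by simp
 also have "\<dots> = inj ?Y (glue (map (OMap f) p) (map (map (OMap f)) qs)) ** ESubst E (map (lab ?Y) (map (map (OMap f)) qs)) **
    EA (map (\<lambda>q. EA (map (HMap f) (steps q))) qs)"
  unfolding inj_mult'[OF Y fp fqs] using Comp_assoc[OF t5(1) t3(1) t4(1)] t3(2,3) t4(2) t5(2) by simp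
 finally show ?thesis unfolding c glue_map[OF qs pathsD(2)[OF p]] .
qed

text \<open>On the summand of \<open>(p, qs)\<close> both composites end in the coprojection of the
  image of \<open>glue p qs\<close>, preceded by the two sides of the multitensor law for the arrows
  of \<open>f\<close> along the pieces \<open>qs\<close>.\<close>

lemma mult_natural_iff:
 "(\<forall>f\<in>vgmaps U V. Comp Gr (TA f) (MMult T (GDom f)) = Comp Gr (MMult T (GCod f)) (TA (TA f))) \<longleftrightarrow>
  (\<forall>fss\<in>lists (lists (Arr V)). EA (concat fss) ** ESubst E (map (map (Dom V)) fss) =
   ESubst E (map (map (Cod V)) fss) ** EA (map EA fss))" (is "?T \<longleftrightarrow> ?E")
proof
 assume E: ?E
 show ?T
 proof
  fix f assume f: "f \<in> vgmaps U V"
  note F = vgmap_facts[OF f]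
  show "Comp Gr (TA f) (MMult T (GDom f)) = Comp Gr (MMult T (GCod f)) (TA (TA f))"
  proof (rule vgmap_eqI[where X = "TO (TO (GDom f))"])
   fix a b assume "a \<in> Vert (TO (TO (GDom f)))" "b \<in> Vert (TO (TO (GDom f)))"
   then have ab: "a \<in> Vert (GDom f)" "b \<in> Vert (GDom f)" using T_Vert F(1) by simp_all
   note t1 = TA_facts[OF f ab] and t2 = mult_facts[OF F(1) ab] and t3 = mult_facts[OF F(2) F(3)[OF ab(1)] F(3)[OF ab(2)]]
   have t4: "HMap (TA (TA f)) (a, b) \<in> Arr V" "Dom V (HMap (TA (TA f)) (a, b)) = VHom (TO (TO (GDom f))) (a, b)"
    "Cod V (HMap (TA (TA f)) (a, b)) = VHom (TO (TO (GCod f))) (OMap f a, OMap f b)"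
    using TA_facts[OF TA_vgmap(1)[OF f], of a b] TA_vgmap[OF f] T_OMap[OF f] T_Vert[OF F(1)] ab by simp_all
   have "HMap (TA f) (a, b) ** HMap (MMult T (GDom f)) (a, b) =
     HMap (MMult T (GCod f)) (OMap f a, OMap f b) ** HMap (TA (TA f)) (a, b)"
   proof (rule coproduct_eqI[OF TTO_coproduct[OF F(1) ab]])
    fix t assume "t \<in> Sigma (paths (Vert (GDom f)) a b) (refinements (Vert (GDom f)))"
    then obtain p qs where t: "t = (p, qs)" and p: "p \<in> paths (Vert (GDom f)) a b"
     and qs: "qs \<in> refinements (Vert (GDom f)) p" by auto
    have q: "q \<in> lists (Vert (GDom f))" if "q \<in> set qs" for q using refinements_lists[OF qs] that by auto
    define fss where "fss = map (\<lambda>q. map (HMap f) (steps q)) qs"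
    have fA: "fss \<in> lists (lists (Arr V))"
    proof (rule in_listsI, rule ballI)
     fix fs assume "fs \<in> set fss"
     then obtain q' where "q' \<in> set qs" "fs = map (HMap f) (steps q')" by (auto simp: fss_def)
     then show "fs \<in> lists (Arr V)" using map_HMap_facts(1)[OF f q] by simp
    qed
    have D: "map (map (Dom V)) fss = map (lab (GDom f)) qs"
     using map_HMap_facts(2)[OF f q] by (simp add: fss_def)
    have C: "map (map (Cod V)) fss = map (\<lambda>q. map (Cod V) (map (HMap f) (steps q))) qs"
     "map EA fss = map (\<lambda>q. EA (map (HMap f) (steps q))) qs"
     by (simp_all add: fss_def)
    have e: "EA (concat fss) ** ESubst E (map (lab (GDom f)) qs) =
      ESubst E (map (\<lambda>q. map (Cod V) (map (HMap f) (steps q))) qs) ** EA (map (\<lambda>q. EA (map (HMap f) (steps q))) qs)"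
     using bspec[OF E fA] unfolding D C .
    note i = inj2_facts[OF F(1) p qs]
    have "(HMap (TA f) (a, b) ** HMap (MMult T (GDom f)) (a, b)) ** inj2 (GDom f) (p, qs) =
      HMap (TA f) (a, b) ** HMap (MMult T (GDom f)) (a, b) ** inj2 (GDom f) (p, qs)"
     by (rule Comp_assoc) (simp_all only: t1 t2 i)
    also have "\<dots> = HMap (MMult T (GCod f)) (OMap f a, OMap f b) ** HMap (TA (TA f)) (a, b) ** inj2 (GDom f) (p, qs)"
     unfolding mult_natural_left[OF f p qs] mult_natural_right[OF f p qs] e[unfolded fss_def] ..
    also have "\<dots> = (HMap (MMult T (GCod f)) (OMap f a, OMap f b) ** HMap (TA (TA f)) (a, b)) ** inj2 (GDom f) (p, qs)"
     by (rule Comp_assoc[symmetric]) (simp_all only: t3 t4 i)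
    finally show "(HMap (TA f) (a, b) ** HMap (MMult T (GDom f)) (a, b)) **
      (case t of (p, qs) \<Rightarrow> inj (TO (GDom f)) p ** EA (map (inj (GDom f)) qs)) =
     (HMap (MMult T (GCod f)) (OMap f a, OMap f b) ** HMap (TA (TA f)) (a, b)) **
      (case t of (p, qs) \<Rightarrow> inj (TO (GDom f)) p ** EA (map (inj (GDom f)) qs))"
     unfolding t by (simp only: prod.case fst_conv snd_conv)
   qed (use t1 t2 t3 t4 in auto)
   then show "HMap (Comp Gr (TA f) (MMult T (GDom f))) (a, b) = HMap (Comp Gr (MMult T (GCod f)) (TA (TA f))) (a, b)"
    using ab T_mult[OF F(1)] TA_vgmap[OF f] TA_vgmap[OF TA_vgmap(1)[OF f]] T_Vert F(1) T_OMap[OF f] T_OMap[OF TA_vgmap(1)[OF f]]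
    by simp
  qed (use f F T_mult TA_vgmap T_OMap T_Vert in \<open>auto intro!: Comp_vgmap\<close>)
 qed
next
 assume T: ?T
 show ?E
 proof
  fix fss assume fss: "fss \<in> lists (lists (Arr V))"
  let ?fs = "concat fss"
  have l: "?fs \<in> lists (Arr V)" using fss by (auto simp: in_lists_conv_set)
  note g = grf[OF l]
  let ?f = "grf ?fs" and ?X = "gr (map (Dom V) ?fs)" and ?r = "std (length ?fs)"
  note F = vgmap_facts[OF g(1)]
  have X: "?X \<in> vgraphs U V" "gr (map (Cod V) ?fs) \<in> vgraphs U V" using F(1,2) g(2,3) by simp_all
  have r: "?r \<in> lists (Vert ?X)" using std_lists[of "map (Dom V) ?fs"] by simp
  \<comment> \<open>A given \<open>fss\<close> is realised along the standard path for
    \<open>concat fss\<close>, cut into pieces as long as the members of \<open>fss\<close>.\<close>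
  obtain p qs where p: "p \<in> paths (Vert ?X) (hd ?r) (last ?r)" and qs: "qs \<in> refinements (Vert ?X) p"
   and gl: "glue p qs = ?r" and len: "map (\<lambda>q. length q - 1) qs = map length fss"
   by (rule path_split[OF r std_nonempty, of "map length fss"]) (simp_all add: length_concat)
  let ?a = "hd ?r" and ?b = "last ?r"
  have ab: "?a \<in> Vert (GDom ?f)" "?b \<in> Vert (GDom ?f)" using pathsD(5,6)[OF p] g(2) by simp_all
  have o: "OMap ?f ?a = ?a" "OMap ?f ?b = ?b" using g(4) by simp_all
  have pq: "p \<in> paths (Vert (GDom ?f)) ?a ?b" "qs \<in> refinements (Vert (GDom ?f)) p" using p qs g(2) by simp_all
  have q: "q \<in> lists (Vert (GDom ?f))" if "q \<in> set qs" for q using refinements_lists[OF pq(2)] that by auto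
  have "concat (map (\<lambda>q. map (HMap ?f) (steps q)) qs) = map (HMap ?f) (steps ?r)"
   using steps_glue[OF qs pathsD(2)[OF p]] unfolding gl by (simp add: map_concat comp_def)
  then have fs: "map (\<lambda>q. map (HMap ?f) (steps q)) qs = fss"
   using g(5) len by (intro concat_eq_lengths) (simp_all add: comp_def)
  let ?fss = "map (\<lambda>q. map (HMap ?f) (steps q)) qs"
  have "map (lab (GDom ?f)) qs = map (map (Dom V)) ?fss" using map_HMap_facts(2)[OF g(1) q] by simp
  then have D: "map (lab (GDom ?f)) qs = map (map (Dom V)) fss" unfolding fs .
  have "map (\<lambda>q. map (Cod V) (map (HMap ?f) (steps q))) qs = map (map (Cod V)) ?fss"
   "map (\<lambda>q. EA (map (HMap ?f) (steps q))) qs = map EA ?fss" by simp_all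
  then have C: "map (\<lambda>q. map (Cod V) (map (HMap ?f) (steps q))) qs = map (map (Cod V)) fss"
   "map (\<lambda>q. EA (map (HMap ?f) (steps q))) qs = map EA fss" unfolding fs .
  note t1 = TA_facts[OF g(1) ab] and t2 = mult_facts[OF F(1) ab] and t3 = mult_facts[OF F(2) F(3)[OF ab(1)] F(3)[OF ab(2)]]
   and i = inj2_facts[OF F(1) pq]
  have t4: "HMap (TA (TA ?f)) (?a, ?b) \<in> Arr V" "Dom V (HMap (TA (TA ?f)) (?a, ?b)) = VHom (TO (TO (GDom ?f))) (?a, ?b)"
    "Cod V (HMap (TA (TA ?f)) (?a, ?b)) = VHom (TO (TO (GCod ?f))) (OMap ?f ?a, OMap ?f ?b)"
   using TA_facts[OF TA_vgmap(1)[OF g(1)], of ?a ?b] TA_vgmap[OF g(1)] T_OMap[OF g(1)] T_Vert[OF F(1)] ab by simp_all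
  have "HMap (Comp Gr (TA ?f) (MMult T (GDom ?f))) (?a, ?b) = HMap (Comp Gr (MMult T (GCod ?f)) (TA (TA ?f))) (?a, ?b)"
   using bspec[OF T g(1)] by (simp only:)
  then have m: "HMap (TA ?f) (?a, ?b) ** HMap (MMult T (GDom ?f)) (?a, ?b) =
    HMap (MMult T (GCod ?f)) (OMap ?f ?a, OMap ?f ?b) ** HMap (TA (TA ?f)) (?a, ?b)"
   using ab T_mult[OF F(1)] TA_vgmap[OF g(1)] TA_vgmap[OF TA_vgmap(1)[OF g(1)]] T_Vert F(1) T_OMap[OF g(1)]
    T_OMap[OF TA_vgmap(1)[OF g(1)]] by simp
  have "HMap (TA ?f) (?a, ?b) ** HMap (MMult T (GDom ?f)) (?a, ?b) ** inj2 (GDom ?f) (p, qs) =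
    (HMap (TA ?f) (?a, ?b) ** HMap (MMult T (GDom ?f)) (?a, ?b)) ** inj2 (GDom ?f) (p, qs)"
   by (rule Comp_assoc[symmetric]) (simp_all only: t1 t2 i)
  also have "\<dots> = HMap (MMult T (GCod ?f)) (OMap ?f ?a, OMap ?f ?b) ** HMap (TA (TA ?f)) (?a, ?b) ** inj2 (GDom ?f) (p, qs)"
   unfolding m by (rule Comp_assoc) (simp_all only: t3 t4 i)
  finally have e: "inj (gr (map (Cod V) ?fs)) ?r ** EA ?fs ** ESubst E (map (map (Dom V)) fss) =
    inj (gr (map (Cod V) ?fs)) ?r ** ESubst E (map (map (Cod V)) fss) ** EA (map EA fss)"
   unfolding mult_natural_left[OF g(1) pq] mult_natural_right[OF g(1) pq]
   unfolding gl fs D C g(3) grf_path[OF l r] .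
  have rp: "?r \<in> paths (Vert (gr (map (Cod V) ?fs))) (node 0) (node (length ?fs))"
   using std_paths[of "map (Cod V) ?fs"] by simp
  have lr: "lab (gr (map (Cod V) ?fs)) ?r = map (Cod V) ?fs" using map_VHom_gr[of "map (Cod V) ?fs"] by simp
  have fA: "fs \<in> lists (Arr V)" if "fs \<in> set fss" for fs using fss that by auto
  have zD: "z \<in> lists (Obj V)" if "z \<in> set (map (map (Dom V)) fss)" for z using that Dom_lists[OF fA] by auto
  have zC: "z \<in> lists (Obj V)" if "z \<in> set (map (map (Cod V)) fss)" for z using that Cod_lists[OF fA] by auto
  have s1: "ESubst E (map (map (Dom V)) fss) \<in> Arr V" "Dom V (ESubst E (map (map (Dom V)) fss)) = EO (map EO (map (map (Dom V)) fss))"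
   "Cod V (ESubst E (map (map (Dom V)) fss)) = EO (map (Dom V) ?fs)"
   using E_subst_facts[of "map (map (Dom V)) fss", OF zD] by (simp_all add: map_concat)
  have s2: "ESubst E (map (map (Cod V)) fss) \<in> Arr V" "Dom V (ESubst E (map (map (Cod V)) fss)) = EO (map EO (map (map (Cod V)) fss))"
   "Cod V (ESubst E (map (map (Cod V)) fss)) = EO (map (Cod V) ?fs)"
   using E_subst_facts[of "map (map (Cod V)) fss", OF zC] by (simp_all add: map_concat)
  have s3: "EA (map EA fss) \<in> Arr V" "Dom V (EA (map EA fss)) = EO (map EO (map (map (Dom V)) fss))"
   "Cod V (EA (map EA fss)) = EO (map EO (map (map (Cod V)) fss))"
   using EA_map_Arr[of fss EA] EA_Arr[OF fA] by (simp_all add: comp_def cong: map_cong)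
  show "EA ?fs ** ESubst E (map (map (Dom V)) fss) = ESubst E (map (map (Cod V)) fss) ** EA (map EA fss)"
   by (rule mono_arrD[OF inj_mono[OF X(2) rp] e])
    (simp_all only: Comp_Arr Dom_Comp Cod_Comp EA_Arr[OF l] s1 s2 s3 inj_facts[OF X(2) rp] lr)
 qed
qed

section \<open>Unit laws\<close>

lemma EA_unit_facts:
 assumes "Z \<in> lists (Obj V)"
 shows "EA (map (EUnit E) Z) \<in> Arr V" "Dom V (EA (map (EUnit E) Z)) = EO Z"
  "Cod V (EA (map (EUnit E) Z)) = EO (map EO (map (\<lambda>z. [z]) Z))"
proof -
 have *: "EUnit E z \<in> Arr V" "Dom V (EUnit E z) = z" "Cod V (EUnit E z) = EO [z]" if "z \<in> set Z" for z
  using E_unit_facts[of z] assms that by auto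
 show "EA (map (EUnit E) Z) \<in> Arr V" "Dom V (EA (map (EUnit E) Z)) = EO Z"
  "Cod V (EA (map (EUnit E) Z)) = EO (map EO (map (\<lambda>z. [z]) Z))"
  using EA_map_Arr[of Z "EUnit E"] * by (simp_all add: comp_def cong: map_cong)
qed

text \<open>The unit at \<open>TO X\<close> has to be moved past \<open>inj X q\<close>, which is an
  instance of \<open>nat\<close>. After that \<open>q\<close> appears as the only piece of the
  one-step path \<open>[a, b]\<close>, and gluing returns \<open>q\<close>.\<close>

lemma unit_law_left:
 assumes X: "X \<in> vgraphs U V" and q: "q \<in> paths (Vert X) a b"
  and nat: "\<And>f. f \<in> Arr V \<Longrightarrow> EA [f] ** EUnit E (Dom V f) = EUnit E (Cod V f) ** f"
 shows "(HMap (MMult T X) (a, b) ** HMap (MUnit T (TO X)) (a, b)) ** inj X q =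
  inj X q ** ESubst E [lab X q] ** EUnit E (EO (lab X q))"
proof -
 have ab: "a \<in> Vert X" "b \<in> Vert X" using pathsD[OF q] by auto
 have abT: "a \<in> Vert (TO X)" "b \<in> Vert (TO X)" using ab T_Vert[OF X] by auto
 have p: "[a, b] \<in> paths (Vert X) a b" using ab by simp
 have pT: "[a, b] \<in> paths (Vert (TO X)) a b" using abT by simp
 note qs = refinements_pair[OF q] and i = inj_facts[OF X q] and iT = inj_facts[OF TO_vgraph[OF X] pT]
  and m = mult_facts[OF X ab] and u = E_unit_facts[OF vgraph_facts(2)[OF TO_vgraph[OF X] abT]]
 note s = subst_lab_facts[OF X qs]
 have lO: "EO (lab X q) \<in> Obj V" by (rule EO_Obj[OF lab_lists[OF X pathsD(1)[OF q]]])
 note u' = E_unit_facts[OF lO] and e = EA_inj_facts[OF X qs]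
 have "(HMap (MMult T X) (a, b) ** HMap (MUnit T (TO X)) (a, b)) ** inj X q =
   HMap (MMult T X) (a, b) ** inj (TO X) [a, b] ** EUnit E (VHom (TO X) (a, b)) ** inj X q"
  unfolding inj_unit[OF TO_vgraph[OF X] abT] using i iT m u by simp
 also have "EUnit E (VHom (TO X) (a, b)) ** inj X q = EA [inj X q] ** EUnit E (EO (lab X q))"
  using nat[OF i(1)] i by simp
 also have "HMap (MMult T X) (a, b) ** inj (TO X) [a, b] ** EA [inj X q] ** EUnit E (EO (lab X q)) =
   (HMap (MMult T X) (a, b) ** inj2 X ([a, b], [q])) ** EUnit E (EO (lab X q))"
  using m iT e u' by simp
 also have "\<dots> = inj X q ** ESubst E [lab X q] ** EUnit E (EO (lab X q))"
  unfolding inj_mult'[OF X p qs] glue_pair[OF q] using i s u' by simp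
 finally show ?thesis .
qed

text \<open>\<open>TA (MUnit T X)\<close> sends the summand of \<open>p\<close> to the summand in
  which every step of \<open>p\<close> is refined by itself; gluing returns
  \<open>p\<close>.\<close>

lemma unit_law_right:
 assumes X: "X \<in> vgraphs U V" and p: "p \<in> paths (Vert X) a b"
 shows "(HMap (MMult T X) (a, b) ** HMap (TA (MUnit T X)) (a, b)) ** inj X p =
  inj X p ** ESubst E (map (\<lambda>z. [z]) (lab X p)) ** EA (map (EUnit E) (lab X p))"
proof -
 let ?qs = "map (\<lambda>(x, y). [x, y]) (steps p)"
 have ab: "a \<in> Vert X" "b \<in> Vert X" using pathsD[OF p] by auto
 note qs = refinements_steps[OF pathsD(1)[OF p]]
 have U: "MUnit T X \<in> vgmaps U V" "GDom (MUnit T X) = X" "GCod (MUnit T X) = TO X" "OMap (MUnit T X) = (\<lambda>a\<in>Vert X. a)"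
  using T_unit[OF X] by auto
 have idp: "map (OMap (MUnit T X)) p = p" by (rule map_idI) (use U(4) pathsD(1)[OF p] in auto)
 have pT: "p \<in> paths (Vert (TO X)) a b" using p T_Vert[OF X] by simp
 note i = inj_facts[OF X p] and iT = inj_facts[OF TO_vgraph[OF X] pT] and m = mult_facts[OF X ab]
  and t = TA_facts[OF U(1), unfolded U(2,3), OF ab] and h = EA_HMap_facts[OF U(1), unfolded U(2,3), OF pathsD(1)[OF p], unfolded idp]
  and e = EA_inj_facts[OF X qs] and s = subst_lab_facts[OF X qs] and ig = inj_glue_facts[OF X p qs]
 have lq: "map (lab X) ?qs = map (\<lambda>z. [z]) (lab X p)" by (simp add: split_beta')
 have st: "fst x \<in> Vert X \<and> snd x \<in> Vert X" if "x \<in> set (steps p)" for x using steps_mem[OF pathsD(1)[OF p] that] .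
 have uO: "VHom X x \<in> Obj V" if "x \<in> set (steps p)" for x using st[OF that] vgraph_facts(2)[OF X, of "fst x" "snd x"] by simp
 have u: "EA (map (EUnit E) (lab X p)) \<in> Arr V" "Cod V (EA (map (EUnit E) (lab X p))) = EO (map EO (map (lab X) ?qs))"
  using EA_unit_facts[OF lab_lists[OF X pathsD(1)[OF p]]] unfolding lq by blast+
 have "EA (map (HMap (MUnit T X)) (steps p)) = EA (map (\<lambda>x. inj X [fst x, snd x] ** EUnit E (VHom X x)) (steps p))"
  using inj_unit[OF X] st by (intro arg_cong[of _ _ EA] map_cong) (auto simp: prod_eq_iff split: prod.splits)
 also have "\<dots> = EA (map (\<lambda>x. inj X [fst x, snd x]) (steps p)) ** EA (map (\<lambda>x. EUnit E (VHom X x)) (steps p))"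
 proof (rule EA_Comp_map[symmetric])
  fix x assume x: "x \<in> set (steps p)"
  have "[fst x, snd x] \<in> paths (Vert X) (fst x) (snd x)" using st[OF x] by simp
  from inj_facts[OF X this] E_unit_facts[OF uO[OF x]]
  show "EUnit E (VHom X x) \<in> Arr V \<and> inj X [fst x, snd x] \<in> Arr V \<and>
   Dom V (inj X [fst x, snd x]) = Cod V (EUnit E (VHom X x))" by simp
 qed
 finally have H: "EA (map (HMap (MUnit T X)) (steps p)) = EA (map (inj X) ?qs) ** EA (map (EUnit E) (lab X p))"
  by (simp add: comp_def split_beta')
 have "(HMap (MMult T X) (a, b) ** HMap (TA (MUnit T X)) (a, b)) ** inj X p =
   HMap (MMult T X) (a, b) ** HMap (TA (MUnit T X)) (a, b) ** inj X p"
  using m t i U ab by simp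
 also have "HMap (TA (MUnit T X)) (a, b) ** inj X p = inj (TO X) p ** EA (map (HMap (MUnit T X)) (steps p))"
  using inj_natural'[OF U(1), unfolded U(2,3), OF p] idp by simp
 also have "HMap (MMult T X) (a, b) ** \<dots> = (HMap (MMult T X) (a, b) ** inj2 X (p, ?qs)) ** EA (map (EUnit E) (lab X p))"
  unfolding H fst_conv snd_conv by (simp only: Comp_assoc Comp_Arr Dom_Comp Cod_Comp m iT e u)
 also have "\<dots> = inj X p ** ESubst E (map (\<lambda>z. [z]) (lab X p)) ** EA (map (EUnit E) (lab X p))"
  unfolding inj_mult'[OF X p qs]
  unfolding Comp_assoc[OF u(1) s(1) ig(1), unfolded s(2,3) ig(2) u(2), OF refl refl]
  unfolding glue_steps[OF pathsD(2)[OF p]] lq ..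
 finally show ?thesis .
qed

lemma unit_law_left_iff:
 assumes nat: "\<forall>f\<in>Arr V. EA [f] ** EUnit E (Dom V f) = EUnit E (Cod V f) ** f"
 shows "(\<forall>X\<in>vgraphs U V. Comp Gr (MMult T X) (MUnit T (TO X)) = Ident Gr (TO X)) \<longleftrightarrow>
  (\<forall>Z\<in>lists (Obj V). ESubst E [Z] ** EUnit E (EO Z) = Ident V (EO Z))" (is "?T \<longleftrightarrow> ?E")
proof
 assume E: ?E
 show ?T
 proof
  fix X assume X: "X \<in> vgraphs U V"
  show "Comp Gr (MMult T X) (MUnit T (TO X)) = Ident Gr (TO X)"
  proof (rule vgmap_eqI[where X = "TO X"])
   fix a b assume abT: "a \<in> Vert (TO X)" "b \<in> Vert (TO X)"
   then have ab: "a \<in> Vert X" "b \<in> Vert X" using T_Vert[OF X] by auto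
   have "HMap (MMult T X) (a, b) ** HMap (MUnit T (TO X)) (a, b) = Ident V (VHom (TO X) (a, b))"
   proof (rule coproduct_eqI[OF inj_coproduct[OF X ab]])
    fix q assume q: "q \<in> paths (Vert X) a b"
    have "ESubst E [lab X q] ** EUnit E (EO (lab X q)) = Ident V (EO (lab X q))"
     using E lab_lists[OF X pathsD(1)[OF q]] by blast
    then show "(HMap (MMult T X) (a, b) ** HMap (MUnit T (TO X)) (a, b)) ** inj X q =
      Ident V (VHom (TO X) (a, b)) ** inj X q"
     using unit_law_left[OF X q bspec[OF nat]] inj_facts[OF X q] by simp
   qed (use mult_facts[OF X ab] unit_facts[OF TO_vgraph[OF X] abT] vgraph_facts(2)[OF TO_vgraph[OF X] abT] in auto)
   then show "HMap (Comp Gr (MMult T X) (MUnit T (TO X))) (a, b) = HMap (Ident Gr (TO X)) (a, b)"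
    using abT T_unit[OF TO_vgraph[OF X]] by simp
  qed (use X T_mult[OF X] T_unit[OF TO_vgraph[OF X]] T_Vert in \<open>auto intro!: Comp_vgmap Ident_vgmap\<close>)
 qed
next
 assume T: ?T
 show ?E
 proof
  fix Z assume Z: "Z \<in> lists (Obj V)"
  let ?X = "gr Z" and ?a = "node 0" and ?b = "node (length Z)" and ?r = "std (length Z)"
  note X = gr_vgraph[OF Z] and r = std_paths[of Z] and ZO = EO_Obj[OF Z]
  have ab: "?a \<in> Vert (TO ?X)" "?b \<in> Vert (TO ?X)" using T_Vert[OF X] by auto
  have "HMap (Comp Gr (MMult T ?X) (MUnit T (TO ?X))) (?a, ?b) = HMap (Ident Gr (TO ?X)) (?a, ?b)"
   using bspec[OF T X] by simp
  then have m: "HMap (MMult T ?X) (?a, ?b) ** HMap (MUnit T (TO ?X)) (?a, ?b) = Ident V (VHom (TO ?X) (?a, ?b))"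
   using ab T_unit[OF TO_vgraph[OF X]] by simp
  have e: "inj ?X ?r ** ESubst E [Z] ** EUnit E (EO Z) = inj ?X ?r ** Ident V (EO Z)"
   using unit_law_left[OF X r bspec[OF nat]] inj_facts[OF X r] unfolding m by simp
  show "ESubst E [Z] ** EUnit E (EO Z) = Ident V (EO Z)"
   by (rule mono_arrD[OF inj_mono[OF X r] e])
    (use E_subst_facts[of "[Z]"] Z E_unit_facts[OF ZO] ZO inj_facts[OF X r] in auto)
 qed
qed

lemma unit_law_right_iff:
 "(\<forall>X\<in>vgraphs U V. Comp Gr (MMult T X) (TA (MUnit T X)) = Ident Gr (TO X)) \<longleftrightarrow>
  (\<forall>Z\<in>lists (Obj V). ESubst E (map (\<lambda>z. [z]) Z) ** EA (map (EUnit E) Z) = Ident V (EO Z))" (is "?T \<longleftrightarrow> ?E")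
proof
 assume E: ?E
 show ?T
 proof
  fix X assume X: "X \<in> vgraphs U V"
  have U: "MUnit T X \<in> vgmaps U V" "GDom (MUnit T X) = X" "GCod (MUnit T X) = TO X" "OMap (MUnit T X) = (\<lambda>a\<in>Vert X. a)"
   using T_unit[OF X] by auto
  note UA = TA_vgmap[OF U(1), unfolded U(2,3)]
  show "Comp Gr (MMult T X) (TA (MUnit T X)) = Ident Gr (TO X)"
  proof (rule vgmap_eqI[where X = "TO X"])
   fix a b assume abT: "a \<in> Vert (TO X)" "b \<in> Vert (TO X)"
   then have ab: "a \<in> Vert X" "b \<in> Vert X" using T_Vert[OF X] by auto
   have "HMap (MMult T X) (a, b) ** HMap (TA (MUnit T X)) (a, b) = Ident V (VHom (TO X) (a, b))"
   proof (rule coproduct_eqI[OF inj_coproduct[OF X ab]])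
    fix q assume q: "q \<in> paths (Vert X) a b"
    have "ESubst E (map (\<lambda>z. [z]) (lab X q)) ** EA (map (EUnit E) (lab X q)) = Ident V (EO (lab X q))"
     using E lab_lists[OF X pathsD(1)[OF q]] by blast
    then show "(HMap (MMult T X) (a, b) ** HMap (TA (MUnit T X)) (a, b)) ** inj X q =
      Ident V (VHom (TO X) (a, b)) ** inj X q"
     using unit_law_right[OF X q] inj_facts[OF X q] by simp
   qed (use mult_facts[OF X ab] TA_facts[OF U(1), unfolded U(2,3), OF ab] U(4) ab vgraph_facts(2)[OF TO_vgraph[OF X] abT] in auto)
   then show "HMap (Comp Gr (MMult T X) (TA (MUnit T X))) (a, b) = HMap (Ident Gr (TO X)) (a, b)"
    using abT ab UA T_OMap[OF U(1)] U(4) by simp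
  qed (use X T_mult[OF X] UA U(4) T_OMap[OF U(1)] T_Vert in \<open>auto intro!: Comp_vgmap Ident_vgmap\<close>)
 qed
next
 assume T: ?T
 show ?E
 proof
  fix Z assume Z: "Z \<in> lists (Obj V)"
  let ?X = "gr Z" and ?a = "node 0" and ?b = "node (length Z)" and ?r = "std (length Z)"
  note X = gr_vgraph[OF Z] and r = std_paths[of Z] and ZO = EO_Obj[OF Z]
  have U: "MUnit T ?X \<in> vgmaps U V" "GDom (MUnit T ?X) = ?X" "GCod (MUnit T ?X) = TO ?X" "OMap (MUnit T ?X) = (\<lambda>a\<in>Vert ?X. a)"
   using T_unit[OF X] by auto
  note UA = TA_vgmap[OF U(1), unfolded U(2,3)]
  have ab: "?a \<in> Vert (TO ?X)" "?b \<in> Vert (TO ?X)" using T_Vert[OF X] by auto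
  have "HMap (Comp Gr (MMult T ?X) (TA (MUnit T ?X))) (?a, ?b) = HMap (Ident Gr (TO ?X)) (?a, ?b)"
   using bspec[OF T X] by simp
  then have m: "HMap (MMult T ?X) (?a, ?b) ** HMap (TA (MUnit T ?X)) (?a, ?b) = Ident V (VHom (TO ?X) (?a, ?b))"
   using ab UA T_OMap[OF U(1)] U(4) by simp
  have e: "inj ?X ?r ** ESubst E (map (\<lambda>z. [z]) Z) ** EA (map (EUnit E) Z) = inj ?X ?r ** Ident V (EO Z)"
   using unit_law_right[OF X r] inj_facts[OF X r] unfolding m by simp
  have s: "ESubst E (map (\<lambda>z. [z]) Z) \<in> Arr V" "Dom V (ESubst E (map (\<lambda>z. [z]) Z)) = EO (map EO (map (\<lambda>z. [z]) Z))"
   "Cod V (ESubst E (map (\<lambda>z. [z]) Z)) = EO Z"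
  proof -
   have z: "z \<in> lists (Obj V)" if "z \<in> set (map (\<lambda>z. [z]) Z)" for z using Z that by auto
   show "ESubst E (map (\<lambda>z. [z]) Z) \<in> Arr V" "Dom V (ESubst E (map (\<lambda>z. [z]) Z)) = EO (map EO (map (\<lambda>z. [z]) Z))"
    "Cod V (ESubst E (map (\<lambda>z. [z]) Z)) = EO Z"
    using E_subst_facts[of "map (\<lambda>z. [z]) Z", OF z] by simp_all
  qed
  show "ESubst E (map (\<lambda>z. [z]) Z) ** EA (map (EUnit E) Z) = Ident V (EO Z)"
   by (rule mono_arrD[OF inj_mono[OF X r] e])
    (use s EA_unit_facts[OF Z] ZO inj_facts[OF X r] in \<open>auto simp del: map_map\<close>)
 qed
qed

section \<open>Associativity\<close>

lemma refinements2_facts: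
 assumes "ts \<in> refinements2 S p" "t \<in> set ts"
 shows "fst t \<in> paths S (hd (fst t)) (last (fst t))" "snd t \<in> refinements S (fst t)"
 using assms refinements_paths[of "map fst ts" S p "fst t"] by (auto simp: refinements2_iff)

lemma refinements2_glue:
 assumes "ts \<in> refinements2 S p" "p \<noteq> []"
 shows "glue p (map (\<lambda>t. glue (fst t) (snd t)) ts) = glue (glue p (map fst ts)) (concat (map snd ts))"
  and "concat (map snd ts) \<in> refinements S (glue p (map fst ts))"
  and "map (\<lambda>t. glue (fst t) (snd t)) ts \<in> refinements S p"
 using glue_glue[of ts S p] assms unfolding refinements2_iff split_beta' by force+

lemma inj3_facts:
 assumes X: "X \<in> vgraphs U V" and p: "p \<in> paths (Vert X) a b" and ts: "ts \<in> refinements2 (Vert X) p"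
 shows "EA (map (inj2 X) ts) \<in> Arr V" "Cod V (EA (map (inj2 X) ts)) = EO (lab (TO (TO X)) p)"
  "inj (TO (TO X)) p \<in> Arr V" "Dom V (inj (TO (TO X)) p) = EO (lab (TO (TO X)) p)"
  "Cod V (inj (TO (TO X)) p) = VHom (TO (TO (TO X))) (a, b)"
proof -
 note t = refinements2_facts[OF ts]
 have i: "inj2 X t \<in> Arr V" "Cod V (inj2 X t) = VHom (TO (TO X)) (hd (fst t), last (fst t))" if "t \<in> set ts" for t
  using inj2_facts[OF X t[OF that]] by simp_all
 have "map (\<lambda>q. (hd q, last q)) (map fst ts) = steps p"
  using ts refinements_ends[of "map fst ts" "Vert X" p] unfolding refinements2_iff by blast
 then have "map (\<lambda>t. Cod V (inj2 X t)) ts = lab (TO (TO X)) p"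
  using i(2) by (auto simp: comp_def dest: sym)
 then show "EA (map (inj2 X) ts) \<in> Arr V" "Cod V (EA (map (inj2 X) ts)) = EO (lab (TO (TO X)) p)"
  using EA_map_Arr[of ts "inj2 X", OF i(1)] by (simp_all del: map_eq_conv)
 show "inj (TO (TO X)) p \<in> Arr V" "Dom V (inj (TO (TO X)) p) = EO (lab (TO (TO X)) p)"
  "Cod V (inj (TO (TO X)) p) = VHom (TO (TO (TO X))) (a, b)"
  using inj_facts[OF TO_vgraph[OF TO_vgraph[OF X]], of p a b] T_Vert X p by simp_all
qed

text \<open>The multiplication at \<open>TO X\<close> joins the two outer levels. Naturality of the
  substitution, \<open>nat\<close>, carries the resulting substitution past the coprojections of the
  innermost level, and the multiplication at \<open>X\<close> then meets the flattened
  refinement.\<close>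

lemma assoc_left:
 assumes X: "X \<in> vgraphs U V" and p: "p \<in> paths (Vert X) a b" and ts: "ts \<in> refinements2 (Vert X) p"
  and nat: "\<forall>fss\<in>lists (lists (Arr V)). EA (concat fss) ** ESubst E (map (map (Dom V)) fss) =
   ESubst E (map (map (Cod V)) fss) ** EA (map EA fss)"
 defines "Z \<equiv> map (\<lambda>t. map (lab X) (snd t)) ts"
 shows "HMap (MMult T X) (a, b) ** HMap (MMult T (TO X)) (a, b) ** inj (TO (TO X)) p ** EA (map (inj2 X) ts) =
  inj X (glue p (map (\<lambda>t. glue (fst t) (snd t)) ts)) ** ESubst E (concat Z) ** ESubst E (map (map EO) Z)"
proof -
 let ?qs = "map fst ts" and ?rss = "map snd ts"
 define fss where "fss = map (\<lambda>t. map (inj X) (snd t)) ts"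
 note t = refinements2_facts[OF ts] and XT = TO_vgraph[OF X]
 have ab: "a \<in> Vert X" "b \<in> Vert X" using pathsD[OF p] by auto
 have abT: "a \<in> Vert (TO X)" "b \<in> Vert (TO X)" using ab T_Vert[OF X] by auto
 have qs: "?qs \<in> refinements (Vert X) p" using ts by (simp add: refinements2_iff)
 have pT: "p \<in> paths (Vert (TO X)) a b" and qsT: "?qs \<in> refinements (Vert (TO X)) p" using p qs T_Vert[OF X] by auto
 note rs = refinements2_glue(2)[OF ts pathsD(2)[OF p]] and g = glue_paths[OF p qs]
 have fssA: "fss \<in> lists (lists (Arr V))"
 proof (rule in_listsI, rule ballI)
  fix fs assume "fs \<in> set fss"
  then obtain t' where "t' \<in> set ts" "fs = map (inj X) (snd t')" by (auto simp: fss_def)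
  then show "fs \<in> lists (Arr V)" using map_inj_facts(1)[OF X t(2)] by simp
 qed
 have fssD: "map (map (Dom V)) fss = map (map EO) Z"
  using map_inj_facts(2)[OF X t(2)] by (simp add: fss_def Z_def)
 have fssC: "map (map (Cod V)) fss = map (lab (TO X)) ?qs"
  using map_inj_facts(3)[OF X t(2)] by (simp add: fss_def)
 have cfss: "concat fss = map (inj X) (concat ?rss)" by (simp add: fss_def map_concat comp_def)
 have cZ: "map (lab X) (concat ?rss) = concat Z" by (simp add: Z_def map_concat comp_def)
 have "EA (map (inj2 X) ts) = EA (map (\<lambda>t. inj (TO X) (fst t)) ts) ** EA (map (\<lambda>t. EA (map (inj X) (snd t))) ts)"
 proof (rule EA_Comp_map[symmetric])
  fix t' assume t': "t' \<in> set ts"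
  have "fst t' \<in> paths (Vert (TO X)) (hd (fst t')) (last (fst t'))" using t(1)[OF t'] T_Vert[OF X] by simp
  from inj_facts[OF XT this] EA_inj_facts[OF X t(2)[OF t']]
  show "EA (map (inj X) (snd t')) \<in> Arr V \<and> inj (TO X) (fst t') \<in> Arr V \<and>
   Dom V (inj (TO X) (fst t')) = Cod V (EA (map (inj X) (snd t')))" by simp
 qed
 then have s: "EA (map (inj2 X) ts) = EA (map (inj (TO X)) ?qs) ** EA (map EA fss)"
  by (simp add: fss_def comp_def)
 have fA: "EA fs \<in> Arr V" "Dom V (EA fs) = EO (map (Dom V) fs)" "Cod V (EA fs) = EO (map (Cod V) fs)" if "fs \<in> set fss" for fs
  using EA_Arr[of fs] fssA that by auto
 have B: "EA (map EA fss) \<in> Arr V" "Cod V (EA (map EA fss)) = EO (map EO (map (lab (TO X)) ?qs))"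
  unfolding fssC[symmetric] using EA_map_Arr[of fss EA, OF fA(1)] fA(2,3) by (simp_all add: comp_def cong: map_cong)
 note m1 = mult_facts[OF X ab] and m2 = mult_facts[OF XT abT] and i1 = inj2_facts[OF XT pT qsT]
  and ig = inj_glue_facts[OF XT pT qsT] and sb = subst_lab_facts[OF XT qsT] and j = inj3_facts[OF X p ts]
  and e2 = EA_inj_facts[OF XT qsT] and i2 = inj2_facts[OF X g rs] and sb2 = subst_lab_facts[OF X rs]
  and ig2 = inj_glue_facts[OF X g rs] and e3 = EA_inj_facts[OF X rs]
 have sZ: "ESubst E (map (map EO) Z) \<in> Arr V" "Cod V (ESubst E (map (map EO) Z)) = EO (map EO (concat Z))"
 proof -
  have "z \<in> lists (Obj V)" if "z \<in> set (map (map EO) Z)" for z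
   unfolding fssD[symmetric] using that fssA unfolding fssD[symmetric] by (auto simp: in_lists_conv_set)
  from E_subst_facts[of "map (map EO) Z", OF this]
  show "ESubst E (map (map EO) Z) \<in> Arr V" "Cod V (ESubst E (map (map EO) Z)) = EO (map EO (concat Z))"
   by (simp_all add: map_concat)
 qed
 have "HMap (MMult T (TO X)) (a, b) ** inj (TO (TO X)) p ** EA (map (inj2 X) ts) =
   (HMap (MMult T (TO X)) (a, b) ** inj2 (TO X) (p, ?qs)) ** EA (map EA fss)"
  unfolding s fst_conv snd_conv by (simp only: Comp_assoc Comp_Arr Dom_Comp Cod_Comp m2 j e2 B)
 also have "\<dots> = inj (TO X) (glue p ?qs) ** ESubst E (map (lab (TO X)) ?qs) ** EA (map EA fss)"
  unfolding inj_mult'[OF XT pT qsT] by (rule Comp_assoc) (simp_all only: ig sb B)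
 also have "ESubst E (map (lab (TO X)) ?qs) ** EA (map EA fss) = EA (concat fss) ** ESubst E (map (map EO) Z)"
  using bspec[OF nat fssA] unfolding fssD fssC by simp
 finally have "HMap (MMult T X) (a, b) ** HMap (MMult T (TO X)) (a, b) ** inj (TO (TO X)) p ** EA (map (inj2 X) ts) =
   HMap (MMult T X) (a, b) ** inj (TO X) (glue p ?qs) ** EA (map (inj X) (concat ?rss)) ** ESubst E (map (map EO) Z)"
  unfolding cfss by (simp only:)
 also have "\<dots> = (HMap (MMult T X) (a, b) ** inj2 X (glue p ?qs, concat ?rss)) ** ESubst E (map (map EO) Z)"
  unfolding fst_conv snd_conv using lab_glue[OF qsT pathsD(2)[OF pT]]
  by (simp only: Comp_assoc Comp_Arr Dom_Comp Cod_Comp m1 ig e3 sZ cZ)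
 also have "\<dots> = inj X (glue (glue p ?qs) (concat ?rss)) ** ESubst E (map (lab X) (concat ?rss)) ** ESubst E (map (map EO) Z)"
  unfolding inj_mult'[OF X g rs] by (rule Comp_assoc) (simp_all only: ig2[unfolded cZ] sb2[unfolded cZ] sZ cZ)
 finally show ?thesis unfolding cZ refinements2_glue(1)[OF ts pathsD(2)[OF p]] .
qed

text \<open>The two inner levels are joined first, inside \<open>EA\<close>. What brings them there
  is naturality of the coprojections along the map \<open>MMult T X\<close>.\<close>

lemma assoc_right:
 assumes X: "X \<in> vgraphs U V" and p: "p \<in> paths (Vert X) a b" and ts: "ts \<in> refinements2 (Vert X) p"
 defines "Z \<equiv> map (\<lambda>t. map (lab X) (snd t)) ts"
 shows "HMap (MMult T X) (a, b) ** HMap (TA (MMult T X)) (a, b) ** inj (TO (TO X)) p ** EA (map (inj2 X) ts) =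
  inj X (glue p (map (\<lambda>t. glue (fst t) (snd t)) ts)) ** ESubst E (map concat Z) ** EA (map (ESubst E) Z)"
proof -
 let ?gs = "map (\<lambda>t. glue (fst t) (snd t)) ts"
 note t = refinements2_facts[OF ts] and XT = TO_vgraph[OF X]
 have ab: "a \<in> Vert X" "b \<in> Vert X" using pathsD[OF p] by auto
 have M: "MMult T X \<in> vgmaps U V" "GDom (MMult T X) = TO (TO X)" "GCod (MMult T X) = TO X"
  "OMap (MMult T X) = (\<lambda>a\<in>Vert X. a)" using T_mult[OF X] by auto
 have VT: "Vert (TO (TO X)) = Vert X" "Vert (TO X) = Vert X" using T_Vert X by simp_all
 have pT: "p \<in> paths (Vert (TO X)) a b" and pTT: "p \<in> paths (Vert (TO (TO X))) a b" using p VT by auto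
 have idp: "map (OMap (MMult T X)) p = p" by (rule map_idI) (use M(4) pathsD(1)[OF p] in auto)
 note gs = refinements2_glue(3)[OF ts pathsD(2)[OF p]]
 have st: "steps p = map (\<lambda>t. (hd (fst t), last (fst t))) ts"
  using ts refinements_ends[of "map fst ts" "Vert X" p] by (simp add: refinements2_iff comp_def)
 have gl: "map (lab X) ?gs = map concat Z"
  using lab_glue[OF t(2) pathsD(2)[OF t(1)]] by (simp add: Z_def)
 have ts2: "t' = (fst t', snd t')" for t' :: "'i list \<times> 'i list list" by simp
 have sb: "ESubst E z \<in> Arr V" "Cod V (ESubst E z) = EO (concat z)" if "z \<in> set Z" for z
  using subst_lab_facts[OF X t(2)] that by (auto simp: Z_def)
 have S: "EA (map (ESubst E) Z) \<in> Arr V" "Cod V (EA (map (ESubst E) Z)) = EO (map EO (map (lab X) ?gs))"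
  unfolding gl using EA_map_Arr[of Z "ESubst E", OF sb(1)] sb(2) by (simp_all add: comp_def cong: map_cong)
 have "EA (map (HMap (MMult T X)) (steps p)) ** EA (map (inj2 X) ts) =
   EA (map (\<lambda>t. HMap (MMult T X) (hd (fst t), last (fst t)) ** inj2 X t) ts)"
  unfolding st map_map comp_def
 proof (rule EA_Comp_map)
  fix t' assume t': "t' \<in> set ts"
  show "inj2 X t' \<in> Arr V \<and> HMap (MMult T X) (hd (fst t'), last (fst t')) \<in> Arr V \<and>
    Dom V (HMap (MMult T X) (hd (fst t'), last (fst t'))) = Cod V (inj2 X t')"
   using inj2_facts[OF X t[OF t']] mult_facts[OF X pathsD(5,6)[OF t(1)[OF t']]] by simp
 qed
 also have "map (\<lambda>t. HMap (MMult T X) (hd (fst t), last (fst t)) ** inj2 X t) ts =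
   map (\<lambda>t. inj X (glue (fst t) (snd t)) ** ESubst E (map (lab X) (snd t))) ts"
 proof (rule map_cong[OF refl])
  fix t' assume t': "t' \<in> set ts"
  show "HMap (MMult T X) (hd (fst t'), last (fst t')) ** inj2 X t' =
   inj X (glue (fst t') (snd t')) ** ESubst E (map (lab X) (snd t'))"
   using inj_mult'[OF X t[OF t']] unfolding fst_conv snd_conv .
 qed
 also have "EA \<dots> = EA (map (\<lambda>t. inj X (glue (fst t) (snd t))) ts) ** EA (map (\<lambda>t. ESubst E (map (lab X) (snd t))) ts)"
 proof (rule EA_Comp_map[symmetric])
  fix t' assume t': "t' \<in> set ts"
  show "ESubst E (map (lab X) (snd t')) \<in> Arr V \<and> inj X (glue (fst t') (snd t')) \<in> Arr V \<and>
   Dom V (inj X (glue (fst t') (snd t'))) = Cod V (ESubst E (map (lab X) (snd t')))"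
   using inj_glue_facts[OF X t[OF t']] subst_lab_facts[OF X t(2)[OF t']] by simp
 qed
 finally have H: "EA (map (HMap (MMult T X)) (steps p)) ** EA (map (inj2 X) ts) =
   EA (map (inj X) ?gs) ** EA (map (ESubst E) Z)"
  by (simp add: Z_def comp_def)
 note m = mult_facts[OF X ab] and j = inj3_facts[OF X p ts] and e = EA_inj_facts[OF X gs]
  and iT = inj_facts[OF XT pT] and h = EA_HMap_facts[OF M(1), unfolded M(2,3), OF pathsD(1)[OF pTT], unfolded idp]
  and ig = inj_glue_facts[OF X p gs] and sg = subst_lab_facts[OF X gs]
 have tm: "HMap (TA (MMult T X)) (a, b) \<in> Arr V" "Dom V (HMap (TA (MMult T X)) (a, b)) = VHom (TO (TO (TO X))) (a, b)"
  "Cod V (HMap (TA (MMult T X)) (a, b)) = VHom (TO (TO X)) (a, b)"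
  using TA_facts[OF M(1), of a b] M ab VT by simp_all
 have n: "HMap (TA (MMult T X)) (a, b) ** inj (TO (TO X)) p = inj (TO X) p ** EA (map (HMap (MMult T X)) (steps p))"
  using inj_natural'[OF M(1), unfolded M(2,3), OF pTT] idp by simp
 have "HMap (TA (MMult T X)) (a, b) ** inj (TO (TO X)) p ** EA (map (inj2 X) ts) =
   (HMap (TA (MMult T X)) (a, b) ** inj (TO (TO X)) p) ** EA (map (inj2 X) ts)"
  by (rule Comp_assoc[symmetric]) (simp_all only: tm j)
 also have "\<dots> = inj (TO X) p ** EA (map (HMap (MMult T X)) (steps p)) ** EA (map (inj2 X) ts)"
  unfolding n by (rule Comp_assoc) (simp_all only: iT h j)
 finally have "HMap (MMult T X) (a, b) ** HMap (TA (MMult T X)) (a, b) ** inj (TO (TO X)) p ** EA (map (inj2 X) ts) =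
   HMap (MMult T X) (a, b) ** inj (TO X) p ** EA (map (inj X) ?gs) ** EA (map (ESubst E) Z)"
  unfolding H by (simp only:)
 also have "\<dots> = (HMap (MMult T X) (a, b) ** inj2 X (p, ?gs)) ** EA (map (ESubst E) Z)"
  unfolding fst_conv snd_conv by (simp only: Comp_assoc Comp_Arr Dom_Comp Cod_Comp m iT e S)
 also have "\<dots> = inj X (glue p ?gs) ** ESubst E (map (lab X) ?gs) ** EA (map (ESubst E) Z)"
  unfolding inj_mult'[OF X p gs] by (rule Comp_assoc) (simp_all only: ig sg S)
 finally show ?thesis unfolding gl .
qed

text \<open>Both composites end in the coprojection of the same path, by associativity of gluing,
  and are preceded by the two sides of the multitensor law for the labels \<open>Z\<close> of the
  summand. Every \<open>Z\<close> occurs: the standard path for its twofold concatenation is cut on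
  two levels.\<close>

lemma assoc_iff:
 assumes nat: "\<forall>fss\<in>lists (lists (Arr V)). EA (concat fss) ** ESubst E (map (map (Dom V)) fss) =
   ESubst E (map (map (Cod V)) fss) ** EA (map EA fss)"
 shows "(\<forall>X\<in>vgraphs U V. Comp Gr (MMult T X) (MMult T (TO X)) = Comp Gr (MMult T X) (TA (MMult T X))) \<longleftrightarrow>
  (\<forall>Z\<in>lists (lists (lists (Obj V))). ESubst E (concat Z) ** ESubst E (map (map EO) Z) =
    ESubst E (map concat Z) ** EA (map (ESubst E) Z))" (is "?T \<longleftrightarrow> ?E")
proof -
 have H: "HMap (Comp Gr (MMult T X) (MMult T (TO X))) (a, b) = HMap (MMult T X) (a, b) ** HMap (MMult T (TO X)) (a, b)"
  "HMap (Comp Gr (MMult T X) (TA (MMult T X))) (a, b) = HMap (MMult T X) (a, b) ** HMap (TA (MMult T X)) (a, b)"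
  "HMap (MMult T X) (a, b) \<in> Arr V" "Dom V (HMap (MMult T X) (a, b)) = VHom (TO (TO X)) (a, b)"
  "Cod V (HMap (MMult T X) (a, b)) = VHom (TO X) (a, b)"
  "HMap (MMult T (TO X)) (a, b) \<in> Arr V" "Dom V (HMap (MMult T (TO X)) (a, b)) = VHom (TO (TO (TO X))) (a, b)"
  "Cod V (HMap (MMult T (TO X)) (a, b)) = VHom (TO (TO X)) (a, b)"
  "HMap (TA (MMult T X)) (a, b) \<in> Arr V" "Dom V (HMap (TA (MMult T X)) (a, b)) = VHom (TO (TO (TO X))) (a, b)"
  "Cod V (HMap (TA (MMult T X)) (a, b)) = VHom (TO (TO X)) (a, b)"
  if X: "X \<in> vgraphs U V" and ab: "a \<in> Vert X" "b \<in> Vert X" for X a b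
 proof -
  have M: "MMult T X \<in> vgmaps U V" "GDom (MMult T X) = TO (TO X)" "GCod (MMult T X) = TO X"
   "OMap (MMult T X) = (\<lambda>a\<in>Vert X. a)" using T_mult[OF X] by auto
  have VT: "Vert (TO (TO (TO X))) = Vert X" "Vert (TO (TO X)) = Vert X" "Vert (TO X) = Vert X" using T_Vert X by simp_all
  show "HMap (Comp Gr (MMult T X) (MMult T (TO X))) (a, b) = HMap (MMult T X) (a, b) ** HMap (MMult T (TO X)) (a, b)"
   using T_mult[OF TO_vgraph[OF X]] ab VT by simp
  show "HMap (Comp Gr (MMult T X) (TA (MMult T X))) (a, b) = HMap (MMult T X) (a, b) ** HMap (TA (MMult T X)) (a, b)"
   using TA_vgmap[OF M(1)] T_OMap[OF M(1)] M(2-4) ab VT by simp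
  show "HMap (TA (MMult T X)) (a, b) \<in> Arr V" "Dom V (HMap (TA (MMult T X)) (a, b)) = VHom (TO (TO (TO X))) (a, b)"
   "Cod V (HMap (TA (MMult T X)) (a, b)) = VHom (TO (TO X)) (a, b)"
   using TA_facts[OF M(1), of a b] M ab VT by simp_all
  show "HMap (MMult T X) (a, b) \<in> Arr V" "Dom V (HMap (MMult T X) (a, b)) = VHom (TO (TO X)) (a, b)"
   "Cod V (HMap (MMult T X) (a, b)) = VHom (TO X) (a, b)"
   "HMap (MMult T (TO X)) (a, b) \<in> Arr V" "Dom V (HMap (MMult T (TO X)) (a, b)) = VHom (TO (TO (TO X))) (a, b)"
   "Cod V (HMap (MMult T (TO X)) (a, b)) = VHom (TO (TO X)) (a, b)"
   using mult_facts[OF X ab] mult_facts[OF TO_vgraph[OF X], of a b] ab VT by simp_all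
 qed
 have A: "(HMap (Comp Gr (MMult T X) (MMult T (TO X))) (a, b)) ** inj (TO (TO X)) p ** EA (map (inj2 X) ts) =
   HMap (MMult T X) (a, b) ** HMap (MMult T (TO X)) (a, b) ** inj (TO (TO X)) p ** EA (map (inj2 X) ts)"
  "(HMap (Comp Gr (MMult T X) (TA (MMult T X))) (a, b)) ** inj (TO (TO X)) p ** EA (map (inj2 X) ts) =
   HMap (MMult T X) (a, b) ** HMap (TA (MMult T X)) (a, b) ** inj (TO (TO X)) p ** EA (map (inj2 X) ts)"
  if X: "X \<in> vgraphs U V" and p: "p \<in> paths (Vert X) a b" and ts: "ts \<in> refinements2 (Vert X) p" for X p ts a b
 proof -
  note h = H[OF X pathsD(5,6)[OF p]] and j = inj3_facts[OF X p ts]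
  show "(HMap (Comp Gr (MMult T X) (MMult T (TO X))) (a, b)) ** inj (TO (TO X)) p ** EA (map (inj2 X) ts) =
   HMap (MMult T X) (a, b) ** HMap (MMult T (TO X)) (a, b) ** inj (TO (TO X)) p ** EA (map (inj2 X) ts)"
   unfolding h(1) by (rule Comp_assoc) (simp_all only: h(3-) j Comp_Arr Dom_Comp Cod_Comp)
  show "(HMap (Comp Gr (MMult T X) (TA (MMult T X))) (a, b)) ** inj (TO (TO X)) p ** EA (map (inj2 X) ts) =
   HMap (MMult T X) (a, b) ** HMap (TA (MMult T X)) (a, b) ** inj (TO (TO X)) p ** EA (map (inj2 X) ts)"
   unfolding h(2) by (rule Comp_assoc) (simp_all only: h(3-) j Comp_Arr Dom_Comp Cod_Comp)
 qed
 show ?thesis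
 proof
  assume E: ?E
  show ?T
  proof
   fix X assume X: "X \<in> vgraphs U V"
   have M: "MMult T X \<in> vgmaps U V" "GDom (MMult T X) = TO (TO X)" "GCod (MMult T X) = TO X"
    "OMap (MMult T X) = (\<lambda>a\<in>Vert X. a)" using T_mult[OF X] by auto
   have VT: "Vert (TO (TO (TO X))) = Vert X" "Vert (TO (TO X)) = Vert X" "Vert (TO X) = Vert X" using T_Vert X by simp_all
   have c: "Comp Gr (MMult T X) (MMult T (TO X)) \<in> vgmaps U V" "Comp Gr (MMult T X) (TA (MMult T X)) \<in> vgmaps U V"
    using T_mult[OF TO_vgraph[OF X]] M TA_vgmap[OF M(1)] by (auto intro!: Comp_vgmap)
   show "Comp Gr (MMult T X) (MMult T (TO X)) = Comp Gr (MMult T X) (TA (MMult T X))"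
   proof (rule vgmap_eqI[OF c, where X = "TO (TO (TO X))"])
    fix a b assume "a \<in> Vert (TO (TO (TO X)))" "b \<in> Vert (TO (TO (TO X)))"
    then have ab: "a \<in> Vert X" "b \<in> Vert X" using VT by auto
    note h = H[OF X ab]
    show "HMap (Comp Gr (MMult T X) (MMult T (TO X))) (a, b) = HMap (Comp Gr (MMult T X) (TA (MMult T X))) (a, b)"
    proof (rule coproduct_eqI[OF TTTO_coproduct[OF X ab]])
     fix u assume "u \<in> Sigma (paths (Vert X) a b) (refinements2 (Vert X))"
     then obtain p ts where u: "u = (p, ts)" and p: "p \<in> paths (Vert X) a b" and ts: "ts \<in> refinements2 (Vert X) p" by auto
     define Z where "Z = map (\<lambda>t. map (lab X) (snd t)) ts"
     have "Z \<in> lists (lists (lists (Obj V)))"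
     proof (rule in_listsI, rule ballI, rule in_listsI, rule ballI)
      fix x y assume "x \<in> set Z" "y \<in> set x"
      then obtain t r where t: "t \<in> set ts" "r \<in> set (snd t)" "y = lab X r" by (auto simp: Z_def)
      then show "y \<in> lists (Obj V)"
       using lab_lists[OF X pathsD(1)[OF refinements_paths[OF refinements2_facts(2)[OF ts t(1)] t(2)]]] by simp
     qed
     with E have e: "ESubst E (concat Z) ** ESubst E (map (map EO) Z) = ESubst E (map concat Z) ** EA (map (ESubst E) Z)"
      by (rule bspec)
     show "HMap (Comp Gr (MMult T X) (MMult T (TO X))) (a, b) ** (case u of (p, ts) \<Rightarrow> inj (TO (TO X)) p ** EA (map (inj2 X) ts)) =
      HMap (Comp Gr (MMult T X) (TA (MMult T X))) (a, b) ** (case u of (p, ts) \<Rightarrow> inj (TO (TO X)) p ** EA (map (inj2 X) ts))"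
      unfolding u prod.case A[OF X p ts] assoc_left[OF X p ts nat, folded Z_def] assoc_right[OF X p ts, folded Z_def] e ..
    qed (use h in simp_all)
   qed (use X VT M T_mult[OF TO_vgraph[OF X]] TA_vgmap[OF M(1)] T_OMap[OF M(1)] in auto)
  qed
 next
  assume T: ?T
  show ?E
  proof
   fix Z assume Z: "Z \<in> lists (lists (lists (Obj V)))"
   let ?z = "concat (concat Z)"
   have z: "?z \<in> lists (Obj V)" using Z by (auto simp: in_lists_conv_set)
   let ?X = "gr ?z" and ?r = "std (length ?z)"
   note X = gr_vgraph[OF z] and rp = std_paths[of ?z]
   have "sum_list (map sum_list (map (map length) Z)) = length ?z"
    by (induction Z) (auto simp: length_concat)
   then have l: "sum_list (map sum_list (map (map length) Z)) = length ?r - 1" by simp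
   obtain p ts where p: "p \<in> paths (Vert ?X) (hd ?r) (last ?r)" and ts1: "map fst ts \<in> refinements (Vert ?X) p"
    and ts2: "\<And>q rs. (q, rs) \<in> set ts \<Longrightarrow> rs \<in> refinements (Vert ?X) q"
    and gl: "glue p (map (\<lambda>(q, rs). glue q rs) ts) = ?r"
    and len: "map (\<lambda>(q, rs). map (\<lambda>r. length r - 1) rs) ts = map (map length) Z"
    using path_split2[OF std_lists[of ?z] std_nonempty l] by metis
   have ts: "ts \<in> refinements2 (Vert ?X) p" using ts1 ts2 by (auto simp: refinements2_iff)
   define Z' where "Z' = map (\<lambda>t. map (lab ?X) (snd t)) ts"
   note t = refinements2_facts[OF ts]
   have "map (lab ?X) (map (\<lambda>t. glue (fst t) (snd t)) ts) = map concat Z'"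
    using lab_glue[OF t(2) pathsD(2)[OF t(1)]] by (simp add: Z'_def)
   then have "concat (concat Z') = lab ?X ?r"
    using lab_glue[OF refinements2_glue(3)[OF ts pathsD(2)[OF p]] pathsD(2)[OF p], of ?X] gl
    by (simp add: split_beta' concat_map_concat)
   then have cc: "concat (concat Z') = concat (concat Z)" using map_VHom_gr[of ?z] by simp
   have ll: "map (map length) Z' = map (map length) Z"
    unfolding len[symmetric] by (simp add: Z'_def split_beta' comp_def)
   have "map length (concat Z') = map length (concat Z)" using arg_cong[OF ll, of concat] by (simp add: map_concat)
   then have "concat Z' = concat Z" using concat_eq_lengths[OF cc] by simp
   moreover have "map length Z' = map length Z" using arg_cong[OF ll, of "map length"] by (simp add: comp_def)
   \<comment> \<open>The twofold concatenation and the lengths on both levels determine the nested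
     list.\<close>
   ultimately have ZZ: "Z' = Z" by (rule concat_eq_lengths)
   note X' = bspec[OF T X]
   have e: "inj ?X ?r ** ESubst E (concat Z) ** ESubst E (map (map EO) Z) =
     inj ?X ?r ** ESubst E (map concat Z) ** EA (map (ESubst E) Z)"
    using A[OF X p ts] unfolding X' assoc_left[OF X p ts nat, folded Z'_def] assoc_right[OF X p ts, folded Z'_def]
     gl[unfolded split_beta'] ZZ by simp
   have zz: "y \<in> lists (Obj V)" if "x \<in> set Z" "y \<in> set x" for x y using Z that by auto
   have s1: "ESubst E (concat Z) \<in> Arr V" "Dom V (ESubst E (concat Z)) = EO (map EO (concat Z))"
    "Cod V (ESubst E (concat Z)) = EO (concat (concat Z))"
    using E_subst_facts[of "concat Z"] zz by (auto simp: map_concat)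
   have s2: "ESubst E (map concat Z) \<in> Arr V" "Dom V (ESubst E (map concat Z)) = EO (map EO (map concat Z))"
    "Cod V (ESubst E (map concat Z)) = EO (concat (concat Z))"
   proof -
    have "y \<in> lists (Obj V)" if "y \<in> set (map concat Z)" for y using zz that by (fastforce simp: in_lists_conv_set)
    from E_subst_facts[of "map concat Z", OF this]
    show "ESubst E (map concat Z) \<in> Arr V" "Dom V (ESubst E (map concat Z)) = EO (map EO (map concat Z))"
     "Cod V (ESubst E (map concat Z)) = EO (concat (concat Z))" by (simp_all add: concat_map_concat)
   qed
   have s3: "ESubst E (map (map EO) Z) \<in> Arr V" "Dom V (ESubst E (map (map EO) Z)) = EO (map EO (map (map EO) Z))"
    "Cod V (ESubst E (map (map EO) Z)) = EO (map EO (concat Z))"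
   proof -
    have "y \<in> lists (Obj V)" if y: "y \<in> set (map (map EO) Z)" for y
    proof -
     obtain x where "x \<in> set Z" "y = map EO x" using y by auto
     then show ?thesis using zz EO_Obj by (auto simp: in_lists_conv_set)
    qed
    from E_subst_facts[of "map (map EO) Z", OF this]
    show "ESubst E (map (map EO) Z) \<in> Arr V" "Dom V (ESubst E (map (map EO) Z)) = EO (map EO (map (map EO) Z))"
     "Cod V (ESubst E (map (map EO) Z)) = EO (map EO (concat Z))" by (simp_all add: map_concat)
   qed
   have s4: "EA (map (ESubst E) Z) \<in> Arr V" "Dom V (EA (map (ESubst E) Z)) = EO (map EO (map (map EO) Z))"
    "Cod V (EA (map (ESubst E) Z)) = EO (map EO (map concat Z))"
   proof -
    have *: "ESubst E x \<in> Arr V" "Dom V (ESubst E x) = EO (map EO x)" "Cod V (ESubst E x) = EO (concat x)" if "x \<in> set Z" for x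
     using E_subst_facts[of x] zz[OF that] by simp_all
    show "EA (map (ESubst E) Z) \<in> Arr V" "Dom V (EA (map (ESubst E) Z)) = EO (map EO (map (map EO) Z))"
     "Cod V (EA (map (ESubst E) Z)) = EO (map EO (map concat Z))"
     using EA_map_Arr[of Z "ESubst E", OF *(1)] *(2,3) by (simp_all add: comp_def cong: map_cong)
   qed
   note i = inj_facts[OF X rp, unfolded map_VHom_gr]
   show "ESubst E (concat Z) ** ESubst E (map (map EO) Z) = ESubst E (map concat Z) ** EA (map (ESubst E) Z)"
    by (rule mono_arrD[OF inj_mono[OF X rp] e]) (simp_all only: Comp_Arr Dom_Comp Cod_Comp s1 s2 s3 s4 i)
  qed
 qed
qed

text \<open>The order matters: the left unit law is compared under naturality of the unit and
  associativity under naturality of the substitution, so the naturality laws are matched before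
  these.\<close>

theorem multitensor_iff_monad: "is_multitensor V E \<longleftrightarrow> is_monad Gr T"
 unfolding is_multitensor_iff is_monad_iff
 using unit_natural_iff mult_natural_iff unit_law_left_iff unit_law_right_iff assoc_iff by blast

end

section \<open>Cartesian multitensors present cartesian monads\<close>

text \<open>Forming paths preserves pullbacks of vertex sets. Preimages exist vertex by vertex; that
  the resulting path runs from \<open>a\<close> to \<open>b\<close> is where \<open>uniq\<close>
  comes in.\<close>

lemma path_pullback_ex:
 assumes ex: "\<And>x y. x \<in> SX \<Longrightarrow> y \<in> SY \<Longrightarrow> f x = g y \<Longrightarrow> \<exists>a\<in>S. p a = x \<and> q a = y"
  and uniq: "\<And>a b. a \<in> S \<Longrightarrow> b \<in> S \<Longrightarrow> p a = p b \<Longrightarrow> q a = q b \<Longrightarrow> a = b"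
  and ab: "a \<in> S" "b \<in> S"
  and r: "r \<in> paths SX (p a) (p b)" and s: "s \<in> paths SY (q a) (q b)" and e: "map f r = map g s"
 shows "\<exists>t\<in>paths S a b. map p t = r \<and> map q t = s"
proof -
 have len: "length s = length r" using arg_cong[OF e, of length] by simp
 have "\<exists>a. a \<in> S \<and> p a = r ! k \<and> q a = s ! k" if k: "k < length r" for k
 proof -
  have "f (r ! k) = g (s ! k)" using arg_cong[OF e, of "\<lambda>xs. xs ! k"] k len by simp
  moreover have "r ! k \<in> SX" "s ! k \<in> SY" using pathsD(1)[OF r] pathsD(1)[OF s] k len by (simp_all add: in_lists_conv_set)
  ultimately show ?thesis using ex by blast
 qed
 then obtain t where t: "length t = length r" "\<And>k. k < length r \<Longrightarrow> t ! k \<in> S \<and> p (t ! k) = r ! k \<and> q (t ! k) = s ! k"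
  using Skolem_list_nth[of "length r" "\<lambda>k a. a \<in> S \<and> p a = r ! k \<and> q a = s ! k"] by blast
 have m: "map p t = r" "map q t = s" using t len by (auto intro: nth_equalityI)
 have ne: "t \<noteq> []" using pathsD(2)[OF r] m(1) by auto
 have tS: "t \<in> lists S" using t by (auto simp: in_lists_conv_set in_set_conv_nth)
 then have hl: "hd t \<in> S" "last t \<in> S" using ne by (auto simp: in_lists_conv_set)
 have "hd t = a"
  using pathsD(3)[OF r] pathsD(3)[OF s] m ne by (intro uniq hl ab) (auto simp: hd_map)
 moreover have "last t = b"
  using pathsD(4)[OF r] pathsD(4)[OF s] m ne by (intro uniq hl ab) (auto simp: last_map)
 ultimately have "t \<in> paths S a b" using pathsI[OF tS ne] by simp
 then show ?thesis using m by blast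
qed

lemma path_pullback_uniq:
 assumes uniq: "\<And>a b. a \<in> S \<Longrightarrow> b \<in> S \<Longrightarrow> p a = p b \<Longrightarrow> q a = q b \<Longrightarrow> a = b"
  and "t \<in> lists S" "t' \<in> lists S" "map p t = map p t'" "map q t = map q t'"
 shows "t = t'"
proof (rule nth_equalityI)
 show len: "length t = length t'" using arg_cong[OF assms(4), of length] by simp
 fix k assume k: "k < length t"
 have "p (t ! k) = p (t' ! k)" "q (t ! k) = q (t' ! k)"
  using arg_cong[OF assms(4), of "\<lambda>xs. xs ! k"] arg_cong[OF assms(5), of "\<lambda>xs. xs ! k"] k len by simp_all
 then show "t ! k = t' ! k" using uniq assms(2,3) k len by (simp add: in_lists_conv_set)
qed

text \<open>The lengths tell where the first piece ends inside the glued path; it is stripped off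
  and the rest follows by induction. This uniqueness makes the index square of a multiplication a
  pullback.\<close>

lemma glue_inj:
 assumes "qs \<in> refinements S p" "p \<noteq> []" "qs' \<in> refinements S' p'" "p' \<noteq> []"
  "glue p qs = glue p' qs'" "map length qs = map length qs'"
 shows "p = p' \<and> qs = qs'"
 using assms
proof (induction arbitrary: p' qs' rule: refinements_induct)
 case (single a)
 then have "qs' = []" by simp
 then have "length p' = 1" using arg_cong[OF refinements_ends[OF single(1)], of length] single(2) by (cases p') auto
 then obtain b where "p' = [b]" by (cases p') auto
 then show ?case using single \<open>qs' = []\<close> by simp
next
 case (Cons x y p q qs)
 obtain q' qs'' where qs': "qs' = q' # qs''" using Cons.prems(4) by (cases qs') auto
 have "steps p' \<noteq> []" using refinements_ends[OF Cons.prems(1)] qs' by auto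
 then obtain x' y' p'' where p': "p' = x' # y' # p''" by (metis list.exhaust steps_simps(1,2))
 have q': "q' \<in> paths S' x' y'" "qs'' \<in> refinements S' (y' # p'')"
  using Cons.prems(1) unfolding qs' p' by (auto simp: refinements_Cons)
 have e: "q @ tl (glue (y # p) qs) = q' @ tl (glue (y' # p'') qs'')"
  using Cons.prems(3) unfolding qs' p' glue_Cons[OF Cons.hyps(1)] glue_Cons[OF q'(1)] .
 have l: "length q = length q'" "map length qs = map length qs''" using Cons.prems(4) qs' by auto
 have qq: "q = q'" "tl (glue (y # p) qs) = tl (glue (y' # p'') qs'')" using e l(1) by auto
 have xy: "x = x'" "y = y'" using pathsD(3,4)[OF Cons.hyps(1)] pathsD(3,4)[OF q'(1)] qq(1) by auto
 have "glue (y # p) qs = glue (y' # p'') qs''" using qq(2) xy(2) by (simp add: glue_def)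
 from Cons.IH[OF q'(2) _ this l(2)] show ?case using qq(1) xy qs' p' by simp
qed

context extensive_category
begin

lemma seq_simps [simp]: "Obj (seq_cat V) = lists (Obj V)" "Arr (seq_cat V) = lists (Arr V)"
 "Dom (seq_cat V) = map (Dom V)" "Cod (seq_cat V) = map (Cod V)" "Ident (seq_cat V) = map (Ident V)"
 "Comp (seq_cat V) = map2 (Comp V)"
 by (simp_all add: seq_cat_def)

lemma lists_nth: "xs \<in> lists A \<longleftrightarrow> (\<forall>k<length xs. xs ! k \<in> A)"
 by (simp add: in_lists_conv_set all_set_conv_all_nth)

lemma seq_category: "category (seq_cat V)"
 unfolding category_def
proof (intro conjI ballI impI)
 fix f g assume a: "f \<in> Arr (seq_cat V)" "g \<in> Arr (seq_cat V)" "Dom (seq_cat V) g = Cod (seq_cat V) f"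
 then have l: "length g = length f" by (metis length_map seq_simps(3,4))
 have "Dom V (g ! k) = Cod V (f ! k)" if "k < length f" for k
  using arg_cong[OF a(3), of "\<lambda>xs. xs ! k"] that l by simp
 then show "Comp (seq_cat V) g f \<in> hom (seq_cat V) (Dom (seq_cat V) f) (Cod (seq_cat V) g)"
  using a(1,2) l by (auto simp: lists_nth intro!: nth_equalityI)
next
 fix f assume "f \<in> Arr (seq_cat V)"
 then show "Comp (seq_cat V) f (Ident (seq_cat V) (Dom (seq_cat V) f)) = f"
  "Comp (seq_cat V) (Ident (seq_cat V) (Cod (seq_cat V) f)) f = f"
  by (auto simp: lists_nth intro!: nth_equalityI)
next
 fix f g h assume a: "f \<in> Arr (seq_cat V)" "g \<in> Arr (seq_cat V)" "h \<in> Arr (seq_cat V)"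
  "Dom (seq_cat V) g = Cod (seq_cat V) f" "Dom (seq_cat V) h = Cod (seq_cat V) g"
 then have l: "length g = length f" "length h = length f" by (metis length_map seq_simps(3,4))+
 have "Dom V (g ! k) = Cod V (f ! k)" "Dom V (h ! k) = Cod V (g ! k)" if "k < length f" for k
  using arg_cong[OF a(4), of "\<lambda>xs. xs ! k"] arg_cong[OF a(5), of "\<lambda>xs. xs ! k"] that l by simp_all
 then show "Comp (seq_cat V) h (Comp (seq_cat V) g f) = Comp (seq_cat V) (Comp (seq_cat V) h g) f"
  using a(1-3) l by (auto simp: lists_nth intro!: nth_equalityI)
qed (auto simp: lists_nth intro!: nth_equalityI)

lemma seq_pullbackI:
 assumes len: "length qs = length ps" "length fs = length ps" "length gs = length ps"
  and pb: "\<And>k. k < length ps \<Longrightarrow> is_pullback V (ps ! k) (qs ! k) (fs ! k) (gs ! k)"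
 shows "is_pullback (seq_cat V) ps qs fs gs"
proof -
 interpret S: Category "seq_cat V" by unfold_locales (rule seq_category)
 note c = pullback_facts[OF pb]
 show ?thesis
 proof (rule S.pullbackI)
  fix h k assume hk: "h \<in> Arr (seq_cat V)" "k \<in> Arr (seq_cat V)" "Dom (seq_cat V) h = Dom (seq_cat V) k"
   "Cod (seq_cat V) h = Dom (seq_cat V) fs" "Cod (seq_cat V) k = Dom (seq_cat V) gs"
   "S.cmp fs h = S.cmp gs k"
  note hk' = hk[unfolded seq_simps]
  have l: "length h = length ps" "length k = length ps"
   using arg_cong[OF hk'(4), of length] arg_cong[OF hk'(5), of length] len by simp_all
  have "\<exists>u. u \<in> Arr V \<and> Dom V u = Dom V (h ! n) \<and> Cod V u = Dom V (ps ! n) \<and> ps ! n ** u = h ! n \<and> qs ! n ** u = k ! n"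
   if n: "n < length ps" for n
  proof -
   have "Dom V (h ! n) = Dom V (k ! n)" "Cod V (h ! n) = Dom V (fs ! n)" "Cod V (k ! n) = Dom V (gs ! n)"
    "fs ! n ** h ! n = gs ! n ** k ! n"
    using arg_cong[OF hk'(3), of "\<lambda>xs. xs ! n"] arg_cong[OF hk'(4), of "\<lambda>xs. xs ! n"]
     arg_cong[OF hk'(5), of "\<lambda>xs. xs ! n"] arg_cong[OF hk'(6), of "\<lambda>xs. xs ! n"] n l len by simp_all
   then show ?thesis using pullback_lift[OF pb[OF n], of "h ! n" "k ! n"] hk'(1,2) n l by (metis lists_nth)
  qed
  then obtain u where u: "length u = length ps" "\<And>n. n < length ps \<Longrightarrow> u ! n \<in> Arr V \<and> Dom V (u ! n) = Dom V (h ! n) \<and>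
    Cod V (u ! n) = Dom V (ps ! n) \<and> ps ! n ** u ! n = h ! n \<and> qs ! n ** u ! n = k ! n"
   using Skolem_list_nth[of "length ps" "\<lambda>n u. u \<in> Arr V \<and> Dom V u = Dom V (h ! n) \<and> Cod V u = Dom V (ps ! n) \<and>
    ps ! n ** u = h ! n \<and> qs ! n ** u = k ! n"] by blast
  show "\<exists>u\<in>Arr (seq_cat V). Dom (seq_cat V) u = Dom (seq_cat V) h \<and> Cod (seq_cat V) u = Dom (seq_cat V) ps \<and>
    S.cmp ps u = h \<and> S.cmp qs u = k"
   using u l len by (intro bexI[of _ u]) (auto simp: lists_nth intro!: nth_equalityI)
 next
  fix u v assume uv: "u \<in> Arr (seq_cat V)" "v \<in> Arr (seq_cat V)" "Dom (seq_cat V) u = Dom (seq_cat V) v"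
   "Cod (seq_cat V) u = Dom (seq_cat V) ps" "Cod (seq_cat V) v = Dom (seq_cat V) ps"
   "S.cmp ps u = S.cmp ps v" "S.cmp qs u = S.cmp qs v"
  note uv' = uv[unfolded seq_simps]
  have l: "length u = length ps" "length v = length ps"
   using arg_cong[OF uv'(4), of length] arg_cong[OF uv'(5), of length] by simp_all
  show "u = v"
  proof (rule nth_equalityI)
   fix n assume n: "n < length u"
   then have e: "Dom V (u ! n) = Dom V (v ! n)" "Cod V (u ! n) = Dom V (ps ! n)" "Cod V (v ! n) = Dom V (ps ! n)"
    "ps ! n ** u ! n = ps ! n ** v ! n" "qs ! n ** u ! n = qs ! n ** v ! n"
    using arg_cong[OF uv'(3), of "\<lambda>xs. xs ! n"] arg_cong[OF uv'(4), of "\<lambda>xs. xs ! n"]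
     arg_cong[OF uv'(5), of "\<lambda>xs. xs ! n"] arg_cong[OF uv'(6), of "\<lambda>xs. xs ! n"]
     arg_cong[OF uv'(7), of "\<lambda>xs. xs ! n"] l len by simp_all
   show "u ! n = v ! n"
    by (rule pullback_eqI[OF pb _ _ e]) (use n l uv'(1,2) in \<open>auto simp: lists_nth\<close>)
  qed (simp add: l)
 qed (use c len in \<open>auto simp: lists_nth intro!: nth_equalityI\<close>)
qed

end

context presentation
begin

text \<open>Paths of the pullback are pairs of paths with a common image, so the index square is a
  pullback. On the summand of a path the square is \<open>EA\<close> applied to the pullback squares
  at its steps.\<close>

lemma preserves_pullbacks_T:
 assumes E: "preserves_pullbacks (seq_cat V) V (EFun E)"
 shows "preserves_pullbacks Gr Gr (MFun T)"
 unfolding preserves_pullbacks_def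
proof (intro allI impI)
 interpret G: Category Gr by unfold_locales (rule Graphs_category)
 fix p q f g assume pb: "is_pullback Gr p q f g"
 note c = G.pullback_facts[OF pb, unfolded Graphs_simps]
 note P = vgmap_facts[OF c(1)] and Q = vgmap_facts[OF c(2)] and F = vgmap_facts[OF c(3)] and GG = vgmap_facts[OF c(4)]
 have o: "OMap f (OMap p a) = OMap g (OMap q a)" if "a \<in> Vert (GDom p)" for a
  using arg_cong[OF c(9), of "\<lambda>f. OMap f a"] that c(5) by simp
 note V1 = pullback_graphs_vertex[OF pb] and V2 = pullback_graphs_vertex_unique[OF pb]
 show "is_pullback Gr (TA p) (TA q) (TA f) (TA g)"
 proof (rule pullback_graphsI)
  fix a b assume "a \<in> Vert (GDom (TA p))" "b \<in> Vert (GDom (TA p))"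
  then have ab: "a \<in> Vert (GDom p)" "b \<in> Vert (GDom p)" using TA_vgmap(2)[OF c(1)] T_Vert[OF P(1)] by auto
  have v: "OMap p a \<in> Vert (GDom f)" "OMap p b \<in> Vert (GDom f)" "OMap q a \<in> Vert (GDom g)" "OMap q b \<in> Vert (GDom g)"
   using P(3) Q(3) ab c(5-7) by auto
  have abq: "a \<in> Vert (GDom q)" "b \<in> Vert (GDom q)" using ab c(5) by auto
  have vZ: "OMap f (OMap p a) \<in> Vert (GCod f)" "OMap f (OMap p b) \<in> Vert (GCod f)" using F(3) v by auto
  have path_q: "map (OMap q) t \<in> paths (Vert (GDom g)) (OMap q a) (OMap q b)" if "t \<in> paths (Vert (GDom p)) a b" for t
   using paths_vgmap[OF c(2), of t a b] that c(5,7) by simp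
  have path_p: "map (OMap p) t \<in> paths (Vert (GDom f)) (OMap p a) (OMap p b)" if "t \<in> paths (Vert (GDom p)) a b" for t
   using paths_vgmap[OF c(1) that] c(6) by simp
  have path_g: "map (OMap g) t \<in> paths (Vert (GCod f)) (OMap f (OMap p a)) (OMap f (OMap p b))"
   if "t \<in> paths (Vert (GDom g)) (OMap q a) (OMap q b)" for t
   using paths_vgmap[OF c(4) that] c(8) o[OF ab(1)] o[OF ab(2)] by simp
  have "is_pullback V (HMap (TA p) (a, b)) (HMap (TA q) (a, b)) (HMap (TA f) (OMap p a, OMap p b)) (HMap (TA g) (OMap q a, OMap q b))"
  proof (rule coproduct_pullback[where pI = "map (OMap p)" and qI = "map (OMap q)" and fI = "map (OMap f)" and gI = "map (OMap g)"
     and pk = "\<lambda>t. EA (map (HMap p) (steps t))" and qk = "\<lambda>t. EA (map (HMap q) (steps t))"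
     and fi = "\<lambda>t. EA (map (HMap f) (steps t))" and gj = "\<lambda>t. EA (map (HMap g) (steps t))",
     OF small_paths[OF P(1)] small_paths[OF F(1)] small_paths[OF GG(1)] small_paths[OF F(2)]
     inj_coproduct[OF P(1) ab] inj_coproduct[OF F(1) v(1,2)] inj_coproduct[OF GG(1) v(3,4)] inj_coproduct[OF F(2) vZ]])
   show "HMap (TA p) (a, b) \<in> hom V (VHom (TO (GDom p)) (a, b)) (VHom (TO (GDom f)) (OMap p a, OMap p b))"
    using TA_facts[OF c(1) ab] c(6) by simp
   show "HMap (TA q) (a, b) \<in> hom V (VHom (TO (GDom p)) (a, b)) (VHom (TO (GDom g)) (OMap q a, OMap q b))"
    using TA_facts[OF c(2) abq] c(5,7) by simp
   show "HMap (TA f) (OMap p a, OMap p b) \<in> hom V (VHom (TO (GDom f)) (OMap p a, OMap p b)) (VHom (TO (GCod f)) (OMap f (OMap p a), OMap f (OMap p b)))"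
    using TA_facts[OF c(3) v(1,2)] by simp
   show "HMap (TA g) (OMap q a, OMap q b) \<in> hom V (VHom (TO (GDom g)) (OMap q a, OMap q b)) (VHom (TO (GCod f)) (OMap f (OMap p a), OMap f (OMap p b)))"
    using TA_facts[OF c(4) v(3,4)] c(8) o ab by simp
  next
   fix r s assume rs: "r \<in> paths (Vert (GDom f)) (OMap p a) (OMap p b)" "s \<in> paths (Vert (GDom g)) (OMap q a) (OMap q b)"
    "map (OMap f) r = map (OMap g) s"
   show "\<exists>k\<in>paths (Vert (GDom p)) a b. map (OMap p) k = r \<and> map (OMap q) k = s"
    by (rule path_pullback_ex[OF V1 V2 ab rs])
  next
   fix k l assume "k \<in> paths (Vert (GDom p)) a b" "l \<in> paths (Vert (GDom p)) a b" "map (OMap p) k = map (OMap p) l" "map (OMap q) k = map (OMap q) l"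
   then show "k = l" using path_pullback_uniq[of "Vert (GDom p)" "OMap p" "OMap q" k l] V2 pathsD(1) by metis
  next
   fix k assume k: "k \<in> paths (Vert (GDom p)) a b"
   show "map (OMap p) k \<in> paths (Vert (GDom f)) (OMap p a) (OMap p b)" by (rule path_p[OF k])
   show "map (OMap q) k \<in> paths (Vert (GDom g)) (OMap q a) (OMap q b)" by (rule path_q[OF k])
   show "HMap (TA p) (a, b) ** inj (GDom p) k = inj (GDom f) (map (OMap p) k) ** EA (map (HMap p) (steps k))"
    using inj_natural'[OF c(1) k] c(6) by simp
   show "HMap (TA q) (a, b) ** inj (GDom p) k = inj (GDom g) (map (OMap q) k) ** EA (map (HMap q) (steps k))"
    using inj_natural'[OF c(2), of k a b] k c(5,7) by simp
   show "map (OMap f) (map (OMap p) k) = map (OMap g) (map (OMap q) k)"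
    using o pathsD(1)[OF k] by (auto simp: in_lists_conv_set)
   show "Dom V (EA (map (HMap p) (steps k))) = path_tensor E (GDom p) k"
    using EA_HMap_facts[OF c(1) pathsD(1)[OF k]] by (simp add: path_tensor_def)
   have st: "\<exists>x y. steps k ! n = (x, y) \<and> x \<in> Vert (GDom p) \<and> y \<in> Vert (GDom p)" if "n < length (steps k)" for n
    using steps_mem[OF pathsD(1)[OF k] nth_mem[OF that]] by (cases "steps k ! n") auto
   have "is_pullback (seq_cat V) (map (HMap p) (steps k)) (map (HMap q) (steps k))
     (map (HMap f) (steps (map (OMap p) k))) (map (HMap g) (steps (map (OMap q) k)))"
   proof (rule seq_pullbackI)
    fix n assume "n < length (map (HMap p) (steps k))"
    then have n: "n < length (steps k)" by simp
    obtain x y where xy: "steps k ! n = (x, y)" "x \<in> Vert (GDom p)" "y \<in> Vert (GDom p)" using st[OF n] by blast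
    show "is_pullback V (map (HMap p) (steps k) ! n) (map (HMap q) (steps k) ! n)
     (map (HMap f) (steps (map (OMap p) k)) ! n) (map (HMap g) (steps (map (OMap q) k)) ! n)"
     using pullback_graphs_hom[OF pb xy(2,3)] xy(1) n by (simp add: steps_map)
   qed (simp_all add: steps_map)
   then show "is_pullback V (EA (map (HMap p) (steps k))) (EA (map (HMap q) (steps k)))
     (EA (map (HMap f) (steps (map (OMap p) k)))) (EA (map (HMap g) (steps (map (OMap q) k))))"
    using E by (simp add: preserves_pullbacks_def)
  next
   fix r assume r: "r \<in> paths (Vert (GDom f)) (OMap p a) (OMap p b)"
   show "map (OMap f) r \<in> paths (Vert (GCod f)) (OMap f (OMap p a)) (OMap f (OMap p b))" by (rule paths_vgmap[OF c(3) r])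
   show "HMap (TA f) (OMap p a, OMap p b) ** inj (GDom f) r = inj (GCod f) (map (OMap f) r) ** EA (map (HMap f) (steps r))"
    by (rule inj_natural'[OF c(3) r])
   show "EA (map (HMap f) (steps r)) \<in> hom V (path_tensor E (GDom f) r) (path_tensor E (GCod f) (map (OMap f) r))"
    using EA_HMap_facts[OF c(3) pathsD(1)[OF r]] by (simp add: path_tensor_def)
  next
   fix s assume s: "s \<in> paths (Vert (GDom g)) (OMap q a) (OMap q b)"
   show "map (OMap g) s \<in> paths (Vert (GCod f)) (OMap f (OMap p a)) (OMap f (OMap p b))" by (rule path_g[OF s])
   show "HMap (TA g) (OMap q a, OMap q b) ** inj (GDom g) s = inj (GCod f) (map (OMap g) s) ** EA (map (HMap g) (steps s))"
    using inj_natural'[OF c(4) s] c(8) by simp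
   show "EA (map (HMap g) (steps s)) \<in> hom V (path_tensor E (GDom g) s) (path_tensor E (GCod f) (map (OMap g) s))"
    using EA_HMap_facts[OF c(4) pathsD(1)[OF s]] c(8) by (simp add: path_tensor_def)
  qed
  then show "is_pullback V (HMap (TA p) (a, b)) (HMap (TA q) (a, b)) (HMap (TA f) (OMap (TA p) a, OMap (TA p) b)) (HMap (TA g) (OMap (TA q) a, OMap (TA q) b))"
   by (simp add: T_OMap c(1-4))
 next
  show "\<And>x y. x \<in> Vert (GDom (TA f)) \<Longrightarrow> y \<in> Vert (GDom (TA g)) \<Longrightarrow> OMap (TA f) x = OMap (TA g) y \<Longrightarrow>
   \<exists>a\<in>Vert (GDom (TA p)). OMap (TA p) a = x \<and> OMap (TA q) a = y"
   using V1 by (simp add: T_OMap c(1-4) TA_vgmap T_Vert P(1) F(1) GG(1))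
  show "\<And>a b. a \<in> Vert (GDom (TA p)) \<Longrightarrow> b \<in> Vert (GDom (TA p)) \<Longrightarrow> OMap (TA p) a = OMap (TA p) b \<Longrightarrow>
   OMap (TA q) a = OMap (TA q) b \<Longrightarrow> a = b"
   using V2 by (simp add: T_OMap c(1-4) TA_vgmap T_Vert P(1))
 qed (use c(5-8) o in \<open>simp_all add: T_OMap c(1-4) TA_vgmap T_Vert P(1) Q(1)\<close>)
qed

text \<open>A hom of \<open>X\<close> or \<open>Y\<close> is regarded as a coproduct with the single
  index \<open>()\<close>. The index square is a pullback because a path from \<open>a\<close> to
  \<open>b\<close> whose image has one step is \<open>[a, b]\<close>.\<close>

lemma unit_cartesian_T:
 assumes E: "is_cartesian_nat V V (id_fctr V) (unary_part V E) (EUnit E)"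
  and nat: "is_nat Gr Gr (id_fctr Gr) (MFun T) (MUnit T)"
 shows "is_cartesian_nat Gr Gr (id_fctr Gr) (MFun T) (MUnit T)"
 unfolding is_cartesian_nat_def
proof (intro conjI ballI nat)
 have Epb: "is_pullback V (EUnit E (Dom V f)) f (EA [f]) (EUnit E (Cod V f))" if "f \<in> Arr V" for f
  using E that by (simp add: is_cartesian_nat_def id_fctr_def unary_part_def comp_fctr_def seq_unit_def)
 fix f assume "f \<in> Arr Gr"
 then have f: "f \<in> vgmaps U V" by simp
 let ?X = "GDom f" and ?Y = "GCod f"
 note F = vgmap_facts[OF f] and UX = T_unit[OF vgmap_facts(1)[OF f]] and UY = T_unit[OF vgmap_facts(2)[OF f]]
 have "is_pullback Gr (MUnit T ?X) f (TA f) (MUnit T ?Y)"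
 proof (rule pullback_graphsI)
  fix a b assume "a \<in> Vert (GDom (MUnit T ?X))" "b \<in> Vert (GDom (MUnit T ?X))"
  then have ab: "a \<in> Vert ?X" "b \<in> Vert ?X" using UX by auto
  have fab: "OMap f a \<in> Vert ?Y" "OMap f b \<in> Vert ?Y" using F(3) ab by auto
  have p: "[a, b] \<in> paths (Vert ?X) a b" and p': "[OMap f a, OMap f b] \<in> paths (Vert ?Y) (OMap f a) (OMap f b)"
   using ab fab by simp_all
  have hO: "VHom ?X (a, b) \<in> Obj V" "VHom ?Y (OMap f a, OMap f b) \<in> Obj V"
   using vgraph_facts(2)[OF F(1) ab] vgraph_facts(2)[OF F(2) fab] by auto
  note u = E_unit_facts[OF hO(1)] and u' = E_unit_facts[OF hO(2)]
  have "is_pullback V (HMap (MUnit T ?X) (a, b)) (HMap f (a, b)) (HMap (TA f) (a, b)) (HMap (MUnit T ?Y) (OMap f a, OMap f b))"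
  proof (rule coproduct_pullback[where pI = "\<lambda>_. [a, b]" and qI = "\<lambda>x. x" and fI = "map (OMap f)"
     and gI = "\<lambda>_. [OMap f a, OMap f b]" and pk = "\<lambda>_. EUnit E (VHom ?X (a, b))" and qk = "\<lambda>_. HMap f (a, b)"
     and fi = "\<lambda>t. EA (map (HMap f) (steps t))" and gj = "\<lambda>_. EUnit E (VHom ?Y (OMap f a, OMap f b))",
     OF small_finite small_paths[OF F(1)] small_finite small_paths[OF F(2)]
     coproduct_singleton[OF hO(1), where x = "()"] inj_coproduct[OF F(1) ab] coproduct_singleton[OF hO(2), where x = "()"]
     inj_coproduct[OF F(2) fab]])
   fix r j assume r: "r \<in> paths (Vert ?X) a b" and "map (OMap f) r = [OMap f a, OMap f b]"
   then have "length r = 2" by (metis length_Cons length_map list.size(3) numeral_2_eq_2)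
   then have "r = [a, b]" using pathsD(2-4)[OF r] by (cases r; cases "tl r") auto
   then show "\<exists>k\<in>{()}. [a, b] = r \<and> k = j" by simp
  next
   fix r assume r: "r \<in> paths (Vert ?X) a b"
   show "map (OMap f) r \<in> paths (Vert ?Y) (OMap f a) (OMap f b)" by (rule paths_vgmap[OF f r])
   show "HMap (TA f) (a, b) ** inj ?X r = inj ?Y (map (OMap f) r) ** EA (map (HMap f) (steps r))" by (rule inj_natural'[OF f r])
   show "EA (map (HMap f) (steps r)) \<in> hom V (path_tensor E ?X r) (path_tensor E ?Y (map (OMap f) r))"
    using EA_HMap_facts[OF f pathsD(1)[OF r]] by (simp add: path_tensor_def)
  next
   show "is_pullback V (EUnit E (VHom ?X (a, b))) (HMap f (a, b)) (EA (map (HMap f) (steps [a, b]))) (EUnit E (VHom ?Y (OMap f a, OMap f b)))"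
    using Epb[OF F(4)[OF ab]] F(5,6)[OF ab] by simp
  qed (use unit_facts[OF F(1) ab] unit_facts[OF F(2) fab] TA_facts[OF f ab] F(4-6)[OF ab] p p' u u' inj_unit[OF F(1) ab]
    inj_unit[OF F(2) fab] inj_facts[OF F(1) p] inj_facts[OF F(2) p'] in \<open>simp_all add: path_tensor_def\<close>)
  then show "is_pullback V (HMap (MUnit T ?X) (a, b)) (HMap f (a, b)) (HMap (TA f) (OMap (MUnit T ?X) a, OMap (MUnit T ?X) b))
    (HMap (MUnit T ?Y) (OMap f a, OMap f b))"
   using UX ab by simp
 qed (use f F UX UY TA_vgmap[OF f] T_OMap[OF f] T_Vert[OF F(1)] in auto)
 then show "is_pullback Gr (MUnit T (Dom Gr f)) (FArr (id_fctr Gr) f) (TA f) (MUnit T (Cod Gr f))"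
  using f by (simp add: id_fctr_def)
qed

text \<open>The index square is a pullback because a path \<open>r\<close> of the domain, together
  with a decomposition of its image, decomposes in the same way: \<open>r\<close> is cut at the same
  lengths.\<close>

lemma mult_cartesian_T:
 assumes E: "is_cartesian_nat (seq_cat (seq_cat V)) V (nested V E) (flattened V E) (ESubst E)"
  and nat: "is_nat Gr Gr (comp_fctr Gr (MFun T) (MFun T)) (MFun T) (MMult T)"
 shows "is_cartesian_nat Gr Gr (comp_fctr Gr (MFun T) (MFun T)) (MFun T) (MMult T)"
 unfolding is_cartesian_nat_def
proof (intro conjI ballI nat)
 have Epb: "is_pullback V (ESubst E (map (map (Dom V)) fss)) (EA (map EA fss)) (EA (concat fss)) (ESubst E (map (map (Cod V)) fss))"
  if "fss \<in> lists (lists (Arr V))" for fss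
  using E that by (simp add: is_cartesian_nat_def nested_def flattened_def comp_fctr_def seq_concat_def seq_map_def seq_cat_def)
 fix f assume "f \<in> Arr Gr"
 then have f: "f \<in> vgmaps U V" by simp
 let ?X = "GDom f" and ?Y = "GCod f"
 note F = vgmap_facts[OF f] and MX = T_mult[OF vgmap_facts(1)[OF f]] and MY = T_mult[OF vgmap_facts(2)[OF f]]
 note T1 = TA_vgmap[OF f] and T2 = TA_vgmap[OF TA_vgmap(1)[OF f]]
 have VX: "Vert (TO (TO ?X)) = Vert ?X" "Vert (TO ?X) = Vert ?X" using T_Vert F(1) by simp_all
 have VY: "Vert (TO (TO ?Y)) = Vert ?Y" "Vert (TO ?Y) = Vert ?Y" using T_Vert F(2) by simp_all
 have o2: "OMap (TA (TA f)) = OMap f" using T_OMap[OF T1(1)] T_OMap[OF f] by simp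
 have "is_pullback Gr (MMult T ?X) (TA (TA f)) (TA f) (MMult T ?Y)"
 proof (rule pullback_graphsI)
  fix a b assume "a \<in> Vert (GDom (MMult T ?X))" "b \<in> Vert (GDom (MMult T ?X))"
  then have ab: "a \<in> Vert ?X" "b \<in> Vert ?X" using MX VX by auto
  have fab: "OMap f a \<in> Vert ?Y" "OMap f b \<in> Vert ?Y" using F(3) ab by auto
  have tt: "HMap (TA (TA f)) (a, b) \<in> hom V (VHom (TO (TO ?X)) (a, b)) (VHom (TO (TO ?Y)) (OMap f a, OMap f b))"
   using TA_facts[OF T1(1), of a b] T1 T_OMap[OF f] VX ab by simp
  let ?IX = "Sigma (paths (Vert ?X) a b) (refinements (Vert ?X))" and ?IY = "Sigma (paths (Vert ?Y) (OMap f a) (OMap f b)) (refinements (Vert ?Y))"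
  have "is_pullback V (HMap (MMult T ?X) (a, b)) (HMap (TA (TA f)) (a, b)) (HMap (TA f) (a, b)) (HMap (MMult T ?Y) (OMap f a, OMap f b))"
  proof (rule coproduct_pullback[where pI = "\<lambda>(p, qs). glue p qs" and qI = "\<lambda>(p, qs). (map (OMap f) p, map (map (OMap f)) qs)"
     and fI = "map (OMap f)" and gI = "\<lambda>(p, qs). glue p qs"
     and pk = "\<lambda>(p, qs). ESubst E (map (lab ?X) qs)" and qk = "\<lambda>(p, qs). EA (map (\<lambda>q. EA (map (HMap f) (steps q))) qs)"
     and fi = "\<lambda>t. EA (map (HMap f) (steps t))" and gj = "\<lambda>(p, qs). ESubst E (map (lab ?Y) qs)",
     OF small_Sigma_paths[OF F(1)] small_paths[OF F(1)] small_Sigma_paths[OF F(2)] small_paths[OF F(2)]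
     TTO_coproduct[OF F(1) ab] inj_coproduct[OF F(1) ab] TTO_coproduct[OF F(2) fab] inj_coproduct[OF F(2) fab]])
   show "HMap (MMult T ?X) (a, b) \<in> hom V (VHom (TO (TO ?X)) (a, b)) (VHom (TO ?X) (a, b))" using mult_facts[OF F(1) ab] by simp
   show "HMap (MMult T ?Y) (OMap f a, OMap f b) \<in> hom V (VHom (TO (TO ?Y)) (OMap f a, OMap f b)) (VHom (TO ?Y) (OMap f a, OMap f b))"
    using mult_facts[OF F(2) fab] by simp
   show "HMap (TA f) (a, b) \<in> hom V (VHom (TO ?X) (a, b)) (VHom (TO ?Y) (OMap f a, OMap f b))" using TA_facts[OF f ab] by simp
  next
   fix r t assume r: "r \<in> paths (Vert ?X) a b" and t: "t \<in> ?IY" and e: "map (OMap f) r = (case t of (p, qs) \<Rightarrow> glue p qs)"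
   obtain p' qs' where t': "t = (p', qs')" "p' \<in> paths (Vert ?Y) (OMap f a) (OMap f b)" "qs' \<in> refinements (Vert ?Y) p'" using t by auto
   have "length (glue p' qs') - 1 = sum_list (map (\<lambda>q. length q - 1) qs')"
    by (simp add: glue_def length_concat comp_def)
   then have l: "sum_list (map (\<lambda>q. length q - 1) qs') = length r - 1" using arg_cong[OF e, of length] t'(1) by simp
   obtain p qs where p: "p \<in> paths (Vert ?X) (hd r) (last r)" "qs \<in> refinements (Vert ?X) p" "glue p qs = r"
    "map (\<lambda>q. length q - 1) qs = map (\<lambda>q. length q - 1) qs'"
    by (rule path_split[OF pathsD(1,2)[OF r] l])
   have pab: "p \<in> paths (Vert ?X) a b" using p(1) pathsD(3,4)[OF r] by simp
   \<comment> \<open>Pieces are nonempty, so equal numbers of steps mean equal lengths in spite of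
     truncated subtraction.\<close>
   have ne: "length q \<ge> 1" if "q \<in> set qs \<union> set qs'" for q
    using that refinements_paths[OF p(2), of q] refinements_paths[OF t'(3), of q] pathsD(2) by (cases q) force+
   have ne': "length q = Suc (length q - 1)" if "q \<in> set qs \<union> set qs'" for q using ne[OF that] by simp
   have "map length qs = map (\<lambda>q. Suc (length q - 1)) qs" by (rule map_cong[OF refl], rule ne') simp
   also have "\<dots> = map (\<lambda>q. Suc (length q - 1)) qs'" using arg_cong[OF p(4), of "map Suc"] by (simp add: comp_def)
   also have "\<dots> = map length qs'" by (rule map_cong[OF refl], rule ne'[symmetric]) simp
   finally have ll: "map length (map (map (OMap f)) qs) = map length qs'" by (simp add: comp_def)
   have g: "glue (map (OMap f) p) (map (map (OMap f)) qs) = glue p' qs'"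
    using e p(3) glue_map[OF p(2) pathsD(2)[OF p(1)], of "OMap f"] t'(1) by simp
   have "map (OMap f) p = p' \<and> map (map (OMap f)) qs = qs'"
    by (rule glue_inj[OF refinements_vgmap[OF f p(2)] _ t'(3) pathsD(2)[OF t'(2)] g ll]) (use pathsD(2)[OF p(1)] in simp)
   then show "\<exists>k\<in>?IX. (case k of (p, qs) \<Rightarrow> glue p qs) = r \<and> (case k of (p, qs) \<Rightarrow> (map (OMap f) p, map (map (OMap f)) qs)) = t"
    using pab p(2,3) t'(1) by (intro bexI[of _ "(p, qs)"]) auto
  next
   fix k l assume "k \<in> ?IX" "l \<in> ?IX" and e: "(case k of (p, qs) \<Rightarrow> glue p qs) = (case l of (p, qs) \<Rightarrow> glue p qs)"
    "(case k of (p, qs) \<Rightarrow> (map (OMap f) p, map (map (OMap f)) qs)) = (case l of (p, qs) \<Rightarrow> (map (OMap f) p, map (map (OMap f)) qs))"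
   then obtain p qs p' qs' where k: "k = (p, qs)" "p \<in> paths (Vert ?X) a b" "qs \<in> refinements (Vert ?X) p"
    and l: "l = (p', qs')" "p' \<in> paths (Vert ?X) a b" "qs' \<in> refinements (Vert ?X) p'" by auto
   have m: "map (map (OMap f)) qs = map (map (OMap f)) qs'" using e(2) k(1) l(1) by simp
   have "map length qs = map length qs'" using arg_cong[OF m, of "map length"] by (simp add: comp_def)
   then have "p = p' \<and> qs = qs'"
    using glue_inj[OF k(3) pathsD(2)[OF k(2)] l(3) pathsD(2)[OF l(2)]] e(1) k(1) l(1) by simp
   then show "k = l" using k(1) l(1) by simp
  next
   fix k assume "k \<in> ?IX"
   then obtain p qs where k: "k = (p, qs)" and p: "p \<in> paths (Vert ?X) a b" and qs: "qs \<in> refinements (Vert ?X) p" by auto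
   note g = glue_paths[OF p qs]
   have q: "q \<in> lists (Vert ?X)" if "q \<in> set qs" for q using refinements_lists[OF qs] that by auto
   show "(case k of (p, qs) \<Rightarrow> glue p qs) \<in> paths (Vert ?X) a b" using g k by simp
   show "(case k of (p, qs) \<Rightarrow> (map (OMap f) p, map (map (OMap f)) qs)) \<in> ?IY"
    using paths_vgmap[OF f p] refinements_vgmap[OF f qs] k by simp
   show "map (OMap f) (case k of (p, qs) \<Rightarrow> glue p qs) =
     (case case k of (p, qs) \<Rightarrow> (map (OMap f) p, map (map (OMap f)) qs) of (p, qs) \<Rightarrow> glue p qs)"
    using glue_map[OF qs pathsD(2)[OF p]] k by simp
   show "HMap (MMult T ?X) (a, b) ** (case k of (p, qs) \<Rightarrow> inj (TO ?X) p ** EA (map (inj ?X) qs)) =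
     inj ?X (case k of (p, qs) \<Rightarrow> glue p qs) ** (case k of (p, qs) \<Rightarrow> ESubst E (map (lab ?X) qs))"
    using inj_mult'[OF F(1) p qs] k by simp
   show "HMap (TA (TA f)) (a, b) ** (case k of (p, qs) \<Rightarrow> inj (TO ?X) p ** EA (map (inj ?X) qs)) =
     (case case k of (p, qs) \<Rightarrow> (map (OMap f) p, map (map (OMap f)) qs) of (p, qs) \<Rightarrow> inj (TO ?Y) p ** EA (map (inj ?Y) qs)) **
      (case k of (p, qs) \<Rightarrow> EA (map (\<lambda>q. EA (map (HMap f) (steps q))) qs))"
    using TTA_inj2[OF f p qs] k by (simp only: prod.case fst_conv snd_conv)
   show "Dom V (case k of (p, qs) \<Rightarrow> ESubst E (map (lab ?X) qs)) = (case k of (p, qs) \<Rightarrow> EO (map EO (map (lab ?X) qs)))"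
    using subst_lab_facts[OF F(1) qs] k by simp
   define fss where "fss = map (\<lambda>q. map (HMap f) (steps q)) qs"
   have fA: "fss \<in> lists (lists (Arr V))"
   proof (rule in_listsI, rule ballI)
    fix fs assume "fs \<in> set fss"
    then obtain q' where "q' \<in> set qs" "fs = map (HMap f) (steps q')" by (auto simp: fss_def)
    then show "fs \<in> lists (Arr V)" using map_HMap_facts(1)[OF f q] by simp
   qed
   have D: "map (map (Dom V)) fss = map (lab ?X) qs" using map_HMap_facts(2)[OF f q] by (simp add: fss_def)
   have C: "map (map (Cod V)) fss = map (lab ?Y) (map (map (OMap f)) qs)" using map_HMap_facts(3)[OF f q] by (simp add: fss_def)
   have cc: "concat fss = map (HMap f) (steps (glue p qs))"
    using steps_glue[OF qs pathsD(2)[OF p]] by (simp add: fss_def map_concat comp_def)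
   have ee: "map EA fss = map (\<lambda>q. EA (map (HMap f) (steps q))) qs" by (simp add: fss_def)
   show "is_pullback V (case k of (p, qs) \<Rightarrow> ESubst E (map (lab ?X) qs)) (case k of (p, qs) \<Rightarrow> EA (map (\<lambda>q. EA (map (HMap f) (steps q))) qs))
     (EA (map (HMap f) (steps (case k of (p, qs) \<Rightarrow> glue p qs))))
     (case case k of (p, qs) \<Rightarrow> (map (OMap f) p, map (map (OMap f)) qs) of (p, qs) \<Rightarrow> ESubst E (map (lab ?Y) qs))"
    using Epb[OF fA] unfolding D C cc ee k prod.case .
  next
   fix r assume r: "r \<in> paths (Vert ?X) a b"
   show "map (OMap f) r \<in> paths (Vert ?Y) (OMap f a) (OMap f b)" by (rule paths_vgmap[OF f r])
   show "HMap (TA f) (a, b) ** inj ?X r = inj ?Y (map (OMap f) r) ** EA (map (HMap f) (steps r))" by (rule inj_natural'[OF f r])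
   show "EA (map (HMap f) (steps r)) \<in> hom V (path_tensor E ?X r) (path_tensor E ?Y (map (OMap f) r))"
    using EA_HMap_facts[OF f pathsD(1)[OF r]] by (simp add: path_tensor_def)
  next
   fix t assume "t \<in> ?IY"
   then obtain p qs where t: "t = (p, qs)" and p: "p \<in> paths (Vert ?Y) (OMap f a) (OMap f b)" and qs: "qs \<in> refinements (Vert ?Y) p" by auto
   show "(case t of (p, qs) \<Rightarrow> glue p qs) \<in> paths (Vert ?Y) (OMap f a) (OMap f b)" using glue_paths[OF p qs] t by simp
   show "HMap (MMult T ?Y) (OMap f a, OMap f b) ** (case t of (p, qs) \<Rightarrow> inj (TO ?Y) p ** EA (map (inj ?Y) qs)) =
     inj ?Y (case t of (p, qs) \<Rightarrow> glue p qs) ** (case t of (p, qs) \<Rightarrow> ESubst E (map (lab ?Y) qs))"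
    using inj_mult'[OF F(2) p qs] t by simp
   show "(case t of (p, qs) \<Rightarrow> ESubst E (map (lab ?Y) qs)) \<in> hom V (case t of (p, qs) \<Rightarrow> EO (map EO (map (lab ?Y) qs)))
     (path_tensor E ?Y (case t of (p, qs) \<Rightarrow> glue p qs))"
    using subst_lab_facts[OF F(2) qs] lab_glue[OF qs pathsD(2)[OF p]] t by (simp add: path_tensor_def)
  qed (rule tt)
  then show "is_pullback V (HMap (MMult T ?X) (a, b)) (HMap (TA (TA f)) (a, b)) (HMap (TA f) (OMap (MMult T ?X) a, OMap (MMult T ?X) b))
    (HMap (MMult T ?Y) (OMap (TA (TA f)) a, OMap (TA (TA f)) b))"
   using MX ab o2 by simp
 qed (use F MX MY T1 T2 T_OMap[OF f] o2 VX VY in auto)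
 then show "is_pullback Gr (MMult T (Dom Gr f)) (FArr (comp_fctr Gr (MFun T) (MFun T)) f) (TA f) (MMult T (Cod Gr f))"
  using f by (simp add: comp_fctr_def)
qed

theorem cartesian_monad_if_cartesian_multitensor:
 assumes "is_cartesian_multitensor V E" shows "is_cartesian_monad Gr T"
proof -
 have m: "is_monad Gr T" using assms multitensor_iff_monad by (simp add: is_cartesian_multitensor_def)
 then show ?thesis
  using preserves_pullbacks_T unit_cartesian_T mult_cartesian_T assms
  unfolding is_cartesian_monad_def is_cartesian_multitensor_def is_monad_def by blast
qed

lemma over_Set_T: "over_Set U V T"
 unfolding over_Set_def id_on_objects_def using T_Vert T_OMap T_unit T_mult by simp

end

section \<open>Morphisms of presentations\<close>

text \<open>\<psi> restricts to \<phi> on the summand of every path. Extensionality of both lets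
  each be determined by the other as a whole function. Naturality is left out, so that it can be
  transferred along the relation.\<close>

definition related where
 "related U V A S i B T j \<phi> \<psi> \<longleftrightarrow>
   (\<forall>Z\<in>lists (Obj V). \<phi> Z \<in> hom V (FObj (EFun A) Z) (FObj (EFun B) Z)) \<and>
   \<phi> \<in> extensional (lists (Obj V)) \<and> \<psi> \<in> extensional (vgraphs U V) \<and>
   (\<forall>X\<in>vgraphs U V. \<psi> X \<in> vgmaps U V \<and> GDom (\<psi> X) = FObj (MFun S) X \<and> GCod (\<psi> X) = FObj (MFun T) X \<and>
    OMap (\<psi> X) = (\<lambda>a\<in>Vert X. a) \<and>
    (\<forall>a b. \<forall>p\<in>paths (Vert X) a b. Comp V (HMap (\<psi> X) (a, b)) (i X p) = Comp V (j X p) (\<phi> (map (VHom X) (steps p)))))"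

locale presentation_pair = extensive_category U V + A: presentation U V A S i + B: presentation U V B T j
 for U :: "'i set set" and V :: "('o, 'a) cat"
  and A :: "('o, 'a) multitensor" and S :: "(('i, 'o) vgraph, ('i, 'o, 'a) vgmap) monad" and i
  and B :: "('o, 'a) multitensor" and T :: "(('i, 'o) vgraph, ('i, 'o, 'a) vgmap) monad" and j
begin

abbreviation rel where "rel \<equiv> related U V A S i B T j"
abbreviation lab where "lab X p \<equiv> map (VHom X) (steps p)"

lemma rel_phi:
 assumes "rel \<phi> \<psi>" "Z \<in> lists (Obj V)"
 shows "\<phi> Z \<in> Arr V" "Dom V (\<phi> Z) = A.EO Z" "Cod V (\<phi> Z) = B.EO Z"
 using assms by (auto simp: related_def)

lemma rel_psi:
 assumes "rel \<phi> \<psi>" "X \<in> vgraphs U V"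
 shows "\<psi> X \<in> vgmaps U V" "GDom (\<psi> X) = A.TO X" "GCod (\<psi> X) = B.TO X" "OMap (\<psi> X) = (\<lambda>a\<in>Vert X. a)"
 using assms by (auto simp: related_def)

lemma rel_inj:
 assumes "rel \<phi> \<psi>" "X \<in> vgraphs U V" "p \<in> paths (Vert X) a b"
 shows "HMap (\<psi> X) (a, b) ** i X p = j X p ** \<phi> (lab X p)"
 using assms by (auto simp: related_def)

lemma rel_psi_hom:
 assumes r: "rel \<phi> \<psi>" and X: "X \<in> vgraphs U V" and ab: "a \<in> Vert X" "b \<in> Vert X"
 shows "HMap (\<psi> X) (a, b) \<in> Arr V" "Dom V (HMap (\<psi> X) (a, b)) = VHom (A.TO X) (a, b)"
  "Cod V (HMap (\<psi> X) (a, b)) = VHom (B.TO X) (a, b)"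
 using vgmap_facts(4-6)[OF rel_psi(1)[OF r X], of a b] rel_psi[OF r X] A.T_Vert[OF X] ab by simp_all

section \<open>Transformations of multitensors and of functors on graphs determine each
  other\<close>

text \<open>Coprojections are jointly epic.\<close>

lemma rel_unique:
 assumes r: "rel \<phi> \<psi>" and r': "rel \<phi> \<psi>'" shows "\<psi> = \<psi>'"
proof (rule extensionalityI[of _ "vgraphs U V"])
 fix X assume X: "X \<in> vgraphs U V"
 note P = rel_psi[OF r X] and P' = rel_psi[OF r' X]
 show "\<psi> X = \<psi>' X"
 proof (rule vgmap_eqI[OF P(1) P'(1) P(2) P'(2)])
  fix a b assume "a \<in> Vert (A.TO X)" "b \<in> Vert (A.TO X)"
  then have ab: "a \<in> Vert X" "b \<in> Vert X" using A.T_Vert[OF X] by auto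
  show "HMap (\<psi> X) (a, b) = HMap (\<psi>' X) (a, b)"
   by (rule coproduct_eqI[OF A.inj_coproduct[OF X ab]])
    (simp_all add: rel_psi_hom[OF r X ab] rel_psi_hom[OF r' X ab] rel_inj[OF r X] rel_inj[OF r' X])
 qed (simp_all add: P P')
qed (use r r' in \<open>auto simp: related_def\<close>)

text \<open>Every sequence labels a standard path, and the coprojection of that path is
  monic.\<close>

lemma rel_unique_phi:
 assumes r: "rel \<phi> \<psi>" and r': "rel \<phi>' \<psi>" shows "\<phi> = \<phi>'"
proof (rule extensionalityI[of _ "lists (Obj V)"])
 fix Z assume Z: "Z \<in> lists (Obj V)"
 note X = gr_vgraph[OF Z] and p = std_paths[of Z]
 have "j (gr Z) (std (length Z)) ** \<phi> Z = j (gr Z) (std (length Z)) ** \<phi>' Z"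
  using rel_inj[OF r X p] rel_inj[OF r' X p] by simp
 then show "\<phi> Z = \<phi>' Z"
  by (rule mono_arrD[OF B.inj_mono[OF X p]])
   (use rel_phi[OF r Z] rel_phi[OF r' Z] B.inj_facts[OF X p] in simp_all)
qed (use r r' in \<open>auto simp: related_def\<close>)

lemma rel_exists:
 assumes "\<And>Z. Z \<in> lists (Obj V) \<Longrightarrow> \<phi> Z \<in> hom V (A.EO Z) (B.EO Z)" "\<phi> \<in> extensional (lists (Obj V))"
 obtains \<psi> where "rel \<phi> \<psi>"
proof -
 have "\<exists>u. u \<in> hom V (VHom (A.TO X) (a, b)) (VHom (B.TO X) (a, b)) \<and>
   (\<forall>p\<in>paths (Vert X) a b. u ** i X p = j X p ** \<phi> (lab X p))"
  if X: "X \<in> vgraphs U V" and ab: "a \<in> Vert X" "b \<in> Vert X" for X a b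
 proof (rule coproduct_lift[OF A.inj_coproduct[OF X ab]])
  show "VHom (B.TO X) (a, b) \<in> Obj V" using coproduct_facts(1)[OF B.inj_coproduct[OF X ab]] .
  fix p assume p: "p \<in> paths (Vert X) a b"
  show "j X p ** \<phi> (lab X p) \<in> hom V (path_tensor A X p) (VHom (B.TO X) (a, b))"
   using B.inj_facts[OF X p] assms(1)[OF lab_lists[OF X pathsD(1)[OF p]]] by (simp add: path_tensor_def)
 qed auto
 then obtain u where u: "\<And>X a b. X \<in> vgraphs U V \<Longrightarrow> a \<in> Vert X \<Longrightarrow> b \<in> Vert X \<Longrightarrow>
   u X a b \<in> hom V (VHom (A.TO X) (a, b)) (VHom (B.TO X) (a, b)) \<and>
   (\<forall>p\<in>paths (Vert X) a b. u X a b ** i X p = j X p ** \<phi> (lab X p))" by metis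
 define \<psi> where "\<psi> = (\<lambda>X\<in>vgraphs U V. \<lparr>GDom = A.TO X, GCod = B.TO X, OMap = (\<lambda>a\<in>Vert X. a),
   HMap = (\<lambda>(a, b)\<in>Vert X \<times> Vert X. u X a b)\<rparr>)"
 have "rel \<phi> \<psi>"
  unfolding related_def
 proof (intro conjI ballI allI)
  fix X assume X: "X \<in> vgraphs U V"
  show "\<psi> X \<in> vgmaps U V"
   by (rule vgmapI[OF A.TO_vgraph[OF X] B.TO_vgraph[OF X]])
    (use X u[OF X] A.T_Vert[OF X] B.T_Vert[OF X] in \<open>auto simp: \<psi>_def\<close>)
  fix a b p assume p: "p \<in> paths (Vert X) a b"
  show "HMap (\<psi> X) (a, b) ** i X p = j X p ** \<phi> (lab X p)"
   using u[OF X pathsD(5,6)[OF p]] p X pathsD(5,6)[OF p] by (simp add: \<psi>_def)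
 qed (use assms in \<open>auto simp: \<psi>_def\<close>)
 then show ?thesis using that by blast
qed

lemma phi_nat_iff:
 assumes r: "rel \<phi> \<psi>"
 shows "is_nat (seq_cat V) V (EFun A) (EFun B) \<phi> \<longleftrightarrow>
  (\<forall>fs\<in>lists (Arr V). B.EA fs ** \<phi> (map (Dom V) fs) = \<phi> (map (Cod V) fs) ** A.EA fs)"
 using r unfolding is_nat_def by (auto simp: related_def)

lemma psi_nat_iff:
 assumes r: "rel \<phi> \<psi>"
 shows "is_nat Gr Gr (MFun S) (MFun T) \<psi> \<longleftrightarrow>
  (\<forall>f\<in>vgmaps U V. Comp Gr (B.TA f) (\<psi> (GDom f)) = Comp Gr (\<psi> (GCod f)) (A.TA f))"
 using r unfolding is_nat_def by (auto simp: related_def)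

lemma natural_left:
 assumes r: "rel \<phi> \<psi>" and f: "f \<in> vgmaps U V" and p: "p \<in> paths (Vert (GDom f)) a b"
 shows "(HMap (B.TA f) (a, b) ** HMap (\<psi> (GDom f)) (a, b)) ** i (GDom f) p =
  j (GCod f) (map (OMap f) p) ** B.EA (map (HMap f) (steps p)) ** \<phi> (lab (GDom f) p)"
proof -
 let ?X = "GDom f" and ?Y = "GCod f"
 note F = vgmap_facts[OF f]
 note X = F(1) and Y = F(2)
 note ab = pathsD(5,6)[OF p]
 note t = B.TA_facts[OF f ab] and s = rel_psi_hom[OF r X ab] and ii = A.inj_facts[OF X p] and jj = B.inj_facts[OF X p]
  and ph = rel_phi[OF r lab_lists[OF X pathsD(1)[OF p]]] and jY = B.inj_facts[OF Y paths_vgmap[OF f p]]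
  and h = B.EA_HMap_facts[OF f pathsD(1)[OF p]]
 have "(HMap (B.TA f) (a, b) ** HMap (\<psi> ?X) (a, b)) ** i ?X p = HMap (B.TA f) (a, b) ** HMap (\<psi> ?X) (a, b) ** i ?X p"
  by (rule Comp_assoc) (simp_all only: t s ii)
 also have "\<dots> = (HMap (B.TA f) (a, b) ** j ?X p) ** \<phi> (lab ?X p)"
  unfolding rel_inj[OF r X p] by (rule Comp_assoc[symmetric]) (simp_all only: t jj ph)
 also have "\<dots> = j ?Y (map (OMap f) p) ** B.EA (map (HMap f) (steps p)) ** \<phi> (lab ?X p)"
  unfolding B.inj_natural'[OF f p] by (rule Comp_assoc) (simp_all only: jY h ph)
 finally show ?thesis .
qed

lemma natural_right:
 assumes r: "rel \<phi> \<psi>" and f: "f \<in> vgmaps U V" and p: "p \<in> paths (Vert (GDom f)) a b"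
 shows "(HMap (\<psi> (GCod f)) (OMap f a, OMap f b) ** HMap (A.TA f) (a, b)) ** i (GDom f) p =
  j (GCod f) (map (OMap f) p) ** \<phi> (lab (GCod f) (map (OMap f) p)) ** A.EA (map (HMap f) (steps p))"
proof -
 let ?X = "GDom f" and ?Y = "GCod f"
 note F = vgmap_facts[OF f]
 note X = F(1) and Y = F(2)
 note ab = pathsD(5,6)[OF p]
 note fab = F(3)[OF ab(1)] F(3)[OF ab(2)] and fp = paths_vgmap[OF f p]
 note t = A.TA_facts[OF f ab] and s = rel_psi_hom[OF r Y fab] and ii = A.inj_facts[OF X p] and iY = A.inj_facts[OF Y fp]
  and ph = rel_phi[OF r lab_lists[OF Y pathsD(1)[OF fp]]] and jY = B.inj_facts[OF Y fp]
  and h = A.EA_HMap_facts[OF f pathsD(1)[OF p]]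
 have "(HMap (\<psi> ?Y) (OMap f a, OMap f b) ** HMap (A.TA f) (a, b)) ** i ?X p =
   HMap (\<psi> ?Y) (OMap f a, OMap f b) ** HMap (A.TA f) (a, b) ** i ?X p"
  by (rule Comp_assoc) (simp_all only: t s ii)
 also have "\<dots> = (HMap (\<psi> ?Y) (OMap f a, OMap f b) ** i ?Y (map (OMap f) p)) ** A.EA (map (HMap f) (steps p))"
  unfolding A.inj_natural'[OF f p] by (rule Comp_assoc[symmetric]) (simp_all only: s iY h)
 also have "\<dots> = j ?Y (map (OMap f) p) ** \<phi> (lab ?Y (map (OMap f) p)) ** A.EA (map (HMap f) (steps p))"
  unfolding rel_inj[OF r Y fp] by (rule Comp_assoc) (simp_all only: jY h ph)
 finally show ?thesis .
qed

text \<open>One direction compares summand by summand; the other tests on \<open>grf fs\<close> and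
  cancels the coprojection of the standard path.\<close>

lemma natural_iff:
 assumes r: "rel \<phi> \<psi>"
 shows "is_nat (seq_cat V) V (EFun A) (EFun B) \<phi> \<longleftrightarrow> is_nat Gr Gr (MFun S) (MFun T) \<psi>"
 unfolding phi_nat_iff[OF r] psi_nat_iff[OF r]
proof
 assume E: "\<forall>fs\<in>lists (Arr V). B.EA fs ** \<phi> (map (Dom V) fs) = \<phi> (map (Cod V) fs) ** A.EA fs"
 show "\<forall>f\<in>vgmaps U V. Comp Gr (B.TA f) (\<psi> (GDom f)) = Comp Gr (\<psi> (GCod f)) (A.TA f)"
 proof
  fix f assume f: "f \<in> vgmaps U V"
  note F = vgmap_facts[OF f] and SA = A.TA_vgmap[OF f] and TB = B.TA_vgmap[OF f]
  note PX = rel_psi[OF r F(1)] and PY = rel_psi[OF r F(2)] and VX = A.T_Vert[OF F(1)]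
  show "Comp Gr (B.TA f) (\<psi> (GDom f)) = Comp Gr (\<psi> (GCod f)) (A.TA f)"
  proof (rule vgmap_eqI[where X = "A.TO (GDom f)"])
   fix a b assume "a \<in> Vert (A.TO (GDom f))" "b \<in> Vert (A.TO (GDom f))"
   then have ab: "a \<in> Vert (GDom f)" "b \<in> Vert (GDom f)" using VX by auto
   note t = B.TA_facts[OF f ab] and s = rel_psi_hom[OF r F(1) ab] and t' = A.TA_facts[OF f ab]
    and s' = rel_psi_hom[OF r F(2) F(3)[OF ab(1)] F(3)[OF ab(2)]]
   have "HMap (B.TA f) (a, b) ** HMap (\<psi> (GDom f)) (a, b) =
     HMap (\<psi> (GCod f)) (OMap f a, OMap f b) ** HMap (A.TA f) (a, b)"
   proof (rule coproduct_eqI[OF A.inj_coproduct[OF F(1) ab]])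
    fix p assume p: "p \<in> paths (Vert (GDom f)) a b"
    note m = map_HMap_facts[OF f pathsD(1)[OF p]]
    show "(HMap (B.TA f) (a, b) ** HMap (\<psi> (GDom f)) (a, b)) ** i (GDom f) p =
      (HMap (\<psi> (GCod f)) (OMap f a, OMap f b) ** HMap (A.TA f) (a, b)) ** i (GDom f) p"
     unfolding natural_left[OF r f p] natural_right[OF r f p] using bspec[OF E m(1)] unfolding m(2,3) by (simp only:)
   qed (simp_all add: t s t' s')
   then show "HMap (Comp Gr (B.TA f) (\<psi> (GDom f))) (a, b) = HMap (Comp Gr (\<psi> (GCod f)) (A.TA f)) (a, b)"
    using ab PX SA VX A.T_OMap[OF f] by simp
  qed (use F SA TB PX PY VX A.T_OMap[OF f] B.T_OMap[OF f] in \<open>auto intro!: Comp_vgmap\<close>)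
 qed
next
 assume T: "\<forall>f\<in>vgmaps U V. Comp Gr (B.TA f) (\<psi> (GDom f)) = Comp Gr (\<psi> (GCod f)) (A.TA f)"
 show "\<forall>fs\<in>lists (Arr V). B.EA fs ** \<phi> (map (Dom V) fs) = \<phi> (map (Cod V) fs) ** A.EA fs"
 proof
  fix fs assume fs: "fs \<in> lists (Arr V)"
  note g = grf[OF fs]
  let ?f = "grf fs" and ?r = "std (length fs)" and ?a = "node 0" and ?b = "node (length fs)"
  note F = vgmap_facts[OF g(1)] and SA = A.TA_vgmap[OF g(1)] and TB = B.TA_vgmap[OF g(1)]
  note PX = rel_psi[OF r F(1)] and VX = A.T_Vert[OF F(1)]
  have r0: "?r \<in> paths (Vert (gr (map (Dom V) fs))) ?a ?b" "?r \<in> paths (Vert (gr (map (Cod V) fs))) ?a ?b"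
   using std_paths[of "map (Dom V) fs"] std_paths[of "map (Cod V) fs"] by simp_all
  have rp: "?r \<in> paths (Vert (GDom ?f)) ?a ?b" "?r \<in> paths (Vert (GCod ?f)) ?a ?b" using r0 g(2,3) by simp_all
  note ab = pathsD(5,6)[OF rp(1)]
  have ab': "?a \<in> Vert (A.TO (GDom ?f))" "?b \<in> Vert (A.TO (GDom ?f))" using ab VX by simp_all
  have "HMap (Comp Gr (B.TA ?f) (\<psi> (GDom ?f))) (?a, ?b) = HMap (Comp Gr (\<psi> (GCod ?f)) (A.TA ?f)) (?a, ?b)"
   using bspec[OF T g(1)] by (simp only:)
  then have m: "HMap (B.TA ?f) (?a, ?b) ** HMap (\<psi> (GDom ?f)) (?a, ?b) =
    HMap (\<psi> (GCod ?f)) (OMap ?f ?a, OMap ?f ?b) ** HMap (A.TA ?f) (?a, ?b)"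
   using ab ab' PX SA A.T_OMap[OF g(1)] by simp
  have lb: "lab (GDom ?f) ?r = map (Dom V) fs" "lab (GCod ?f) ?r = map (Cod V) fs"
   using map_VHom_gr[of "map (Dom V) fs"] map_VHom_gr[of "map (Cod V) fs"] g(2,3) by simp_all
  have pid: "map (OMap ?f) ?r = ?r" by (rule grf_path[OF fs pathsD(1)[OF r0(1)]])
  have e: "j (GCod ?f) ?r ** B.EA fs ** \<phi> (map (Dom V) fs) = j (GCod ?f) ?r ** \<phi> (map (Cod V) fs) ** A.EA fs"
   using natural_left[OF r g(1) rp(1)] natural_right[OF r g(1) rp(1)] unfolding m g(5) pid lb by (simp only:)
  note jj = B.inj_facts[OF F(2) rp(2), unfolded lb] and pD = rel_phi[OF r A.Dom_lists[OF fs]]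
   and pC = rel_phi[OF r A.Cod_lists[OF fs]]
  show "B.EA fs ** \<phi> (map (Dom V) fs) = \<phi> (map (Cod V) fs) ** A.EA fs"
   by (rule mono_arrD[OF B.inj_mono[OF F(2) rp(2)] e])
    (simp_all only: jj pD pC A.EA_Arr[OF fs] B.EA_Arr[OF fs] Comp_Arr Dom_Comp Cod_Comp)
 qed
qed

section \<open>Compatibility with units and multiplications\<close>

lemma mor_unit:
 assumes r: "rel \<phi> \<psi>" and X: "X \<in> vgraphs U V" and ab: "a \<in> Vert X" "b \<in> Vert X"
 shows "HMap (\<psi> X) (a, b) ** HMap (MUnit S X) (a, b) = j X [a, b] ** \<phi> [VHom X (a, b)] ** EUnit A (VHom X (a, b))"
proof -
 have p: "[a, b] \<in> paths (Vert X) a b" using ab by simp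
 have l: "[VHom X (a, b)] \<in> lists (Obj V)" using vgraph_facts(2)[OF X ab] by simp
 note s = rel_psi_hom[OF r X ab] and ii = A.inj_facts[OF X p] and u = A.E_unit_facts[OF vgraph_facts(2)[OF X ab]]
  and jj = B.inj_facts[OF X p] and ph = rel_phi[OF r l]
 have "HMap (\<psi> X) (a, b) ** HMap (MUnit S X) (a, b) = (HMap (\<psi> X) (a, b) ** i X [a, b]) ** EUnit A (VHom X (a, b))"
  unfolding A.inj_unit[OF X ab] using s ii u by simp
 also have "\<dots> = j X [a, b] ** \<phi> [VHom X (a, b)] ** EUnit A (VHom X (a, b))"
  unfolding rel_inj[OF r X p] using jj ph u by simp
 finally show ?thesis .
qed

lemma mor_mult_left:
 assumes r: "rel \<phi> \<psi>" and X: "X \<in> vgraphs U V" and p: "p \<in> paths (Vert X) a b" and qs: "qs \<in> refinements (Vert X) p"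
 shows "(HMap (\<psi> X) (a, b) ** HMap (MMult S X) (a, b)) ** A.inj2 X (p, qs) =
  j X (glue p qs) ** \<phi> (concat (map (lab X) qs)) ** ESubst A (map (lab X) qs)"
proof -
 note ab = pathsD(5,6)[OF p] and g = glue_paths[OF p qs]
 have lg: "lab X (glue p qs) = concat (map (lab X) qs)" by (rule A.lab_glue[OF qs pathsD(2)[OF p]])
 note s = rel_psi_hom[OF r X ab] and m = A.mult_facts[OF X ab] and i2 = A.inj2_facts[OF X p qs]
  and ig = A.inj_glue_facts[OF X p qs] and sb = A.subst_lab_facts[OF X qs] and jg = B.inj_glue_facts[OF X p qs]
  and ph = rel_phi[OF r lab_lists[OF X pathsD(1)[OF g]], unfolded lg]
 have "(HMap (\<psi> X) (a, b) ** HMap (MMult S X) (a, b)) ** A.inj2 X (p, qs) =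
   HMap (\<psi> X) (a, b) ** HMap (MMult S X) (a, b) ** A.inj2 X (p, qs)"
  by (rule Comp_assoc) (simp_all only: s m i2)
 also have "\<dots> = (HMap (\<psi> X) (a, b) ** i X (glue p qs)) ** ESubst A (map (lab X) qs)"
  unfolding A.inj_mult'[OF X p qs] by (rule Comp_assoc[symmetric]) (simp_all only: s ig sb)
 also have "\<dots> = j X (glue p qs) ** \<phi> (concat (map (lab X) qs)) ** ESubst A (map (lab X) qs)"
  unfolding rel_inj[OF r X g] lg by (rule Comp_assoc) (simp_all only: jg ph sb)
 finally show ?thesis .
qed

lemma EA_phi_facts:
 assumes r: "rel \<phi> \<psi>" and Z: "\<And>z. z \<in> set Z \<Longrightarrow> z \<in> lists (Obj V)"
 shows "A.EA (map \<phi> Z) \<in> Arr V" "Dom V (A.EA (map \<phi> Z)) = A.EO (map A.EO Z)" "Cod V (A.EA (map \<phi> Z)) = A.EO (map B.EO Z)"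
 using A.EA_map_Arr[of Z \<phi>, OF rel_phi(1)[OF r Z]] rel_phi(2,3)[OF r Z] by (simp_all cong: map_cong)

text \<open>Naturality of \<phi> at the arrows \<open>map (j X) qs\<close> exchanges \<phi> with the
  coprojections of the inner level.\<close>

lemma mor_mult_right:
 assumes r: "rel \<phi> \<psi>" and nat: "is_nat (seq_cat V) V (EFun A) (EFun B) \<phi>"
  and X: "X \<in> vgraphs U V" and p: "p \<in> paths (Vert X) a b" and qs: "qs \<in> refinements (Vert X) p"
 shows "(HMap (MMult T X) (a, b) ** HMap (\<psi> (B.TO X)) (a, b) ** HMap (A.TA (\<psi> X)) (a, b)) ** A.inj2 X (p, qs) =
  j X (glue p qs) ** ESubst B (map (lab X) qs) ** \<phi> (map B.EO (map (lab X) qs)) ** A.EA (map \<phi> (map (lab X) qs))"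
proof -
 let ?Z = "map (lab X) qs"
 note ab = pathsD(5,6)[OF p] and SX = A.TO_vgraph[OF X] and TX = B.TO_vgraph[OF X] and P = rel_psi[OF r X]
 have VS: "Vert (A.TO X) = Vert X" "Vert (B.TO X) = Vert X" using A.T_Vert[OF X] B.T_Vert[OF X] by auto
 have abT: "a \<in> Vert (B.TO X)" "b \<in> Vert (B.TO X)" and pS: "p \<in> paths (Vert (A.TO X)) a b" and pT: "p \<in> paths (Vert (B.TO X)) a b"
  using ab p VS by auto
 have q: "q \<in> paths (Vert X) (hd q) (last q)" if "q \<in> set qs" for q using refinements_paths[OF qs that] .
 have Z: "z \<in> lists (Obj V)" if "z \<in> set ?Z" for z using that lab_lists[OF X pathsD(1)[OF q]] by auto
 have idp: "map (OMap (\<psi> X)) p = p" by (rule map_idI) (use P(4) pathsD(1)[OF p] in auto)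
 note ep = EA_phi_facts[OF r Z, of ?Z]
 have BZ: "map B.EO ?Z \<in> lists (Obj V)" using B.EO_Obj Z by (auto simp: in_lists_conv_set)
 note pbZ = rel_phi[OF r BZ] and lT = lab_lists[OF TX pathsD(1)[OF pT]]
 note plT = rel_phi[OF r lT]
 have pS': "p \<in> paths (Vert (GDom (\<psi> X))) a b" using pS P(2) by simp
 have n: "HMap (A.TA (\<psi> X)) (a, b) ** i (A.TO X) p = i (B.TO X) p ** A.EA (map (HMap (\<psi> X)) (steps p))"
  using A.inj_natural'[OF P(1) pS'] P idp by simp
 note mi = A.map_inj_facts[OF X qs] and mj = B.map_inj_facts[OF X qs] and ei = A.EA_inj_facts[OF X qs] and ej = B.EA_inj_facts[OF X qs]
 have "A.EA (map (HMap (\<psi> X)) (steps p)) ** A.EA (map (i X) qs) = A.EA (map (\<lambda>q. HMap (\<psi> X) (hd q, last q) ** i X q) qs)"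
  unfolding refinements_ends[OF qs, symmetric] map_map comp_def
 proof (rule A.EA_Comp_map)
  fix x assume x: "x \<in> set qs"
  show "i X x \<in> Arr V \<and> HMap (\<psi> X) (hd x, last x) \<in> Arr V \<and> Dom V (HMap (\<psi> X) (hd x, last x)) = Cod V (i X x)"
   using A.inj_facts[OF X q[OF x]] rel_psi_hom[OF r X pathsD(5,6)[OF q[OF x]]] by simp
 qed
 also have "map (\<lambda>q. HMap (\<psi> X) (hd q, last q) ** i X q) qs = map (\<lambda>q. j X q ** \<phi> (lab X q)) qs"
  using rel_inj[OF r X q] by simp
 also have "A.EA \<dots> = A.EA (map (j X) qs) ** A.EA (map (\<lambda>q. \<phi> (lab X q)) qs)"
 proof (rule A.EA_Comp_map[symmetric])
  fix x assume x: "x \<in> set qs"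
  show "\<phi> (lab X x) \<in> Arr V \<and> j X x \<in> Arr V \<and> Dom V (j X x) = Cod V (\<phi> (lab X x))"
   using B.inj_facts[OF X q[OF x]] rel_phi[OF r lab_lists[OF X pathsD(1)[OF q[OF x]]]] by simp
 qed
 finally have H: "A.EA (map (HMap (\<psi> X)) (steps p)) ** A.EA (map (i X) qs) = A.EA (map (j X) qs) ** A.EA (map \<phi> ?Z)"
  by (simp add: comp_def)
 have nt: "\<phi> (lab (B.TO X) p) ** A.EA (map (j X) qs) = B.EA (map (j X) qs) ** \<phi> (map B.EO ?Z)"
  using bspec[OF nat[unfolded phi_nat_iff[OF r]] mj(1)] unfolding mj(2,3) by simp
 note Aj = A.EA_Arr[OF mj(1), unfolded mj(2,3)] and Bj = B.EA_Arr[OF mj(1), unfolded mj(2,3)]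
 have ta: "HMap (A.TA (\<psi> X)) (a, b) \<in> Arr V" "Dom V (HMap (A.TA (\<psi> X)) (a, b)) = VHom (A.TO (A.TO X)) (a, b)"
  "Cod V (HMap (A.TA (\<psi> X)) (a, b)) = VHom (A.TO (B.TO X)) (a, b)"
  using A.TA_facts[OF P(1), of a b] P ab VS by simp_all
 note sT = rel_psi_hom[OF r TX abT] and m = B.mult_facts[OF X ab] and iS = A.inj_facts[OF SX pS] and iT = A.inj_facts[OF TX pT]
  and jT = B.inj_facts[OF TX pT] and i2 = A.inj2_facts[OF X p qs] and j2 = B.inj2_facts[OF X p qs]
  and jg = B.inj_glue_facts[OF X p qs] and sb = B.subst_lab_facts[OF X qs]
 have he: "A.EA (map (HMap (\<psi> X)) (steps p)) \<in> Arr V" "Dom V (A.EA (map (HMap (\<psi> X)) (steps p))) = A.EO (lab (A.TO X) p)"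
  "Cod V (A.EA (map (HMap (\<psi> X)) (steps p))) = A.EO (lab (B.TO X) p)"
  using A.EA_HMap_facts[OF P(1) pathsD(1)[OF pS']] P idp by simp_all
 have 1: "HMap (A.TA (\<psi> X)) (a, b) ** A.inj2 X (p, qs) = i (B.TO X) p ** A.EA (map (j X) qs) ** A.EA (map \<phi> ?Z)"
 proof -
  have "HMap (A.TA (\<psi> X)) (a, b) ** A.inj2 X (p, qs) = (HMap (A.TA (\<psi> X)) (a, b) ** i (A.TO X) p) ** A.EA (map (i X) qs)"
   unfolding fst_conv snd_conv by (rule Comp_assoc[symmetric]) (simp_all only: ta iS ei)
  also have "\<dots> = i (B.TO X) p ** A.EA (map (HMap (\<psi> X)) (steps p)) ** A.EA (map (i X) qs)"
   unfolding n by (rule Comp_assoc) (simp_all only: iT he ei)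
  finally show ?thesis unfolding H .
 qed
 have 2: "HMap (\<psi> (B.TO X)) (a, b) ** i (B.TO X) p ** A.EA (map (j X) qs) ** A.EA (map \<phi> ?Z) =
   B.inj2 X (p, qs) ** \<phi> (map B.EO ?Z) ** A.EA (map \<phi> ?Z)"
 proof -
  have "HMap (\<psi> (B.TO X)) (a, b) ** i (B.TO X) p ** A.EA (map (j X) qs) ** A.EA (map \<phi> ?Z) =
    (HMap (\<psi> (B.TO X)) (a, b) ** i (B.TO X) p) ** A.EA (map (j X) qs) ** A.EA (map \<phi> ?Z)"
   by (rule Comp_assoc[symmetric]) (simp_all only: sT iT Aj ep Comp_Arr Dom_Comp Cod_Comp)
  also have "\<dots> = j (B.TO X) p ** \<phi> (lab (B.TO X) p) ** A.EA (map (j X) qs) ** A.EA (map \<phi> ?Z)"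
   unfolding rel_inj[OF r TX pT] by (rule Comp_assoc) (simp_all only: jT plT Aj ep Comp_Arr Dom_Comp Cod_Comp)
  also have "\<phi> (lab (B.TO X) p) ** A.EA (map (j X) qs) ** A.EA (map \<phi> ?Z) = B.EA (map (j X) qs) ** \<phi> (map B.EO ?Z) ** A.EA (map \<phi> ?Z)"
   by (rule Comp_swap[OF nt]) (simp_all only: plT Aj Bj pbZ ep)
  also have "j (B.TO X) p ** \<dots> = B.inj2 X (p, qs) ** \<phi> (map B.EO ?Z) ** A.EA (map \<phi> ?Z)"
   unfolding fst_conv snd_conv by (rule Comp_assoc[symmetric]) (simp_all only: jT Bj pbZ ep Comp_Arr Dom_Comp Cod_Comp)
  finally show ?thesis .
 qed
 have "(HMap (MMult T X) (a, b) ** HMap (\<psi> (B.TO X)) (a, b) ** HMap (A.TA (\<psi> X)) (a, b)) ** A.inj2 X (p, qs) =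
   HMap (MMult T X) (a, b) ** HMap (\<psi> (B.TO X)) (a, b) ** HMap (A.TA (\<psi> X)) (a, b) ** A.inj2 X (p, qs)"
  by (simp only: Comp_assoc Comp_Arr Dom_Comp Cod_Comp m sT ta i2)
 also have "\<dots> = HMap (MMult T X) (a, b) ** B.inj2 X (p, qs) ** \<phi> (map B.EO ?Z) ** A.EA (map \<phi> ?Z)" unfolding 1 2 ..
 also have "\<dots> = (HMap (MMult T X) (a, b) ** B.inj2 X (p, qs)) ** \<phi> (map B.EO ?Z) ** A.EA (map \<phi> ?Z)"
  by (rule Comp_assoc[symmetric]) (simp_all only: m j2 pbZ ep Comp_Arr Dom_Comp Cod_Comp)
 also have "\<dots> = j X (glue p qs) ** ESubst B ?Z ** \<phi> (map B.EO ?Z) ** A.EA (map \<phi> ?Z)"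
  unfolding B.inj_mult'[OF X p qs] by (rule Comp_assoc) (simp_all only: jg sb pbZ ep Comp_Arr Dom_Comp Cod_Comp)
 finally show ?thesis .
qed

lemma mor_unit_iff:
 assumes r: "rel \<phi> \<psi>"
 shows "(\<forall>X\<in>vgraphs U V. Comp Gr (\<psi> X) (MUnit S X) = MUnit T X) \<longleftrightarrow> (\<forall>x\<in>Obj V. \<phi> [x] ** EUnit A x = EUnit B x)"
proof
 assume E: "\<forall>x\<in>Obj V. \<phi> [x] ** EUnit A x = EUnit B x"
 show "\<forall>X\<in>vgraphs U V. Comp Gr (\<psi> X) (MUnit S X) = MUnit T X"
 proof
  fix X assume X: "X \<in> vgraphs U V"
  note P = rel_psi[OF r X] and SU = A.T_unit[OF X] and TU = B.T_unit[OF X]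
  show "Comp Gr (\<psi> X) (MUnit S X) = MUnit T X"
  proof (rule vgmap_eqI[where X = X])
   fix a b assume ab: "a \<in> Vert X" "b \<in> Vert X"
   show "HMap (Comp Gr (\<psi> X) (MUnit S X)) (a, b) = HMap (MUnit T X) (a, b)"
    using mor_unit[OF r X ab] B.inj_unit[OF X ab] bspec[OF E vgraph_facts(2)[OF X ab]] SU ab by simp
  qed (use P SU TU in \<open>auto intro!: Comp_vgmap\<close>)
 qed
next
 assume T: "\<forall>X\<in>vgraphs U V. Comp Gr (\<psi> X) (MUnit S X) = MUnit T X"
 show "\<forall>x\<in>Obj V. \<phi> [x] ** EUnit A x = EUnit B x"
 proof
  fix x assume x: "x \<in> Obj V"
  then have l: "[x] \<in> lists (Obj V)" by simp
  note X = gr_vgraph[OF l]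
  let ?X = "gr [x]" and ?a = "node 0" and ?b = "node 1"
  have ab: "?a \<in> Vert ?X" "?b \<in> Vert ?X" by simp_all
  have v: "VHom ?X (?a, ?b) = x" using VHom_gr[of 0 "[x]" 1] by simp
  have p: "[?a, ?b] \<in> paths (Vert ?X) ?a ?b" using ab by simp
  have "HMap (Comp Gr (\<psi> ?X) (MUnit S ?X)) (?a, ?b) = HMap (MUnit T ?X) (?a, ?b)" using bspec[OF T X] by simp
  then have e: "j ?X [?a, ?b] ** \<phi> [x] ** EUnit A x = j ?X [?a, ?b] ** EUnit B x"
   using mor_unit[OF r X ab] B.inj_unit[OF X ab] A.T_unit[OF X] ab v by simp
  show "\<phi> [x] ** EUnit A x = EUnit B x"
   by (rule mono_arrD[OF B.inj_mono[OF X p] e])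
    (use A.E_unit_facts[OF x] B.E_unit_facts[OF x] rel_phi[OF r l] B.inj_facts[OF X p] v in simp_all)
 qed
qed

lemma mor_mult_iff:
 assumes r: "rel \<phi> \<psi>" and nat: "is_nat (seq_cat V) V (EFun A) (EFun B) \<phi>"
 shows "(\<forall>X\<in>vgraphs U V. Comp Gr (\<psi> X) (MMult S X) = Comp Gr (MMult T X) (Comp Gr (\<psi> (B.TO X)) (A.TA (\<psi> X)))) \<longleftrightarrow>
  (\<forall>Z\<in>lists (lists (Obj V)). \<phi> (concat Z) ** ESubst A Z = ESubst B Z ** \<phi> (map B.EO Z) ** A.EA (map \<phi> Z))"
proof -
 have H: "HMap (Comp Gr (\<psi> X) (MMult S X)) (a, b) = HMap (\<psi> X) (a, b) ** HMap (MMult S X) (a, b)"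
   "HMap (Comp Gr (MMult T X) (Comp Gr (\<psi> (B.TO X)) (A.TA (\<psi> X)))) (a, b) =
    HMap (MMult T X) (a, b) ** HMap (\<psi> (B.TO X)) (a, b) ** HMap (A.TA (\<psi> X)) (a, b)"
  if X: "X \<in> vgraphs U V" and ab: "a \<in> Vert X" "b \<in> Vert X" for X a b
  using rel_psi[OF r X] rel_psi[OF r B.TO_vgraph[OF X]] A.T_mult[OF X] B.T_mult[OF X] A.TA_vgmap[OF rel_psi(1)[OF r X]]
   A.T_OMap[OF rel_psi(1)[OF r X]] A.T_Vert X B.T_Vert[OF X] ab by simp_all
 show ?thesis
 proof
  assume E: "\<forall>Z\<in>lists (lists (Obj V)). \<phi> (concat Z) ** ESubst A Z = ESubst B Z ** \<phi> (map B.EO Z) ** A.EA (map \<phi> Z)"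
  show "\<forall>X\<in>vgraphs U V. Comp Gr (\<psi> X) (MMult S X) = Comp Gr (MMult T X) (Comp Gr (\<psi> (B.TO X)) (A.TA (\<psi> X)))"
  proof
   fix X assume X: "X \<in> vgraphs U V"
   note P = rel_psi[OF r X] and PT = rel_psi[OF r B.TO_vgraph[OF X]] and SM = A.T_mult[OF X] and TM = B.T_mult[OF X]
   note AP = A.TA_vgmap[OF P(1)] and AO = A.T_OMap[OF P(1)]
   have VT: "Vert (A.TO (A.TO X)) = Vert X" "Vert (A.TO X) = Vert X" "Vert (B.TO X) = Vert X" using A.T_Vert X B.T_Vert[OF X] by simp_all
   have c: "Comp Gr (\<psi> X) (MMult S X) \<in> vgmaps U V" "Comp Gr (MMult T X) (Comp Gr (\<psi> (B.TO X)) (A.TA (\<psi> X))) \<in> vgmaps U V"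
    using P PT SM TM AP by (auto intro!: Comp_vgmap)
   show "Comp Gr (\<psi> X) (MMult S X) = Comp Gr (MMult T X) (Comp Gr (\<psi> (B.TO X)) (A.TA (\<psi> X)))"
   proof (rule vgmap_eqI[OF c, where X = "A.TO (A.TO X)"])
    fix a b assume "a \<in> Vert (A.TO (A.TO X))" "b \<in> Vert (A.TO (A.TO X))"
    then have ab: "a \<in> Vert X" "b \<in> Vert X" using VT by auto
    have h1: "HMap (Comp Gr (\<psi> X) (MMult S X)) (a, b) \<in> Arr V"
     "Dom V (HMap (Comp Gr (\<psi> X) (MMult S X)) (a, b)) = VHom (A.TO (A.TO X)) (a, b)"
     "Cod V (HMap (Comp Gr (\<psi> X) (MMult S X)) (a, b)) = VHom (B.TO X) (a, b)"
     using vgmap_facts(4-6)[OF c(1), of a b] SM P ab VT by simp_all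
    have h2: "HMap (Comp Gr (MMult T X) (Comp Gr (\<psi> (B.TO X)) (A.TA (\<psi> X)))) (a, b) \<in> Arr V"
     "Dom V (HMap (Comp Gr (MMult T X) (Comp Gr (\<psi> (B.TO X)) (A.TA (\<psi> X)))) (a, b)) = VHom (A.TO (A.TO X)) (a, b)"
     "Cod V (HMap (Comp Gr (MMult T X) (Comp Gr (\<psi> (B.TO X)) (A.TA (\<psi> X)))) (a, b)) = VHom (B.TO X) (a, b)"
     using vgmap_facts(4-6)[OF c(2), of a b] TM P PT AP AO ab VT by simp_all
    show "HMap (Comp Gr (\<psi> X) (MMult S X)) (a, b) = HMap (Comp Gr (MMult T X) (Comp Gr (\<psi> (B.TO X)) (A.TA (\<psi> X)))) (a, b)"
    proof (rule coproduct_eqI[OF A.TTO_coproduct[OF X ab]])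
     fix t assume "t \<in> Sigma (paths (Vert X) a b) (refinements (Vert X))"
     then obtain p qs where t: "t = (p, qs)" and p: "p \<in> paths (Vert X) a b" and qs: "qs \<in> refinements (Vert X) p" by auto
     have "map (lab X) qs \<in> lists (lists (Obj V))"
     proof (rule in_listsI, rule ballI)
      fix z assume "z \<in> set (map (lab X) qs)"
      then obtain q where "q \<in> set qs" "z = lab X q" by auto
      then show "z \<in> lists (Obj V)" using lab_lists[OF X pathsD(1)[OF refinements_paths[OF qs]]] by simp
     qed
     note e = bspec[OF E this]
     have "HMap (Comp Gr (\<psi> X) (MMult S X)) (a, b) ** A.inj2 X (p, qs) =
       HMap (Comp Gr (MMult T X) (Comp Gr (\<psi> (B.TO X)) (A.TA (\<psi> X)))) (a, b) ** A.inj2 X (p, qs)"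
      unfolding H[OF X ab] mor_mult_left[OF r X p qs] mor_mult_right[OF r nat X p qs] e ..
     then show "HMap (Comp Gr (\<psi> X) (MMult S X)) (a, b) ** (case t of (p, qs) \<Rightarrow> i (A.TO X) p ** A.EA (map (i X) qs)) =
       HMap (Comp Gr (MMult T X) (Comp Gr (\<psi> (B.TO X)) (A.TA (\<psi> X)))) (a, b) ** (case t of (p, qs) \<Rightarrow> i (A.TO X) p ** A.EA (map (i X) qs))"
      unfolding t prod.case fst_conv snd_conv .
    qed (simp_all only: h1 h2)
   qed (use P PT SM TM AP AO VT in auto)
  qed
 next
  assume T: "\<forall>X\<in>vgraphs U V. Comp Gr (\<psi> X) (MMult S X) = Comp Gr (MMult T X) (Comp Gr (\<psi> (B.TO X)) (A.TA (\<psi> X)))"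
  show "\<forall>Z\<in>lists (lists (Obj V)). \<phi> (concat Z) ** ESubst A Z = ESubst B Z ** \<phi> (map B.EO Z) ** A.EA (map \<phi> Z)"
  proof
   fix Z assume Z: "Z \<in> lists (lists (Obj V))"
   let ?z = "concat Z"
   have zz: "z \<in> lists (Obj V)" if "z \<in> set Z" for z using Z that by auto
   have z: "?z \<in> lists (Obj V)" using Z by (auto simp: in_lists_conv_set)
   let ?X = "gr ?z" and ?r = "std (length ?z)"
   note X = gr_vgraph[OF z] and rp = std_paths[of ?z]
   obtain p qs where p: "p \<in> paths (Vert ?X) (hd ?r) (last ?r)" and qs: "qs \<in> refinements (Vert ?X) p"
    and gl: "glue p qs = ?r" and len: "map (\<lambda>q. length q - 1) qs = map length Z"
    by (rule path_split[OF std_lists std_nonempty, of "map length Z" ?z]) (simp_all add: length_concat)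
   have ZZ: "map (lab ?X) qs = Z"
    by (rule concat_eq_lengths)
     (use A.lab_glue[OF qs pathsD(2)[OF p], of ?X] gl len in \<open>simp_all add: comp_def\<close>)
   have "HMap (Comp Gr (\<psi> ?X) (MMult S ?X)) (hd ?r, last ?r) =
    HMap (Comp Gr (MMult T ?X) (Comp Gr (\<psi> (B.TO ?X)) (A.TA (\<psi> ?X)))) (hd ?r, last ?r)" using bspec[OF T X] by (simp only:)
   note m = this[unfolded H[OF X pathsD(5,6)[OF p]]]
   have e: "j ?X ?r ** \<phi> ?z ** ESubst A Z = j ?X ?r ** ESubst B Z ** \<phi> (map B.EO Z) ** A.EA (map \<phi> Z)"
    using mor_mult_left[OF r X p qs] unfolding m mor_mult_right[OF r nat X p qs] ZZ gl by simp
   have BZ: "map B.EO Z \<in> lists (Obj V)" using B.EO_Obj zz by (auto simp: in_lists_conv_set)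
   note s1 = A.E_subst_facts[of Z, OF zz] and s2 = B.E_subst_facts[of Z, OF zz] and p1 = rel_phi[OF r z] and p2 = rel_phi[OF r BZ]
    and p3 = EA_phi_facts[OF r zz, of Z] and jj = B.inj_facts[OF X rp, unfolded map_VHom_gr]
   show "\<phi> ?z ** ESubst A Z = ESubst B Z ** \<phi> (map B.EO Z) ** A.EA (map \<phi> Z)"
    by (rule mono_arrD[OF B.inj_mono[OF X rp] e]) (simp_all only: Comp_Arr Dom_Comp Cod_Comp s1 s2 p1 p2 p3 jj)
  qed
 qed
qed

theorem multitensor_mor_iff_monad_mor:
 assumes r: "rel \<phi> \<psi>"
 shows "is_multitensor_mor V A B \<phi> \<longleftrightarrow> is_monad_mor Gr S T \<psi>"
proof -
 have "is_monad_mor Gr S T \<psi> \<longleftrightarrow> is_nat Gr Gr (MFun S) (MFun T) \<psi> \<and>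
   (\<forall>X\<in>vgraphs U V. Comp Gr (\<psi> X) (MUnit S X) = MUnit T X) \<and>
   (\<forall>X\<in>vgraphs U V. Comp Gr (\<psi> X) (MMult S X) = Comp Gr (MMult T X) (Comp Gr (\<psi> (B.TO X)) (A.TA (\<psi> X))))"
  unfolding is_monad_mor_def by auto
 then show ?thesis
  unfolding is_multitensor_mor_def natural_iff[OF r, symmetric] mor_unit_iff[OF r] using mor_mult_iff[OF r] by blast
qed

text \<open>The index square has identities on two opposite sides and so is a pullback. On the
  summand of \<open>p\<close> the square is the naturality square of \<phi> at the arrows of
  \<open>f\<close> along \<open>p\<close>.\<close>

lemma cartesian_psi:
 assumes r: "rel \<phi> \<psi>" and c: "is_cartesian_nat (seq_cat V) V (EFun A) (EFun B) \<phi>"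
 shows "is_cartesian_nat Gr Gr (MFun S) (MFun T) \<psi>"
 unfolding is_cartesian_nat_def
proof (intro conjI ballI)
 show "is_nat Gr Gr (MFun S) (MFun T) \<psi>" using c natural_iff[OF r] by (simp add: is_cartesian_nat_def)
 have Epb: "is_pullback V (\<phi> (map (Dom V) fs)) (A.EA fs) (B.EA fs) (\<phi> (map (Cod V) fs))" if "fs \<in> lists (Arr V)" for fs
  using c that by (simp add: is_cartesian_nat_def)
 fix f assume "f \<in> Arr Gr"
 then have f: "f \<in> vgmaps U V" by simp
 let ?X = "GDom f" and ?Y = "GCod f"
 note F = vgmap_facts[OF f]
 note PX = rel_psi[OF r F(1)] and PY = rel_psi[OF r F(2)] and SA = A.TA_vgmap[OF f] and TB = B.TA_vgmap[OF f]
 have "is_pullback Gr (\<psi> ?X) (A.TA f) (B.TA f) (\<psi> ?Y)"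
 proof (rule pullback_graphsI)
  fix a b assume "a \<in> Vert (GDom (\<psi> ?X))" "b \<in> Vert (GDom (\<psi> ?X))"
  then have ab: "a \<in> Vert ?X" "b \<in> Vert ?X" using PX A.T_Vert[OF F(1)] by auto
  note fab = F(3)[OF ab(1)] F(3)[OF ab(2)]
  have "is_pullback V (HMap (\<psi> ?X) (a, b)) (HMap (A.TA f) (a, b)) (HMap (B.TA f) (a, b)) (HMap (\<psi> ?Y) (OMap f a, OMap f b))"
  proof (rule coproduct_pullback[where pI = "\<lambda>p. p" and qI = "map (OMap f)" and fI = "map (OMap f)" and gI = "\<lambda>p. p"
     and pk = "\<lambda>p. \<phi> (lab ?X p)" and qk = "\<lambda>p. A.EA (map (HMap f) (steps p))"
     and fi = "\<lambda>p. B.EA (map (HMap f) (steps p))" and gj = "\<lambda>p. \<phi> (lab ?Y p)",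
     OF small_paths[OF F(1)] small_paths[OF F(1)] small_paths[OF F(2)] small_paths[OF F(2)]
     A.inj_coproduct[OF F(1) ab] B.inj_coproduct[OF F(1) ab] A.inj_coproduct[OF F(2) fab] B.inj_coproduct[OF F(2) fab]])
   fix p assume p: "p \<in> paths (Vert ?X) a b"
   note m = map_HMap_facts[OF f pathsD(1)[OF p]]
   show "map (OMap f) p \<in> paths (Vert ?Y) (OMap f a) (OMap f b)" by (rule paths_vgmap[OF f p])
   show "HMap (\<psi> ?X) (a, b) ** i ?X p = j ?X p ** \<phi> (lab ?X p)" by (rule rel_inj[OF r F(1) p])
   show "HMap (A.TA f) (a, b) ** i ?X p = i ?Y (map (OMap f) p) ** A.EA (map (HMap f) (steps p))" by (rule A.inj_natural'[OF f p])
   show "HMap (B.TA f) (a, b) ** j ?X p = j ?Y (map (OMap f) p) ** B.EA (map (HMap f) (steps p))" by (rule B.inj_natural'[OF f p])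
   show "Dom V (\<phi> (lab ?X p)) = path_tensor A ?X p"
    using rel_phi[OF r lab_lists[OF F(1) pathsD(1)[OF p]]] by (simp add: path_tensor_def)
   show "B.EA (map (HMap f) (steps p)) \<in> hom V (path_tensor B ?X p) (path_tensor B ?Y (map (OMap f) p))"
    using B.EA_HMap_facts[OF f pathsD(1)[OF p]] by (simp add: path_tensor_def)
   show "is_pullback V (\<phi> (lab ?X p)) (A.EA (map (HMap f) (steps p))) (B.EA (map (HMap f) (steps p))) (\<phi> (lab ?Y (map (OMap f) p)))"
    using Epb[OF m(1)] unfolding m(2,3) .
  next
   fix p assume p: "p \<in> paths (Vert ?Y) (OMap f a) (OMap f b)"
   show "HMap (\<psi> ?Y) (OMap f a, OMap f b) ** i ?Y p = j ?Y p ** \<phi> (lab ?Y p)" by (rule rel_inj[OF r F(2) p])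
   show "\<phi> (lab ?Y p) \<in> hom V (path_tensor A ?Y p) (path_tensor B ?Y p)"
    using rel_phi[OF r lab_lists[OF F(2) pathsD(1)[OF p]]] by (simp add: path_tensor_def)
  qed (use paths_vgmap[OF f] A.TA_facts[OF f ab] B.TA_facts[OF f ab] rel_psi_hom[OF r F(1) ab] rel_psi_hom[OF r F(2) fab] in auto)
  then show "is_pullback V (HMap (\<psi> ?X) (a, b)) (HMap (A.TA f) (a, b)) (HMap (B.TA f) (OMap (\<psi> ?X) a, OMap (\<psi> ?X) b))
    (HMap (\<psi> ?Y) (OMap (A.TA f) a, OMap (A.TA f) b))"
   using PX(4) A.T_OMap[OF f] ab by simp
 qed (use F PX PY SA TB A.T_OMap[OF f] B.T_OMap[OF f] A.T_Vert B.T_Vert in auto)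
 then show "is_pullback Gr (\<psi> (Dom Gr f)) (A.TA f) (B.TA f) (\<psi> (Cod Gr f))" by simp
qed

text \<open>Indices do not move under \<psi>, so the coprojection on one side is the pullback of
  that on the other. This later lifts arrows into the summand of a path.\<close>

lemma rel_pullback:
 assumes r: "rel \<phi> \<psi>" and X: "X \<in> vgraphs U V" and p: "p \<in> paths (Vert X) a b"
 shows "is_pullback V (i X p) (\<phi> (lab X p)) (HMap (\<psi> X) (a, b)) (j X p)"
proof -
 note ab = pathsD(5,6)[OF p]
 show ?thesis
  by (rule coproduct_inj_pullback[where fI = "\<lambda>p. p" and fi = "\<lambda>p. \<phi> (lab X p)",
     OF small_paths[OF X] small_paths[OF X] A.inj_coproduct[OF X ab] B.inj_coproduct[OF X ab]])
   (use p rel_psi_hom[OF r X ab] rel_inj[OF r X] rel_phi[OF r lab_lists[OF X pathsD(1)]] in \<open>auto simp: path_tensor_def\<close>)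
qed

end

text \<open>Together with uniqueness of related transformations this yields the equations between
  composites that functoriality and the equivalence call for.\<close>

lemma related_comp:
 assumes "presentation_pair U V A S i B T j" "presentation_pair U V B T j C R k"
  and "related U V A S i B T j \<phi> \<psi>" "related U V B T j C R k \<phi>' \<psi>'"
 shows "related U V A S i C R k (comp_nat (seq_cat V) V \<phi>' \<phi>) (comp_nat (Graphs U V) (Graphs U V) \<psi>' \<psi>)"
proof -
 interpret AB: presentation_pair U V A S i B T j by fact
 interpret BC: presentation_pair U V B T j C R k by fact
 note r = assms(3) and r' = assms(4)
 show ?thesis
  unfolding related_def
 proof (intro conjI ballI allI)
  fix Z assume Z: "Z \<in> lists (Obj V)"
  show "comp_nat (seq_cat V) V \<phi>' \<phi> Z \<in> hom V (FObj (EFun A) Z) (FObj (EFun C) Z)"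
   using Z AB.rel_phi[OF r Z] BC.rel_phi[OF r' Z] by (simp add: comp_nat_def)
 next
  fix X assume X: "X \<in> vgraphs U V"
  note P = AB.rel_psi[OF r X] and P' = BC.rel_psi[OF r' X]
  have e: "comp_nat (Graphs U V) (Graphs U V) \<psi>' \<psi> X = Comp (Graphs U V) (\<psi>' X) (\<psi> X)"
   using X by (simp add: comp_nat_def)
  show "comp_nat (Graphs U V) (Graphs U V) \<psi>' \<psi> X \<in> vgmaps U V"
   "GDom (comp_nat (Graphs U V) (Graphs U V) \<psi>' \<psi> X) = FObj (MFun S) X"
   "GCod (comp_nat (Graphs U V) (Graphs U V) \<psi>' \<psi> X) = FObj (MFun R) X"
   unfolding e using P P' by (auto intro!: AB.Comp_vgmap)
  show "OMap (comp_nat (Graphs U V) (Graphs U V) \<psi>' \<psi> X) = (\<lambda>a\<in>Vert X. a)"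
   unfolding e using P P' AB.A.T_Vert[OF X] by (auto simp: Graphs_def fun_eq_iff)
  fix a b p assume p: "p \<in> paths (Vert X) a b"
  note ab = pathsD(5,6)[OF p]
  have l: "map (VHom X) (steps p) \<in> lists (Obj V)" by (rule AB.lab_lists[OF X pathsD(1)[OF p]])
  note s = AB.rel_psi_hom[OF r X ab] and s' = BC.rel_psi_hom[OF r' X ab] and f = AB.rel_phi[OF r l] and f' = BC.rel_phi[OF r' l]
   and ii = AB.A.inj_facts[OF X p] and jj = AB.B.inj_facts[OF X p] and kk = BC.B.inj_facts[OF X p]
  have "HMap (comp_nat (Graphs U V) (Graphs U V) \<psi>' \<psi> X) (a, b) = Comp V (HMap (\<psi>' X) (a, b)) (HMap (\<psi> X) (a, b))"
   unfolding e using P AB.A.T_Vert[OF X] ab by simp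
  then have "Comp V (HMap (comp_nat (Graphs U V) (Graphs U V) \<psi>' \<psi> X) (a, b)) (i X p) =
    Comp V (HMap (\<psi>' X) (a, b)) (Comp V (HMap (\<psi> X) (a, b)) (i X p))"
   by (simp only:) (rule AB.Comp_assoc, simp_all only: s s' ii)
  also have "\<dots> = Comp V (Comp V (HMap (\<psi>' X) (a, b)) (j X p)) (\<phi> (map (VHom X) (steps p)))"
   unfolding AB.rel_inj[OF r X p] by (rule AB.Comp_assoc[symmetric]) (simp_all only: s' jj f)
  also have "\<dots> = Comp V (k X p) (Comp V (\<phi>' (map (VHom X) (steps p))) (\<phi> (map (VHom X) (steps p))))"
   unfolding BC.rel_inj[OF r' X p] by (rule AB.Comp_assoc) (simp_all only: kk f f')
  finally show "Comp V (HMap (comp_nat (Graphs U V) (Graphs U V) \<psi>' \<psi> X) (a, b)) (i X p) =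
    Comp V (k X p) (comp_nat (seq_cat V) V \<phi>' \<phi> (map (VHom X) (steps p)))"
   using l by (simp add: comp_nat_def)
 qed (simp_all add: comp_nat_def)
qed

lemma related_id:
 assumes "presentation U V A S i"
 shows "related U V A S i A S i (id_nat (seq_cat V) V (EFun A)) (id_nat (Graphs U V) (Graphs U V) (MFun S))"
proof -
 interpret A: presentation U V A S i by fact
 show ?thesis
  unfolding related_def
 proof (intro conjI ballI allI)
  fix X assume X: "X \<in> vgraphs U V"
  have e: "id_nat (Graphs U V) (Graphs U V) (MFun S) X = Ident (Graphs U V) (A.TO X)" using X by (simp add: id_nat_def)
  show "id_nat (Graphs U V) (Graphs U V) (MFun S) X \<in> vgmaps U V" "GDom (id_nat (Graphs U V) (Graphs U V) (MFun S) X) = A.TO X"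
   "GCod (id_nat (Graphs U V) (Graphs U V) (MFun S) X) = A.TO X"
   "OMap (id_nat (Graphs U V) (Graphs U V) (MFun S) X) = (\<lambda>a\<in>Vert X. a)"
   unfolding e using A.TO_vgraph[OF X] A.T_Vert[OF X] by (auto intro!: A.Ident_vgmap)
  fix a b p assume p: "p \<in> paths (Vert X) a b"
  show "Comp V (HMap (id_nat (Graphs U V) (Graphs U V) (MFun S) X) (a, b)) (i X p) =
    Comp V (i X p) (id_nat (seq_cat V) V (EFun A) (map (VHom X) (steps p)))"
   unfolding e using A.inj_facts[OF X p] A.T_Vert[OF X] pathsD(5,6)[OF p] A.lab_lists[OF X pathsD(1)[OF p]]
   by (simp add: id_nat_def del: in_lists_conv_set)
 qed (use A.EO_Obj in \<open>simp_all add: id_nat_def del: in_lists_conv_set\<close>)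
qed

section \<open>The presentation of \<open>\<Gamma> E\<close>\<close>

context tensor_functor
begin

abbreviation GO where "GO \<equiv> gamma_obj V E"
abbreviation GA where "GA \<equiv> gamma_arr V E"
abbreviation gi where "gi \<equiv> gamma_inj V E"

lemma Vert_gamma [simp]: "Vert (GO X) = Vert X"
 by (simp add: gamma_obj_def)

lemma gamma_coproduct:
 assumes X: "X \<in> vgraphs U V" and ab: "a \<in> Vert X" "b \<in> Vert X"
 shows "is_coproduct V (paths (Vert X) a b) (path_tensor E X) (VHom (GO X) (a, b)) (gi X)"
proof -
 have "path_tensor E X p \<in> Obj V" if "p \<in> paths (Vert X) a b" for p
  using EO_Obj[OF lab_lists[OF X pathsD(1)[OF that]]] by (simp add: path_tensor_def)
 then obtain c \<iota> where "is_coproduct V (paths (Vert X) a b) (path_tensor E X) c \<iota>"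
  by (rule coproduct_exists[OF small_paths[OF X]])
 note c = coproduct_chosen[OF this]
 have "VHom (GO X) (a, b) = coprod V (paths (Vert X) a b) (path_tensor E X)" using ab by (simp add: gamma_obj_def)
 then show ?thesis using coproduct_cong[OF c, of _ "gi X"] by (simp add: gamma_inj_def paths_def)
qed

lemma gamma_vgraph: "X \<in> vgraphs U V \<Longrightarrow> GO X \<in> vgraphs U V"
 using coproduct_facts(1)[OF gamma_coproduct]
 by (auto simp: vgraphs_def gamma_obj_def PiE_iff)

lemma gi_facts:
 assumes X: "X \<in> vgraphs U V" and p: "p \<in> paths (Vert X) a b"
 shows "gi X p \<in> Arr V" "Dom V (gi X p) = EO (map (VHom X) (steps p))" "Cod V (gi X p) = VHom (GO X) (a, b)"
 using coproduct_facts(2-4)[OF gamma_coproduct[OF X pathsD(5,6)[OF p]] p] by (simp_all add: path_tensor_def)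

lemma gamma_arr:
 assumes f: "f \<in> vgmaps U V"
 shows "GA f \<in> vgmaps U V" "GDom (GA f) = GO (GDom f)" "GCod (GA f) = GO (GCod f)" "OMap (GA f) = OMap f"
  "p \<in> paths (Vert (GDom f)) a b \<Longrightarrow>
   HMap (GA f) (a, b) ** gi (GDom f) p = gi (GCod f) (map (OMap f) p) ** EA (map (HMap f) (steps p))"
proof -
 note F = vgmap_facts[OF f]
 show s: "GDom (GA f) = GO (GDom f)" "GCod (GA f) = GO (GCod f)" "OMap (GA f) = OMap f"
  by (simp_all add: gamma_arr_def Let_def)
 let ?X = "GDom f" and ?Y = "GCod f"
 let ?g = "\<lambda>p. gi ?Y (map (OMap f) p) ** EA (map (HMap f) (steps p))"
 have H: "HMap (GA f) (a, b) \<in> Arr V \<and> Dom V (HMap (GA f) (a, b)) = VHom (GO ?X) (a, b) \<and>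
   Cod V (HMap (GA f) (a, b)) = VHom (GO ?Y) (OMap f a, OMap f b) \<and>
   (\<forall>p\<in>paths (Vert ?X) a b. HMap (GA f) (a, b) ** gi ?X p = ?g p)" if ab: "a \<in> Vert ?X" "b \<in> Vert ?X" for a b
 proof -
  have h: "HMap (GA f) (a, b) = cotuple V (paths (Vert ?X) a b) (path_tensor E ?X) (VHom (GO ?Y) (OMap f a, OMap f b)) ?g"
   using ab by (simp add: gamma_arr_def Let_def)
  have d: "VHom (GO ?X) (a, b) = coprod V (paths (Vert ?X) a b) (path_tensor E ?X)" using ab by (simp add: gamma_obj_def)
  have i: "gi ?X p = coinj V (paths (Vert ?X) a b) (path_tensor E ?X) p" if "p \<in> paths (Vert ?X) a b" for p
   using that by (simp add: gamma_inj_def paths_def)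
  have O: "VHom (GO ?Y) (OMap f a, OMap f b) \<in> Obj V"
   by (rule coproduct_facts(1)[OF gamma_coproduct[OF F(2) F(3)[OF ab(1)] F(3)[OF ab(2)]]])
  have g: "?g p \<in> hom V (path_tensor E ?X p) (VHom (GO ?Y) (OMap f a, OMap f b))" if p: "p \<in> paths (Vert ?X) a b" for p
   using gi_facts[OF F(2) paths_vgmap[OF f p]] map_HMap_facts[OF f pathsD(1)[OF p]]
    EA_Arr[OF map_HMap_facts(1)[OF f pathsD(1)[OF p]]] by (simp add: path_tensor_def del: map_map)
  note t = cotuple_facts[OF gamma_coproduct[OF F(1) ab] O g]
  show ?thesis unfolding h d using t i by simp
 qed
 show "p \<in> paths (Vert ?X) a b \<Longrightarrow> HMap (GA f) (a, b) ** gi ?X p = ?g p" using H pathsD(5,6) by metis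
 show "GA f \<in> vgmaps U V"
 proof (rule vgmapI[OF gamma_vgraph[OF F(1)] gamma_vgraph[OF F(2)] s(1,2)])
  show "HMap (GA f) \<in> extensional (Vert (GO ?X) \<times> Vert (GO ?X))" by (simp add: gamma_arr_def Let_def)
  show "OMap (GA f) \<in> extensional (Vert (GO ?X))" using f by (simp add: s vgmaps_def PiE_def)
 qed (use H s F in auto)
qed

lemma gamma_functor: "is_functor Gr Gr (MFun (gamma_monad U V E))"
proof -
 let ?F = "MFun (gamma_monad U V E)"
 have o: "FObj ?F X = GO X" if "X \<in> vgraphs U V" for X using that by (simp add: gamma_monad_def)
 have m: "FArr ?F f = GA f" if "f \<in> vgmaps U V" for f using that by (simp add: gamma_monad_def)
 \<comment> \<open>\<open>GA f\<close> is the only map with its behaviour on summands, so the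
   functor laws reduce to checking this behaviour.\<close>
 have eq: "GA f = g" if f: "f \<in> vgmaps U V" and g: "g \<in> vgmaps U V" "GDom g = GO (GDom f)" "GCod g = GO (GCod f)"
   "\<And>a. a \<in> Vert (GDom f) \<Longrightarrow> OMap g a = OMap f a"
  and e: "\<And>p a b. p \<in> paths (Vert (GDom f)) a b \<Longrightarrow>
   HMap g (a, b) ** gi (GDom f) p = gi (GCod f) (map (OMap f) p) ** EA (map (HMap f) (steps p))" for f g
 proof -
  note G = gamma_arr[OF f]
  show ?thesis
  proof (rule vgmap_eqI[OF G(1) g(1) G(2) g(2)])
   fix a b assume "a \<in> Vert (GO (GDom f))" "b \<in> Vert (GO (GDom f))"
   then have ab: "a \<in> Vert (GDom f)" "b \<in> Vert (GDom f)" by auto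
   show "HMap (GA f) (a, b) = HMap g (a, b)"
   proof (rule coproduct_eqI[OF gamma_coproduct[OF vgmap_facts(1)[OF f] ab]])
    fix p assume "p \<in> paths (Vert (GDom f)) a b"
    then show "HMap (GA f) (a, b) ** gi (GDom f) p = HMap g (a, b) ** gi (GDom f) p" using e G(5) by simp
   qed (use vgmap_facts(4-6)[OF G(1), of a b] vgmap_facts(4-6)[OF g(1), of a b] G g ab in simp_all)
  qed (use G g in simp_all)
 qed
 show ?thesis
  unfolding is_functor_def
 proof (intro conjI ballI impI)
  fix X assume "X \<in> Obj Gr"
  then have X: "X \<in> vgraphs U V" by simp
  have "GA (Ident Gr X) = Ident Gr (GO X)"
  proof (rule eq)
   fix p a b assume "p \<in> paths (Vert (GDom (Ident Gr X))) a b"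
   then have p: "p \<in> paths (Vert X) a b" by simp
   have st: "s \<in> Vert X \<times> Vert X" if "s \<in> set (steps p)" for s using steps_subset[OF pathsD(1)[OF p]] that by blast
   have m1: "map (OMap (Ident Gr X)) p = p" by (rule map_idI) (use pathsD(1)[OF p] in auto)
   have m2: "map (HMap (Ident Gr X)) (steps p) = map (Ident V) (map (VHom X) (steps p))" using st by auto
   show "HMap (Ident Gr (GO X)) (a, b) ** gi (GDom (Ident Gr X)) p =
     gi (GCod (Ident Gr X)) (map (OMap (Ident Gr X)) p) ** EA (map (HMap (Ident Gr X)) (steps p))"
    unfolding m1 m2 EA_Ident[OF lab_lists[OF X pathsD(1)[OF p]]] using gi_facts[OF X p] pathsD(5,6)[OF p] by simp
  qed (use X gamma_vgraph[OF X] in \<open>simp_all add: Ident_vgmap\<close>)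
  then show "FArr ?F (Ident Gr X) = Ident Gr (FObj ?F X)" using X m[OF Ident_vgmap[OF X]] o by simp
 next
  fix f g assume "f \<in> Arr Gr" "g \<in> Arr Gr" "Dom Gr g = Cod Gr f"
  then have f: "f \<in> vgmaps U V" and g: "g \<in> vgmaps U V" and c: "GDom g = GCod f" by auto
  note F = gamma_arr[OF f] and G = gamma_arr[OF g]
  have "GA (Comp Gr g f) = Comp Gr (GA g) (GA f)"
  proof (rule eq)
   fix p a b assume "p \<in> paths (Vert (GDom (Comp Gr g f))) a b"
   then have p: "p \<in> paths (Vert (GDom f)) a b" by simp
   note ab = pathsD(5,6)[OF p] and fp = paths_vgmap[OF f p]
   have fp': "map (OMap f) p \<in> paths (Vert (GDom g)) (OMap f a) (OMap f b)" using fp c by simp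
   note i = gi_facts[OF vgmap_facts(1)[OF f] p] and i2 = gi_facts[OF vgmap_facts(2)[OF f] fp]
    and i3 = gi_facts[OF vgmap_facts(2)[OF g] paths_vgmap[OF g fp']]
   note mf = map_HMap_facts[OF f pathsD(1)[OF p]] and mg = map_HMap_facts[OF g pathsD(1)[OF fp'], unfolded c]
   note ef = EA_Arr[OF mf(1), unfolded mf(2,3)] and eg = EA_Arr[OF mg(1), unfolded mg(2,3)]
   have tf: "HMap (GA f) (a, b) \<in> Arr V" "Dom V (HMap (GA f) (a, b)) = VHom (GO (GDom f)) (a, b)"
    "Cod V (HMap (GA f) (a, b)) = VHom (GO (GCod f)) (OMap f a, OMap f b)"
    "HMap (GA g) (OMap f a, OMap f b) \<in> Arr V" "Dom V (HMap (GA g) (OMap f a, OMap f b)) = VHom (GO (GCod f)) (OMap f a, OMap f b)"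
    using vgmap_facts(4-6)[OF F(1), of a b] vgmap_facts(4-6)[OF G(1), of "OMap f a" "OMap f b"] F G ab c vgmap_facts(3)[OF f] by simp_all
   have "HMap (Comp Gr (GA g) (GA f)) (a, b) ** gi (GDom f) p = (HMap (GA g) (OMap f a, OMap f b) ** HMap (GA f) (a, b)) ** gi (GDom f) p"
    using F ab by simp
   also have "\<dots> = HMap (GA g) (OMap f a, OMap f b) ** HMap (GA f) (a, b) ** gi (GDom f) p" using tf i by simp
   also have "\<dots> = (HMap (GA g) (OMap f a, OMap f b) ** gi (GDom g) (map (OMap f) p)) ** EA (map (HMap f) (steps p))"
    unfolding F(5)[OF p] c by (rule Comp_assoc[symmetric]) (simp_all only: tf i2 ef)
   also have "\<dots> = gi (GCod g) (map (OMap g) (map (OMap f) p)) ** EA (map (HMap g) (steps (map (OMap f) p))) ** EA (map (HMap f) (steps p))"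
    unfolding G(5)[OF fp'] by (rule Comp_assoc) (simp_all only: i3 ef eg c)
   also have "EA (map (HMap g) (steps (map (OMap f) p))) ** EA (map (HMap f) (steps p)) = EA (map (HMap (Comp Gr g f)) (steps p))"
    unfolding map_HMap_Comp[OF pathsD(1)[OF p]] by (rule EA_Comp[OF mf(1) mg(1)]) (simp only: mf mg)
   finally show "HMap (Comp Gr (GA g) (GA f)) (a, b) ** gi (GDom (Comp Gr g f)) p =
     gi (GCod (Comp Gr g f)) (map (OMap (Comp Gr g f)) p) ** EA (map (HMap (Comp Gr g f)) (steps p))"
    unfolding map_OMap_Comp[OF pathsD(1)[OF p]] Graphs_Comp_simps(1,2) .
  qed (use f g c F G in \<open>simp_all add: Comp_vgmap\<close>)
  then show "FArr ?F (Comp Gr g f) = Comp Gr (FArr ?F g) (FArr ?F f)" using m[OF f] m[OF g] m[OF Comp_vgmap[OF f g c]] by simp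
 qed (use gamma_vgraph gamma_arr vgmap_facts(1,2) in \<open>auto simp: gamma_monad_def Graphs_category\<close>)
qed

lemma gamma_presented: "presented_functor U V E (gamma_monad U V E) gi"
proof
 show "is_functor Gr Gr (MFun (gamma_monad U V E))" by (rule gamma_functor)
next
 fix f p assume f: "f \<in> vgmaps U V" and p: "p \<in> lists (Vert (GDom f))" "p \<noteq> []"
 show "HMap (FArr (MFun (gamma_monad U V E)) f) (hd p, last p) ** gi (GDom f) p =
   gi (GCod f) (map (OMap f) p) ** EA (map (HMap f) (steps p))"
  using gamma_arr(5)[OF f pathsI[OF p]] f by (simp add: gamma_monad_def)
qed (use gamma_coproduct gamma_arr in \<open>simp_all add: gamma_monad_def\<close>)

end

context multitensor_data
begin

lemma gamma_presentation: "presentation U V E (gamma_monad U V E) gi"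
proof -
 interpret P: presented_functor U V E "gamma_monad U V E" gi by (rule gamma_presented)
 have TO: "P.TO X = GO X" if "X \<in> vgraphs U V" for X using that by (simp add: gamma_monad_def)
 have U: "MUnit (gamma_monad U V E) X = gamma_unit V E X" "MMult (gamma_monad U V E) X = gamma_mult V E X"
  if "X \<in> vgraphs U V" for X using that by (simp_all add: gamma_monad_def)
 \<comment> \<open>The description of \<open>gamma_mult\<close> by \<open>THE\<close> is justified
   here: the twofold iterate is a coproduct over all pairs \<open>(p, qs)\<close>, so exactly one
   arrow has the required restrictions.\<close>
 have M: "HMap (gamma_mult V E X) (a, b) \<in> hom V (VHom (GO (GO X)) (a, b)) (VHom (GO X) (a, b)) \<and>
   (\<forall>p\<in>paths (Vert X) a b. \<forall>qs\<in>refinements (Vert X) p.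
    HMap (gamma_mult V E X) (a, b) ** gi (GO X) p ** EA (map (gi X) qs) =
    gi X (glue p qs) ** ESubst E (map (\<lambda>q. map (VHom X) (steps q)) qs))"
  if X: "X \<in> vgraphs U V" and ab: "a \<in> Vert X" "b \<in> Vert X" for X a b
 proof -
  have GX: "GO X \<in> vgraphs U V" by (rule gamma_vgraph[OF X])
  have co: "is_coproduct V (Sigma (paths (Vert X) a b) (refinements (Vert X))) (\<lambda>(p, qs). EO (map EO (map (P.lab X) qs)))
    (VHom (GO (GO X)) (a, b)) (\<lambda>(p, qs). gi (GO X) p ** EA (map (gi X) qs))"
   using P.TTO_coproduct[OF X ab] TO X GX by simp
  have d: "VHom (GO X) (a, b) \<in> Obj V" by (rule coproduct_facts(1)[OF gamma_coproduct[OF X ab]])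
  have "gi X (glue p qs) ** ESubst E (map (P.lab X) qs) \<in> hom V (EO (map EO (map (P.lab X) qs))) (VHom (GO X) (a, b))"
   if p: "p \<in> paths (Vert X) a b" and qs: "qs \<in> refinements (Vert X) p" for p qs
  proof -
   have "z \<in> lists (Obj V)" if "z \<in> set (map (P.lab X) qs)" for z
    using that lab_lists[OF X] refinements_lists[OF qs] by auto
   note s = E_subst_facts[of "map (P.lab X) qs", OF this]
   have "P.lab X (glue p qs) = concat (map (P.lab X) qs)"
    using steps_glue[OF qs pathsD(2)[OF p]] by (simp add: map_concat comp_def)
   then show ?thesis using s gi_facts[OF X glue_paths[OF p qs]] by simp
  qed
  then have "\<exists>!u. u \<in> hom V (VHom (GO (GO X)) (a, b)) (VHom (GO X) (a, b)) \<and>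
    (\<forall>t\<in>Sigma (paths (Vert X) a b) (refinements (Vert X)). u ** (case t of (p, qs) \<Rightarrow> gi (GO X) p ** EA (map (gi X) qs)) =
     (case t of (p, qs) \<Rightarrow> gi X (glue p qs) ** ESubst E (map (P.lab X) qs)))"
   by (intro coproduct_ex1[OF co d]) auto
  then have "\<exists>!u. u \<in> hom V (VHom (GO (GO X)) (a, b)) (VHom (GO X) (a, b)) \<and>
   (\<forall>p\<in>paths (Vert X) a b. \<forall>qs\<in>refinements (Vert X) p. u ** gi (GO X) p ** EA (map (gi X) qs) =
    gi X (glue p qs) ** ESubst E (map (\<lambda>q. map (VHom X) (steps q)) qs))"
   by (simp only: split_paired_Ball_Sigma prod.case)
  from theI'[OF this] show ?thesis using ab by (simp add: gamma_mult_def Let_def)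
 qed
 show ?thesis
 proof
  fix X assume X: "X \<in> vgraphs U V"
  have GX: "GO X \<in> vgraphs U V" by (rule gamma_vgraph[OF X])
  have u: "HMap (gamma_unit V E X) (a, b) = gi X [a, b] ** EUnit E (VHom X (a, b))" if "a \<in> Vert X" "b \<in> Vert X" for a b
   using that by (simp add: gamma_unit_def)
  have "gamma_unit V E X \<in> vgmaps U V"
  proof (rule vgmapI[OF X GX])
   fix a b assume ab: "a \<in> Vert X" "b \<in> Vert X"
   have "[a, b] \<in> paths (Vert X) a b" using ab by simp
   from gi_facts[OF X this] E_unit[OF vgraph_facts(2)[OF X ab]] u[OF ab]
   show "HMap (gamma_unit V E X) (a, b) \<in> hom V (VHom X (a, b)) (VHom (GO X) (OMap (gamma_unit V E X) a, OMap (gamma_unit V E X) b))"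
    using ab by (simp add: gamma_unit_def)
  qed (simp_all add: gamma_unit_def)
  then show "MUnit (gamma_monad U V E) X \<in> vgmaps U V \<and> GDom (MUnit (gamma_monad U V E) X) = X \<and>
    GCod (MUnit (gamma_monad U V E) X) = P.TO X \<and> OMap (MUnit (gamma_monad U V E) X) = (\<lambda>a\<in>Vert X. a)"
   unfolding U[OF X] TO[OF X] by (simp add: gamma_unit_def)
  have "gamma_mult V E X \<in> vgmaps U V"
   by (rule vgmapI[OF gamma_vgraph[OF GX] GX]) (use M[OF X] in \<open>auto simp: gamma_mult_def Let_def\<close>)
  then show "MMult (gamma_monad U V E) X \<in> vgmaps U V \<and> GDom (MMult (gamma_monad U V E) X) = P.TO (P.TO X) \<and>
    GCod (MMult (gamma_monad U V E) X) = P.TO X \<and> OMap (MMult (gamma_monad U V E) X) = (\<lambda>a\<in>Vert X. a)"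
   unfolding U[OF X] TO[OF X] TO[OF GX] by (simp add: gamma_mult_def Let_def)
  show "a \<in> Vert X \<Longrightarrow> b \<in> Vert X \<Longrightarrow> HMap (MUnit (gamma_monad U V E) X) (a, b) = gi X [a, b] ** EUnit E (VHom X (a, b))" for a b
   unfolding U[OF X] by (rule u)
  show "HMap (MMult (gamma_monad U V E) X) (a, b) ** gi (P.TO X) p ** EA (map (gi X) qs) =
    gi X (glue p qs) ** ESubst E (map (\<lambda>q. map (VHom X) (steps q)) qs)"
   if "p \<in> paths (Vert X) a b" "qs \<in> refinements (Vert X) p" for p qs a b
   unfolding U[OF X] TO[OF X] using M[OF X pathsD(5,6)[OF that(1)]] that by blast
 qed (simp_all add: gamma_monad_def)
qed

end

lemma gamma_related:
 assumes A: "multitensor_data U V A" and B: "multitensor_data U V B"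
  and \<phi>: "\<And>Z. Z \<in> lists (Obj V) \<Longrightarrow> \<phi> Z \<in> hom V (FObj (EFun A) Z) (FObj (EFun B) Z)" "\<phi> \<in> extensional (lists (Obj V))"
 shows "related U V A (gamma_monad U V A) (gamma_inj V A) B (gamma_monad U V B) (gamma_inj V B) \<phi> (gamma_mor U V A B \<phi>)"
proof -
 interpret A: multitensor_data U V A by fact
 interpret B: multitensor_data U V B by fact
 show ?thesis
  unfolding related_def
 proof (intro conjI ballI allI)
  fix X assume X: "X \<in> vgraphs U V"
  let ?\<psi> = "gamma_mor U V A B \<phi> X" and ?D = "\<lambda>a b. paths (Vert X) a b"
  have H: "HMap ?\<psi> (a, b) \<in> hom V (VHom (A.GO X) (a, b)) (VHom (B.GO X) (a, b)) \<and>
    (\<forall>p\<in>?D a b. Comp V (HMap ?\<psi> (a, b)) (A.gi X p) = Comp V (B.gi X p) (\<phi> (map (VHom X) (steps p))))"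
   if ab: "a \<in> Vert X" "b \<in> Vert X" for a b
  proof -
   have i: "gamma_inj V E X p = coinj V (?D a b) (path_tensor E X) p" if "p \<in> ?D a b" for p E
    using that by (simp add: gamma_inj_def paths_def)
   have d: "VHom (gamma_obj V E X) (a, b) = coprod V (?D a b) (path_tensor E X)" for E using ab by (simp add: gamma_obj_def)
   have h: "HMap ?\<psi> (a, b) = cotuple V (?D a b) (path_tensor A X) (VHom (B.GO X) (a, b))
     (\<lambda>p. Comp V (coinj V (?D a b) (path_tensor B X) p) (\<phi> (map (VHom X) (steps p))))"
    using X ab by (simp add: gamma_mor_def coprod_map_def d)
   have g: "Comp V (coinj V (?D a b) (path_tensor B X) p) (\<phi> (map (VHom X) (steps p))) \<in> hom V (path_tensor A X p) (VHom (B.GO X) (a, b))"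
    if p: "p \<in> ?D a b" for p
    using B.gi_facts[OF X p] \<phi>(1)[OF A.lab_lists[OF X pathsD(1)[OF p]]] i[OF p, of B] by (simp add: path_tensor_def)
   note t = A.cotuple_facts[OF A.gamma_coproduct[OF X ab] A.coproduct_facts(1)[OF B.gamma_coproduct[OF X ab]] g]
   show ?thesis unfolding h using t i d by simp
  qed
  show "?\<psi> \<in> vgmaps U V"
   by (rule A.vgmapI[OF A.gamma_vgraph[OF X] B.gamma_vgraph[OF X]]) (use X H in \<open>auto simp: gamma_mor_def\<close>)
  show "GDom ?\<psi> = FObj (MFun (gamma_monad U V A)) X" "GCod ?\<psi> = FObj (MFun (gamma_monad U V B)) X" "OMap ?\<psi> = (\<lambda>a\<in>Vert X. a)"
   using X by (simp_all add: gamma_mor_def gamma_monad_def)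
  show "Comp V (HMap ?\<psi> (a, b)) (A.gi X p) = Comp V (B.gi X p) (\<phi> (map (VHom X) (steps p)))" if "p \<in> ?D a b" for a b p
   using H[OF pathsD(5,6)[OF that]] that by blast
 qed (use \<phi> in \<open>auto simp: gamma_mor_def\<close>)
qed

section \<open>Cartesian transformations reflect cartesian multitensors\<close>

text \<open>The usual cancellation for pasted squares. Here the first projection of a lift is
  recovered from the universal property of the second square, where the earlier variant cancels a
  monic arrow.\<close>

lemma (in Category) pullback_cancel:
 assumes pb: "is_pullback C (p' ** p) q f' (g' ** g)" and pb': "is_pullback C p' f f' g'"
  and p: "p \<in> Arr C" "g \<in> Arr C" "Cod C p = Dom C f" "Cod C g = Dom C g'" and e: "f ** p = g ** q"
 shows "is_pullback C p q f g"
proof -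
 note b = pullback_facts[OF pb'] and a = pullback_facts(1-8)[OF pb]
 show ?thesis
 proof (rule pullbackI)
  fix h k assume hk: "h \<in> Arr C" "k \<in> Arr C" "Dom C h = Dom C k" "Cod C h = Dom C f" "Cod C k = Dom C g" "f ** h = g ** k"
  have "f' ** p' ** h = g' ** f ** h" by (rule Comp_swap[OF b(9)]) (use hk b in simp_all)
  then obtain u where u: "u \<in> Arr C" "Dom C u = Dom C h" "Cod C u = Dom C (p' ** p)" "(p' ** p) ** u = p' ** h" "q ** u = k"
   using pullback_lift[OF pb, of "p' ** h" k] hk a b p by auto
  have "f ** p ** u = g ** q ** u" by (rule Comp_swap[OF e]) (use u a b p in simp_all)
  then have "p ** u = h" by - (rule pullback_eqI[OF pb'], use u hk a b p in auto)
  then show "\<exists>u\<in>Arr C. Dom C u = Dom C h \<and> Cod C u = Dom C p \<and> p ** u = h \<and> q ** u = k"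
   using u p b by (intro bexI[of _ u]) auto
 next
  fix u v assume "u \<in> Arr C" "v \<in> Arr C" "Dom C u = Dom C v" "Cod C u = Dom C p" "Cod C v = Dom C p" "p ** u = p ** v" "q ** u = q ** v"
  then show "u = v" using a b p by - (rule pullback_eqI[OF pb], auto)
 qed (use a b p e in simp_all)
qed

text \<open>A square of \<open>A\<close> is pasted with a square of \<alpha>. Naturality or the
  morphism laws rewrite the composite as a pullback square of \<open>E\<close> pasted with squares
  of \<alpha>, so it is a pullback, and the square of \<alpha> cancels. Preservation of pullbacks is
  settled before the substitution, which relies on it.\<close>

lemma (in multitensor_data) cartesian_if_over:
 assumes data: "multitensor_data U V A" and A: "is_multitensor V A" and E: "is_cartesian_multitensor V E"
  and mor: "is_multitensor_mor V A E \<alpha>" and cart: "is_cartesian_nat (seq_cat V) V (EFun A) (EFun E) \<alpha>"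
 shows "is_cartesian_multitensor V A"
proof -
 interpret A: multitensor_data U V A by (rule data)
 interpret S: Category "seq_cat V" by unfold_locales (rule seq_category)
 have a: "\<alpha> Z \<in> Arr V" "Dom V (\<alpha> Z) = A.EO Z" "Cod V (\<alpha> Z) = EO Z" if "Z \<in> lists (Obj V)" for Z
  using cart that by (simp_all add: is_cartesian_nat_def is_nat_def)
 have sq: "is_pullback V (\<alpha> (map (Dom V) fs)) (A.EA fs) (EA fs) (\<alpha> (map (Cod V) fs))" if "fs \<in> lists (Arr V)" for fs
  using cart that by (simp add: is_cartesian_nat_def)
 note An = A.is_multitensor_iff[THEN iffD1, OF A]
 have pres: "is_pullback V (A.EA ps) (A.EA qs) (A.EA fs) (A.EA gs)" if pb: "is_pullback (seq_cat V) ps qs fs gs" for ps qs fs gs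
 proof -
  note c = S.pullback_facts[OF pb, unfolded seq_simps]
  have "is_pullback V (EA ps) (EA qs) (EA fs) (EA gs)"
   using E pb by (simp add: is_cartesian_multitensor_def preserves_pullbacks_def)
  from pullback_paste[OF sq[OF c(2)] this]
  have o: "is_pullback V (\<alpha> (map (Dom V) fs) ** A.EA ps) (A.EA qs) (EA fs) (\<alpha> (map (Cod V) gs) ** A.EA gs)"
   using pullback_facts(9)[OF sq[OF c(1)]] pullback_facts(9)[OF sq[OF c(4)]] c(5-7) by simp
  have "A.EA fs ** A.EA ps = A.EA gs ** A.EA qs" using A.EA_Comp[OF c(1,3)] A.EA_Comp[OF c(2,4)] c(6,7,9) by simp
  from pullback_cancel[OF o[folded c(8)] sq[OF c(3)] _ _ _ _ this] show ?thesis
   using A.EA_Arr[OF c(1)] A.EA_Arr[OF c(3)] A.EA_Arr[OF c(4)] a(2)[OF Cod_lists[OF c(3)]] c(6,8) by simp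
 qed
 have unit: "is_pullback V (EUnit A (Dom V f)) f (A.EA [f]) (EUnit A (Cod V f))" if f: "f \<in> Arr V" for f
 proof -
  have l: "[f] \<in> lists (Arr V)" using f by simp
  have "is_pullback V (EUnit E (Dom V f)) f (EA [f]) (EUnit E (Cod V f))"
   using E f by (simp add: is_cartesian_multitensor_def is_cartesian_nat_def id_fctr_def unary_part_def comp_fctr_def seq_unit_def)
  moreover have "\<alpha> [x] ** EUnit A x = EUnit E x" if "x \<in> Obj V" for x using mor that by (simp add: is_multitensor_mor_def)
  ultimately have o: "is_pullback V (\<alpha> [Dom V f] ** EUnit A (Dom V f)) f (EA [f]) (\<alpha> [Cod V f] ** EUnit A (Cod V f))" using f by simp
  show ?thesis
   by (rule pullback_cancel[OF o sq[OF l, simplified]])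
    (use An f A.E_unit[of "Dom V f"] A.E_unit[of "Cod V f"] A.EA_Arr[OF l] a[of "[Cod V f]"] in simp_all)
 qed
 have subst: "is_pullback V (ESubst A (map (map (Dom V)) fss)) (A.EA (map A.EA fss)) (A.EA (concat fss)) (ESubst A (map (map (Cod V)) fss))"
  if fss: "fss \<in> lists (lists (Arr V))" for fss
 proof -
  let ?Z = "map (map (Dom V)) fss" and ?W = "map (map (Cod V)) fss"
  have fs: "fs \<in> lists (Arr V)" if "fs \<in> set fss" for fs using fss that by (auto simp: in_lists_conv_set[of fss])
  have c: "concat fss \<in> lists (Arr V)" using fs by force
  have m: "map EA fss \<in> lists (Arr V)" "map (Dom V) (map EA fss) = map EO ?Z" "map (Cod V) (map EA fss) = map EO ?W"
   using fs EA_Arr by auto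
  have l: "z \<in> lists (Obj V)" if "z \<in> set ?Z \<or> z \<in> set ?W" for z using that fs by fastforce
  have L: "?Z \<in> lists (lists (Obj V))" "?W \<in> lists (lists (Obj V))" using l by (auto simp only: in_lists_conv_set[of ?Z] in_lists_conv_set[of ?W])
  have s: "A.EA (map A.EA fss) \<in> Arr V" "ESubst A ?Z \<in> Arr V" "ESubst A ?W \<in> Arr V" "Cod V (ESubst A ?Z) = A.EO (concat ?Z)"
   "Cod V (ESubst A ?W) = A.EO (concat ?W)"
   using A.EA_map_Arr(1)[of fss A.EA] A.EA_Arr(1)[OF fs] A.E_subst_facts[of ?Z] A.E_subst_facts[of ?W] l by auto
  have "is_pullback (seq_cat V) (map \<alpha> ?Z) (map A.EA fss) (map EA fss) (map \<alpha> ?W)"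
   by (rule seq_pullbackI) (use sq fs in simp_all)
  \<comment> \<open>Three squares are pasted: \<open>A\<close> applied to squares of \<alpha>, the
    square of \<alpha> at \<open>map EA fss\<close>, and the substitution square of
    \<open>E\<close>.\<close>
  from pullback_paste[OF pullback_paste[OF pres[OF this] sq[OF m(1), unfolded m(2,3)]]]
  have "is_pullback V (ESubst E ?Z ** \<alpha> (map EO ?Z) ** A.EA (map \<alpha> ?Z)) (A.EA (map A.EA fss)) (EA (concat fss))
    (ESubst E ?W ** \<alpha> (map EO ?W) ** A.EA (map \<alpha> ?W))"
   using E fss by (auto simp: is_cartesian_multitensor_def is_cartesian_nat_def nested_def flattened_def comp_fctr_def seq_map_def seq_concat_def seq_cat_def)
  moreover have "\<alpha> (concat Z) ** ESubst A Z = ESubst E Z ** \<alpha> (map EO Z) ** A.EA (map \<alpha> Z)" if "Z \<in> lists (lists (Obj V))" for Z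
   using mor that by (simp add: is_multitensor_mor_def)
  note this[OF L(1), symmetric] this[OF L(2), symmetric]
  ultimately have o: "is_pullback V (\<alpha> (concat ?Z) ** ESubst A ?Z) (A.EA (map A.EA fss)) (EA (concat fss)) (\<alpha> (concat ?W) ** ESubst A ?W)"
   by (simp only:)
  have e: "A.EA (concat fss) ** ESubst A ?Z = ESubst A ?W ** A.EA (map A.EA fss)" using An fss by blast
  show ?thesis
   by (rule pullback_cancel[OF o sq[OF c, unfolded map_concat] s(2,3) _ _ e])
    (use s A.EA_Arr[OF c] a(2)[of "concat ?W"] Cod_lists[OF c] in \<open>simp_all add: map_concat\<close>)
 qed
 show ?thesis
  unfolding is_cartesian_multitensor_def preserves_pullbacks_def is_cartesian_nat_def
 proof (intro conjI allI impI ballI)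
  fix fss assume "fss \<in> Arr (seq_cat (seq_cat V))"
  then have "fss \<in> lists (lists (Arr V))" by (simp add: seq_cat_def)
  then show "is_pullback V (ESubst A (Dom (seq_cat (seq_cat V)) fss)) (FArr (nested V A) fss) (FArr (flattened V A) fss)
    (ESubst A (Cod (seq_cat (seq_cat V)) fss))"
   using subst by (simp add: nested_def flattened_def comp_fctr_def seq_map_def seq_concat_def seq_cat_def)
 qed (use A pres unit in \<open>simp_all add: is_multitensor_def id_fctr_def unary_part_def comp_fctr_def seq_unit_def\<close>)
qed

section \<open>Operads over sets are presented by multitensors\<close>

context extensive_category
begin

text \<open>The path \<open>p\<close> of \<open>X\<close>, seen as a map into \<open>X\<close> from the graph of its sequence of homs.\<close>

definition ev :: "('i, 'o) vgraph \<Rightarrow> 'i list \<Rightarrow> ('i, 'o, 'a) vgmap" where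
 "ev X p = grmap X p (map (Ident V) (map (VHom X) (steps p)))"

lemma ev:
 assumes X: "X \<in> vgraphs U V" and p: "p \<in> paths (Vert X) a b"
 shows "ev X p \<in> vgmaps U V" "GDom (ev X p) = gr (map (VHom X) (steps p))" "GCod (ev X p) = X"
  "map (OMap (ev X p)) (std (length p - 1)) = p"
  "map (HMap (ev X p)) (steps (std (length p - 1))) = map (Ident V) (map (VHom X) (steps p))"
  "OMap (ev X p) (node 0) = a" "OMap (ev X p) (node (length p - 1)) = b"
proof -
 let ?L = "map (VHom X) (steps p)" and ?fs = "map (Ident V) (map (VHom X) (steps p))"
 note P = pathsD[OF p]
 have L: "?L \<in> lists (Obj V)" by (rule lab_lists[OF X P(1)])
 have d: "map (Dom V) ?fs = ?L" "map (Cod V) ?fs = ?L" "?fs \<in> lists (Arr V)" using L by (auto intro!: map_idI)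
 have len: "length p = Suc (length ?fs)" "length ?fs = length p - 1" using P(2) by (cases p; simp)+
 show "ev X p \<in> vgmaps U V" unfolding ev_def by (rule grmap_vgmap[OF X P(1) len(1) d(3,2)])
 show "GDom (ev X p) = gr ?L" "GCod (ev X p) = X" by (simp_all only: ev_def grmap_simps d(1))
 show "map (OMap (ev X p)) (std (length p - 1)) = p" "map (HMap (ev X p)) (steps (std (length p - 1))) = ?fs"
  unfolding ev_def using grmap_std(1)[OF len(1), of X] grmap_std(2)[of X p ?fs] unfolding len(2) by auto
 show "OMap (ev X p) (node 0) = a" "OMap (ev X p) (node (length p - 1)) = b"
  unfolding ev_def using grmap_simps(3)[of 0 ?fs X p] grmap_simps(3)[of "length p - 1" ?fs X p] P(2-4)
  by (simp_all add: hd_conv_nth last_conv_nth)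
qed

lemma grf_Ident: "Z \<in> lists (Obj V) \<Longrightarrow> grf (map (Ident V) Z) = Ident Gr (gr Z)"
proof -
 assume Z: "Z \<in> lists (Obj V)"
 let ?I = "map (Ident V) Z"
 have i: "?I \<in> lists (Arr V)" "map (Dom V) ?I = Z" "map (Cod V) ?I = Z" using Z by (auto intro!: map_idI)
 note g = grf[OF i(1), unfolded i(2,3)]
 note v = Ident_vgmap[OF gr_vgraph[OF Z]]
 show ?thesis
 proof (rule gr_map_eqI[OF g(1,2) v])
  show "map (OMap (grf ?I)) (std (length Z)) = map (OMap (Ident Gr (gr Z))) (std (length Z))"
   using g(4) by (auto simp: std_def)
  have "map (HMap (Ident Gr (gr Z))) (steps (std (length Z))) = map (Ident V) (map (VHom (gr Z)) (steps (std (length Z))))"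
   unfolding map_map using steps_subset[OF std_lists[of Z]] by (auto intro!: map_cong)
  then show "map (HMap (grf ?I)) (steps (std (length Z))) = map (HMap (Ident Gr (gr Z))) (steps (std (length Z)))"
   using g(5) by simp
 qed (simp_all add: g(3))
qed

lemma grf_Comp:
 assumes fs: "fs \<in> lists (Arr V)" and gs: "gs \<in> lists (Arr V)" and e: "map (Dom V) gs = map (Cod V) fs"
 shows "grf (map2 (Comp V) gs fs) = Comp Gr (grf gs) (grf fs)"
proof -
 let ?h = "map2 (Comp V) gs fs"
 interpret S: Category "seq_cat V" by unfold_locales (rule seq_category)
 have "length gs = length fs" using arg_cong[OF e, of length] by simp
 then have len: "length gs = length fs" "length ?h = length fs" by simp_all
 have h: "?h \<in> lists (Arr V)" "map (Dom V) ?h = map (Dom V) fs" "map (Cod V) ?h = map (Cod V) gs"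
  using S.Comp_Arr[of fs gs] S.Dom_Comp[of fs gs] S.Cod_Comp[of fs gs] fs gs e by simp_all
 note F = grf[OF fs] and G = grf[OF gs] and H = grf[OF h(1), unfolded h(2,3) len]
 have c: "Comp Gr (grf gs) (grf fs) \<in> vgmaps U V" by (rule Comp_vgmap[OF F(1) G(1)]) (simp add: F G e)
 have l: "std (length fs) \<in> lists (Vert (gr (map (Dom V) fs)))" using std_lists[of "map (Dom V) fs"] by simp
 note P = grf_path[OF fs l]
 show ?thesis
 proof (rule gr_map_eqI[OF H(1,2) c])
  have "map (OMap (grf ?h)) (std (length fs)) = std (length fs)" by (rule grf_path[OF h(1), unfolded h(2), OF l])
  moreover have "map (OMap (grf gs)) (std (length fs)) = std (length fs)"
   using grf_path[OF gs] std_lists[of "map (Dom V) gs"] len by simp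
  ultimately show "map (OMap (grf ?h)) (std (length (map (Dom V) fs))) =
    map (OMap (Comp Gr (grf gs) (grf fs))) (std (length (map (Dom V) fs)))"
   using map_OMap_Comp[of "std (length fs)" "grf fs" "grf gs"] l F(2) P by simp
  show "map (HMap (grf ?h)) (steps (std (length (map (Dom V) fs)))) =
    map (HMap (Comp Gr (grf gs) (grf fs))) (steps (std (length (map (Dom V) fs))))"
   using map_HMap_Comp[of "std (length fs)" "grf fs" "grf gs"] l F(2,5) P H(5) G(5) len by simp
 qed (simp_all add: F G H)
qed

text \<open>Both composites follow the path \<open>map (OMap f) p\<close> with arrows
  \<open>map (HMap f) (steps p)\<close>. Applying the functor of an operad to this equation gives
  naturality of its coprojections.\<close>

lemma ev_natural:
 assumes f: "f \<in> vgmaps U V" and p: "p \<in> paths (Vert (GDom f)) a b"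
 shows "Comp Gr f (ev (GDom f) p) = Comp Gr (ev (GCod f) (map (OMap f) p)) (grf (map (HMap f) (steps p)))"
proof -
 let ?X = "GDom f" and ?Y = "GCod f" and ?q = "map (OMap f) p" and ?fs = "map (HMap f) (steps p)" and ?n = "length p - 1"
 note X = vgmap_facts(1)[OF f] and Y = vgmap_facts(2)[OF f]
 note q = paths_vgmap[OF f p] and P = pathsD[OF p]
 note h = map_HMap_facts[OF f P(1)]
 note g = grf[OF h(1), unfolded h(2,3)]
 note E = ev[OF X p] and E' = ev[OF Y q]
 have c: "Comp Gr f (ev ?X p) \<in> vgmaps U V" by (rule Comp_vgmap[OF E(1) f]) (simp add: E)
 have c': "Comp Gr (ev ?Y ?q) (grf ?fs) \<in> vgmaps U V" by (rule Comp_vgmap[OF g(1) E'(1)]) (simp add: E' g)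
 have l: "std ?n \<in> lists (Vert (gr (map (VHom ?X) (steps p))))" using std_lists[of "map (VHom ?X) (steps p)"] by simp
 have gp: "map (OMap (grf ?fs)) (std ?n) = std ?n" using grf_path[OF h(1), unfolded h(2) , OF l] .
 have e1: "map2 (Comp V) ?fs (map (Ident V) (map (VHom ?X) (steps p))) = ?fs"
 proof (rule nth_equalityI)
  fix i assume "i < length (map2 (Comp V) ?fs (map (Ident V) (map (VHom ?X) (steps p))))"
  then have i: "i < length (steps p)" by simp
  then have "?fs ! i \<in> Arr V" "Dom V (?fs ! i) = map (VHom ?X) (steps p) ! i"
   using h(1) unfolding h(2)[symmetric] by (simp_all add: lists_nth)
  then show "map2 (Comp V) ?fs (map (Ident V) (map (VHom ?X) (steps p))) ! i = ?fs ! i" using i by simp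
 qed simp
 have e2: "map2 (Comp V) (map (Ident V) (map (VHom ?Y) (steps ?q))) ?fs = ?fs"
 proof (rule nth_equalityI)
  fix i assume "i < length (map2 (Comp V) (map (Ident V) (map (VHom ?Y) (steps ?q))) ?fs)"
  then have i: "i < length (steps p)" by simp
  then have "?fs ! i \<in> Arr V" "Cod V (?fs ! i) = map (VHom ?Y) (steps ?q) ! i"
   using h(1) unfolding h(3)[symmetric] by (simp_all add: lists_nth)
  then show "map2 (Comp V) (map (Ident V) (map (VHom ?Y) (steps ?q))) ?fs ! i = ?fs ! i" using i by simp
 qed simp
 have n: "length (map (VHom ?X) (steps p)) = ?n" by simp
 show ?thesis
 proof (rule gr_map_eqI[of _ "map (VHom ?X) (steps p)", OF c _ c', unfolded n])
  show "map (OMap (Comp Gr f (ev ?X p))) (std ?n) = map (OMap (Comp Gr (ev ?Y ?q) (grf ?fs))) (std ?n)"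
   unfolding map_OMap_Comp[of "std ?n" "ev ?X p" f, unfolded E(2), OF l] map_OMap_Comp[of "std ?n" "grf ?fs" "ev ?Y ?q", unfolded g(2), OF l]
    gp E(4) using E'(4) by simp
  show "map (HMap (Comp Gr f (ev ?X p))) (steps (std ?n)) = map (HMap (Comp Gr (ev ?Y ?q) (grf ?fs))) (steps (std ?n))"
   unfolding map_HMap_Comp[of "std ?n" "ev ?X p" f, unfolded E(2), OF l] map_HMap_Comp[of "std ?n" "grf ?fs" "ev ?Y ?q", unfolded g(2), OF l]
    gp E(4,5) e1 using E'(5) g(5) e2 by simp
 qed (simp_all add: E E' g)
qed

lemma multitensor_dataI:
 assumes A: "is_multitensor V A" and d: "is_distributive U V A"
 shows "multitensor_data U V A"
proof
 show "is_functor (seq_cat V) V (EFun A)" using A by (simp add: is_multitensor_def)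
 have "is_nat V V (id_fctr V) (unary_part V A) (EUnit A)" using A by (simp add: is_multitensor_def)
 then show "EUnit A \<in> extensional (Obj V)" "\<And>z. z \<in> Obj V \<Longrightarrow> EUnit A z \<in> hom V z (FObj (EFun A) [z])"
  by (simp_all add: is_nat_def id_fctr_def unary_part_def comp_fctr_def seq_unit_def)
 have "is_nat (seq_cat (seq_cat V)) V (nested V A) (flattened V A) (ESubst A)" using A by (simp add: is_multitensor_def)
 then show "ESubst A \<in> extensional (lists (lists (Obj V)))" "\<And>Z. Z \<in> lists (lists (Obj V)) \<Longrightarrow>
   ESubst A Z \<in> hom V (FObj (EFun A) (map (FObj (EFun A)) Z)) (FObj (EFun A) (concat Z))"
  by (simp_all add: is_nat_def nested_def flattened_def comp_fctr_def seq_map_def seq_concat_def seq_cat_def)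
qed (rule d)

end

text \<open>\<open>E\<close> sends the coprojections to coprojections, and the cartesian squares of
  \<alpha> exhibit their images under \<open>A\<close> as pullbacks of these; coproducts are
  universal.\<close>

lemma (in tensor_functor) distributive_if_over:
 assumes A: "is_functor (seq_cat V) V (EFun A)"
  and \<alpha>: "is_cartesian_nat (seq_cat V) V (EFun A) (EFun E) \<alpha>"
 shows "is_distributive U V A"
 unfolding is_distributive_def
proof (intro ballI allI impI)
 fix xs ys I X c \<iota> assume xs: "xs \<in> lists (Obj V)" and ys: "ys \<in> lists (Obj V)" and I: "I \<in> U"
  and co: "is_coproduct V I X c \<iota>"
 let ?f = "\<lambda>i. map (Ident V) xs @ [\<iota> i] @ map (Ident V) ys"
 note C = coproduct_facts[OF co]
 have f: "?f i \<in> lists (Arr V)" "map (Dom V) (?f i) = xs @ [X i] @ ys" "map (Cod V) (?f i) = xs @ [c] @ ys" if "i \<in> I" for i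
  using C(2-4)[OF that] xs ys by (auto intro!: map_idI)
 have Z: "xs @ [c] @ ys \<in> lists (Obj V)" using xs ys C(1) by simp
 have a: "\<alpha> (xs @ [c] @ ys) \<in> hom V (FObj (EFun A) (xs @ [c] @ ys)) (EO (xs @ [c] @ ys))"
  using \<alpha> Z by (simp add: is_cartesian_nat_def is_nat_def)
 have pb: "is_pullback V (\<alpha> (xs @ [X i] @ ys)) (FArr (EFun A) (?f i)) (EA (?f i)) (\<alpha> (xs @ [c] @ ys))" if "i \<in> I" for i
  using \<alpha> f[OF that] unfolding is_cartesian_nat_def seq_simps by metis
 have "is_coproduct V I (\<lambda>i. Dom V (FArr (EFun A) (?f i))) (Dom V (\<alpha> (xs @ [c] @ ys))) (\<lambda>i. FArr (EFun A) (?f i))"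
  by (rule coproduct_universal[OF small_in[OF I] distributive_small[OF xs ys small_in[OF I] co] _ _ pb]) (use a in simp_all)
 moreover have "Dom V (FArr (EFun A) (?f i)) = FObj (EFun A) (xs @ [X i] @ ys)" if "i \<in> I" for i
  using A f[OF that] unfolding is_functor_def seq_simps hom_iff by metis
 ultimately show "is_coproduct V I (\<lambda>i. FObj (EFun A) (xs @ [X i] @ ys)) (FObj (EFun A) (xs @ [c] @ ys)) (\<lambda>i. FArr (EFun A) (?f i))"
  using a by (auto intro: coproduct_cong)
qed

context presentation
begin

text \<open>A step whose hom is not \<open>zero\<close> leads from \<open>node k\<close> to
  \<open>node (Suc k)\<close>. If no step had hom \<open>zero\<close>, the path would visit the
  vertices in order and be the standard one. So \<open>zero\<close> occurs among the labels, and
  distributivity makes the tensor initial.\<close>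

lemma initial_EO_gr:
 assumes Z: "Z \<in> lists (Obj V)" and p: "p \<in> paths (Vert (gr Z)) (node 0) (node (length Z))" and ne: "p \<noteq> std (length Z)"
 shows "initial V (EO (lab (gr Z) p))"
proof (rule EO_initial[OF lab_lists[OF gr_vgraph[OF Z] pathsD(1)[OF p]] _ initial_zero])
 note P = pathsD[OF p]
 have V: "\<exists>i\<le>length Z. p ! k = node i" if "k < length p" for k
  using P(1) that unfolding lists_nth by fastforce
 have "\<exists>k. Suc k < length p \<and> VHom (gr Z) (p ! k, p ! Suc k) = zero"
 proof (rule ccontr)
  assume n: "\<not> ?thesis"
  have s: "p ! k = node k \<and> k \<le> length Z" if "k < length p" for k
   using that
  proof (induction k)
   case 0 then show ?case using P(2,3) by (simp add: hd_conv_nth)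
  next
   case (Suc k)
   obtain j where j: "p ! Suc k = node j" "j \<le> length Z" using V[OF Suc.prems] by auto
   have "VHom (gr Z) (node k, node j) \<noteq> zero" using n Suc j by force
   then show ?case using VHom_gr[of k Z j] Suc j by (auto split: if_splits)
  qed
  have "length p - 1 = length Z" using s[of "length p - 1"] P(2,4) by (simp add: last_conv_nth)
  then have len: "length p = Suc (length Z)" using P(2) by (cases p) auto
  have "p = std (length Z)" by (rule nth_equalityI) (use len s in auto)
  then show False using ne by simp
 qed
 then obtain k where k: "Suc k < length p" "VHom (gr Z) (p ! k, p ! Suc k) = zero" by auto
 then have "lab (gr Z) p ! k = zero" "k < length (lab (gr Z) p)" by (simp_all add: nth_steps)
 then show "zero \<in> set (lab (gr Z) p)" by (metis nth_mem)
qed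

text \<open>Monic with a right inverse, hence invertible: the summands of all other paths between
  the same ends are initial.\<close>

lemma inj_std:
 assumes Z: "Z \<in> lists (Obj V)"
 defines "s \<equiv> inj (gr Z) (std (length Z))"
 shows "s \<in> Arr V" "Dom V s = EO Z" "Cod V s = VHom (TO (gr Z)) (node 0, node (length Z))" "mono_arr V s"
  and "\<exists>k\<in>Arr V. Dom V k = Cod V s \<and> Cod V k = EO Z \<and> s ** k = Ident V (Cod V s)"
proof -
 note i = inj_facts[OF gr_vgraph[OF Z] std_paths] inj_mono[OF gr_vgraph[OF Z] std_paths]
 show f: "s \<in> Arr V" "Dom V s = EO Z" "Cod V s = VHom (TO (gr Z)) (node 0, node (length Z))" "mono_arr V s"
  using i by (simp_all add: s_def)
 have n: "node 0 \<in> Vert (gr Z)" "node (length Z) \<in> Vert (gr Z)" by simp_all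
 have "initial V (path_tensor E (gr Z) p)" if "p \<in> paths (Vert (gr Z)) (node 0) (node (length Z))" "p \<noteq> std (length Z)" for p
  using initial_EO_gr[OF Z that] by (simp add: path_tensor_def)
 from coproduct_inj_iso[OF inj_coproduct[OF gr_vgraph[OF Z] n] std_paths this] obtain k where
  "k \<in> Arr V" "Dom V k = VHom (TO (gr Z)) (node 0, node (length Z))" "Cod V k = path_tensor E (gr Z) (std (length Z))"
  "inj (gr Z) (std (length Z)) ** k = Ident V (VHom (TO (gr Z)) (node 0, node (length Z)))" by metis
 then show "\<exists>k\<in>Arr V. Dom V k = Cod V s \<and> Cod V k = EO Z \<and> s ** k = Ident V (Cod V s)"
  unfolding f(3) unfolding s_def path_tensor_def map_VHom_gr by metis
qed

text \<open>Naturality of the coprojections at \<open>ev X p\<close>, whose arrows on steps are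
  identities. Every coprojection thus comes from that of a standard path, which suggests how to
  define the coprojections of an operad.\<close>

lemma inj_ev:
 assumes X: "X \<in> vgraphs U V" and p: "p \<in> paths (Vert X) a b"
 shows "HMap (TA (ev X p)) (node 0, node (length (lab X p))) ** inj (gr (lab X p)) (std (length (lab X p))) = inj X p"
proof -
 let ?L = "lab X p"
 have n: "length p - 1 = length ?L" by simp
 note e = ev[OF X p, unfolded n] and L = lab_lists[OF X pathsD(1)[OF p]]
 have "std (length ?L) \<in> paths (Vert (GDom (ev X p))) (node 0) (node (length ?L))" unfolding e(2) by (rule std_paths)
 from inj_natural'[OF e(1) this] show ?thesis
  using inj_facts[OF X p] unfolding e(2-5) EA_Ident[OF L] by simp
qed

end

locale operad_over = presentation U V E T inj
 for U :: "'i set set" and V :: "('o, 'a) cat" and E :: "('o, 'a) multitensor" and T and inj +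
 fixes S :: "(('i, 'o) vgraph, ('i, 'o, 'a) vgmap) monad" and \<alpha> :: "('i, 'o) vgraph \<Rightarrow> ('i, 'o, 'a) vgmap"
 assumes operad: "(S, \<alpha>) \<in> operads_Set U V T"
begin

abbreviation SO where "SO \<equiv> FObj (MFun S)"
abbreviation SA where "SA \<equiv> FArr (MFun S)"

lemma S_functor: "is_functor Gr Gr (MFun S)"
 using operad by (simp add: operads_Set_def is_cartesian_monad_def is_monad_def)

lemma S_over:
 assumes X: "X \<in> vgraphs U V"
 shows "Vert (SO X) = Vert X" "id_on_objects (MUnit S X)" "id_on_objects (MMult S X)" "id_on_objects (\<alpha> X)"
 using operad X by (auto simp: operads_Set_def over_Set_def)

lemma SO_vgraph: "X \<in> vgraphs U V \<Longrightarrow> SO X \<in> vgraphs U V"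
 using S_functor unfolding is_functor_def Graphs_simps by blast

lemma SA_vgmap:
 assumes "f \<in> vgmaps U V"
 shows "SA f \<in> vgmaps U V" "GDom (SA f) = SO (GDom f)" "GCod (SA f) = SO (GCod f)" "OMap (SA f) = OMap f"
 using S_functor operad assms by (simp_all add: is_functor_def operads_Set_def over_Set_def)

lemma SA_facts:
 assumes f: "f \<in> vgmaps U V" and ab: "a \<in> Vert (GDom f)" "b \<in> Vert (GDom f)"
 shows "HMap (SA f) (a, b) \<in> Arr V" "Dom V (HMap (SA f) (a, b)) = VHom (SO (GDom f)) (a, b)"
  "Cod V (HMap (SA f) (a, b)) = VHom (SO (GCod f)) (OMap f a, OMap f b)"
 using vgmap_facts(4-6)[OF SA_vgmap(1)[OF f]] ab SA_vgmap[OF f] S_over(1)[OF vgmap_facts(1)[OF f]] by simp_all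

lemma SA_Comp:
 assumes f: "f \<in> vgmaps U V" and g: "g \<in> vgmaps U V" "GDom g = GCod f"
 shows "SA (Comp Gr g f) = Comp Gr (SA g) (SA f)"
 using S_functor f g by (simp add: is_functor_def)

lemma HMap_SA_Comp:
 assumes f: "f \<in> vgmaps U V" and g: "g \<in> vgmaps U V" "GDom g = GCod f" and ab: "a \<in> Vert (GDom f)" "b \<in> Vert (GDom f)"
 shows "HMap (SA (Comp Gr g f)) (a, b) = HMap (SA g) (OMap f a, OMap f b) ** HMap (SA f) (a, b)"
 using ab SA_vgmap[OF f] S_over(1)[OF vgmap_facts(1)[OF f]] by (simp add: SA_Comp[OF f g])

lemma transformation_facts:
 assumes X: "X \<in> vgraphs U V"
 shows "\<alpha> X \<in> vgmaps U V" "GDom (\<alpha> X) = SO X" "GCod (\<alpha> X) = TO X" "OMap (\<alpha> X) = (\<lambda>a\<in>Vert X. a)"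
  "MUnit S X \<in> vgmaps U V" "GDom (MUnit S X) = X" "GCod (MUnit S X) = SO X" "OMap (MUnit S X) = (\<lambda>a\<in>Vert X. a)"
  "MMult S X \<in> vgmaps U V" "GDom (MMult S X) = SO (SO X)" "GCod (MMult S X) = SO X" "OMap (MMult S X) = (\<lambda>a\<in>Vert X. a)"
proof -
 have m: "is_nat Gr Gr (MFun S) (MFun T) \<alpha>" "is_nat Gr Gr (id_fctr Gr) (MFun S) (MUnit S)"
  "is_nat Gr Gr (comp_fctr Gr (MFun S) (MFun S)) (MFun S) (MMult S)"
  using operad by (simp_all add: operads_Set_def is_cartesian_nat_def is_cartesian_monad_def is_monad_def)
 show c: "\<alpha> X \<in> vgmaps U V" "GDom (\<alpha> X) = SO X" "GCod (\<alpha> X) = TO X"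
  "MUnit S X \<in> vgmaps U V" "GDom (MUnit S X) = X" "GCod (MUnit S X) = SO X"
  "MMult S X \<in> vgmaps U V" "GDom (MMult S X) = SO (SO X)" "GCod (MMult S X) = SO X"
  using m X by (simp_all add: is_nat_def id_fctr_def comp_fctr_def)
 show "OMap (\<alpha> X) = (\<lambda>a\<in>Vert X. a)" "OMap (MUnit S X) = (\<lambda>a\<in>Vert X. a)" "OMap (MMult S X) = (\<lambda>a\<in>Vert X. a)"
  using S_over(2-4)[OF X] S_over(1)[OF X] S_over(1)[OF SO_vgraph[OF X]] c by (simp_all add: id_on_objects_def)
qed

lemma transformation_hom:
 assumes X: "X \<in> vgraphs U V" and ab: "a \<in> Vert X" "b \<in> Vert X"
 shows "HMap (\<alpha> X) (a, b) \<in> Arr V" "Dom V (HMap (\<alpha> X) (a, b)) = VHom (SO X) (a, b)" "Cod V (HMap (\<alpha> X) (a, b)) = VHom (TO X) (a, b)"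
  "HMap (MUnit S X) (a, b) \<in> Arr V" "Dom V (HMap (MUnit S X) (a, b)) = VHom X (a, b)" "Cod V (HMap (MUnit S X) (a, b)) = VHom (SO X) (a, b)"
  "HMap (MMult S X) (a, b) \<in> Arr V" "Dom V (HMap (MMult S X) (a, b)) = VHom (SO (SO X)) (a, b)"
  "Cod V (HMap (MMult S X) (a, b)) = VHom (SO X) (a, b)"
 using vgmap_facts(4-6)[OF transformation_facts(1)[OF X], of a b] vgmap_facts(4-6)[OF transformation_facts(5)[OF X], of a b]
  vgmap_facts(4-6)[OF transformation_facts(9)[OF X], of a b] transformation_facts[OF X] ab S_over(1)[OF X] S_over(1)[OF SO_vgraph[OF X]]
 by simp_all

lemma transformation_natural:
 assumes f: "f \<in> vgmaps U V" and ab: "a \<in> Vert (GDom f)" "b \<in> Vert (GDom f)"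
 shows "HMap (SA f) (a, b) ** HMap (MUnit S (GDom f)) (a, b) = HMap (MUnit S (GCod f)) (OMap f a, OMap f b) ** HMap f (a, b)"
  "HMap (SA f) (a, b) ** HMap (MMult S (GDom f)) (a, b) = HMap (MMult S (GCod f)) (OMap f a, OMap f b) ** HMap (SA (SA f)) (a, b)"
  "is_pullback V (HMap (\<alpha> (GDom f)) (a, b)) (HMap (SA f) (a, b)) (HMap (TA f) (a, b)) (HMap (\<alpha> (GCod f)) (OMap f a, OMap f b))"
proof -
 let ?X = "GDom f" and ?Y = "GCod f"
 note X = vgmap_facts(1)[OF f] and Y = vgmap_facts(2)[OF f]
 have v: "a \<in> Vert (SO ?X)" "b \<in> Vert (SO ?X)" "a \<in> Vert (SO (SO ?X))" "b \<in> Vert (SO (SO ?X))"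
  using ab S_over(1)[OF X] S_over(1)[OF SO_vgraph[OF X]] by simp_all
 note t = transformation_facts[OF X] SA_vgmap[OF f] SA_vgmap[OF SA_vgmap(1)[OF f]]
 have m: "Comp Gr (SA f) (MUnit S ?X) = Comp Gr (MUnit S ?Y) f" "Comp Gr (SA f) (MMult S ?X) = Comp Gr (MMult S ?Y) (SA (SA f))"
  "is_pullback Gr (\<alpha> ?X) (SA f) (TA f) (\<alpha> ?Y)"
  using operad f by (simp_all add: operads_Set_def is_cartesian_nat_def is_cartesian_monad_def is_monad_def is_nat_def id_fctr_def comp_fctr_def)
 show "HMap (SA f) (a, b) ** HMap (MUnit S ?X) (a, b) = HMap (MUnit S ?Y) (OMap f a, OMap f b) ** HMap f (a, b)"
  using arg_cong[OF m(1), of "\<lambda>h. HMap h (a, b)"] t ab by simp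
 show "HMap (SA f) (a, b) ** HMap (MMult S ?X) (a, b) = HMap (MMult S ?Y) (OMap f a, OMap f b) ** HMap (SA (SA f)) (a, b)"
  using arg_cong[OF m(2), of "\<lambda>h. HMap h (a, b)"] t ab v by simp
 show "is_pullback V (HMap (\<alpha> ?X) (a, b)) (HMap (SA f) (a, b)) (HMap (TA f) (a, b)) (HMap (\<alpha> ?Y) (OMap f a, OMap f b))"
  using pullback_graphs_hom[OF m(3), of a b] t ab v by simp
qed

section \<open>The multitensor of an operad\<close>

text \<open>The coprojections of the operad, modelled on the formula for those of \<open>T\<close>:
  the coprojection of the standard path, which is invertible for \<open>T\<close>, is here an
  identity.\<close>

definition sj :: "('i, 'o) vgraph \<Rightarrow> 'i list \<Rightarrow> 'a" where
 "sj X p = HMap (SA (ev X p)) (node 0, node (length p - 1))"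

text \<open>The substitution for \<open>Z\<close> is the multiplication at the graph of \<open>concat Z\<close>, restricted to the
 decomposition of its standard path into paths of the lengths prescribed by \<open>Z\<close>.\<close>

definition splits :: "'o list list \<Rightarrow> 'i list \<times> 'i list list \<Rightarrow> bool" where
 "splits Z = (\<lambda>(p, qs). p \<in> paths (Vert (gr (concat Z))) (node 0) (node (length (concat Z))) \<and>
   qs \<in> refinements (Vert (gr (concat Z))) p \<and> glue p qs = std (length (concat Z)) \<and> map (lab (gr (concat Z))) qs = Z)"

definition splitting :: "'o list list \<Rightarrow> 'i list \<times> 'i list list" where
 "splitting Z = (SOME t. splits Z t)"

text \<open>The value at \<open>Z\<close> is the whole hom between the ends of the test graph. In
  \<open>ESubst\<close> the last factor is the action on the arrows \<open>fs\<close> written out,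
  since the functor is only being defined here; with \<open>sj (SO G) p\<close> it forms the
  coprojection of the pair \<open>(p, qs)\<close>.\<close>

definition bar :: "('o, 'a) multitensor" where
 "bar = \<lparr>EFun = \<lparr>FObj = (\<lambda>Z\<in>lists (Obj V). VHom (SO (gr Z)) (node 0, node (length Z))),
    FArr = (\<lambda>fs\<in>lists (Arr V). HMap (SA (grf fs)) (node 0, node (length fs)))\<rparr>,
   EUnit = (\<lambda>z\<in>Obj V. HMap (MUnit S (gr [z])) (node 0, node 1)),
   ESubst = (\<lambda>Z\<in>lists (lists (Obj V)). let G = gr (concat Z); (p, qs) = splitting Z; fs = map (sj G) qs in
    HMap (MMult S G) (node 0, node (length (concat Z))) ** sj (SO G) p ** HMap (SA (grf fs)) (node 0, node (length fs)))\<rparr>"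

abbreviation barO where "barO \<equiv> FObj (EFun bar)"
abbreviation barA where "barA \<equiv> FArr (EFun bar)"

lemma barO: "Z \<in> lists (Obj V) \<Longrightarrow> barO Z = VHom (SO (gr Z)) (node 0, node (length Z))"
 and barA: "fs \<in> lists (Arr V) \<Longrightarrow> barA fs = HMap (SA (grf fs)) (node 0, node (length fs))"
 by (simp_all add: bar_def)

lemma splitting:
 assumes Z: "Z \<in> lists (lists (Obj V))" shows "splits Z (splitting Z)"
proof -
 let ?n = "length (concat Z)" and ?G = "gr (concat Z)"
 have "sum_list (map length Z) = length (std ?n) - 1" by (simp add: length_concat)
 from path_split[OF std_lists std_nonempty this] obtain p qs
  where p: "p \<in> paths (Vert ?G) (hd (std ?n)) (last (std ?n))" and qs: "qs \<in> refinements (Vert ?G) p"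
   and g: "glue p qs = std ?n" "map (\<lambda>q. length q - 1) qs = map length Z" by metis
 have "concat (map (lab ?G) qs) = concat Z"
  using lab_glue[OF qs pathsD(2)[OF p], of ?G] g(1) map_VHom_gr[of "concat Z"] by simp
 moreover have "map length (map (lab ?G) qs) = map length Z" using g(2) by (simp add: comp_def)
 ultimately have "map (lab ?G) qs = Z" by (rule concat_eq_lengths)
 then have "splits Z (p, qs)" using p qs g(1) by (simp add: splits_def)
 then show ?thesis unfolding splitting_def by (rule someI)
qed

lemma bar_functor: "is_functor (seq_cat V) V (EFun bar)"
 unfolding is_functor_def seq_simps
proof (intro conjI ballI impI)
 show "barO \<in> extensional (lists (Obj V))" "barA \<in> extensional (lists (Arr V))" by (simp_all add: bar_def)
next
 fix Z assume Z: "Z \<in> lists (Obj V)"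
 have v: "node 0 \<in> Vert (gr Z)" "node (length Z) \<in> Vert (gr Z)" by simp_all
 show "barO Z \<in> Obj V" unfolding barO[OF Z]
  by (rule vgraph_facts(2)[OF SO_vgraph[OF gr_vgraph[OF Z]]]) (simp_all only: S_over(1)[OF gr_vgraph[OF Z]] v)
 have "SA (Ident Gr (gr Z)) = Ident Gr (SO (gr Z))" using S_functor Z by (simp add: is_functor_def)
 then show "barA (map (Ident V) Z) = Ident V (barO Z)"
  using Z v by (simp add: barA[OF Ident_lists[OF Z]] grf_Ident[OF Z] barO S_over(1)[OF gr_vgraph[OF Z]])
next
 fix fs assume fs: "fs \<in> lists (Arr V)"
 note g = grf[OF fs]
 have v: "node 0 \<in> Vert (GDom (grf fs))" "node (length fs) \<in> Vert (GDom (grf fs))" using g(2) by simp_all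
 show "barA fs \<in> hom V (barO (map (Dom V) fs)) (barO (map (Cod V) fs))"
  using SA_facts[OF g(1) v] g(2-4) by (simp add: barA[OF fs] barO[OF Dom_lists[OF fs]] barO[OF Cod_lists[OF fs]])
 fix gs assume gs: "gs \<in> lists (Arr V)" and e: "map (Dom V) gs = map (Cod V) fs"
 have l: "length gs = length fs" using arg_cong[OF e, of length] by simp
 interpret Q: Category "seq_cat V" by unfold_locales (rule seq_category)
 have h: "map2 (Comp V) gs fs \<in> lists (Arr V)" using Q.Comp_Arr[of fs gs] fs gs e by simp
 show "barA (map2 (Comp V) gs fs) = barA gs ** barA fs"
  unfolding barA[OF h] barA[OF fs] barA[OF gs] grf_Comp[OF fs gs e]
  using HMap_SA_Comp[OF g(1) grf(1)[OF gs] _ v] grf(2)[OF gs] g(3,4) e l by simp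
qed (use category seq_category in simp_all)

text \<open>The component of \<alpha> at the test graph ends in the whole hom of
  \<open>TO (gr Z)\<close>. The coprojection of the standard path being invertible, it factors
  through \<open>EO Z\<close>.\<close>

definition abar :: "'o list \<Rightarrow> 'a" where
 "abar = (\<lambda>Z\<in>lists (Obj V). SOME g. g \<in> hom V (barO Z) (EO Z) \<and>
   inj (gr Z) (std (length Z)) ** g = HMap (\<alpha> (gr Z)) (node 0, node (length Z)))"

lemma abar:
 assumes Z: "Z \<in> lists (Obj V)"
 shows "abar Z \<in> Arr V" "Dom V (abar Z) = barO Z" "Cod V (abar Z) = EO Z"
  "inj (gr Z) (std (length Z)) ** abar Z = HMap (\<alpha> (gr Z)) (node 0, node (length Z))"
proof -
 let ?a = "HMap (\<alpha> (gr Z)) (node 0, node (length Z))" and ?s = "inj (gr Z) (std (length Z))"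
 have v: "node 0 \<in> Vert (gr Z)" "node (length Z) \<in> Vert (gr Z)" by simp_all
 note a = transformation_hom(1-3)[OF gr_vgraph[OF Z] v] and s = inj_std[OF Z]
 obtain k where k: "k \<in> Arr V" "Dom V k = Cod V ?s" "Cod V k = EO Z" "?s ** k = Ident V (Cod V ?s)" using s(5) by auto
 have "?s ** k ** ?a = Ident V (Cod V ?s) ** ?a"
  by (rule Comp_reassoc[OF k(4)]) (simp_all only: k a s)
 then have "k ** ?a \<in> hom V (barO Z) (EO Z) \<and> ?s ** k ** ?a = ?a" using k a s by (simp add: barO[OF Z])
 from someI[of "\<lambda>g. g \<in> hom V (barO Z) (EO Z) \<and> ?s ** g = ?a", OF this]
 show "abar Z \<in> Arr V" "Dom V (abar Z) = barO Z" "Cod V (abar Z) = EO Z" "?s ** abar Z = ?a"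
  using Z by (simp_all add: abar_def)
qed

lemma sj_facts:
 assumes X: "X \<in> vgraphs U V" and p: "p \<in> paths (Vert X) a b"
 shows "sj X p \<in> Arr V" "Dom V (sj X p) = barO (lab X p)" "Cod V (sj X p) = VHom (SO X) (a, b)"
 using SA_facts[OF ev(1)[OF X p], of "node 0" "node (length p - 1)"] ev(2,3,6,7)[OF X p] lab_lists[OF X pathsD(1)[OF p]]
 by (simp_all add: sj_def barO)

text \<open>The cartesian square of \<alpha> at \<open>ev X p\<close>, with the coprojection of the
  standard path moved to the opposite side, where it turns into \<open>inj X p\<close>.\<close>

lemma sj_pullback:
 assumes X: "X \<in> vgraphs U V" and p: "p \<in> paths (Vert X) a b"
 shows "is_pullback V (abar (lab X p)) (sj X p) (inj X p) (HMap (\<alpha> X) (a, b))"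
proof -
 let ?L = "lab X p" and ?f = "ev X p"
 let ?n = "length ?L"
 note e = ev[OF X p] and L = lab_lists[OF X pathsD(1)[OF p]]
 have n: "length p - 1 = ?n" by simp
 note e = e[unfolded n]
 have v: "node 0 \<in> Vert (GDom ?f)" "node ?n \<in> Vert (GDom ?f)" unfolding e(2) by simp_all
 note s = inj_std[OF L]
 note i = inj_ev[OF X p]
 have "is_pullback V (inj (gr ?L) (std ?n) ** abar ?L) (sj X p) (HMap (TA ?f) (node 0, node ?n)) (HMap (\<alpha> X) (a, b))"
  using transformation_natural(3)[OF e(1) v] unfolding e(2,3,6,7) abar(4)[OF L] sj_def n .
 from pullback_shift[OF this s(4) abar(1)[OF L]] show ?thesis unfolding i using abar(3)[OF L] s(2) by simp
qed

lemma sj_coproduct: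
 assumes X: "X \<in> vgraphs U V" and ab: "a \<in> Vert X" "b \<in> Vert X"
 shows "is_coproduct V (paths (Vert X) a b) (path_tensor bar X) (VHom (SO X) (a, b)) (sj X)"
proof -
 note t = transformation_hom(1-3)[OF X ab]
 have "is_coproduct V (paths (Vert X) a b) (\<lambda>p. Dom V (sj X p)) (Dom V (HMap (\<alpha> X) (a, b))) (sj X)"
  by (rule coproduct_universal[OF small_paths[OF X] inj_coproduct[OF X ab] t(1,3) sj_pullback[OF X]])
 then show ?thesis unfolding t(2)
  by (rule coproduct_cong) (use sj_facts(2)[OF X] in \<open>simp_all add: path_tensor_def\<close>)
qed

text \<open>The square of \<alpha> at \<open>grf fs\<close> is cartesian. Cancelling the monic
  coprojection at the codomain gives naturality of \<open>abar\<close>; cancelling the one at the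
  domain makes the remaining square a pullback.\<close>

lemma abar_cartesian: "is_cartesian_nat (seq_cat V) V (EFun bar) (EFun E) abar"
proof -
 have sq: "EA fs ** abar (map (Dom V) fs) = abar (map (Cod V) fs) ** barA fs \<and>
   is_pullback V (abar (map (Dom V) fs)) (barA fs) (EA fs) (abar (map (Cod V) fs))" if fs: "fs \<in> lists (Arr V)" for fs
 proof -
  let ?Z = "map (Dom V) fs" and ?W = "map (Cod V) fs" and ?f = "grf fs" and ?n = "length fs"
  let ?s = "inj (gr ?Z) (std ?n)" and ?t = "inj (gr ?W) (std ?n)" and ?h = "HMap (TA ?f) (node 0, node ?n)"
  note g = grf[OF fs] and Z = Dom_lists[OF fs] and W = Cod_lists[OF fs]
  have v: "node 0 \<in> Vert (GDom ?f)" "node ?n \<in> Vert (GDom ?f)" unfolding g(2) by simp_all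
  have n: "length ?Z = ?n" "length ?W = ?n" by simp_all
  have og: "OMap ?f (node 0) = node 0" "OMap ?f (node ?n) = node ?n" using g(4) by simp_all
  note a = abar[OF Z, unfolded n] abar[OF W, unfolded n] and s = inj_std(1-4)[OF Z, unfolded n] inj_std(1-4)[OF W, unfolded n]
  note ea = EA_Arr[OF fs]
  have "barA fs \<in> hom V (barO ?Z) (barO ?W)" using bar_functor fs by (simp add: is_functor_def)
  then have b: "barA fs \<in> Arr V" "Dom V (barA fs) = barO ?Z" "Cod V (barA fs) = barO ?W" by simp_all
  have p: "std ?n \<in> paths (Vert (GDom ?f)) (node 0) (node ?n)" unfolding g(2) using std_paths[of ?Z] by simp
  have h: "?h ** ?s = ?t ** EA fs"
   using inj_natural'[OF g(1) p] grf_path[OF fs pathsD(1)[OF p[unfolded g(2)]]] unfolding g(2,3,5) by simp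
  have hf: "?h \<in> Arr V" "Dom V ?h = Cod V ?s" "Cod V ?h = Cod V ?t"
   using TA_facts[OF g(1) v] unfolding g(2,3) s(3,7) og by simp_all
  have pb: "is_pullback V (?s ** abar ?Z) (barA fs) ?h (?t ** abar ?W)"
   using transformation_natural(3)[OF g(1) v] unfolding g(2,3) og a(4,8) barA[OF fs] .
  have "?t ** EA fs ** abar ?Z = ?h ** ?s ** abar ?Z"
   by (rule Comp_swap[OF h[symmetric]]) (simp_all only: a s ea hf)
  also have "\<dots> = (?t ** abar ?W) ** barA fs" by (rule pullback_facts(9)[OF pb])
  also have "\<dots> = ?t ** abar ?W ** barA fs" by (rule Comp_assoc) (simp_all only: a s b)
  finally have e: "EA fs ** abar ?Z = abar ?W ** barA fs"
   by (rule mono_arrD[OF s(8)]) (simp_all only: a s b ea Comp_Arr Dom_Comp Cod_Comp)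
  have "is_pullback V (abar ?Z) (barA fs) (EA fs) (abar ?W)"
   by (rule pullback_mono_cancel[OF pb s(4) _ _ _ _ _ _ _ _ e h]) (simp_all only: a s b ea)
  with e show ?thesis by simp
 qed
 have "abar \<in> extensional (lists (Obj V))" by (simp add: abar_def)
 then show ?thesis using sq abar unfolding is_cartesian_nat_def is_nat_def seq_simps hom_iff by simp
qed

sublocale bar: tensor_functor U V bar
 by unfold_locales (use bar_functor distributive_if_over[OF bar_functor abar_cartesian] in auto)

text \<open>Naturality of the coprojections is the image under \<open>SA\<close> of the naturality
  of \<open>ev\<close>.\<close>

sublocale bar: presented_functor U V bar S sj
proof
 fix f p assume f: "f \<in> vgmaps U V" and p: "p \<in> lists (Vert (GDom f))" "p \<noteq> []"
 let ?X = "GDom f" and ?Y = "GCod f" and ?q = "map (OMap f) p" and ?n = "length p - 1" and ?fs = "map (HMap f) (steps p)"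
 note X = vgmap_facts(1)[OF f] and Y = vgmap_facts(2)[OF f] and P = pathsI[OF p]
 note e = ev[OF X P] and e' = ev[OF Y paths_vgmap[OF f P]] and h = map_HMap_facts[OF f p(1)]
 note g = grf[OF h(1)]
 have v: "node 0 \<in> Vert (GDom (ev ?X p))" "node ?n \<in> Vert (GDom (ev ?X p))" unfolding e(2) by simp_all
 have v': "node 0 \<in> Vert (GDom (grf ?fs))" "node ?n \<in> Vert (GDom (grf ?fs))" unfolding g(2) by simp_all
 have o: "OMap (grf ?fs) (node 0) = node 0" "OMap (grf ?fs) (node ?n) = node ?n" using g(4) by simp_all
 have l: "length ?fs = ?n" "length ?q = length p" by simp_all
 have "HMap (SA f) (hd p, last p) ** sj ?X p = HMap (SA (Comp Gr f (ev ?X p))) (node 0, node ?n)"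
  unfolding HMap_SA_Comp[OF e(1) f e(3)[symmetric] v] e(6,7) sj_def ..
 also have "\<dots> = HMap (SA (Comp Gr (ev ?Y ?q) (grf ?fs))) (node 0, node ?n)" unfolding ev_natural[OF f P] ..
 also have "\<dots> = sj ?Y ?q ** barA ?fs"
  unfolding barA[OF h(1)] sj_def l using HMap_SA_Comp[OF g(1) e'(1) _ v'] unfolding o e'(2) g(3) h(3) by simp
 finally show "HMap (SA f) (hd p, last p) ** sj ?X p = sj ?Y ?q ** barA ?fs" .
qed (use S_functor S_over SA_vgmap sj_coproduct in auto)

lemma barSubst:
 assumes Z: "Z \<in> lists (lists (Obj V))" and t: "splitting Z = (p, qs)"
 shows "ESubst bar Z = HMap (MMult S (gr (concat Z))) (node 0, node (length (concat Z))) ** bar.inj2 (gr (concat Z)) (p, qs)"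
proof -
 let ?G = "gr (concat Z)"
 have G: "?G \<in> vgraphs U V" using Z by (intro gr_vgraph) (force simp: in_lists_conv_set)
 have "qs \<in> refinements (Vert ?G) p" using splitting[OF Z] t by (simp add: splits_def)
 from bar.map_inj_facts(1)[OF G this] show ?thesis
  using Z t by (simp add: bar_def Let_def)
qed

text \<open>The equation for multiplications holds by definition at test graphs, for the chosen
  splitting. Naturality of \<open>MMult S\<close> along \<open>ev X (glue p qs)\<close> transports
  it to \<open>X\<close>. What needs proof is that this map sends the chosen splitting to the given
  \<open>(p, qs)\<close>.\<close>

sublocale bar: presentation U V bar S sj
proof
 show "EUnit bar \<in> extensional (Obj V)" "ESubst bar \<in> extensional (lists (lists (Obj V)))" by (simp_all add: bar_def)
 have ext: "is_nat Gr Gr (id_fctr Gr) (MFun S) (MUnit S)" "is_nat Gr Gr (comp_fctr Gr (MFun S) (MFun S)) (MFun S) (MMult S)"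
  using operad by (simp_all add: operads_Set_def is_cartesian_monad_def is_monad_def)
 then show "MUnit S \<in> extensional (vgraphs U V)" "MMult S \<in> extensional (vgraphs U V)" by (simp_all add: is_nat_def)
next
 fix z assume z: "z \<in> Obj V"
 have G: "gr [z] \<in> vgraphs U V" using z by simp
 have "VHom (gr [z]) (node 0, node 1) = z" using VHom_gr[of 0 "[z]" 1] by simp
 then show "EUnit bar z \<in> hom V z (barO [z])"
  using transformation_hom(4-6)[OF G, of "node 0" "node 1"] z by (simp add: bar_def)
next
 fix Z assume Z: "Z \<in> lists (lists (Obj V))"
 let ?G = "gr (concat Z)" and ?n = "length (concat Z)"
 have c: "concat Z \<in> lists (Obj V)" using Z by (force simp: in_lists_conv_set)
 obtain p qs where t: "splitting Z = (p, qs)" by (cases "splitting Z")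
 have s: "p \<in> paths (Vert ?G) (node 0) (node ?n)" "qs \<in> refinements (Vert ?G) p" "map (lab ?G) qs = Z"
  using splitting[OF Z] t by (simp_all add: splits_def)
 have v: "node 0 \<in> Vert ?G" "node ?n \<in> Vert ?G" by simp_all
 show "ESubst bar Z \<in> hom V (barO (map barO Z)) (barO (concat Z))"
  using bar.inj2_facts[OF gr_vgraph[OF c] s(1,2)] transformation_hom(7-9)[OF gr_vgraph[OF c] v] s(3)
  unfolding barSubst[OF Z t] barO[OF c] by simp
next
 fix X assume X: "X \<in> vgraphs U V"
 show "MUnit S X \<in> vgmaps U V \<and> GDom (MUnit S X) = X \<and> GCod (MUnit S X) = SO X \<and> OMap (MUnit S X) = (\<lambda>a\<in>Vert X. a)"
  "MMult S X \<in> vgmaps U V \<and> GDom (MMult S X) = SO (SO X) \<and> GCod (MMult S X) = SO X \<and> OMap (MMult S X) = (\<lambda>a\<in>Vert X. a)"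
  using transformation_facts[OF X] by simp_all
 show "HMap (MUnit S X) (a, b) = sj X [a, b] ** EUnit bar (VHom X (a, b))" if ab: "a \<in> Vert X" "b \<in> Vert X" for a b
 proof -
  have p: "[a, b] \<in> paths (Vert X) a b" using ab by simp
  let ?f = "ev X [a, b]"
  note e = ev[OF X p, simplified]
  have z: "VHom X (a, b) \<in> Obj V" by (rule vgraph_facts(2)[OF X ab])
  have v: "node 0 \<in> Vert (GDom ?f)" "node 1 \<in> Vert (GDom ?f)" unfolding e(2) by simp_all
  have s: "steps (std (Suc 0)) = [(node 0, node 1)]" by (simp add: std_def)
  have "HMap ?f (node 0, node 1) = Ident V (VHom X (a, b))" using e(5) s by simp
  then show ?thesis using transformation_natural(1)[OF e(1) v] transformation_hom(4-6)[OF X ab] e(2,3,6,7) z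
   by (simp add: sj_def bar_def)
 qed
 fix p qs a b assume p: "p \<in> paths (Vert X) a b" and qs: "qs \<in> refinements (Vert X) p"
 let ?r = "glue p qs" and ?Z = "map (lab X) qs"
 have r: "?r \<in> paths (Vert X) a b" by (rule glue_paths[OF p qs])
 have c: "concat ?Z = lab X ?r" using lab_glue[OF qs pathsD(2)[OF p]] by simp
 let ?G = "gr (lab X ?r)" and ?n = "length (lab X ?r)" and ?f = "ev X ?r"
 have n: "length ?r - 1 = ?n" by simp
 note e = ev[OF X r, unfolded n]
 have Z: "?Z \<in> lists (lists (Obj V))"
 proof (rule in_listsI, rule ballI)
  fix z assume "z \<in> set ?Z"
  then obtain q where "q \<in> set qs" "z = lab X q" by auto
  then show "z \<in> lists (Obj V)" using lab_lists[OF X] refinements_lists[OF qs] by (simp add: in_lists_conv_set[of qs])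
 qed
 obtain p' qs' where t: "splitting ?Z = (p', qs')" by (cases "splitting ?Z")
 have s: "p' \<in> paths (Vert ?G) (node 0) (node ?n)" "qs' \<in> refinements (Vert ?G) p'" "glue p' qs' = std ?n" "map (lab ?G) qs' = ?Z"
  using splitting[OF Z] unfolding t splits_def c by simp_all
 have v: "node 0 \<in> Vert (GDom ?f)" "node ?n \<in> Vert (GDom ?f)" unfolding e(2) by simp_all
 \<comment> \<open>The number of steps of a piece can be read from its labels, and the two
   refinements have the same labels \<open>?Z\<close>.\<close>
 have len: "map length qs' = map length qs"
 proof -
  have ne: "q \<noteq> []" if "q \<in> set qs \<or> q \<in> set qs'" for q using refinements_iff qs s(2) that by blast
  have l: "length qs' = length qs" using arg_cong[OF s(4), of length] by simp
  show ?thesis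
  proof (rule nth_equalityI)
   fix i assume "i < length (map length qs')"
   then have i: "i < length qs'" "i < length qs" using l by simp_all
   have "length (lab ?G (qs' ! i)) = length (lab X (qs ! i))" using arg_cong[OF s(4), of "\<lambda>x. x ! i"] i by simp
   then have "length (qs' ! i) - 1 = length (qs ! i) - 1" by simp
   moreover have "0 < length (qs' ! i)" "0 < length (qs ! i)" using ne i by (meson length_greater_0_conv nth_mem)+
   ultimately have "length (qs' ! i) = length (qs ! i)" by linarith
   then show "map length qs' ! i = map length qs ! i" using i by simp
  qed (simp add: l)
 qed
 have im: "OMap ?f ` Vert ?G \<subseteq> Vert X" using vgmap_facts(3)[OF e(1)] unfolding e(2,3) by auto
 \<comment> \<open>The image of the chosen splitting and the given refinement glue to the same path
   and have pieces of equal lengths.\<close>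
 have "map (OMap ?f) p' = p \<and> map (map (OMap ?f)) qs' = qs"
 proof (rule glue_inj[OF refinements_map[OF s(2) im] _ qs pathsD(2)[OF p]])
  show "glue (map (OMap ?f) p') (map (map (OMap ?f)) qs') = ?r"
   using glue_map[OF s(2) pathsD(2)[OF s(1)], of "OMap ?f"] e(4) unfolding s(3) by simp
 qed (use pathsD(2)[OF s(1)] len in \<open>simp_all add: comp_def\<close>)
 then have m: "map (OMap ?f) p' = p" "map (map (OMap ?f)) qs' = qs" by simp_all
 \<comment> \<open>\<open>ev\<close> carries identities on the steps, so the arrow left over by
   naturality will be an identity.\<close>
 have "map (\<lambda>q. map (HMap ?f) (steps q)) qs' = map (map (Ident V)) ?Z"
 proof (rule concat_eq_lengths)
  have "concat (map (\<lambda>q. map (HMap ?f) (steps q)) qs') = map (HMap ?f) (concat (map steps qs'))" by (simp add: map_concat comp_def)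
  also have "\<dots> = map (HMap ?f) (steps (std ?n))" unfolding steps_glue[OF s(2) pathsD(2)[OF s(1)], symmetric] s(3) ..
  also have "\<dots> = concat (map (map (Ident V)) ?Z)" unfolding e(5) map_concat[symmetric] c ..
  finally show "concat (map (\<lambda>q. map (HMap ?f) (steps q)) qs') = concat (map (map (Ident V)) ?Z)" .
  show "map length (map (\<lambda>q. map (HMap ?f) (steps q)) qs') = map length (map (map (Ident V)) ?Z)"
   unfolding s(4)[symmetric] by simp
 qed
 then have "map barA (map (\<lambda>q. map (HMap ?f) (steps q)) qs') = map barA (map (map (Ident V)) ?Z)" by (rule arg_cong)
 then have "map (\<lambda>q. barA (map (HMap ?f) (steps q))) qs' = map barA (map (map (Ident V)) ?Z)" by (simp add: comp_def)
 moreover have "map barA (map (map (Ident V)) W) = map (Ident V) (map barO W) \<and> map barO W \<in> lists (Obj V)"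
  if "W \<in> lists (lists (Obj V))" for W
  using that by (induction W) (auto simp: bar.EA_Ident bar.EO_Obj)
 note this[OF Z]
 ultimately have h: "barA (map (\<lambda>q. barA (map (HMap ?f) (steps q))) qs') = Ident V (barO (map barO ?Z))"
  by (simp only: bar.EA_Ident)
 note i = bar.inj2_facts[OF X p qs] and G = vgmap_facts(1)[OF e(1), unfolded e(2)]
 note i' = bar.inj2_facts[OF G s(1,2), unfolded s(4)] and M = transformation_hom(7-9)[OF G v[unfolded e(2)]]
 note M' = transformation_hom(7-9)[OF X pathsD(5,6)[OF p]]
 note sf = SA_facts[OF e(1) v, unfolded e(2,3,6,7)] and ssf = SA_facts[OF SA_vgmap(1)[OF e(1)]]
 have vs: "node 0 \<in> Vert (GDom (SA ?f))" "node ?n \<in> Vert (GDom (SA ?f))"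
  unfolding SA_vgmap(2)[OF e(1)] e(2) S_over(1)[OF G] using v[unfolded e(2)] .
 note ssf = SA_facts[OF SA_vgmap(1)[OF e(1)] vs, unfolded SA_vgmap(2-4)[OF e(1)] e(2,3,6,7)]
 have "sj X ?r ** ESubst bar ?Z = HMap (SA ?f) (node 0, node ?n) ** HMap (MMult S ?G) (node 0, node ?n) ** bar.inj2 ?G (p', qs')"
  unfolding barSubst[OF Z t] c sj_def n ..
 also have "\<dots> = HMap (MMult S X) (a, b) ** HMap (SA (SA ?f)) (node 0, node ?n) ** bar.inj2 ?G (p', qs')"
  by (rule Comp_swap[OF transformation_natural(2)[OF e(1) v, unfolded e(2,3,6,7)]]) (simp_all only: sf ssf M M' i')
 also have "HMap (SA (SA ?f)) (node 0, node ?n) ** bar.inj2 ?G (p', qs') = bar.inj2 X (p, qs)"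
  using bar.TTA_inj2[OF e(1), unfolded e(2,3), OF s(1,2)] i unfolding m h by simp
 finally show "HMap (MMult S X) (a, b) ** sj (SO X) p ** barA (map (sj X) qs) = sj X ?r ** ESubst bar (map (\<lambda>q. lab X q) qs)"
  by simp
qed

lemma bar_related: "related U V bar S sj E T inj abar \<alpha>"
 unfolding related_def
proof (intro conjI ballI allI)
 have "is_nat Gr Gr (MFun S) (MFun T) \<alpha>" using operad by (simp add: operads_Set_def is_cartesian_nat_def)
 then show "\<alpha> \<in> extensional (vgraphs U V)" by (simp add: is_nat_def)
 show "HMap (\<alpha> X) (a, b) ** sj X p = inj X p ** abar (lab X p)" if "X \<in> vgraphs U V" "p \<in> paths (Vert X) a b" for X a b p
  by (rule pullback_facts(9)[OF sj_pullback[OF that], symmetric])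
qed (use abar transformation_facts in \<open>simp_all add: abar_def\<close>)

text \<open>The monad laws of \<open>S\<close> yield the multitensor laws, the morphism \<alpha>
  yields the morphism \<open>abar\<close>, and cartesianness is reflected from \<open>E\<close>
  along \<open>abar\<close>.\<close>

lemma bar_over:
 assumes E: "is_cartesian_multitensor V E" shows "(bar, abar) \<in> multitensors_over V E"
proof -
 interpret P: presentation_pair U V bar S sj E T inj ..
 have "is_multitensor V bar"
  unfolding bar.multitensor_iff_monad using operad by (simp add: operads_Set_def is_cartesian_monad_def)
 moreover have "is_multitensor_mor V bar E abar"
  unfolding P.multitensor_mor_iff_monad_mor[OF bar_related] using operad by (simp add: operads_Set_def)
 ultimately show ?thesis
  using cartesian_if_over[OF bar.multitensor_data_axioms _ E _ abar_cartesian] abar_cartesian by (simp add: multitensors_over_def)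
qed

end

section \<open>The equivalence\<close>

lemma natD:
 assumes "is_nat C D F G \<tau>"
 shows "\<tau> \<in> extensional (Obj C)" "\<And>x. x \<in> Obj C \<Longrightarrow> \<tau> x \<in> Arr D" "\<And>x. x \<in> Obj C \<Longrightarrow> Dom D (\<tau> x) = FObj F x"
  "\<And>x. x \<in> Obj C \<Longrightarrow> Cod D (\<tau> x) = FObj G x"
  "\<And>f. f \<in> Arr C \<Longrightarrow> Comp D (FArr G f) (\<tau> (Dom C f)) = Comp D (\<tau> (Cod C f)) (FArr F f)"
 using assms by (simp_all add: is_nat_def)

section \<open>Categories of structures over a fixed one\<close>

context Category
begin

lemma comp_nat_Ident:
 assumes "is_nat B C F G \<tau>"
 shows "comp_nat B C \<tau> (id_nat B C F) = \<tau>" "comp_nat B C (id_nat B C G) \<tau> = \<tau>"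
proof -
 note t = natD[OF assms]
 show "comp_nat B C \<tau> (id_nat B C F) = \<tau>" "comp_nat B C (id_nat B C G) \<tau> = \<tau>"
  by (rule extensionalityI[OF _ t(1)]; use t in \<open>simp add: comp_nat_def id_nat_def\<close>)+
qed

lemma comp_nat_assoc:
 assumes "is_nat B C F G \<phi>" "is_nat B C G H \<psi>" "is_nat B C H K \<chi>"
 shows "comp_nat B C \<chi> (comp_nat B C \<psi> \<phi>) = comp_nat B C (comp_nat B C \<chi> \<psi>) \<phi>"
 unfolding comp_nat_def using natD[OF assms(1)] natD[OF assms(2)] natD[OF assms(3)] by (auto simp: restrict_def)

lemma nat_comp:
 assumes C: "category B" and F: "is_functor B C F" "is_functor B C G" "is_functor B C H" and t: "is_nat B C F G \<phi>" "is_nat B C G H \<psi>"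
 shows "is_nat B C F H (comp_nat B C \<psi> \<phi>)"
 unfolding is_nat_def
proof (intro conjI ballI)
 note p = natD[OF t(1)] and q = natD[OF t(2)]
 fix f assume f: "f \<in> Arr B"
 interpret B: Category B by unfold_locales (rule C)
 have d: "Dom B f \<in> Obj B" "Cod B f \<in> Obj B" using f by simp_all
 have k: "FArr K f \<in> Arr C \<and> Dom C (FArr K f) = FObj K (Dom B f) \<and> Cod C (FArr K f) = FObj K (Cod B f)"
  if "is_functor B C K" for K using that f by (simp add: is_functor_def)
 note k = k[OF F(1)] k[OF F(2)] k[OF F(3)]
 have "FArr H f ** \<psi> (Dom B f) ** \<phi> (Dom B f) = \<psi> (Cod B f) ** FArr G f ** \<phi> (Dom B f)"
  by (rule Comp_swap[OF q(5)[OF f]]) (simp_all only: k p(2-4)[OF d(1)] p(2-4)[OF d(2)] q(2-4)[OF d(1)] q(2-4)[OF d(2)])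
 also have "\<dots> = \<psi> (Cod B f) ** \<phi> (Cod B f) ** FArr F f" unfolding p(5)[OF f] ..
 also have "\<dots> = (\<psi> (Cod B f) ** \<phi> (Cod B f)) ** FArr F f"
  by (rule Comp_assoc[symmetric]) (simp_all only: k p(2-4)[OF d(2)] q(2-4)[OF d(2)])
 finally show "FArr H f ** comp_nat B C \<psi> \<phi> (Dom B f) = comp_nat B C \<psi> \<phi> (Cod B f) ** FArr F f"
  using d by (simp add: comp_nat_def)
qed (use natD[OF t(1)] natD[OF t(2)] in \<open>simp_all add: comp_nat_def\<close>)

lemma nat_Ident:
 assumes "is_functor B C F" shows "is_nat B C F F (id_nat B C F)"
 using assms by (auto simp: is_nat_def is_functor_def id_nat_def category_def)

lemma monad_mor_Ident:
 assumes S: "is_monad C S" shows "is_monad_mor C S S (id_nat C C (MFun S))"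
proof -
 have F: "is_functor C C (MFun S)" using S by (simp add: is_monad_def)
 have u: "is_nat C C (id_fctr C) (MFun S) (MUnit S)" "is_nat C C (comp_fctr C (MFun S) (MFun S)) (MFun S) (MMult S)"
  using S by (simp_all add: is_monad_def)
 have "FObj (MFun S) x \<in> Obj C" "FArr (MFun S) (Ident C x) = Ident C (FObj (MFun S) x)" if "x \<in> Obj C" for x
  using F that by (simp_all add: is_functor_def)
 then show ?thesis using natD[OF u(1)] natD[OF u(2)] nat_Ident[OF F]
  by (simp add: is_monad_mor_def id_nat_def id_fctr_def comp_fctr_def)
qed

lemma monad_mor_comp:
 assumes S: "is_monad C S" and T: "is_monad C T" and R: "is_monad C R"
  and m: "is_monad_mor C S T \<phi>" "is_monad_mor C T R \<psi>"
 shows "is_monad_mor C S R (comp_nat C C \<psi> \<phi>)"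
 unfolding is_monad_mor_def
proof (intro conjI ballI)
 have F: "is_functor C C (MFun S)" "is_functor C C (MFun T)" "is_functor C C (MFun R)" using S T R by (simp_all add: is_monad_def)
 have t: "is_nat C C (MFun S) (MFun T) \<phi>" "is_nat C C (MFun T) (MFun R) \<psi>" using m by (simp_all add: is_monad_mor_def)
 show n: "is_nat C C (MFun S) (MFun R) (comp_nat C C \<psi> \<phi>)" by (rule nat_comp[OF category F t])
 fix x assume x: "x \<in> Obj C"
 let ?S = "FObj (MFun S)" and ?T = "FObj (MFun T)" and ?R = "FObj (MFun R)"
 have u: "is_nat C C (id_fctr C) (MFun S) (MUnit S)" "is_nat C C (comp_fctr C (MFun S) (MFun S)) (MFun S) (MMult S)"
  "is_nat C C (comp_fctr C (MFun T) (MFun T)) (MFun T) (MMult T)" "is_nat C C (comp_fctr C (MFun R) (MFun R)) (MFun R) (MMult R)"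
  using S T R by (simp_all add: is_monad_def)
 have fo: "?S x \<in> Obj C" "?T x \<in> Obj C" "?R x \<in> Obj C" if "x \<in> Obj C" for x using F that by (simp_all add: is_functor_def)
 have fa: "FArr (MFun S) f \<in> Arr C" "Dom C (FArr (MFun S) f) = ?S (Dom C f)" "Cod C (FArr (MFun S) f) = ?S (Cod C f)"
  "FArr (MFun T) f \<in> Arr C" "Dom C (FArr (MFun T) f) = ?T (Dom C f)" "Cod C (FArr (MFun T) f) = ?T (Cod C f)"
  if "f \<in> Arr C" for f using F that by (simp_all add: is_functor_def)
 note p = natD[OF t(1)] and q = natD[OF t(2)]
 note a = p(2-4)[OF x] q(2-4)[OF x] p(2-4)[OF fo(2)[OF x]] p(2-4)[OF fo(3)[OF x]] q(2-4)[OF fo(3)[OF x]]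
  fa[OF p(2)[OF x]] fa[OF q(2)[OF x]]
 have mu: "MUnit S x \<in> Arr C" "Dom C (MUnit S x) = x" "Cod C (MUnit S x) = ?S x"
  "MMult S x \<in> Arr C" "Dom C (MMult S x) = ?S (?S x)" "Cod C (MMult S x) = ?S x"
  "MMult T x \<in> Arr C" "Dom C (MMult T x) = ?T (?T x)" "Cod C (MMult T x) = ?T x"
  "MMult R x \<in> Arr C" "Dom C (MMult R x) = ?R (?R x)" "Cod C (MMult R x) = ?R x"
  using natD(2-4)[OF u(1)] natD(2-4)[OF u(2)] natD(2-4)[OF u(3)] natD(2-4)[OF u(4)] x
  by (simp_all add: id_fctr_def comp_fctr_def)
 have "(\<psi> x ** \<phi> x) ** MUnit S x = \<psi> x ** \<phi> x ** MUnit S x" by (rule Comp_assoc) (simp_all only: a mu)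
 then show "comp_nat C C \<psi> \<phi> x ** MUnit S x = MUnit R x" using m x by (simp add: comp_nat_def is_monad_mor_def)
 have e1: "\<phi> x ** MMult S x = MMult T x ** \<phi> (?T x) ** FArr (MFun S) (\<phi> x)" using m(1) x by (simp add: is_monad_mor_def)
 have e2: "\<psi> x ** MMult T x = (MMult R x ** \<psi> (?R x)) ** FArr (MFun T) (\<psi> x)"
 proof -
  have "\<psi> x ** MMult T x = MMult R x ** \<psi> (?R x) ** FArr (MFun T) (\<psi> x)" using m(2) x by (simp add: is_monad_mor_def)
  also have "\<dots> = (MMult R x ** \<psi> (?R x)) ** FArr (MFun T) (\<psi> x)" by (rule Comp_assoc[symmetric]) (simp_all only: a mu)
  finally show ?thesis .
 qed
 have e3: "FArr (MFun T) (\<psi> x) ** \<phi> (?T x) = \<phi> (?R x) ** FArr (MFun S) (\<psi> x)"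
  using p(5)[OF q(2)[OF x]] unfolding q(3,4)[OF x] .
 have e4: "FArr (MFun S) (\<psi> x) ** FArr (MFun S) (\<phi> x) = FArr (MFun S) (\<psi> x ** \<phi> x)"
  using F(1) a(1-6) by (simp add: is_functor_def)
 have "(\<psi> x ** \<phi> x) ** MMult S x = \<psi> x ** \<phi> x ** MMult S x" by (rule Comp_assoc) (simp_all only: a mu)
 also have "\<dots> = (\<psi> x ** MMult T x) ** \<phi> (?T x) ** FArr (MFun S) (\<phi> x)"
  unfolding e1 by (rule Comp_assoc[symmetric]) (simp_all only: a mu Comp_Arr Dom_Comp Cod_Comp)
 also have "\<dots> = (MMult R x ** \<psi> (?R x)) ** FArr (MFun T) (\<psi> x) ** \<phi> (?T x) ** FArr (MFun S) (\<phi> x)"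
  unfolding e2 by (rule Comp_assoc) (simp_all only: a mu Comp_Arr Dom_Comp Cod_Comp)
 also have "FArr (MFun T) (\<psi> x) ** \<phi> (?T x) ** FArr (MFun S) (\<phi> x) = \<phi> (?R x) ** FArr (MFun S) (\<psi> x) ** FArr (MFun S) (\<phi> x)"
  by (rule Comp_swap[OF e3]) (simp_all only: a)
 also have "\<dots> = \<phi> (?R x) ** FArr (MFun S) (\<psi> x ** \<phi> x)" unfolding e4 ..
 finally have "(\<psi> x ** \<phi> x) ** MMult S x = (MMult R x ** \<psi> (?R x)) ** \<phi> (?R x) ** FArr (MFun S) (\<psi> x ** \<phi> x)" .
 also have "\<dots> = MMult R x ** (\<psi> (?R x) ** \<phi> (?R x)) ** FArr (MFun S) (\<psi> x ** \<phi> x)"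
  unfolding e4[symmetric] by (simp only: a mu Comp_assoc Comp_Arr Dom_Comp Cod_Comp)
 finally show "comp_nat C C \<psi> \<phi> x ** MMult S x =
   MMult R x ** comp_nat C C \<psi> \<phi> (?R x) ** FArr (MFun S) (comp_nat C C \<psi> \<phi> x)"
  using x fo(3)[OF x] by (simp add: comp_nat_def)
qed

text \<open>Both \<^const>\<open>Mult\<close> and \<^const>\<open>Op_Set\<close> are of this form.\<close>

lemma over_category:
 assumes over: "\<And>A \<alpha>. (A, \<alpha>) \<in> Q \<Longrightarrow> is_nat B C (F A) K \<alpha>"
  and nat: "\<And>A A' \<phi>. mor A A' \<phi> \<Longrightarrow> is_nat B C (F A) (F A') \<phi>"
  and id: "\<And>A \<alpha>. (A, \<alpha>) \<in> Q \<Longrightarrow> mor A A (id_nat B C (F A))"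
  and comp: "\<And>A \<alpha> A' \<alpha>' A'' \<alpha>'' \<phi> \<psi>. (A, \<alpha>) \<in> Q \<Longrightarrow> (A', \<alpha>') \<in> Q \<Longrightarrow> (A'', \<alpha>'') \<in> Q \<Longrightarrow>
   mor A A' \<phi> \<Longrightarrow> mor A' A'' \<psi> \<Longrightarrow> mor A A'' (comp_nat B C \<psi> \<phi>)"
 shows "category \<lparr>Obj = Q,
   Arr = {((A, \<alpha>), (A', \<alpha>'), \<phi>). (A, \<alpha>) \<in> Q \<and> (A', \<alpha>') \<in> Q \<and> mor A A' \<phi> \<and> comp_nat B C \<alpha>' \<phi> = \<alpha>},
   Dom = (\<lambda>(a, b, \<phi>). a), Cod = (\<lambda>(a, b, \<phi>). b),
   Ident = (\<lambda>(A, \<alpha>). ((A, \<alpha>), (A, \<alpha>), id_nat B C (F A))),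
   Comp = (\<lambda>(b, c, \<psi>) (a, b', \<phi>). (a, c, comp_nat B C \<psi> \<phi>))\<rparr>"
proof -
 have 1: "comp_nat B C \<alpha> (id_nat B C (F A)) = \<alpha>" if "(A, \<alpha>) \<in> Q" for A \<alpha> by (rule comp_nat_Ident(1)[OF over[OF that]])
 have 2: "comp_nat B C \<phi> (id_nat B C (F A)) = \<phi>" "comp_nat B C (id_nat B C (F A')) \<phi> = \<phi>" if "mor A A' \<phi>" for A A' \<phi>
  by (rule comp_nat_Ident[OF nat[OF that]])+
 have 3: "comp_nat B C \<alpha>'' (comp_nat B C \<psi> \<phi>) = comp_nat B C (comp_nat B C \<alpha>'' \<psi>) \<phi>"
  if "(A'', \<alpha>'') \<in> Q" "mor A A' \<phi>" "mor A' A'' \<psi>" for A A' A'' \<alpha>'' \<phi> \<psi>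
  by (rule comp_nat_assoc[OF nat[OF that(2)] nat[OF that(3)] over[OF that(1)]])
 have 4: "comp_nat B C \<chi> (comp_nat B C \<psi> \<phi>) = comp_nat B C (comp_nat B C \<chi> \<psi>) \<phi>"
  if "mor A A' \<phi>" "mor A' A'' \<psi>" "mor A'' A''' \<chi>" for A A' A'' A''' \<phi> \<psi> \<chi>
  by (rule comp_nat_assoc[OF nat[OF that(1)] nat[OF that(2)] nat[OF that(3)]])
 show ?thesis
  unfolding category_def cat.simps hom_def mem_Collect_eq
  by (intro conjI ballI impI; clarsimp simp: 1 2 id; (rule conjI)?; (rule comp; assumption | rule 3; assumption | rule 4; assumption))
qed

end

lemma presentation_pairI:
 assumes "presentation U V A S i" "presentation U V B T j" shows "presentation_pair U V A S i B T j"
proof -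
 interpret A: presentation U V A S i by fact
 interpret B: presentation U V B T j by fact
 show ?thesis ..
qed

text \<open>A transformation over \<beta>' respects summands automatically. At the test graph of
  \<open>Z\<close>, its restriction to the standard summand lands, after \<beta>', in the standard
  summand for \<open>R\<close>; the coprojection square of \<beta>' is a pullback, and the lift is
  the value of \<phi> at \<open>Z\<close>. Naturality along \<open>ev X p\<close> extends this to
  all paths.\<close>

lemma related_if_over:
 assumes A: "presentation U V A S i" and B: "presentation U V B T j" and E: "presentation U V E R k"
  and \<alpha>: "related U V A S i E R k \<alpha> \<alpha>'" and \<beta>: "related U V B T j E R k \<beta> \<beta>'"
  and \<psi>: "is_nat (Graphs U V) (Graphs U V) (MFun S) (MFun T) \<psi>"
  and over: "comp_nat (Graphs U V) (Graphs U V) \<beta>' \<psi> = \<alpha>'"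
 obtains \<phi> where "related U V A S i B T j \<phi> \<psi>"
proof -
 interpret AB: presentation_pair U V A S i B T j by (rule presentation_pairI[OF A B])
 interpret AE: presentation_pair U V A S i E R k by (rule presentation_pairI[OF A E])
 interpret BE: presentation_pair U V B T j E R k by (rule presentation_pairI[OF B E])
 note comp = AB.Comp_reassoc
 have n: "\<psi> X \<in> vgmaps U V" "GDom (\<psi> X) = AB.A.TO X" "GCod (\<psi> X) = AB.B.TO X" if "X \<in> vgraphs U V" for X
  using \<psi> that by (simp_all add: is_nat_def)
 have ob: "OMap (\<psi> X) a = a" and hm: "HMap (\<alpha>' X) (a, b) = Comp V (HMap (\<beta>' X) (a, b)) (HMap (\<psi> X) (a, b))"
  and ht: "HMap (\<psi> X) (a, b) \<in> Arr V" "Dom V (HMap (\<psi> X) (a, b)) = VHom (AB.A.TO X) (a, b)" "Cod V (HMap (\<psi> X) (a, b)) = VHom (AB.B.TO X) (a, b)"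
  if X: "X \<in> vgraphs U V" and ab: "a \<in> Vert X" "b \<in> Vert X" for X a b
 proof -
  have v: "Vert (GDom (\<psi> X)) = Vert X" "Vert (GCod (\<psi> X)) = Vert X" using n[OF X] AB.A.T_Vert[OF X] AB.B.T_Vert[OF X] by simp_all
  have e: "\<alpha>' X = Comp (Graphs U V) (\<beta>' X) (\<psi> X)" using over X by (auto simp: comp_nat_def)
  \<comment> \<open>Being the identity on vertices is inherited from \<alpha>' and \<beta>'.\<close>
  have ob: "OMap (\<psi> X) a = a" if "a \<in> Vert X" for a
   using arg_cong[OF e, of "\<lambda>h. OMap h a"] that v AB.vgmap_facts(3)[OF n(1)[OF X], of a] AE.rel_psi(4)[OF \<alpha> X] BE.rel_psi(4)[OF \<beta> X]
   by simp
  then show "OMap (\<psi> X) a = a" using ab by simp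
  show "HMap (\<alpha>' X) (a, b) = Comp V (HMap (\<beta>' X) (a, b)) (HMap (\<psi> X) (a, b))" using e v ob ab by simp
  show "HMap (\<psi> X) (a, b) \<in> Arr V" "Dom V (HMap (\<psi> X) (a, b)) = VHom (AB.A.TO X) (a, b)" "Cod V (HMap (\<psi> X) (a, b)) = VHom (AB.B.TO X) (a, b)"
   using AB.vgmap_facts(4-6)[OF n(1)[OF X], of a b] v ob ab n[OF X] by simp_all
 qed
 let ?P = "\<lambda>Z g. g \<in> hom V (AB.A.EO Z) (AB.B.EO Z) \<and>
   Comp V (j (AB.gr Z) (AB.std (length Z))) g = Comp V (HMap (\<psi> (AB.gr Z)) (AB.node 0, AB.node (length Z))) (i (AB.gr Z) (AB.std (length Z)))"
 define \<phi> where "\<phi> = (\<lambda>Z\<in>lists (Obj V). SOME g. ?P Z g)"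
 have \<phi>: "?P Z (\<phi> Z)" if Z: "Z \<in> lists (Obj V)" for Z
 proof -
  let ?X = "AB.gr Z" and ?p = "AB.std (length Z)" and ?ab = "(AB.node 0, AB.node (length Z))"
  have X: "?X \<in> vgraphs U V" using Z by (rule AB.gr_vgraph)
  note p = AB.std_paths[of Z] and L = AB.map_VHom_gr[of Z]
  note v = pathsD(5,6)[OF p]
  note pb = BE.rel_pullback[OF \<beta> X p, unfolded L] and h = ht[OF X v] and fi = AB.A.inj_facts[OF X p, unfolded L]
  note b = BE.rel_psi_hom[OF \<beta> X v] and a = AE.rel_phi[OF \<alpha> Z]
  have "Comp V (HMap (\<beta>' ?X) ?ab) (Comp V (HMap (\<psi> ?X) ?ab) (i ?X ?p)) = Comp V (Comp V (HMap (\<beta>' ?X) ?ab) (HMap (\<psi> ?X) ?ab)) (i ?X ?p)"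
   by (rule AB.Comp_assoc[symmetric]) (simp_all only: h fi b)
  also have "\<dots> = Comp V (k ?X ?p) (\<alpha> Z)" using AE.rel_inj[OF \<alpha> X p] unfolding hm[OF X v] L .
  finally have e: "Comp V (HMap (\<beta>' ?X) ?ab) (Comp V (HMap (\<psi> ?X) ?ab) (i ?X ?p)) = Comp V (k ?X ?p) (\<alpha> Z)" .
  note f = AB.pullback_facts[OF pb] and j = AB.B.inj_facts[OF X p, unfolded L]
  have "Comp V (HMap (\<psi> ?X) ?ab) (i ?X ?p) \<in> Arr V" "Dom V (Comp V (HMap (\<psi> ?X) ?ab) (i ?X ?p)) = AB.A.EO Z"
    "Cod V (Comp V (HMap (\<psi> ?X) ?ab) (i ?X ?p)) = VHom (AB.B.TO ?X) ?ab"
   using h fi by simp_all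
  note c = this
  have "\<exists>g. ?P Z g"
   by (rule AB.pullback_lift[OF pb c(1) a(1) _ _ _ e]) (use c a b j AE.B.inj_facts[OF X p, unfolded L] in auto)
  from someI_ex[OF this] show ?thesis using Z by (simp add: \<phi>_def)
 qed
 have "related U V A S i B T j \<phi> \<psi>"
  unfolding related_def
 proof (intro conjI ballI allI)
  fix X assume X: "X \<in> vgraphs U V"
  have v: "Vert (AB.A.TO X) = Vert X" by (rule AB.A.T_Vert[OF X])
  show "OMap (\<psi> X) = (\<lambda>a\<in>Vert X. a)"
   by (rule extensionalityI[of _ "Vert X"]) (use ob[OF X] n[OF X] v in \<open>auto simp: vgmaps_def PiE_def\<close>)
  fix a b p assume p: "p \<in> paths (Vert X) a b"
  let ?L = "AB.lab X p" and ?f = "AB.ev X p"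
  let ?G = "AB.gr ?L" and ?s = "AB.std (length ?L)" and ?m = "(AB.node 0, AB.node (length ?L))"
  have m: "length p - 1 = length ?L" by simp
  note e = AB.ev[OF X p, unfolded m] and L = AB.lab_lists[OF X pathsD(1)[OF p]]
  note G = AB.gr_vgraph[OF L] and s = AB.std_paths[of ?L]
  note w = pathsD(5,6)[OF s]
  note ia = AB.A.inj_ev[OF X p] and ib = AB.B.inj_ev[OF X p]
  note hX = ht[OF X pathsD(5,6)[OF p]] and hG = ht[OF G w]
  note ta = AB.A.TA_facts[OF e(1), unfolded e(2,3), OF w, unfolded e(6,7)]
  note tb = AB.B.TA_facts[OF e(1), unfolded e(2,3), OF w, unfolded e(6,7)]
  note fa = AB.A.inj_facts[OF G s, unfolded AB.map_VHom_gr] and fb = AB.B.inj_facts[OF G s, unfolded AB.map_VHom_gr]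
  note P = \<phi>[OF L, unfolded hom_iff]
  have "Comp (Graphs U V) (AB.B.TA ?f) (\<psi> ?G) = Comp (Graphs U V) (\<psi> X) (AB.A.TA ?f)"
   using \<psi> e(1-3) unfolding is_nat_def AB.Graphs_simps by metis
  from arg_cong[OF this, of "\<lambda>h. HMap h ?m"]
  have nat: "Comp V (HMap (\<psi> X) (a, b)) (HMap (AB.A.TA ?f) ?m) = Comp V (HMap (AB.B.TA ?f) ?m) (HMap (\<psi> ?G) ?m)"
   using w n[OF G] AB.A.TA_vgmap(2)[OF e(1)] AB.A.T_OMap[OF e(1)] e(2,6,7) ob[OF G w] ob[OF G w(2,1)] AB.A.T_Vert[OF G] by simp
  have "Comp V (HMap (\<psi> X) (a, b)) (i X p) = Comp V (HMap (\<psi> X) (a, b)) (Comp V (HMap (AB.A.TA ?f) ?m) (i ?G ?s))" unfolding ia ..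
  also have "\<dots> = Comp V (HMap (AB.B.TA ?f) ?m) (Comp V (HMap (\<psi> ?G) ?m) (i ?G ?s))"
   by (rule AB.Comp_swap[OF nat]) (simp_all only: hX hG ta tb fa)
  also have "\<dots> = Comp V (HMap (AB.B.TA ?f) ?m) (Comp V (j ?G ?s) (\<phi> ?L))" using P by simp
  also have "\<dots> = Comp V (j X p) (\<phi> ?L)"
   by (rule AB.Comp_reassoc[OF ib]) (use P in \<open>simp_all only: tb fb\<close>)
  finally show "Comp V (HMap (\<psi> X) (a, b)) (i X p) = Comp V (j X p) (\<phi> ?L)" .
 next
  show "\<psi> \<in> extensional (vgraphs U V)" using \<psi> by (simp add: is_nat_def)
 qed (use \<phi> n in \<open>auto simp: \<phi>_def\<close>)
 then show ?thesis by (rule that)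
qed

text \<open>Two monads presented by the same multitensor are linked by the transformation related to
  its identity. That the identity is a multitensor morphism is itself read off from the identity of
  \<open>S\<close>.\<close>

lemma presentation_id_mor:
 assumes A: "presentation U V A S i" "presentation U V A T j" and m: "is_multitensor V A"
 obtains \<psi> where "related U V A S i A T j (id_nat (seq_cat V) V (EFun A)) \<psi>" "is_monad_mor (Graphs U V) S T \<psi>"
proof -
 interpret S: presentation U V A S i by (rule A)
 interpret P: presentation_pair U V A S i A T j by (rule presentation_pairI[OF A])
 interpret Q: presentation_pair U V A S i A S i by (rule presentation_pairI[OF A(1) A(1)])
 interpret G: Category "Graphs U V" by unfold_locales (rule S.Graphs_category)
 have "id_nat (seq_cat V) V (EFun A) Z \<in> hom V (S.EO Z) (S.EO Z)" if "Z \<in> lists (Obj V)" for Z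
  using that S.EO_Obj by (simp add: id_nat_def)
 moreover have "id_nat (seq_cat V) V (EFun A) \<in> extensional (lists (Obj V))" by (simp add: id_nat_def)
 ultimately obtain \<psi> where r: "P.rel (id_nat (seq_cat V) V (EFun A)) \<psi>" by (rule P.rel_exists)
 have "is_multitensor_mor V A A (id_nat (seq_cat V) V (EFun A))"
  unfolding Q.multitensor_mor_iff_monad_mor[OF related_id[OF A(1)]] by (rule G.monad_mor_Ident) (use m S.multitensor_iff_monad in simp)
 then show ?thesis using that[OF r] unfolding P.multitensor_mor_iff_monad_mor[OF r] by simp
qed

section \<open>The functor \<open>Gamma\<close>\<close>

locale cartesian_multitensor = multitensor_data U V E
 for U :: "'i set set" and V :: "('o, 'a) cat" and E :: "('o, 'a) multitensor" +
 assumes cartesian: "is_cartesian_multitensor V E"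
begin

abbreviation M where "M A \<equiv> gamma_monad U V A"
abbreviation j where "j A \<equiv> gamma_inj V A"
abbreviation g where "g A B \<phi> \<equiv> gamma_mor U V A B \<phi>"
abbreviation Op where "Op \<equiv> Op_Set U V (M E)"
abbreviation relG where "relG A B \<phi> \<equiv> related U V A (M A) (j A) B (M B) (j B) \<phi> (g A B \<phi>)"

lemma over_multitensor: "(A, \<alpha>) \<in> multitensors_over V E \<Longrightarrow> is_multitensor V A"
 by (simp add: multitensors_over_def is_cartesian_multitensor_def)

lemma over_data: "(A, \<alpha>) \<in> multitensors_over V E \<Longrightarrow> multitensor_data U V A"
 using distributive_if_over[of A \<alpha>] multitensor_dataI[of A]
 by (auto simp: multitensors_over_def is_cartesian_multitensor_def is_multitensor_def)

lemma over_presentation: "(A, \<alpha>) \<in> multitensors_over V E \<Longrightarrow> presentation U V A (M A) (j A)"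
 using multitensor_data.gamma_presentation[OF over_data] .

lemma nat_related:
 assumes "multitensor_data U V A" "multitensor_data U V B" and n: "is_nat (seq_cat V) V (EFun A) (EFun B) \<phi>"
 shows "relG A B \<phi>"
 by (rule gamma_related[OF assms(1,2)]) (use natD[OF n] in simp_all)

lemma mor_related:
 "(A, \<alpha>) \<in> multitensors_over V E \<Longrightarrow> (B, \<beta>) \<in> multitensors_over V E \<Longrightarrow> is_multitensor_mor V A B \<phi> \<Longrightarrow> relG A B \<phi>"
 by (rule nat_related[OF over_data over_data]) (simp_all add: is_multitensor_mor_def)

lemma over_related:
 "(A, \<alpha>) \<in> multitensors_over V E \<Longrightarrow> relG A E \<alpha>"
 by (rule nat_related[OF over_data[of A \<alpha>] multitensor_data_axioms]) (simp_all add: multitensors_over_def is_multitensor_mor_def)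

lemma mor_iff:
 assumes "(A, \<alpha>) \<in> multitensors_over V E" "(B, \<beta>) \<in> multitensors_over V E"
  and r: "related U V A (M A) (j A) B (M B) (j B) \<phi> \<psi>"
 shows "is_multitensor_mor V A B \<phi> \<longleftrightarrow> is_monad_mor Gr (M A) (M B) \<psi>"
 using presentation_pair.multitensor_mor_iff_monad_mor[OF presentation_pairI[OF assms(1,2)[THEN over_presentation]] r] .

lemma over_monad: "(A, \<alpha>) \<in> multitensors_over V E \<Longrightarrow> is_monad Gr (M A)"
 using presentation.multitensor_iff_monad[OF over_presentation] over_multitensor by blast

lemma gamma_mor_unique:
 assumes "presentation U V A (M A) (j A)" "presentation U V B (M B) (j B)"
  and "related U V A (M A) (j A) B (M B) (j B) \<phi> \<psi>" "relG A B \<phi>"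
 shows "\<psi> = g A B \<phi>"
 using presentation_pair.rel_unique[OF presentation_pairI[OF assms(1,2)] assms(3,4)] .

lemma Graphs_Category: "Category Gr" by unfold_locales (rule Graphs_category)

lemma mor_id:
 assumes A: "(A, \<alpha>) \<in> multitensors_over V E"
 shows "is_multitensor_mor V A A (id_nat (seq_cat V) V (EFun A))"
 unfolding mor_iff[OF A A related_id[OF over_presentation[OF A]]]
 by (rule Category.monad_mor_Ident[OF Graphs_Category over_monad[OF A]])

text \<open>Closure under composition is transferred from monad morphisms, which spares a diagram
  chase with nested tensors. The second claim follows since both transformations are related to the
  same composite.\<close>

lemma mor_comp:
 assumes A: "(A, \<alpha>) \<in> multitensors_over V E" and B: "(B, \<beta>) \<in> multitensors_over V E" and C: "(C, \<gamma>) \<in> multitensors_over V E"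
  and m: "is_multitensor_mor V A B \<phi>" "is_multitensor_mor V B C \<psi>"
 shows "is_multitensor_mor V A C (comp_nat (seq_cat V) V \<psi> \<phi>)" "g A C (comp_nat (seq_cat V) V \<psi> \<phi>) = comp_nat Gr Gr (g B C \<psi>) (g A B \<phi>)"
proof -
 note p = over_presentation[OF A] over_presentation[OF B] over_presentation[OF C]
 note r = mor_related[OF A B m(1)] mor_related[OF B C m(2)]
 note rc = related_comp[OF presentation_pairI[OF p(1,2)] presentation_pairI[OF p(2,3)] r]
 show c: "is_multitensor_mor V A C (comp_nat (seq_cat V) V \<psi> \<phi>)"
  unfolding mor_iff[OF A C rc]
  by (rule Category.monad_mor_comp[OF Graphs_Category over_monad[OF A] over_monad[OF B] over_monad[OF C]])
   (use m mor_iff[OF A B r(1)] mor_iff[OF B C r(2)] in simp_all)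
 show "g A C (comp_nat (seq_cat V) V \<psi> \<phi>) = comp_nat Gr Gr (g B C \<psi>) (g A B \<phi>)"
  by (rule gamma_mor_unique[OF p(1,3) rc mor_related[OF A C c], symmetric])
qed

lemma Mult_category: "category (Mult V E)"
 unfolding Mult_def
 by (rule over_category[where K = "EFun E"]; (rule mor_id mor_comp(1))?; (assumption | simp add: multitensors_over_def is_multitensor_mor_def)?)

lemma Op_category: "category Op"
 unfolding Op_Set_def
proof (rule Category.over_category[OF Graphs_Category, where K = "MFun (M E)"])
 have m: "is_monad Gr A" if "(A, \<alpha>) \<in> operads_Set U V (M E)" for A \<alpha>
  using that by (simp add: operads_Set_def is_cartesian_monad_def)
 show "is_monad_mor Gr A A (id_nat Gr Gr (MFun A))" if "(A, \<alpha>) \<in> operads_Set U V (M E)" for A \<alpha>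
  by (rule Category.monad_mor_Ident[OF Graphs_Category m[OF that]])
 show "is_monad_mor Gr A C (comp_nat Gr Gr \<psi> \<phi>)"
  if "(A, \<alpha>) \<in> operads_Set U V (M E)" "(B, \<beta>) \<in> operads_Set U V (M E)" "(C, \<gamma>) \<in> operads_Set U V (M E)"
   "is_monad_mor Gr A B \<phi>" "is_monad_mor Gr B C \<psi>" for A \<alpha> B \<beta> C \<gamma> \<phi> \<psi>
  by (rule Category.monad_mor_comp[OF Graphs_Category m[OF that(1)] m[OF that(2)] m[OF that(3)] that(4,5)])
qed (simp_all add: operads_Set_def is_monad_mor_def)

lemma gamma_operad:
 assumes A: "(A, \<alpha>) \<in> multitensors_over V E"
 shows "(M A, g A E \<alpha>) \<in> operads_Set U V (M E)"
proof -
 interpret P: presentation_pair U V A "M A" "j A" E "M E" "j E"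
  by (rule presentation_pairI[OF over_presentation[OF A] gamma_presentation])
 note r = over_related[OF A]
 have a: "is_cartesian_multitensor V A" "is_multitensor_mor V A E \<alpha>" "is_cartesian_nat (seq_cat V) V (EFun A) (EFun E) \<alpha>"
  using A by (simp_all add: multitensors_over_def)
 have "id_on_objects (g A E \<alpha> X)" if X: "X \<in> vgraphs U V" for X
  using P.rel_psi[OF r X] P.A.T_Vert[OF X] P.B.T_Vert[OF X] by (simp add: id_on_objects_def)
 then show ?thesis
  using P.A.cartesian_monad_if_cartesian_multitensor[OF a(1)] P.A.over_Set_T P.cartesian_psi[OF r a(3)] a(2)
  unfolding P.multitensor_mor_iff_monad_mor[OF r] by (simp add: operads_Set_def)
qed

lemma gamma_comp_over:
 assumes A: "(A, \<alpha>) \<in> multitensors_over V E" and B: "(B, \<beta>) \<in> multitensors_over V E"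
  and m: "is_multitensor_mor V A B \<phi>" and o: "comp_nat (seq_cat V) V \<beta> \<phi> = \<alpha>"
 shows "comp_nat Gr Gr (g B E \<beta>) (g A B \<phi>) = g A E \<alpha>"
proof -
 note p = over_presentation[OF A] over_presentation[OF B]
 note rc = related_comp[OF presentation_pairI[OF p] presentation_pairI[OF p(2) gamma_presentation] mor_related[OF A B m] over_related[OF B]]
 show ?thesis by (rule gamma_mor_unique[OF p(1) gamma_presentation rc[unfolded o] over_related[OF A]])
qed

lemma Gamma_Obj: "(A, \<alpha>) \<in> multitensors_over V E \<Longrightarrow> FObj (Gamma U V E) (A, \<alpha>) = (M A, g A E \<alpha>)"
 and Gamma_Arr: "((A, \<alpha>), (B, \<beta>), \<phi>) \<in> Arr (Mult V E) \<Longrightarrow>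
  FArr (Gamma U V E) ((A, \<alpha>), (B, \<beta>), \<phi>) = ((M A, g A E \<alpha>), (M B, g B E \<beta>), g A B \<phi>)"
 by (simp_all add: Gamma_def gamma_over_def Mult_def)

lemma Mult_Arr: "((A, \<alpha>), (B, \<beta>), \<phi>) \<in> Arr (Mult V E) \<longleftrightarrow>
  (A, \<alpha>) \<in> multitensors_over V E \<and> (B, \<beta>) \<in> multitensors_over V E \<and> is_multitensor_mor V A B \<phi> \<and> comp_nat (seq_cat V) V \<beta> \<phi> = \<alpha>"
 and Op_Arr: "((S, \<alpha>'), (T, \<beta>'), \<psi>) \<in> Arr Op \<longleftrightarrow>
  (S, \<alpha>') \<in> operads_Set U V (M E) \<and> (T, \<beta>') \<in> operads_Set U V (M E) \<and> is_monad_mor Gr S T \<psi> \<and> comp_nat Gr Gr \<beta>' \<psi> = \<alpha>'"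
 by (simp_all add: Mult_def Op_Set_def)

lemma Mult_simps: "Obj (Mult V E) = multitensors_over V E" "Dom (Mult V E) (a, b, \<phi>) = a" "Cod (Mult V E) (a, b, \<phi>) = b"
  "Comp (Mult V E) (b, c, \<psi>) (a, b', \<phi>) = (a, c, comp_nat (seq_cat V) V \<psi> \<phi>)"
 and Op_simps: "Obj Op = operads_Set U V (M E)" "Dom Op (a', d, \<phi>') = a'" "Cod Op (a', d, \<phi>') = d"
  "Comp Op (d, e, \<psi>') (a', d', \<phi>') = (a', e, comp_nat Gr Gr \<psi>' \<phi>')" "Ident Op (S, \<alpha>') = ((S, \<alpha>'), (S, \<alpha>'), id_nat Gr Gr (MFun S))"
 by (simp_all add: Mult_def Op_Set_def)

lemma Gamma_functor: "is_functor (Mult V E) Op (Gamma U V E)"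
proof -
 interpret C: Category "Mult V E" by unfold_locales (rule Mult_category)
 show ?thesis
  unfolding is_functor_def
 proof (intro conjI ballI impI)
  show "category (Mult V E)" "category Op" by (rule Mult_category Op_category)+
  show "FObj (Gamma U V E) \<in> extensional (Obj (Mult V E))" "FArr (Gamma U V E) \<in> extensional (Arr (Mult V E))"
   by (simp_all add: Gamma_def)
 next
  fix x assume "x \<in> Obj (Mult V E)"
  then obtain A \<alpha> where x: "x = (A, \<alpha>)" "(A, \<alpha>) \<in> multitensors_over V E" by (cases x) (simp add: Mult_def)
  show "FObj (Gamma U V E) x \<in> Obj Op" unfolding x(1) Gamma_Obj[OF x(2)] Op_simps by (rule gamma_operad[OF x(2)])
  have i: "Ident (Mult V E) (A, \<alpha>) = ((A, \<alpha>), (A, \<alpha>), id_nat (seq_cat V) V (EFun A))" by (simp add: Mult_def)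
  have I: "((A, \<alpha>), (A, \<alpha>), id_nat (seq_cat V) V (EFun A)) \<in> Arr (Mult V E)"
   using C.Ident_Arr[of "(A, \<alpha>)"] x(2) unfolding i by (simp add: Mult_def)
  note p = over_presentation[OF x(2)]
  have "g A A (id_nat (seq_cat V) V (EFun A)) = id_nat Gr Gr (MFun (M A))"
   by (rule gamma_mor_unique[OF p p related_id[OF p] mor_related[OF x(2) x(2) mor_id[OF x(2)]], symmetric])
  then show "FArr (Gamma U V E) (Ident (Mult V E) x) = Ident Op (FObj (Gamma U V E) x)"
   unfolding x(1) i Gamma_Arr[OF I] Gamma_Obj[OF x(2)] Op_simps by simp
 next
  fix f assume f: "f \<in> Arr (Mult V E)"
  obtain A \<alpha> B \<beta> \<phi> where e: "f = ((A, \<alpha>), (B, \<beta>), \<phi>)" by (metis prod_cases3 surj_pair)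
  note F = f[unfolded e] and h = f[unfolded e Mult_Arr]
  show "FArr (Gamma U V E) f \<in> hom Op (FObj (Gamma U V E) (Dom (Mult V E) f)) (FObj (Gamma U V E) (Cod (Mult V E) f))"
   unfolding e Mult_simps Gamma_Arr[OF F] using h gamma_operad gamma_comp_over[of A \<alpha> B \<beta> \<phi>]
    mor_iff[of A \<alpha> B \<beta> \<phi> "g A B \<phi>"] mor_related[of A \<alpha> B \<beta> \<phi>] by (simp add: Gamma_Obj Op_Arr Op_simps)
  fix f' assume f': "f' \<in> Arr (Mult V E)" and d: "Dom (Mult V E) f' = Cod (Mult V E) f"
  obtain A' \<alpha>' C \<gamma> \<psi> where e': "f' = ((A', \<alpha>'), (C, \<gamma>), \<psi>)" by (metis prod_cases3 surj_pair)
  have e': "f' = ((B, \<beta>), (C, \<gamma>), \<psi>)" using d unfolding e e' Mult_simps by simp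
  note F' = f'[unfolded e'] and h' = f'[unfolded e' Mult_Arr]
  have c: "((A, \<alpha>), (C, \<gamma>), comp_nat (seq_cat V) V \<psi> \<phi>) \<in> Arr (Mult V E)"
   using C.Comp_Arr[OF f f' d] unfolding e e' Mult_simps .
  show "FArr (Gamma U V E) (Comp (Mult V E) f' f) = Comp Op (FArr (Gamma U V E) f') (FArr (Gamma U V E) f)"
   unfolding e e' Mult_simps Op_simps Gamma_Arr[OF F] Gamma_Arr[OF F'] Gamma_Arr[OF c] using mor_comp(2)[of A \<alpha> B \<beta> C \<gamma> \<phi> \<psi>] h h' by simp
 qed
qed

text \<open>The transformation recovered from \<psi> is a multitensor morphism because \<psi> is a
  monad morphism. It lies over \<open>E\<close> because two transformations related to the same one
  agree.\<close>

lemma Gamma_full: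
 assumes x: "x \<in> Obj (Mult V E)" and y: "y \<in> Obj (Mult V E)" and m: "m \<in> hom Op (FObj (Gamma U V E) x) (FObj (Gamma U V E) y)"
 shows "\<exists>f\<in>hom (Mult V E) x y. FArr (Gamma U V E) f = m"
proof -
 obtain A \<alpha> B \<beta> where e: "x = (A, \<alpha>)" "y = (B, \<beta>)" by (metis surj_pair)
 have A: "(A, \<alpha>) \<in> multitensors_over V E" and B: "(B, \<beta>) \<in> multitensors_over V E" using x y e by (simp_all add: Mult_simps)
 obtain d c \<psi> where m': "m = (d, c, \<psi>)" by (metis prod_cases3)
 have m'': "m = ((M A, g A E \<alpha>), (M B, g B E \<beta>), \<psi>)" using m unfolding e Gamma_Obj[OF A] Gamma_Obj[OF B] m' by (simp add: Op_simps)
 have M: "is_monad_mor Gr (M A) (M B) \<psi>" "comp_nat Gr Gr (g B E \<beta>) \<psi> = g A E \<alpha>"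
  using m unfolding m'' hom_iff Op_Arr by simp_all
 note p = over_presentation[OF A] over_presentation[OF B]
 have "is_nat Gr Gr (MFun (M A)) (MFun (M B)) \<psi>" using M(1) by (simp add: is_monad_mor_def)
 from related_if_over[OF p gamma_presentation over_related[OF A] over_related[OF B] this M(2)]
 obtain \<phi> where r: "related U V A (M A) (j A) B (M B) (j B) \<phi> \<psi>" .
 have mor: "is_multitensor_mor V A B \<phi>" unfolding mor_iff[OF A B r] by (rule M(1))
 interpret AE: presentation_pair U V A "M A" "j A" E "M E" "j E" by (rule presentation_pairI[OF p(1) gamma_presentation])
 note rc = related_comp[OF presentation_pairI[OF p] presentation_pairI[OF p(2) gamma_presentation] r over_related[OF B]]
 have "comp_nat (seq_cat V) V \<beta> \<phi> = \<alpha>" by (rule AE.rel_unique_phi[OF rc[unfolded M(2)] over_related[OF A]])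
 then have F: "((A, \<alpha>), (B, \<beta>), \<phi>) \<in> Arr (Mult V E)" using A B mor by (simp add: Mult_Arr)
 have "\<psi> = g A B \<phi>" by (rule gamma_mor_unique[OF p r mor_related[OF A B mor]])
 then have "FArr (Gamma U V E) ((A, \<alpha>), (B, \<beta>), \<phi>) = m" unfolding Gamma_Arr[OF F] m'' by simp
 moreover have "((A, \<alpha>), (B, \<beta>), \<phi>) \<in> hom (Mult V E) x y" using F e by (simp add: Mult_simps)
 ultimately show ?thesis by blast
qed

lemma Gamma_faithful:
 assumes f: "f \<in> Arr (Mult V E)" and f': "f' \<in> Arr (Mult V E)" and d: "Dom (Mult V E) f = Dom (Mult V E) f'" "Cod (Mult V E) f = Cod (Mult V E) f'"
  and e: "FArr (Gamma U V E) f = FArr (Gamma U V E) f'"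
 shows "f = f'"
proof -
 obtain A \<alpha> B \<beta> \<phi> where s: "f = ((A, \<alpha>), (B, \<beta>), \<phi>)" by (metis prod_cases3 surj_pair)
 obtain a b \<phi>' where s': "f' = (a, b, \<phi>')" by (metis prod_cases3)
 have s': "f' = ((A, \<alpha>), (B, \<beta>), \<phi>')" using d unfolding s s' Mult_simps by simp
 note h = f[unfolded s Mult_Arr] f'[unfolded s' Mult_Arr]
 have A: "(A, \<alpha>) \<in> multitensors_over V E" and B: "(B, \<beta>) \<in> multitensors_over V E"
  and m: "is_multitensor_mor V A B \<phi>" "is_multitensor_mor V A B \<phi>'" using h by simp_all
 have g: "g A B \<phi> = g A B \<phi>'" using e unfolding s s' Gamma_Arr[OF f[unfolded s]] Gamma_Arr[OF f'[unfolded s']] by simp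
 interpret P: presentation_pair U V A "M A" "j A" B "M B" "j B"
  by (rule presentation_pairI[OF over_presentation[OF A] over_presentation[OF B]])
 have "\<phi> = \<phi>'" by (rule P.rel_unique_phi[OF mor_related[OF A B m(1), unfolded g] mor_related[OF A B m(2)]])
 then show ?thesis unfolding s s' by simp
qed

text \<open>\<open>S\<close> and the monad built from \<open>S.bar\<close> are both presented by
  \<open>S.bar\<close>. The transformations related to its identity in the two directions are
  mutually inverse and lie over the monad of \<open>E\<close>, both by uniqueness of related
  transformations.\<close>

lemma Gamma_surj:
 assumes d: "d \<in> Obj Op"
 shows "\<exists>x\<in>Obj (Mult V E). \<exists>i\<in>hom Op (FObj (Gamma U V E) x) d. is_iso Op i"
proof -
 obtain S \<alpha>' where e: "d = (S, \<alpha>')" by fastforce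
 have S: "(S, \<alpha>') \<in> operads_Set U V (M E)" using d e by (simp add: Op_simps)
 interpret G: presentation U V E "M E" "j E" by (rule gamma_presentation)
 interpret S: operad_over U V E "M E" "j E" S \<alpha>' by unfold_locales (rule S)
 let ?A = S.bar and ?\<alpha> = S.abar
 let ?id = "id_nat (seq_cat V) V (EFun ?A)"
 note A = S.bar_over[OF cartesian]
 note p = over_presentation[OF A] S.bar.presentation_axioms
 obtain \<psi> where r: "related U V ?A (M ?A) (j ?A) ?A S S.sj ?id \<psi>" and m: "is_monad_mor Gr (M ?A) S \<psi>"
  by (rule presentation_id_mor[OF p over_multitensor[OF A]])
 obtain \<psi>' where r': "related U V ?A S S.sj ?A (M ?A) (j ?A) ?id \<psi>'" and m': "is_monad_mor Gr S (M ?A) \<psi>'"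
  by (rule presentation_id_mor[OF p(2,1) over_multitensor[OF A]])
 have n: "is_nat (seq_cat V) V (EFun ?A) (EFun ?A) ?id" "is_nat (seq_cat V) V (EFun ?A) (EFun E) ?\<alpha>"
  using mor_id[OF A] A by (simp_all add: is_multitensor_mor_def multitensors_over_def)
 note I = comp_nat_Ident(1)[OF n(1)] comp_nat_Ident(1)[OF n(2)]
 note pG = presentation_pairI[OF p] presentation_pairI[OF p(2,1)] presentation_pairI[OF p(1,1)] presentation_pairI[OF p(2,2)]
  presentation_pairI[OF p(1) gamma_presentation] presentation_pairI[OF p(2) gamma_presentation]
 have c: "comp_nat Gr Gr \<alpha>' \<psi> = g ?A E ?\<alpha>"
  by (rule gamma_mor_unique[OF p(1) gamma_presentation related_comp[OF pG(1,6) r S.bar_related, unfolded I] over_related[OF A]])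
 have c': "comp_nat Gr Gr (g ?A E ?\<alpha>) \<psi>' = \<alpha>'"
  by (rule presentation_pair.rel_unique[OF pG(6) related_comp[OF pG(2,5) r' over_related[OF A], unfolded I] S.bar_related])
 have i: "comp_nat Gr Gr \<psi>' \<psi> = id_nat Gr Gr (MFun (M ?A))"
  by (rule presentation_pair.rel_unique[OF pG(3) related_comp[OF pG(1,2) r r', unfolded I] related_id[OF p(1)]])
 have i': "comp_nat Gr Gr \<psi> \<psi>' = id_nat Gr Gr (MFun S)"
  by (rule presentation_pair.rel_unique[OF pG(4) related_comp[OF pG(2,1) r' r, unfolded I] related_id[OF p(2)]])
 let ?D = "(M ?A, g ?A E ?\<alpha>)"
 have a: "(?D, d, \<psi>) \<in> Arr Op" "(d, ?D, \<psi>') \<in> Arr Op"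
  unfolding e Op_Arr using gamma_operad[OF A] S m m' c c' by simp_all
 have "is_iso Op (?D, d, \<psi>)"
  unfolding is_iso_def by (rule conjI[OF a(1)], rule bexI[of _ "(d, ?D, \<psi>')"]) (use a(2) i i' in \<open>simp_all add: Op_simps e\<close>)
 then show ?thesis using A a(1) Gamma_Obj[OF A] by (intro bexI[of _ "(?A, ?\<alpha>)"] bexI[of _ "(?D, d, \<psi>)"]) (simp_all add: Op_simps Mult_simps)
qed

end

theorem corollary5p23:
  fixes U :: "'i set set" and V :: "('o, 'a) cat" and E :: "('o, 'a) multitensor"
  assumes "universe U"
    and "lextensive U V"
    and "is_distributive U V E"
    and "is_cartesian_multitensor V E"
  shows "is_equivalence (Mult V E) (Op_Set U V (gamma_monad U V E)) (Gamma U V E)"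
proof -
  interpret extensive_category U V
    using assms(1,2) by unfold_locales (simp_all add: lextensive_def extensive_def)
  interpret multitensor_data U V E
    by (rule multitensor_dataI) (use assms(3,4) in \<open>simp_all add: is_cartesian_multitensor_def\<close>)
  interpret cartesian_multitensor U V E by unfold_locales (rule assms(4))
  show ?thesis by (rule equivalenceI[OF Gamma_functor Gamma_full Gamma_faithful Gamma_surj])
qed

end
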